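(* Assume that $(\alpha,\rho)\in\mathcal A$ and write $\hat\rho=1-\rho$. (i) For $z>\max(0,\cos(\pi\rho))$ $$\int_0^\infty e^{-zx}F(x)\,dx=\frac{\sqrt\alpha}{2}S_2(\alpha\rho)\,z^{-\alpha\hat\rho/2-1/2}\left|S_2\left(1+\tfrac{\alpha}{2}+\tfrac{\alpha\hat\rho}{2}+\tfrac{i\alpha\ln z}{2\pi}\right)\right|^2 .$$ The corresponding result for $\hat F$ is obtained by replacing $\rho$ with $\hat\rho$ (and $\hat\rho$ with $\rho$): for $z>\max(0,\cos(\pi\hat\rho))$ $$\int_0^\infty e^{-zx}\hat F(x)\,dx=\frac{\sqrt\alpha}{2}S_2(\alpha\hat\rho)\,z^{-\alpha\rho/2-1/2}\left|S_2\left(1+\tfrac{\alpha}{2}+\tfrac{\alpha\rho}{2}+\tfrac{i\alpha\ln z}{2\pi}\right)\right|^2 .$$ (ii) If $\rho\ge1/2$, then for $\mathrm{Re}(z)\in(-\alpha\hat\rho,0)$ $$\int_0^\infty x^{z-1}F(x)\,dx=\frac{\Gamma(z)S_2(z)}{2S_2(\alpha\hat\rho+z)} .$$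
   Context: Parameters: $\mathcal A=\{\alpha\in(0,1],\ \rho\in(0,1)\}\cup\{\alpha\in(1,2],\ 1-1/\alpha<\rho<1/\alpha\}$. Double sine function: $S_2(z)=S_2(z;\alpha)$ is the meromorphic function of $z$ satisfying $$S_2(z+1)=\frac{S_2(z)}{2\sin(\pi z/\alpha)},\qquad S_2(z+\alpha)=\frac{S_2(z)}{2\sin(\pi z)},\qquad S_2((1+\alpha)/2)=1 .$$ These conditions determine it for irrational $\alpha$; for every $\alpha>0$ it is the meromorphic continuation of the function given for $0<\mathrm{Re}(z)<1+\alpha$ by $$S_2(z;\alpha)=\exp\left(\int_0^\infty\left[\frac{\sinh((2z-1-\alpha)y)}{2\sinh(y)\sinh(\alpha y)}-\frac{2z-1-\alpha}{2\alpha y}\right]\frac{dy}{y}\right).$$ Functions $G,F$: for $x\ge 0$, $$G(x)=\int_0^\infty e^{-zx}z^{\alpha\rho/2-1/2}\left|S_2\left(1+\alpha+\tfrac{\alpha\hat\rho}{2}+\tfrac{i\alpha\ln z}{2\pi}\right)\right|^2dz,$$ $$F(x)=e^{x\cos(\pi\rho)}\sin\left(x\sin(\pi\rho)+\tfrac{\pi\rho(1-\alpha\hat\rho)}{2}\right)+\frac{\sqrt\alpha}{4\pi}S_2(-\alpha\hat\rho)\,G(x).$$ $\hat G$ and $\hat F$ are defined by the same formulas with $\rho$ and $\hat\rho$ interchanged. *)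

theory Defs
  imports "HOL-Complex_Analysis.Complex_Analysis"
begin

definition admissible :: "real \<Rightarrow> real \<Rightarrow> bool" where
  "admissible \<alpha> \<rho> \<longleftrightarrow>
     (0 < \<alpha> \<and> \<alpha> \<le> 1 \<and> 0 < \<rho> \<and> \<rho> < 1) \<or>
     (1 < \<alpha> \<and> \<alpha> \<le> 2 \<and> 1 - 1 / \<alpha> < \<rho> \<and> \<rho> < 1 / \<alpha>)"

definition log_S2_integrand :: "real \<Rightarrow> complex \<Rightarrow> real \<Rightarrow> complex" where
  "log_S2_integrand \<alpha> z y =
     (sinh ((2 * z - 1 - of_real \<alpha>) * of_real y) / of_real (2 * sinh y * sinh (\<alpha> * y))
       - (2 * z - 1 - of_real \<alpha>) / of_real (2 * \<alpha> * y)) / of_real y"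

(* The double sine function: the meromorphic continuation to the whole plane of the exponential
   integral on the strip 0 < Re z < 1 + alpha. The continuation is unique because a nicely
   meromorphic function is 0 at its poles and has no removable singularities. *)
definition S2 :: "real \<Rightarrow> complex \<Rightarrow> complex" where
  "S2 \<alpha> = (THE f. f nicely_meromorphic_on UNIV \<and>
     (\<forall>z. 0 < Re z \<and> Re z < 1 + \<alpha> \<longrightarrow>
        f z = exp (LBINT y:{0<..}. log_S2_integrand \<alpha> z y)))"

(* In G and F the parameter 1 - \<rho> is the conjugate parameter \<rho>-hat, so the hatted functions
   are G \<alpha> (1 - \<rho>) and F \<alpha> (1 - \<rho>). *)
definition G :: "real \<Rightarrow> real \<Rightarrow> real \<Rightarrow> real" where
  "G \<alpha> \<rho> x = (LBINT z:{0<..}. exp (- z * x) * z powr (\<alpha> * \<rho> / 2 - 1 / 2) *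
     (cmod (S2 \<alpha> (Complex (1 + \<alpha> + \<alpha> * (1 - \<rho>) / 2) (\<alpha> * ln z / (2 * pi)))))\<^sup>2)"

(* Complex-valued, since S2 is; S2 is in fact real at the real argument used here. *)
definition F :: "real \<Rightarrow> real \<Rightarrow> real \<Rightarrow> complex" where
  "F \<alpha> \<rho> x =
     of_real (exp (x * cos (pi * \<rho>)) *
       sin (x * sin (pi * \<rho>) + pi * \<rho> * (1 - \<alpha> * (1 - \<rho>)) / 2))
     + of_real (sqrt \<alpha> / (4 * pi)) * S2 \<alpha> (of_real (- \<alpha> * (1 - \<rho>))) * of_real (G \<alpha> \<rho> x)"

end

theory Submission
  imports Defs "HOL-Real_Asymp.Real_Asymp"
begin

text \<open>
  On the strip \<open>0 < Re z < 1 + \<alpha>\<close> the double sine function is the exponential of an integral. Its two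
  functional equations there come from \<open>log (2 sin (\<pi> z))\<close> being a similar integral, and the
  functional equation with period \<open>\<alpha>\<close> glues translates of the strip into the meromorphic
  continuation. The Riemann--Lebesgue lemma gives the growth on vertical lines.

  For (i), write the claimed Laplace transform as \<open>h (ln z)\<close>. In the logarithmic variable \<open>u\<close>, \<open>h\<close> is
  analytic for \<open>\<bar>Im u\<bar> \<le> \<pi>\<close> except for simple poles at \<open>\<plusminus> i \<pi> \<rho>\<close>, and its jump across the cut
  \<open>\<bar>Im u\<bar> = \<pi>\<close> is a multiple of the density in \<open>G\<close>. Cauchy's formula therefore represents it as a Stieltjes
  transform plus two simple fractions, which is the Laplace transform of \<open>F\<close>.

  For (ii), \<open>h (ln z) = o(1 / z)\<close> at infinity forces \<open>F 0 = 0\<close>, so that the Mellin transform of \<open>F\<close> exists to the left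
  of 0. Up to a Gamma factor it is the Mellin transform \<open>M\<close> of the Laplace transform, and shifting the contour
  by \<open>2 \<pi> i / \<alpha>\<close> in \<open>u\<close> gives a first-order difference equation for \<open>M\<close>. The claimed product \<open>T\<close> of double
  sine functions solves the same equation, so \<open>M / T\<close> has period 1. Since it grows slower than
  \<open>exp (2 \<pi> \<bar>Im z\<bar>)\<close> it is constant, and the behaviour at \<open>z = 1\<close> shows that the constant is 1.
\<close>

section \<open>Integrals over lines and half-lines\<close>

text \<open>Almost all of the work is done with \<open>S2_strip\<close>: an exponential has no
  zeros, so each pole and zero that occurs comes from an explicit sine or \<open>cosh\<close>, and
  quotients are harmless. \<open>S2\<close> itself returns only when the final formulas are read
  off. The hypothesis \<rho> \<ge> 1/2 in (ii) means \<open>cos \<theta> \<le> 0\<close>: the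
  oscillating term of \<open>F\<close> is then bounded, and (i) holds at every positive point, so
  that it can be integrated over the whole half-line. The margin in the uniqueness argument is wide:
  \<open>M\<close> is bounded on closed vertical substrips, while its competitor decays like exp (-
  pi * \<rho> * |Im z|), and the exponent pi * \<rho> stays below 2 * pi. For most purposes
  two-sided bounds on |S2| are enough. The sharp asymptotics from the Riemann-Lebesgue lemma serve a
  single purpose, the limit of \<open>h\<close> at minus infinity, which determines the pole of
  \<open>M\<close> at 1 and hence the last constant.\<close>

lemma integrable_exp_neg_abs:
  fixes \<delta> :: real
  assumes "\<delta> > 0"
  shows "integrable lborel (\<lambda>t. exp (- \<delta> * \<bar>t\<bar>))"
proof -
  have "set_integrable lborel (einterval 0 \<infinity>) (\<lambda>t. exp (- \<delta> * t))"
  proof (rule interval_integral_FTC_nonneg)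
    show "DERIV (\<lambda>t. - exp (- \<delta> * t) / \<delta>) t :> exp (- \<delta> * t)" for t
      using assms by (auto intro!: derivative_eq_intros)
    show "(((\<lambda>t. - exp (- \<delta> * t) / \<delta>) \<circ> real_of_ereal) \<longlongrightarrow> - exp (- \<delta> * 0) / \<delta>) (at_right 0)"
      unfolding zero_ereal_def ereal_tendsto_simps
      by (intro tendsto_intros) (use assms in auto)
    have "((\<lambda>t. - exp (- \<delta> * t) / \<delta>) \<longlongrightarrow> 0) at_top"
      using assms by real_asymp
    then show "(((\<lambda>t. - exp (- \<delta> * t) / \<delta>) \<circ> real_of_ereal) \<longlongrightarrow> 0) (at_left \<infinity>)"
      by (simp add: ereal_tendsto_simps)
  qed (auto intro!: continuous_intros)
  then have 1: "set_integrable lborel {0<..} (\<lambda>t. exp (- \<delta> * \<bar>t\<bar>))"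
  proof -
    have "(\<lambda>t. indicat_real {0<..} t *\<^sub>R exp (- \<delta> * \<bar>t\<bar>)) = (\<lambda>t. indicat_real (einterval 0 \<infinity>) t *\<^sub>R exp (- \<delta> * t))"
      by (rule ext) (auto simp: indicator_def einterval_iff zero_ereal_def)
    then show "set_integrable lborel {0<..} (\<lambda>t. exp (- \<delta> * \<bar>t\<bar>))"
      using \<open>set_integrable lborel (einterval 0 \<infinity>) _\<close> unfolding set_integrable_def by simp
  qed
  from lborel_integrable_real_affine[OF this[unfolded set_integrable_def], of "-1" 0]
  have 2: "set_integrable lborel {..<0} (\<lambda>t. exp (- \<delta> * \<bar>t\<bar>))"
    by (simp add: set_integrable_def indicator_def)
  have "set_integrable lborel ({0<..} \<union> {..<0}) (\<lambda>t. exp (- \<delta> * \<bar>t\<bar>))"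
    by (rule set_integrable_Un[OF 1 2]) auto
  moreover have "AE t in lborel. (indicator ({0<..} \<union> {..<0}) t *\<^sub>R exp (- \<delta> * \<bar>t\<bar>)) = exp (- \<delta> * \<bar>t\<bar>)"
    using AE_lborel_singleton[of "0::real"] by eventually_elim (auto simp: indicator_def)
  ultimately show ?thesis
    unfolding set_integrable_def by (subst (asm) integrable_cong_AE) auto
qed

lemma integrable_continuous_exp_decay:
  fixes g :: "real \<Rightarrow> complex"
  assumes cont: "continuous_on UNIV g" and "\<delta> > 0"
    and bd: "\<And>t. X \<le> \<bar>t\<bar> \<Longrightarrow> norm (g t) \<le> C * exp (- \<delta> * \<bar>t\<bar>)"
  shows "integrable lborel g"
proof -
  have "compact (g ` {-X..X})"
    by (intro compact_continuous_image continuous_on_subset[OF cont]) auto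
  then obtain M where M: "\<And>t. t \<in> {-X..X} \<Longrightarrow> norm (g t) \<le> M"
    by (meson bounded_iff compact_imp_bounded image_eqI)
  \<comment> \<open>For |t| < X the product exp (\<delta> |X|) * exp (- \<delta> |t|) is at least 1,
    so the second summand covers the maximum on the compact middle part.\<close>
  define K where "K = \<bar>C\<bar> + \<bar>M\<bar> * exp (\<delta> * \<bar>X\<bar>)"
  have bound: "norm (g t) \<le> K * exp (- \<delta> * \<bar>t\<bar>)" for t
  proof (cases "X \<le> \<bar>t\<bar>")
    case True
    have "norm (g t) \<le> C * exp (- \<delta> * \<bar>t\<bar>)" by (rule bd[OF True])
    also have "\<dots> \<le> K * exp (- \<delta> * \<bar>t\<bar>)"
      unfolding K_def by (intro mult_right_mono) (auto intro!: add_increasing2)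
    finally show ?thesis .
  next
    case False
    then have "norm (g t) \<le> M" by (intro M) (auto simp: abs_if split: if_splits)
    then have "norm (g t) \<le> \<bar>M\<bar>" by linarith
    also have "\<dots> \<le> \<bar>M\<bar> * (exp (\<delta> * \<bar>X\<bar>) * exp (- \<delta> * \<bar>t\<bar>))"
    proof -
      have "\<delta> * \<bar>t\<bar> \<le> \<delta> * \<bar>X\<bar>" using False assms(2) by (intro mult_left_mono) auto
      then have "1 \<le> exp (\<delta> * \<bar>X\<bar>) * exp (- \<delta> * \<bar>t\<bar>)"
        by (simp add: exp_add[symmetric])
      then show ?thesis
        using mult_left_mono[of 1 "exp (\<delta> * \<bar>X\<bar>) * exp (- \<delta> * \<bar>t\<bar>)" "\<bar>M\<bar>"] by simp
    qed
    also have "\<dots> \<le> K * exp (- \<delta> * \<bar>t\<bar>)" unfolding K_def by (auto simp: algebra_simps)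
    finally show ?thesis .
  qed
  show ?thesis
  proof (rule Bochner_Integration.integrable_bound)
    show "integrable lborel (\<lambda>t. K * exp (- \<delta> * \<bar>t\<bar>))"
      by (intro integrable_mult_right integrable_exp_neg_abs assms)
    show "g \<in> borel_measurable lborel"
      using borel_measurable_continuous_onI[OF cont] by simp
    show "AE t in lborel. norm (g t) \<le> norm (K * exp (- \<delta> * \<bar>t\<bar>))"
      using bound by (intro AE_I2) (auto intro: order_trans[OF bound])
  qed
qed

lemma has_contour_integral_linepath_same_Im_iff:
  assumes "Im z = c" "Im z' = c" "Re z = a" "Re z' = b" "a < b"
  shows   "(f has_contour_integral I) (linepath z z') \<longleftrightarrow>
             ((\<lambda>x. f (Complex x c)) has_integral I) {a..b}"
proof -
  have "(f has_contour_integral I) (linepath z z') \<longleftrightarrow>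
          ((\<lambda>x. f (linepath z z' x) * (z' - z)) has_integral I) {0..1}"
    by (subst has_contour_integral_linepath) simp_all
  also have "\<dots> \<longleftrightarrow> ((\<lambda>x. f (Complex (a + (b - a) * x) c) * (b - a)) has_integral I) {0..1}"
    using assms
    by (intro has_integral_cong arg_cong2[of _ _ _ _ "(*)"] arg_cong[of _ _ f])
       (auto simp: linepath_def complex_eq_iff algebra_simps)
  also have "{0..1} = (\<lambda>x. x / (b - a)) ` {0..b-a}"
    using assms by simp
  also have "((\<lambda>x. f (Complex (a + (b - a) * x) c) * (b-a)) has_integral I) \<dots> \<longleftrightarrow>
             ((\<lambda>x. f (Complex (a + x) c) * (b-a)) has_integral ((b-a) *\<^sub>R I)) {0..b-a}"
    by (subst has_integral_stretch_real_iff) (use assms in simp_all)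
  also have "\<dots> \<longleftrightarrow> ((\<lambda>x. of_real (b-a) * (f (Complex x c))) has_integral (b-a) *\<^sub>R I) {a..b}"
    by (subst has_integral_shift_real_ivl_iff[where c = "-a"])
       (simp_all add: scaleR_conv_of_real mult_ac)
  also have "\<dots> \<longleftrightarrow> ((\<lambda>x. f (Complex x c)) has_integral I) {a..b}"
    by (subst has_integral_mult_right_iff) (use assms in \<open>auto simp: scaleR_conv_of_real\<close>)
  finally show ?thesis .
qed

lemma set_integral_symmetric_tendsto:
  fixes g :: "real \<Rightarrow> complex"
  assumes "integrable lborel g"
  shows "(\<lambda>n. LBINT t:{-real n..real n}. g t) \<longlonglongrightarrow> (LBINT t. g t)"
  unfolding set_lebesgue_integral_def
proof (rule integral_dominated_convergence[where w = "\<lambda>t. norm (g t)"])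
  show "AE t in lborel. (\<lambda>n. indicat_real {- real n..real n} t *\<^sub>R g t) \<longlonglongrightarrow> g t"
  proof (rule AE_I2)
    fix t :: real
    obtain N where "\<bar>t\<bar> \<le> real N" using real_arch_simple by blast
    then have "\<forall>\<^sub>F n in sequentially. indicat_real {- real n..real n} t *\<^sub>R g t = g t"
      by (intro eventually_sequentiallyI[of N]) (auto simp: indicator_def)
    then show "(\<lambda>n. indicat_real {- real n..real n} t *\<^sub>R g t) \<longlonglongrightarrow> g t"
      by (simp add: tendsto_eventually)
  qed
qed (use assms in \<open>auto simp: indicator_def\<close>)

text \<open>The vertical sides of a rectangle are pushed to infinity, where the exponential decay
  makes them vanish. The larger strip from \<open>a'\<close> to \<open>b'\<close> gives an open
  domain around both boundary lines. Counterclockwise orientation makes the left side lower edge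
  minus upper edge.\<close>

theorem strip_residue:
  fixes f :: "complex \<Rightarrow> complex"
  assumes ab: "a' < a" "a < b" "b < b'" and fin: "finite P"
    and P: "\<And>p. p \<in> P \<Longrightarrow> a < Im p \<and> Im p < b"
    and hol: "f holomorphic_on {u. a' < Im u \<and> Im u < b'} - P"
    and \<delta>: "\<delta> > 0"
    and bd: "\<And>u. a \<le> Im u \<Longrightarrow> Im u \<le> b \<Longrightarrow> X \<le> \<bar>Re u\<bar> \<Longrightarrow> norm (f u) \<le> C * exp (- \<delta> * \<bar>Re u\<bar>)"
  shows "integrable lborel (\<lambda>t. f (Complex t a))" (is ?A)
    and "integrable lborel (\<lambda>t. f (Complex t b))" (is ?B)
    and "(LBINT t. f (Complex t a)) - (LBINT t. f (Complex t b)) = 2 * pi * \<i> * (\<Sum>p\<in>P. residue f p)"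
proof -
  let ?S = "{u. a' < Im u \<and> Im u < b'}"
  have cont: "continuous_on (?S - P) f" using hol by (rule holomorphic_on_imp_continuous_on)
  have contline: "continuous_on UNIV (\<lambda>t. f (Complex t c))" if "c = a \<or> c = b" for c
    using that ab P
    by (intro continuous_on_compose2[OF cont]) (auto simp: Complex_eq intro!: continuous_intros, fastforce+)
  show A: ?A
    by (rule integrable_continuous_exp_decay[OF contline \<delta>, where X = X and C = C])
       (use bd[of "Complex _ a"] ab in auto)
  show B: ?B
    by (rule integrable_continuous_exp_decay[OF contline \<delta>, where X = X and C = C])
       (use bd[of "Complex _ b"] ab in auto)
  have S: "open ?S" "convex ?S"
  proof -
    have "?S = {u. Im u > a'} \<inter> {u. Im u < b'}" by auto
    then show "open ?S" "convex ?S"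
      by (auto intro!: open_Int convex_Int open_halfspace_Im_gt open_halfspace_Im_lt
          convex_halfspace_Im_gt convex_halfspace_Im_lt)
  qed
  \<comment> \<open>Beyond \<open>R0\<close> a vertical side meets no pole and lies in the region
    where the decay bound applies.\<close>
  obtain R0 where R0: "\<And>p. p \<in> P \<Longrightarrow> \<bar>Re p\<bar> < R0" "R0 > 0" "R0 \<ge> X"
  proof -
    have "bounded ((\<lambda>p. \<bar>Re p\<bar>) ` P)" using fin by (simp add: finite_imp_bounded)
    then obtain B where "\<And>p. p \<in> P \<Longrightarrow> \<bar>Re p\<bar> \<le> B" by (auto simp: bounded_iff)
    then show ?thesis by (intro that[of "max (max (B + 1) 1) X"]) force+
  qed
  let ?V = "\<lambda>x. contour_integral (linepath (Complex x a) (Complex x b)) f"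
  have V: "norm (?V x) \<le> \<bar>C\<bar> * exp (- \<delta> * \<bar>x\<bar>) * (b - a)" "f contour_integrable_on (linepath (Complex x a) (Complex x b))"
    if x: "\<bar>x\<bar> \<ge> R0" for x
  proof -
    have seg: "closed_segment (Complex x a) (Complex x b) \<subseteq> ?S - P"
      and seg': "u \<in> closed_segment (Complex x a) (Complex x b) \<Longrightarrow> Re u = x \<and> a \<le> Im u \<and> Im u \<le> b" for u
      using ab R0(1) x by (auto simp: closed_segment_same_Re closed_segment_eq_real_ivl, fastforce)
    show int: "f contour_integrable_on (linepath (Complex x a) (Complex x b))"
      by (intro contour_integrable_continuous_linepath continuous_on_subset[OF cont] seg)
    have "norm (?V x) \<le> (\<bar>C\<bar> * exp (- \<delta> * \<bar>x\<bar>)) * norm (Complex x b - Complex x a)"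
    proof (rule contour_integral_bound_linepath[OF int])
      fix u assume u: "u \<in> closed_segment (Complex x a) (Complex x b)"
      have "norm (f u) \<le> C * exp (- \<delta> * \<bar>Re u\<bar>)" using seg'[OF u] x R0(3) by (intro bd) auto
      also have "\<dots> \<le> \<bar>C\<bar> * exp (- \<delta> * \<bar>x\<bar>)" using seg'[OF u] by (simp add: mult_right_mono)
      finally show "norm (f u) \<le> \<bar>C\<bar> * exp (- \<delta> * \<bar>x\<bar>)" .
    qed auto
    also have "norm (Complex x b - Complex x a) = b - a"
      using ab by (simp add: cmod_def)
    finally show "norm (?V x) \<le> \<bar>C\<bar> * exp (- \<delta> * \<bar>x\<bar>) * (b - a)" .
  qed
  let ?H = "\<lambda>c n. LBINT t:{-real n..real n}. f (Complex t c)"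
  have H: "(f has_contour_integral ?H c n) (linepath (Complex (- real n) c) (Complex (real n) c))"
    if "c = a \<or> c = b" "n > 0" for c n
  proof -
    have "set_integrable lborel {-real n..real n} (\<lambda>t. f (Complex t c))"
      by (intro borel_integrable_atLeastAtMost' continuous_on_subset[OF contline[OF that(1)]]) auto
    from set_borel_integral_eq_integral[OF this]
    have "((\<lambda>t. f (Complex t c)) has_integral ?H c n) {-real n..real n}"
      by (metis integrable_integral)
    then show ?thesis
      using that by (subst has_contour_integral_linepath_same_Im_iff) auto
  qed
  let ?RES = "2 * pi * \<i> * (\<Sum>p\<in>P. residue f p)"
  have key: "?H a n + ?V (real n) - ?H b n - ?V (- real n) = ?RES" if n: "real n > R0" for n
  proof -
    have n0: "n > 0" using n R0(2) by linarith
    let ?g = "rectpath (Complex (- real n) a) (Complex (real n) b)"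
    have im: "path_image ?g \<subseteq> ?S - P"
      using ab P R0(1) n by (auto simp: path_image_rectpath) fastforce+
    have "contour_integral ?g f = 2 * pi * \<i> * (\<Sum>p\<in>P. winding_number ?g p * residue f p)"
      using im S by (intro Residue_theorem[OF _ _ fin hol])
        (auto intro!: convex_connected winding_number_zero_outside[of _ ?S])
    also have "(\<Sum>p\<in>P. winding_number ?g p * residue f p) = (\<Sum>p\<in>P. residue f p)"
      using P R0(1) n by (intro sum.cong refl, subst winding_number_rectpath)
       (auto simp: in_box_complex_iff abs_less_iff, (fastforce dest: less_trans)+)
    finally have 1: "contour_integral ?g f = ?RES" .
    have Va: "(f has_contour_integral ?V (real n)) (linepath (Complex (real n) a) (Complex (real n) b))"
      by (intro has_contour_integral_integral V) (use n in auto)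
    have Vb: "(f has_contour_integral ?V (- real n)) (linepath (Complex (- real n) a) (Complex (- real n) b))"
      by (intro has_contour_integral_integral V) (use n in auto)
    have "(f has_contour_integral (?H a n + (?V (real n) + (- ?H b n + - ?V (- real n))))) ?g"
      unfolding rectpath_def Let_def
      using H[of a n] H[of b n] n0 Va Vb
      by (intro has_contour_integral_join valid_path_join)
         (auto intro: has_contour_integral_reversepath[of "linepath _ _", simplified])
    from contour_integral_unique[OF this] 1 show ?thesis by (simp add: algebra_simps)
  qed
  have lim0: "(\<lambda>n. \<bar>C\<bar> * exp (- \<delta> * real n) * (b - a)) \<longlonglongrightarrow> 0"
  proof -
    have "(\<lambda>n. exp (- \<delta> * real n)) \<longlonglongrightarrow> 0" using \<delta> by real_asymp
    then have "(\<lambda>n. \<bar>C\<bar> * exp (- \<delta> * real n) * (b - a)) \<longlonglongrightarrow> \<bar>C\<bar> * 0 * (b - a)"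
      by (intro tendsto_intros)
    then show ?thesis by simp
  qed
  have ev: "\<forall>\<^sub>F n in sequentially. real n > R0"
    using eventually_gt_at_top[of "nat \<lceil>R0\<rceil>"] by eventually_elim linarith
  have V1: "(\<lambda>n. ?V (real n)) \<longlonglongrightarrow> 0" and V2: "(\<lambda>n. ?V (- real n)) \<longlonglongrightarrow> 0"
    by (rule Lim_null_comparison[OF eventually_mono[OF ev] lim0]; use V(1)[of "real _"] V(1)[of "- real _"] in force)+
  have "(\<lambda>n. ?H a n + ?V (real n) - ?H b n - ?V (- real n)) \<longlonglongrightarrow>
     (LBINT t. f (Complex t a)) + 0 - (LBINT t. f (Complex t b)) - 0"
    by (intro tendsto_intros V1 V2 set_integral_symmetric_tendsto A B)
  moreover have "(\<lambda>n. ?H a n + ?V (real n) - ?H b n - ?V (- real n)) \<longlonglongrightarrow> ?RES"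
    using key by (intro tendsto_eventually eventually_mono[OF ev]) auto
  ultimately show "(LBINT t. f (Complex t a)) - (LBINT t. f (Complex t b)) = ?RES"
    using LIMSEQ_unique by fastforce
qed

text \<open>Cauchy's inequality turns a dominating function for \<open>f\<close> itself into one for
  its derivative, and so for the difference quotients. Hence only \<open>f\<close> has to be
  estimated, never its derivative.\<close>

lemma has_field_derivative_integral_param:
  fixes f :: "complex \<Rightarrow> 'a \<Rightarrow> complex"
  assumes S: "open S" "z \<in> S"
    and meas: "\<And>w. w \<in> S \<Longrightarrow> f w \<in> borel_measurable M"
    and hol: "\<And>y. y \<in> space M \<Longrightarrow> (\<lambda>w. f w y) holomorphic_on S"
    and g: "integrable M g" and r: "r > 0"
    and bd: "\<And>w y. w \<in> S \<Longrightarrow> dist z w < r \<Longrightarrow> y \<in> space M \<Longrightarrow> norm (f w y) \<le> g y"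
  shows "((\<lambda>w. \<integral>y. f w y \<partial>M) has_field_derivative (\<integral>y. deriv (\<lambda>w. f w y) z \<partial>M)) (at z)"
proof -
  obtain e where e: "e > 0" "ball z e \<subseteq> S" using S open_contains_ball by blast
  \<comment> \<open>With a third of the radius, a disc of radius \<open>s\<close> about any point of
    \<open>ball z s\<close> still lies in \<open>S\<close> and in the region where \<open>g\<close>
    dominates.\<close>
  define s where "s = min e r / 3"
  have s: "s > 0" "3 * s \<le> r" "3 * s \<le> e" using e r by (auto simp: s_def)
  have sub: "w \<in> S" if "dist z w < 3 * s" for w using that e s by auto
  have der: "norm (deriv (\<lambda>w. f w y) w) \<le> g y / s" if y: "y \<in> space M" and w: "w \<in> ball z s" for y w
  proof -
    have ss: "cball w s \<subseteq> S"
    proof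
      fix x assume "x \<in> cball w s"
      then have "dist z x < 3 * s" using w dist_triangle[of z x w] s(1) by auto
      then show "x \<in> S" by (rule sub)
    qed
    have "norm ((deriv ^^ 1) (\<lambda>w. f w y) w) \<le> fact 1 * g y / s ^ 1"
    proof (rule Cauchy_inequality)
      show "(\<lambda>w. f w y) holomorphic_on ball w s"
        by (rule holomorphic_on_subset[OF hol[OF y]]) (use ss ball_subset_cball in blast)
      show "continuous_on (cball w s) (\<lambda>w. f w y)"
        by (rule continuous_on_subset[OF holomorphic_on_imp_continuous_on[OF hol[OF y]] ss])
      fix x assume "norm (w - x) = s"
      then have "dist z x < 3 * s" using w dist_triangle[of z x w] s(1) by (auto simp: dist_norm)
      then show "norm (f x y) \<le> g y" using sub[of x] s(2) by (intro bd y) auto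
    qed (rule s)
    then show ?thesis by simp
  qed
  have lip: "norm (f w y - f z y) \<le> g y / s * norm (w - z)" if y: "y \<in> space M" and w: "w \<in> ball z s" for y w
  proof (rule field_differentiable_bound[of "ball z s"])
    fix x assume x: "x \<in> ball z s"
    then have "x \<in> S" using sub[of x] s(1) by auto
    then show "((\<lambda>w. f w y) has_field_derivative deriv (\<lambda>w. f w y) x) (at x within ball z s)"
      using hol[OF y] S(1) holomorphic_derivI by blast
  qed (use der y w s in auto)
  have int: "integrable M (f w)" if "w \<in> ball z s" for w
  proof (rule Bochner_Integration.integrable_bound[OF g])
    have "w \<in> S" using that sub[of w] s(1) by auto
    then show "f w \<in> borel_measurable M" by (rule meas)
    show "AE y in M. norm (f w y) \<le> norm (g y)"
      using \<open>w \<in> S\<close> that s by (intro AE_I2 order_trans[OF bd]) auto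
  qed
  show ?thesis
    unfolding has_field_derivative_iff tendsto_at_iff_sequentially comp_def
  proof (intro allI impI)
    fix X :: "nat \<Rightarrow> complex" assume X: "\<forall>i. X i \<in> UNIV - {z}" "X \<longlonglongrightarrow> z"
    have ev: "\<forall>\<^sub>F i in sequentially. X i \<in> ball z s"
      using X(2) s(1) by (intro topological_tendstoD) auto
    then obtain N where N: "\<And>i. i \<ge> N \<Longrightarrow> X i \<in> ball z s" by (auto simp: eventually_sequentially)
    let ?q = "\<lambda>i y. (f (X (i + N)) y - f z y) / (X (i + N) - z)"
    have zs: "z \<in> ball z s" using s by auto
    have lim: "(\<lambda>i. ?q i y) \<longlonglongrightarrow> deriv (\<lambda>w. f w y) z" if "y \<in> space M" for y
    proof -
      have "((\<lambda>w. f w y) has_field_derivative deriv (\<lambda>w. f w y) z) (at z)"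
        using hol[OF that] S holomorphic_derivI by blast
      then have "(\<lambda>i. (f (X i) y - f z y) / (X i - z)) \<longlonglongrightarrow> deriv (\<lambda>w. f w y) z"
        unfolding has_field_derivative_iff tendsto_at_iff_sequentially comp_def using X by auto
      then show ?thesis by (rule LIMSEQ_ignore_initial_segment)
    qed
    have qm: "?q i \<in> borel_measurable M" for i
      using int[OF N[of "i + N"]] int[OF zs] by auto
    \<comment> \<open>The derivative is measurable in \<open>y\<close> as a pointwise limit of the
      measurable difference quotients.\<close>
    have dm: "(\<lambda>y. deriv (\<lambda>w. f w y) z) \<in> borel_measurable M"
      by (rule borel_measurable_LIMSEQ_metric[OF qm lim])
    have "(\<lambda>i. \<integral>y. ?q i y \<partial>M) \<longlonglongrightarrow> (\<integral>y. deriv (\<lambda>w. f w y) z \<partial>M)"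
    proof (rule integral_dominated_convergence[where w = "\<lambda>y. g y / s"])
      show "AE y in M. norm (?q i y) \<le> g y / s" for i
      proof (intro AE_I2)
        fix y assume y: "y \<in> space M"
        have "norm (X (i + N) - z) > 0" using X by auto
        then show "norm (?q i y) \<le> g y / s"
          using lip[OF y N[of "i + N"]] by (simp add: norm_divide divide_le_eq)
      qed
    qed (use g lim qm dm in auto)
    moreover have "(\<integral>y. ?q i y \<partial>M) = ((\<integral>y. f (X (i + N)) y \<partial>M) - (\<integral>y. f z y \<partial>M)) / (X (i + N) - z)" for i
      using int[OF N[of "i + N"]] int[OF zs] by simp
    ultimately have "(\<lambda>i. ((\<integral>y. f (X (i + N)) y \<partial>M) - (\<integral>y. f z y \<partial>M)) / (X (i + N) - z)) \<longlonglongrightarrow> (\<integral>y. deriv (\<lambda>w. f w y) z \<partial>M)"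
      by (simp only:)
    then show "(\<lambda>i. ((\<integral>y. f (X i) y \<partial>M) - (\<integral>y. f z y \<partial>M)) / (X i - z)) \<longlonglongrightarrow> (\<integral>y. deriv (\<lambda>w. f w y) z \<partial>M)"
      by (rule LIMSEQ_offset[of "\<lambda>i. ((\<integral>y. f (X i) y \<partial>M) - (\<integral>y. f z y \<partial>M)) / (X i - z)"])
  qed
qed

text \<open>The change of variables is a theorem about absolute integrability on sets of reals;
  Borel measurability of \<open>f\<close> lets both sides be transferred to
  \<open>lborel\<close>.\<close>

lemma exp_substitution:
  fixes f :: "real \<Rightarrow> complex"
  assumes m: "set_borel_measurable borel {0<..} f"
  shows "set_integrable lborel {0<..} f \<longleftrightarrow> integrable lborel (\<lambda>t. exp t *\<^sub>R f (exp t))" (is ?A)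
    and "(LBINT x:{0<..}. f x) = (LBINT t. exp t *\<^sub>R f (exp t))" (is ?B)
proof -
  have r: "range exp = {(0::real)<..}"
  proof (intro subset_antisym subsetI)
    fix x :: real assume "x \<in> {0<..}"
    then have "x = exp (ln x)" by simp
    then show "x \<in> range exp" by blast
  qed auto
  have m2: "(\<lambda>t. exp t *\<^sub>R f (exp t)) \<in> borel_measurable borel"
  proof -
    have "(\<lambda>t. exp t *\<^sub>R ((\<lambda>x. indicator {0<..} x *\<^sub>R f x) (exp t))) \<in> borel_measurable borel"
    proof (rule borel_measurable_scaleR)
      have e: "(exp :: real \<Rightarrow> real) \<in> borel \<rightarrow>\<^sub>M borel"
        by (intro borel_measurable_continuous_onI continuous_on_exp continuous_on_id)
      then show "(\<lambda>t::real. exp t) \<in> borel_measurable borel" .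
      show "(\<lambda>t. (\<lambda>x. indicator {0<..} x *\<^sub>R f x) (exp t)) \<in> borel_measurable borel"
        by (rule measurable_compose[OF e]) (use m in \<open>simp add: set_borel_measurable_def\<close>)
    qed
    then show ?thesis by simp
  qed
  have *: "(\<lambda>x. \<bar>exp x\<bar> *\<^sub>R f (exp x)) absolutely_integrable_on UNIV \<and> integral UNIV (\<lambda>x. \<bar>exp x\<bar> *\<^sub>R f (exp x)) = b
          \<longleftrightarrow> f absolutely_integrable_on range exp \<and> integral (range exp) f = b" for b
    by (rule has_absolute_integral_change_of_variables_real)
       (auto intro: derivative_eq_intros inj_onI)
  have 1: "f absolutely_integrable_on {0<..} \<longleftrightarrow> set_integrable lborel {0<..} f"
    using m unfolding set_integrable_def set_borel_measurable_def by (simp add: integrable_completion)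
  have 2: "(\<lambda>t. exp t *\<^sub>R f (exp t)) absolutely_integrable_on UNIV \<longleftrightarrow> integrable lborel (\<lambda>t. exp t *\<^sub>R f (exp t))"
    using m2 unfolding set_integrable_def by (simp add: integrable_completion)
  show A: ?A using *[unfolded r] 1 2 by auto
  show ?B
  proof (cases "set_integrable lborel {0<..} f")
    case True
    then have "integrable lborel (\<lambda>t. exp t *\<^sub>R f (exp t))" using A by simp
    then have "integral UNIV (\<lambda>x. exp x *\<^sub>R f (exp x)) = (LBINT t. exp t *\<^sub>R f (exp t))"
      using integral_lborel by metis
    moreover have "(LBINT x:{0<..}. f x) = integral {0<..} f"
      using set_borel_integral_eq_integral(2)[OF True] .
    moreover have "integral {0<..} f = integral UNIV (\<lambda>x. exp x *\<^sub>R f (exp x))"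
      using *[of "integral UNIV (\<lambda>x. \<bar>exp x\<bar> *\<^sub>R f (exp x))", unfolded r] A True 2 by auto
    ultimately show ?thesis by simp
  next
    case False
    \<comment> \<open>Without integrability both integrals take the default value 0, so the equation
      needs no convergence assumption.\<close>
    have "(LBINT x:{0<..}. f x) = 0"
      using False unfolding set_integrable_def set_lebesgue_integral_def by (rule not_integrable_integral_eq)
    moreover have "(LBINT t. exp t *\<^sub>R f (exp t)) = 0"
      using False A by (intro not_integrable_integral_eq) simp
    ultimately show ?thesis by simp
  qed
qed

section \<open>The double sine function on its strip\<close>

lemma holomorphic_on_sinh' [holomorphic_intros]: "f holomorphic_on S \<Longrightarrow> (\<lambda>z. sinh (f z)) holomorphic_on S"
  and holomorphic_on_cosh' [holomorphic_intros]: "f holomorphic_on S \<Longrightarrow> (\<lambda>z. cosh (f z)) holomorphic_on S"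
  for f :: "complex \<Rightarrow> complex"
  unfolding sinh_field_def cosh_field_def by (auto intro!: holomorphic_intros)

lemma norm_sinh_le: "norm (sinh w) \<le> exp \<bar>Re w\<bar>" for w :: complex
proof -
  have "norm (sinh w) \<le> (norm (exp w) + norm (exp (- w))) / 2"
    unfolding sinh_field_def norm_divide using norm_triangle_ineq4[of "exp w" "exp (- w)"]
    by (simp del: norm_exp_eq_Re)
  also have "\<dots> \<le> (exp \<bar>Re w\<bar> + exp \<bar>Re w\<bar>) / 2"
    by (intro divide_right_mono add_mono) auto
  finally show ?thesis by simp
qed

text \<open>The even Taylor terms cancel in exp w - exp (- w), so the second-order remainder of the
  exponential leaves a cubic error. This precision is what the cancellation at y = 0 in
  \<open>double_sine_kernel_bound\<close> requires.\<close>

lemma norm_sinh_minus_self_le: "norm (sinh w - w) \<le> exp (norm w) * norm w ^ 3 / 2" for w :: complex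
proof -
  have *: "norm (exp v - (1 + v + v\<^sup>2 / 2)) \<le> exp (norm v) * norm v ^ 3 / 2" for v :: complex
  proof -
    have "(\<Sum>i\<le>2. v ^ i / fact i) = 1 + v + v\<^sup>2 / 2"
      by (simp add: numeral_2_eq_2 atMost_Suc)
    then show ?thesis using Taylor_exp_field[of v 2] by (simp add: numeral_3_eq_3)
  qed
  have "sinh w - w = ((exp w - (1 + w + w\<^sup>2 / 2)) - (exp (- w) - (1 + (- w) + (- w)\<^sup>2 / 2))) / 2"
    by (simp add: sinh_field_def field_simps)
  then have "norm (sinh w - w) \<le> (norm (exp w - (1 + w + w\<^sup>2 / 2)) + norm (exp (- w) - (1 + (- w) + (- w)\<^sup>2 / 2))) / 2"
    using norm_triangle_ineq4[of "exp w - (1 + w + w\<^sup>2 / 2)" "exp (- w) - (1 + (- w) + (- w)\<^sup>2 / 2)"]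
    by (simp only: norm_divide norm_numeral) (simp del: power2_minus)
  also have "\<dots> \<le> (exp (norm w) * norm w ^ 3 / 2 + exp (norm w) * norm w ^ 3 / 2) / 2"
    using *[of w] *[of "- w"] by (intro divide_right_mono add_mono) auto
  finally show ?thesis by simp
qed

lemma sinh_le_cubic:
  fixes x :: real assumes "0 \<le> x" shows "x \<le> sinh x" "sinh x \<le> x + exp x * x ^ 3 / 2"
proof -
  have e: "sinh (complex_of_real x) = of_real (sinh x)"
    by (simp add: sinh_field_def exp_of_real[symmetric] del: exp_of_real)
  have "norm (of_real (sinh x - x) :: complex) \<le> exp x * x ^ 3 / 2"
    using norm_sinh_minus_self_le[of "of_real x"] assms by (simp add: e)
  then show "sinh x \<le> x + exp x * x ^ 3 / 2" unfolding norm_of_real by linarith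
  have "\<exists>z>0. z < x \<and> sinh x - sinh 0 = (x - 0) * cosh z" if "x > 0"
    by (rule MVT2[OF that]) (auto intro!: derivative_eq_intros)
  then show "x \<le> sinh x"
    using assms cosh_real_ge_1 mult_left_mono[of 1 "cosh _" x] by (cases "x = 0") force+
qed

text \<open>The variable a = 2z - 1 - \<alpha> is centred at the symmetry point of the strip: the
  kernel is odd in \<open>a\<close>, and 0 < Re z < 1 + \<alpha> becomes |Re a| < 1 +
  \<alpha>.\<close>

definition double_sine_kernel :: "real \<Rightarrow> complex \<Rightarrow> real \<Rightarrow> complex" where
  "double_sine_kernel \<alpha> a y =
     (sinh (a * of_real y) / of_real (2 * sinh y * sinh (\<alpha> * y)) - a / of_real (2 * \<alpha> * y)) / of_real y"

lemma log_S2_integrand_eq: "log_S2_integrand \<alpha> z = double_sine_kernel \<alpha> (2 * z - 1 - of_real \<alpha>)"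
  by (simp add: fun_eq_iff log_S2_integrand_def double_sine_kernel_def)

text \<open>Near 0 both terms blow up like 1/y^2 and their singularities cancel. At infinity the
  first term is exponentially small because \<open>m < 1 + \<alpha>\<close>, while the second decays
  only like 1/y^2; this dictates the shape of the bound. Uniformity in \<open>a\<close> is what
  holomorphy of the integral uses.\<close>

lemma double_sine_kernel_bound:
  fixes \<alpha> m A :: real
  assumes \<alpha>: "\<alpha> > 0" and m: "0 \<le> m" "m < 1 + \<alpha>" and A: "A \<ge> 0"
  obtains C where "C > 0"
    "\<And>a y. y > 0 \<Longrightarrow> \<bar>Re a\<bar> \<le> m \<Longrightarrow> norm a \<le> A \<Longrightarrow> norm (double_sine_kernel \<alpha> a y) \<le> C / (1 + y\<^sup>2)"
proof -
  define c1 where "c1 = exp 1 / (2::real)"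
  define c2 where "c2 = exp \<alpha> * \<alpha> ^ 3 / 2"
  define K where "K = c2 + \<alpha> * c1 + c1 * c2"
  define C1 where "C1 = (\<alpha> * (exp A * A ^ 3 / 2) + A * K) / (2 * \<alpha>\<^sup>2)"
  have c: "c1 > 0" "c2 > 0" "K > 0" using \<alpha> by (auto simp: c1_def c2_def K_def intro!: add_pos_pos mult_pos_pos)
  have small: "norm (double_sine_kernel \<alpha> a y) \<le> C1" if y: "0 < y" "y \<le> 1" and a: "norm a \<le> A" for a y
  proof -
    define D where "D = sinh y * sinh (\<alpha> * y)"
    have p: "y ^ n \<le> 1" for n using y by (simp add: power_le_one)
    have s: "y \<le> sinh y" "sinh y \<le> y + c1 * y ^ 3"
    proof -
      show "y \<le> sinh y" using y by (intro sinh_le_cubic) auto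
      have "sinh y \<le> y + exp y * y ^ 3 / 2" using y by (intro sinh_le_cubic) auto
      also have "\<dots> \<le> y + c1 * y ^ 3" unfolding c1_def using y by (auto intro!: mult_right_mono divide_right_mono)
      finally show "sinh y \<le> y + c1 * y ^ 3" .
    qed
    have t: "\<alpha> * y \<le> sinh (\<alpha> * y)" "sinh (\<alpha> * y) \<le> \<alpha> * y + c2 * y ^ 3"
    proof -
      show "\<alpha> * y \<le> sinh (\<alpha> * y)" using y \<alpha> by (intro sinh_le_cubic) auto
      have "sinh (\<alpha> * y) \<le> \<alpha> * y + exp (\<alpha> * y) * (\<alpha> * y) ^ 3 / 2" using y \<alpha> by (intro sinh_le_cubic) auto
      also have "exp (\<alpha> * y) * (\<alpha> * y) ^ 3 \<le> exp \<alpha> * (\<alpha> * y) ^ 3"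
        using y \<alpha> by (intro mult_right_mono) (auto simp: mult_left_le)
      also have "\<alpha> * y + exp \<alpha> * (\<alpha> * y) ^ 3 / 2 = \<alpha> * y + c2 * y ^ 3"
        by (simp add: c2_def power_mult_distrib)
      finally show "sinh (\<alpha> * y) \<le> \<alpha> * y + c2 * y ^ 3" by simp
    qed
    have D1: "\<alpha> * y\<^sup>2 \<le> D"
      using mult_mono[OF s(1) t(1)] y \<alpha> by (simp add: D_def power2_eq_square algebra_simps)
    have "D \<le> (y + c1 * y ^ 3) * (\<alpha> * y + c2 * y ^ 3)"
      unfolding D_def using s t y \<alpha> c by (intro mult_mono) (auto intro: order_trans[OF _ s(1)] order_trans[OF _ t(1)])
    also have "\<dots> = \<alpha> * y\<^sup>2 + (c2 + \<alpha> * c1 + c1 * c2 * y\<^sup>2) * y ^ 4"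
      by (simp add: algebra_simps power2_eq_square power3_eq_cube power4_eq_xxxx)
    also have "\<dots> \<le> \<alpha> * y\<^sup>2 + K * y ^ 4"
      unfolding K_def using y c p[of 2] by (intro add_left_mono mult_right_mono) (auto simp: mult_left_le)
    finally have D2: "D \<le> \<alpha> * y\<^sup>2 + K * y ^ 4" .
    have Dpos: "D > 0" using D1 \<alpha> y by (metis mult_pos_pos zero_less_power order_less_le_trans)
    define w where "w = a * of_real y"
    have nw: "norm w \<le> A * y" "norm w \<le> A"
      using a y mult_mono[of "norm a" A y 1] A by (auto simp: w_def norm_mult intro: mult_right_mono)
    have sw: "norm (sinh w - w) \<le> exp A * (A * y) ^ 3 / 2"
    proof -
      have "norm (sinh w - w) \<le> exp (norm w) * norm w ^ 3 / 2" by (rule norm_sinh_minus_self_le)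
      also have "\<dots> \<le> exp A * (A * y) ^ 3 / 2"
        using nw by (intro divide_right_mono mult_mono power_mono) auto
      finally show ?thesis .
    qed
    \<comment> \<open>Splitting off the linear term \<open>w\<close> of \<open>sinh w\<close> writes
      the numerator as two pieces of order y^4 each, matching \<open>D * y\<^sup>2\<close> in the
      denominator.\<close>
    define N where "N = of_real (\<alpha> * y) * (sinh w - w) - a * of_real (D - \<alpha> * y\<^sup>2)"
    have eq: "double_sine_kernel \<alpha> a y = N / of_real (2 * D * \<alpha> * y\<^sup>2)"
      using Dpos y \<alpha> unfolding double_sine_kernel_def N_def w_def mult.assoc[of 2 "sinh y"] D_def[symmetric]
      by (simp add: field_simps power2_eq_square)
    have "norm N \<le> norm (of_real (\<alpha> * y) * (sinh w - w)) + norm (a * of_real (D - \<alpha> * y\<^sup>2))"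
      unfolding N_def by (rule norm_triangle_ineq4)
    also have "norm (of_real (\<alpha> * y) * (sinh w - w)) \<le> \<alpha> * y * (exp A * (A * y) ^ 3 / 2)"
      using sw y \<alpha> by (simp add: norm_mult)
    also have "norm (a * of_real (D - \<alpha> * y\<^sup>2)) \<le> A * (K * y ^ 4)"
      unfolding norm_mult norm_of_real using a D1 D2 A by (intro mult_mono) auto
    finally have N: "norm N \<le> (\<alpha> * (exp A * A ^ 3 / 2) + A * K) * y ^ 4"
      by (simp add: algebra_simps power3_eq_cube power4_eq_xxxx power_mult_distrib)
    have "norm (double_sine_kernel \<alpha> a y) = norm N / (2 * D * \<alpha> * y\<^sup>2)"
      unfolding eq norm_divide norm_of_real using Dpos y \<alpha> by simp
    also have "\<dots> \<le> ((\<alpha> * (exp A * A ^ 3 / 2) + A * K) * y ^ 4) / (2 * (\<alpha> * y\<^sup>2) * \<alpha> * y\<^sup>2)"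
      using N D1 \<alpha> y order_trans[OF norm_ge_zero N]
      by (intro frac_le mult_right_mono mult_left_mono) simp_all
    also have "\<dots> = C1" unfolding C1_def using \<alpha> y by (simp add: field_simps power2_eq_square power4_eq_xxxx)
    finally show ?thesis .
  qed
  have C1: "C1 \<ge> 0" using \<alpha> A c by (auto simp: C1_def intro!: divide_nonneg_nonneg add_nonneg_nonneg mult_nonneg_nonneg)
  \<comment> \<open>\<open>d\<close> is the decay rate left when exp (m y) is divided by exp ((1 +
    \<alpha>) y), and \<open>\<kappa>\<close> is chosen so that sinh (\<alpha> y) \<ge> \<kappa> exp
    (\<alpha> y) for y \<ge> 1.\<close>
  define d where "d = 1 + \<alpha> - m"
  define \<kappa> where "\<kappa> = (1 - exp (- 2 * \<alpha>)) / 2"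
  have d: "d > 0" "\<kappa> > 0" using m \<alpha> by (auto simp: d_def \<kappa>_def)
  define C2 where "C2 = 4 * (1 + 2 / d\<^sup>2) / (2 * \<kappa>) + A / \<alpha>"
  have large: "norm (double_sine_kernel \<alpha> a y) \<le> C2 / (1 + y\<^sup>2)"
    if y: "1 \<le> y" and a: "norm a \<le> A" "\<bar>Re a\<bar> \<le> m" for a y
  proof -
    have s: "sinh y \<ge> exp y / 4"
    proof -
      have "exp (- 2 * y) \<le> 1 / 2"
      proof -
        have "2 \<le> exp (1::real)" using exp_ge_add_one_self[of 1] by simp
        also have "\<dots> \<le> exp (2 * y)" using y by simp
        finally show ?thesis by (simp add: exp_minus field_simps)
      qed
      then have *: "exp y * exp (- 2 * y) \<le> exp y * (1 / 2)" by (rule mult_left_mono) simp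
      have "sinh y = (exp y - exp y * exp (- 2 * y)) / 2"
        by (simp add: sinh_field_def exp_add[symmetric])
      also have "\<dots> \<ge> (exp y - exp y * (1 / 2)) / 2" using * by (intro divide_right_mono diff_left_mono) auto
      finally show ?thesis by simp
    qed
    have t: "sinh (\<alpha> * y) \<ge> \<kappa> * exp (\<alpha> * y)"
    proof -
      have "exp (- 2 * (\<alpha> * y)) \<le> exp (- 2 * \<alpha>)" using y \<alpha> by simp
      then have *: "exp (\<alpha> * y) * exp (- 2 * (\<alpha> * y)) \<le> exp (\<alpha> * y) * exp (- 2 * \<alpha>)" by (rule mult_left_mono) simp
      have "\<kappa> * exp (\<alpha> * y) = (exp (\<alpha> * y) - exp (\<alpha> * y) * exp (- 2 * \<alpha>)) / 2"
        by (simp add: \<kappa>_def algebra_simps)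
      also have "\<dots> \<le> (exp (\<alpha> * y) - exp (\<alpha> * y) * exp (- 2 * (\<alpha> * y))) / 2"
        using * by (intro divide_right_mono diff_left_mono) auto
      also have "\<dots> = sinh (\<alpha> * y)"
        by (simp add: sinh_field_def exp_add[symmetric])
      finally show ?thesis .
    qed
    have den: "2 * sinh y * sinh (\<alpha> * y) \<ge> 2 * (exp y / 4) * (\<kappa> * exp (\<alpha> * y))"
      using s t d y by (intro mult_mono) (auto intro: order_trans[OF _ s] simp: less_imp_le)
    have pos: "2 * (exp y / 4) * (\<kappa> * exp (\<alpha> * y)) > 0" using d by simp
    have numr: "norm (sinh (a * of_real y)) \<le> exp (m * y)"
    proof -
      have "norm (sinh (a * of_real y)) \<le> exp \<bar>Re (a * of_real y)\<bar>" by (rule norm_sinh_le)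
      also have "\<dots> \<le> exp (m * y)" using a y by (simp add: abs_mult mult_right_mono)
      finally show ?thesis .
    qed
    have "norm (sinh (a * of_real y) / of_real (2 * sinh y * sinh (\<alpha> * y))) \<le>
       exp (m * y) / (2 * (exp y / 4) * (\<kappa> * exp (\<alpha> * y)))"
      unfolding norm_divide norm_of_real using numr den pos
      by (intro frac_le) auto
    also have "\<dots> = (4 / (2 * \<kappa>)) * exp (- d * y)"
      using d by (simp add: d_def field_simps exp_add[symmetric])
    also have "\<dots> \<le> (4 / (2 * \<kappa>)) * ((1 + 2 / d\<^sup>2) / (1 + y\<^sup>2))"
    proof (intro mult_left_mono)
      have "exp (d * y) \<ge> (d * y)\<^sup>2 / 2" "exp (d * y) \<ge> 1"
      proof -
        have "d * y \<ge> 0" using d y by simp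
        then show "exp (d * y) \<ge> (d * y)\<^sup>2 / 2" "exp (d * y) \<ge> 1"
          using exp_lower_Taylor_quadratic[of "d * y"] by auto
      qed
      then have "1 \<le> exp (d * y)" "y\<^sup>2 \<le> 2 / d\<^sup>2 * exp (d * y)"
        using d by (simp_all add: field_simps power_mult_distrib)
      then have "1 + y\<^sup>2 \<le> (1 + 2 / d\<^sup>2) * exp (d * y)"
        unfolding distrib_right mult_1 by (rule add_mono)
      then show "exp (- d * y) \<le> (1 + 2 / d\<^sup>2) / (1 + y\<^sup>2)"
        by (simp add: exp_minus field_simps add_pos_nonneg)
    qed (use d in auto)
    finally have 1: "norm (sinh (a * of_real y) / of_real (2 * sinh y * sinh (\<alpha> * y))) \<le>
        4 * (1 + 2 / d\<^sup>2) / (2 * \<kappa>) / (1 + y\<^sup>2)" by (simp only: times_divide_times_eq divide_divide_eq_left)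
    have y2: "1 + y\<^sup>2 \<le> 2 * y\<^sup>2" "y\<^sup>2 > 0" using y by (auto simp: power2_eq_square mult_ge1_I)
    have 2: "norm (a / of_real (2 * \<alpha> * y) / of_real y) \<le> A / \<alpha> / (1 + y\<^sup>2)"
    proof -
      have "norm (a / of_real (2 * \<alpha> * y) / of_real y) = norm a / (\<alpha> * (2 * y\<^sup>2))"
        using y \<alpha> by (simp add: norm_divide norm_mult power2_eq_square)
      also have "\<dots> \<le> A / (\<alpha> * (1 + y\<^sup>2))" using a y2 \<alpha> A by (intro frac_le) (auto intro!: mult_pos_pos add_pos_nonneg)
      finally show ?thesis by simp
    qed
    have "norm (double_sine_kernel \<alpha> a y) \<le> norm (sinh (a * of_real y) / of_real (2 * sinh y * sinh (\<alpha> * y)) / of_real y) +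
        norm (a / of_real (2 * \<alpha> * y) / of_real y)"
      unfolding double_sine_kernel_def diff_divide_distrib by (rule norm_triangle_ineq4)
    also have "norm (sinh (a * of_real y) / of_real (2 * sinh y * sinh (\<alpha> * y)) / of_real y) \<le>
        norm (sinh (a * of_real y) / of_real (2 * sinh y * sinh (\<alpha> * y)))"
      unfolding norm_divide[of _ "of_real y"] using y by (simp add: divide_le_eq mult_le_cancel_left1)
    finally show ?thesis using 1 2 unfolding C2_def by (simp add: add_divide_distrib)
  qed
  have C2: "C2 \<ge> 0" using \<alpha> A d by (auto simp: C2_def intro!: divide_nonneg_nonneg add_nonneg_nonneg mult_nonneg_nonneg)
  show ?thesis
  \<comment> \<open>The factor 2 bounds 1 + y^2 on (0, 1], and the summand 1 makes the constant
    strictly positive.\<close>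
  proof (rule that[of "2 * C1 + C2 + 1"])
    fix a y assume y: "(y::real) > 0" and a: "\<bar>Re a\<bar> \<le> m" "norm a \<le> A"
    have p: "1 + y\<^sup>2 > 0" by (simp add: add_pos_nonneg)
    show "norm (double_sine_kernel \<alpha> a y) \<le> (2 * C1 + C2 + 1) / (1 + y\<^sup>2)"
    proof (cases "y \<le> 1")
      case True
      have "C1 * (1 + y\<^sup>2) \<le> C1 * 2" using True y C1 by (intro mult_left_mono) (auto simp: power_le_one)
      then have "C1 * (1 + y\<^sup>2) \<le> 2 * C1 + C2 + 1" using C2 by simp
      then have "C1 \<le> (2 * C1 + C2 + 1) / (1 + y\<^sup>2)" using p by (simp add: pos_le_divide_eq)
      then show ?thesis using small[OF y True a(2)] by simp
    next
      case False
      have "norm (double_sine_kernel \<alpha> a y) \<le> C2 / (1 + y\<^sup>2)" using False a by (intro large) auto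
      also have "\<dots> \<le> (2 * C1 + C2 + 1) / (1 + y\<^sup>2)" using C1 p by (intro divide_right_mono) auto
      finally show ?thesis .
    qed
  qed (use C1 C2 in auto)
qed

lemma integrable_inverse_1_plus_square: "integrable lborel (\<lambda>y::real. C / (1 + y\<^sup>2))" for C :: real
proof -
  have p: "1 + x\<^sup>2 \<noteq> 0" for x :: real by (metis add_pos_nonneg less_irrefl zero_le_power2 zero_less_one)
  have "set_integrable lborel (einterval (-\<infinity>) \<infinity>) (\<lambda>y::real. 1 / (1 + y\<^sup>2))"
  proof (rule interval_integral_FTC_nonneg)
    show "DERIV arctan x :> 1 / (1 + x\<^sup>2)" for x :: real
      by (auto intro!: derivative_eq_intros simp: divide_inverse)
    show "((arctan \<circ> real_of_ereal) \<longlongrightarrow> - (pi / 2)) (at_right (-\<infinity>))"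
      by (simp add: ereal_tendsto_simps tendsto_arctan_at_bot)
    show "((arctan \<circ> real_of_ereal) \<longlongrightarrow> pi / 2) (at_left \<infinity>)"
      by (simp add: ereal_tendsto_simps tendsto_arctan_at_top)
  qed (auto intro!: continuous_intros simp: p)
  then have "integrable lborel (\<lambda>y::real. 1 / (1 + y\<^sup>2))"
    by (simp add: set_integrable_def)
  from integrable_mult_right[OF this, of C] show ?thesis by simp
qed

lemma double_sine_kernel_measurable [measurable]:
  assumes "\<alpha> > 0"
  shows "(\<lambda>y. indicator {0<..} y *\<^sub>R double_sine_kernel \<alpha> a y) \<in> borel_measurable borel"
  unfolding double_sine_kernel_def
  by (rule borel_measurable_continuous_on_indicator)
     (use assms in \<open>auto intro!: continuous_intros\<close>)

lemma double_sine_kernel_integrable: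
  assumes "\<alpha> > 0" "\<bar>Re a\<bar> < 1 + \<alpha>"
  shows "set_integrable lborel {0<..} (double_sine_kernel \<alpha> a)"
proof -
  obtain C where C: "C > 0" "\<And>y. y > 0 \<Longrightarrow> norm (double_sine_kernel \<alpha> a y) \<le> C / (1 + y\<^sup>2)"
    using double_sine_kernel_bound[OF assms(1), of "\<bar>Re a\<bar>" "norm a"] assms(2) by (metis abs_ge_zero norm_ge_zero order_refl)
  show ?thesis
    unfolding set_integrable_def
  proof (rule Bochner_Integration.integrable_bound[OF integrable_inverse_1_plus_square[of C]])
    show "AE y in lborel. norm (indicat_real {0<..} y *\<^sub>R double_sine_kernel \<alpha> a y) \<le> norm (C / (1 + y\<^sup>2))"
    proof (rule AE_I2)
      fix y :: real
      show "norm (indicat_real {0<..} y *\<^sub>R double_sine_kernel \<alpha> a y) \<le> norm (C / (1 + y\<^sup>2))"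
        using C(2)[of y] C(1) by (auto simp: indicator_def)
    qed
  qed (use double_sine_kernel_measurable[OF assms(1)] in simp)
qed

definition log_S2_strip :: "real \<Rightarrow> complex \<Rightarrow> complex" where
  "log_S2_strip \<alpha> z = (LBINT y:{0<..}. log_S2_integrand \<alpha> z y)"

text \<open>Being an exponential it vanishes nowhere; outside the strip all zeros and poles of
  \<open>S2\<close> stem from the sines of the functional equation.\<close>

definition S2_strip :: "real \<Rightarrow> complex \<Rightarrow> complex" where
  "S2_strip \<alpha> z = exp (log_S2_strip \<alpha> z)"

lemma S2_strip_nonzero [simp]: "S2_strip \<alpha> z \<noteq> 0"
  by (simp add: S2_strip_def)

lemma open_vertical_strip: "open {z. a < Re z \<and> Re z < b}" and convex_vertical_strip: "convex {z. a < Re z \<and> Re z < b}"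
proof -
  have "{z. a < Re z \<and> Re z < b} = {z. Re z > a} \<inter> {z. Re z < b}" by auto
  then show "open {z. a < Re z \<and> Re z < b}" "convex {z. a < Re z \<and> Re z < b}"
    by (auto intro!: open_Int convex_Int open_halfspace_Re_gt open_halfspace_Re_lt
        convex_halfspace_Re_gt convex_halfspace_Re_lt)
qed

lemma set_integral_double_sine_kernel_holomorphic:
  assumes \<alpha>: "\<alpha> > 0"
  shows "(\<lambda>a. LBINT y:{0<..}. double_sine_kernel \<alpha> a y) holomorphic_on {a. - (1 + \<alpha>) < Re a \<and> Re a < 1 + \<alpha>}"
proof (rule holomorphic_onI)
  let ?S = "{a. - (1 + \<alpha>) < Re a \<and> Re a < 1 + \<alpha>}"
  fix z assume z: "z \<in> ?S"
  \<comment> \<open>\<open>m\<close> lies halfway between |Re z| and the edge of the strip, so the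
    disc of radius \<open>m - \<bar>Re z\<bar>\<close> about \<open>z\<close> stays inside |Re a|
    \<le> m.\<close>
  define m where "m = (\<bar>Re z\<bar> + (1 + \<alpha>)) / 2"
  have m: "\<bar>Re z\<bar> < m" "m < 1 + \<alpha>" "0 \<le> m" using z by (auto simp: m_def)
  define r where "r = m - \<bar>Re z\<bar>"
  obtain C where C: "C > 0" "\<And>a y. y > 0 \<Longrightarrow> \<bar>Re a\<bar> \<le> m \<Longrightarrow> norm a \<le> norm z + r \<Longrightarrow> norm (double_sine_kernel \<alpha> a y) \<le> C / (1 + y\<^sup>2)"
    using double_sine_kernel_bound[OF \<alpha> m(3,2), of "norm z + r"] m by (metis r_def add_nonneg_nonneg norm_ge_zero diff_ge_0_iff_ge less_imp_le)
  have "((\<lambda>a. \<integral>y. indicator {0<..} y *\<^sub>R double_sine_kernel \<alpha> a y \<partial>lborel) has_field_derivative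
     (\<integral>y. deriv (\<lambda>a. indicator {0<..} y *\<^sub>R double_sine_kernel \<alpha> a y) z \<partial>lborel)) (at z)"
  proof (rule has_field_derivative_integral_param[OF open_vertical_strip z _ _ integrable_inverse_1_plus_square[of C], where r = r])
    show "(\<lambda>w. indicat_real {0<..} y *\<^sub>R double_sine_kernel \<alpha> w y) holomorphic_on ?S" for y
      using \<alpha> by (cases "y > 0") (auto simp: double_sine_kernel_def indicator_def intro!: holomorphic_intros)
    show "r > 0" using m by (simp add: r_def)
    fix w y assume w: "w \<in> ?S" "dist z w < r"
    have "\<bar>Re w\<bar> \<le> m" "norm w \<le> norm z + r"
    proof -
      have "\<bar>Re (w - z)\<bar> \<le> norm (w - z)" by (rule abs_Re_le_cmod)
      then show "\<bar>Re w\<bar> \<le> m" using w by (simp add: r_def dist_norm norm_minus_commute)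
      have "norm w \<le> norm z + norm (w - z)" by (rule norm_triangle_sub)
      then show "norm w \<le> norm z + r" using w by (simp add: dist_norm norm_minus_commute)
    qed
    then show "norm (indicat_real {0<..} y *\<^sub>R double_sine_kernel \<alpha> w y) \<le> C / (1 + y\<^sup>2)"
      using C(1) C(2)[of y w] by (auto simp: indicator_def add_pos_nonneg)
  qed (use double_sine_kernel_measurable[OF \<alpha>] in auto)
  then have "(\<lambda>a. LBINT y:{0<..}. double_sine_kernel \<alpha> a y) field_differentiable at z"
    unfolding set_lebesgue_integral_def field_differentiable_def by (rule exI)
  then show "(\<lambda>a. LBINT y:{0<..}. double_sine_kernel \<alpha> a y) field_differentiable at z within ?S"
    by (rule field_differentiable_at_within)
qed

lemma log_S2_strip_holomorphic:
  assumes "\<alpha> > 0"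
  shows "log_S2_strip \<alpha> holomorphic_on {z. 0 < Re z \<and> Re z < 1 + \<alpha>}"
proof -
  have "(\<lambda>a. LBINT y:{0<..}. double_sine_kernel \<alpha> a y) \<circ> (\<lambda>z. 2 * z - 1 - of_real \<alpha>) holomorphic_on {z. 0 < Re z \<and> Re z < 1 + \<alpha>}"
  proof (rule holomorphic_on_compose_gen[OF _ set_integral_double_sine_kernel_holomorphic[OF assms]])
    show "(\<lambda>z. 2 * z - 1 - complex_of_real \<alpha>) holomorphic_on {z. 0 < Re z \<and> Re z < 1 + \<alpha>}"
      by (intro holomorphic_on_diff holomorphic_on_mult holomorphic_on_const holomorphic_on_ident)
    show "(\<lambda>z. 2 * z - 1 - complex_of_real \<alpha>) ` {z. 0 < Re z \<and> Re z < 1 + \<alpha>} \<subseteq> {a. - (1 + \<alpha>) < Re a \<and> Re a < 1 + \<alpha>}"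
      by (rule image_subsetI) simp
  qed
  then show ?thesis unfolding comp_def log_S2_strip_def log_S2_integrand_eq .
qed

lemma S2_strip_holomorphic:
  assumes "\<alpha> > 0"
  shows "S2_strip \<alpha> holomorphic_on {z. 0 < Re z \<and> Re z < 1 + \<alpha>}"
  unfolding S2_strip_def using log_S2_strip_holomorphic[OF assms] by (intro holomorphic_intros)

text \<open>The integrand is odd about the centre (1 + \<alpha>)/2 of the strip, and negation
  commutes with the integral even where that takes its default value.\<close>

lemma S2_strip_reflection:
  shows "S2_strip \<alpha> z * S2_strip \<alpha> (1 + of_real \<alpha> - z) = 1"
proof -
  have "log_S2_integrand \<alpha> (1 + of_real \<alpha> - z) y = - log_S2_integrand \<alpha> z y" for y
  proof -
    have "2 * (1 + of_real \<alpha> - z) - 1 - of_real \<alpha> = - (2 * z - 1 - of_real \<alpha>)" by (simp add: algebra_simps)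
    moreover have "double_sine_kernel \<alpha> (- a) y = - double_sine_kernel \<alpha> a y" for a
      by (simp add: double_sine_kernel_def diff_divide_distrib)
    ultimately show ?thesis
      unfolding log_S2_integrand_eq by metis
  qed
  then have "log_S2_strip \<alpha> (1 + of_real \<alpha> - z) = - log_S2_strip \<alpha> z"
    by (simp add: log_S2_strip_def set_lebesgue_integral_def)
  then show ?thesis by (simp add: S2_strip_def exp_add[symmetric])
qed

lemma cnj_sinh: "cnj (sinh z) = sinh (cnj z)"
  by (simp add: sinh_field_def exp_cnj)

lemma log_S2_strip_cnj: "log_S2_strip \<alpha> (cnj z) = cnj (log_S2_strip \<alpha> z)"
proof -
  have "log_S2_integrand \<alpha> (cnj z) y = cnj (log_S2_integrand \<alpha> z y)" for y
    by (simp add: log_S2_integrand_def cnj_sinh)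
  then show ?thesis
    unfolding log_S2_strip_def set_lebesgue_integral_def
    by (simp add: scaleR_conv_of_real Bochner_Integration.integral_cnj[symmetric] del: Bochner_Integration.integral_cnj)
qed

lemma S2_strip_cnj: "S2_strip \<alpha> (cnj z) = cnj (S2_strip \<alpha> z)"
  by (simp add: S2_strip_def exp_cnj log_S2_strip_cnj)

section \<open>Functional equations on the strip\<close>

lemma set_integral_Ioi_scale:
  fixes g :: "real \<Rightarrow> complex"
  assumes "c > 0"
  shows "(LBINT y:{0<..}. of_real c * g (c * y)) = (LBINT y:{0<..}. g y)"
proof -
  have "(LBINT y:{0<..}. g y) = \<bar>c\<bar> *\<^sub>R (LBINT y. indicator {0<..} (0 + c * y) *\<^sub>R g (0 + c * y))"
    unfolding set_lebesgue_integral_def using assms by (subst lborel_integral_real_affine[where c = c and t = 0]) auto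
  also have "\<dots> = (LBINT y. indicator {0<..} y *\<^sub>R (of_real c * g (c * y)))"
    using assms by (simp add: indicator_def zero_less_mult_iff scaleR_conv_of_real mult_ac flip: integral_mult_right_zero)
  finally show ?thesis unfolding set_lebesgue_integral_def by simp
qed

lemma integral_lincomb:
  fixes g h :: "'a \<Rightarrow> complex"
  assumes "integrable M g" "integrable M h"
  shows "(\<integral>x. (c * g x - d * h x) / k \<partial>M) = (c * (\<integral>x. g x \<partial>M) - d * (\<integral>x. h x \<partial>M)) / k"
  using assms by simp

lemma integral_even_eq:
  fixes g :: "real \<Rightarrow> complex"
  assumes int: "integrable lborel g" and even: "\<And>t. g (- t) = g t"
  shows "(LBINT t. g t) = 2 * (LBINT t:{0<..}. g t)"
proof -
  have i: "set_integrable lborel A g" if "A \<in> sets lborel" for A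
    using int that unfolding set_integrable_def by (intro integrable_scaleR_left integrable_mult_indicator)
  have "(LBINT t. g t) = (LBINT t:{0<..} \<union> {..<0}. g t)"
    unfolding set_lebesgue_integral_def
  proof (rule integral_cong_AE)
    show "AE t in lborel. g t = indicat_real ({0<..} \<union> {..<0}) t *\<^sub>R g t"
      using AE_lborel_singleton[of "0::real"] by eventually_elim (auto simp: indicator_def)
  qed (use int in auto)
  also have "\<dots> = (LBINT t:{0<..}. g t) + (LBINT t:{..<0}. g t)"
    by (rule set_integral_Un) (auto intro: i)
  also have "(LBINT t:{..<0}. g t) = (LBINT t. indicator {..<0} (0 + (-1) * t) *\<^sub>R g (0 + (-1) * t))"
    unfolding set_lebesgue_integral_def by (subst lborel_integral_real_affine[where c = "-1" and t = 0]) auto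
  also have "\<dots> = (LBINT t:{0<..}. g t)"
    unfolding set_lebesgue_integral_def by (simp add: even indicator_def)
  finally show ?thesis by simp
qed

section \<open>Two classical integrals by shifting contours\<close>

lemma norm_sinh_ge: "sinh \<bar>Re u\<bar> \<le> norm (sinh u)" and norm_cosh_ge: "sinh \<bar>Re u\<bar> \<le> norm (cosh u)" for u :: complex
proof -
  have "sinh \<bar>Re u\<bar> = \<bar>norm (exp u) - norm (exp (- u))\<bar> / 2"
    by (auto simp: sinh_field_def abs_if)
  moreover have "\<bar>norm (exp u) - norm (exp (- u))\<bar> \<le> norm (exp u - exp (- u))"
    by (rule norm_triangle_ineq3)
  moreover have "\<bar>norm (exp u) - norm (exp (- u))\<bar> \<le> norm (exp u + exp (- u))"
    using norm_triangle_ineq3[of "exp u" "- exp (- u)"] by simp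
  ultimately show "sinh \<bar>Re u\<bar> \<le> norm (sinh u)" "sinh \<bar>Re u\<bar> \<le> norm (cosh u)"
    by (auto simp: sinh_field_def cosh_field_def norm_divide)
qed

lemma sinh_ge_exp: "1 \<le> x \<Longrightarrow> exp x / 4 \<le> sinh x" for x :: real
proof -
  assume x: "1 \<le> x"
  have "2 \<le> exp (1::real)" using exp_ge_add_one_self[of 1] by simp
  also have "\<dots> \<le> exp (2 * x)" using x by simp
  finally have "exp (- (2 * x)) \<le> 1 / 2" by (simp add: exp_minus field_simps)
  then have "exp x * exp (- (2 * x)) \<le> exp x * (1 / 2)" by (rule mult_left_mono) simp
  then have "(exp x - exp x * (1 / 2)) / 2 \<le> (exp x - exp x * exp (- (2 * x))) / 2"
    by (intro divide_right_mono diff_left_mono) auto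
  then show ?thesis by (simp add: sinh_field_def exp_add[symmetric])
qed

text \<open>Only the exponential numerator is estimated: the bounded imaginary part of
  \<open>u\<close> contributes a constant, and the real part a growth that \<open>cosh\<close> or
  \<open>sinh\<close> will beat when k < 1.\<close>

lemma exp_over_cosh_bound:
  fixes a :: complex
  assumes "1 \<le> \<bar>Re u\<bar>" "0 \<le> Im u" "Im u \<le> m" "\<bar>Re a\<bar> \<le> k"
  shows "norm (exp (a * u)) \<le> exp (\<bar>Im a\<bar> * m) * exp (k * \<bar>Re u\<bar>)"
proof -
  have "Re (a * u) \<le> \<bar>Im a\<bar> * m + k * \<bar>Re u\<bar>"
  proof -
    have "Re a * Re u \<le> \<bar>Re a\<bar> * \<bar>Re u\<bar>" by (metis abs_ge_self abs_mult)
    also have "\<dots> \<le> k * \<bar>Re u\<bar>" using assms by (intro mult_right_mono) auto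
    finally have 1: "Re a * Re u \<le> k * \<bar>Re u\<bar>" .
    have "- (Im a * Im u) \<le> \<bar>Im a\<bar> * \<bar>Im u\<bar>" by (metis abs_ge_minus_self abs_mult)
    also have "\<dots> \<le> \<bar>Im a\<bar> * m" using assms by (intro mult_left_mono) auto
    finally show ?thesis using 1 by simp
  qed
  then show ?thesis by (simp add: exp_add[symmetric])
qed

text \<open>The strip from Im u = 0 to Im u = pi contains the single pole i pi/2, and the upper edge
  reproduces the lower one up to the factor - exp (i pi a). The product form of the result spares a
  discussion of zeros of the cosine.\<close>

lemma exp_over_cosh_integral:
  fixes a :: complex
  assumes a: "\<bar>Re a\<bar> < 1"
  shows "integrable lborel (\<lambda>t::real. exp (a * t) / cosh (of_real t))"
    and "(LBINT t. exp (a * of_real t) / cosh (of_real t)) * cos (pi * a / 2) = pi"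
proof -
  let ?f = "\<lambda>u. exp (a * u) / cosh u"
  \<comment> \<open>The margins -1 and 4 leave room around [0, pi] but keep out the neighbouring
    zeros - i pi/2 and 3 i pi/2.\<close>
  have zero: "u = \<i> * pi / 2" if "-1 < Im u" "Im u < 4" "cosh u = 0" for u
  proof -
    have "cos (\<i> * u) = 0" using that by (simp add: cosh_conv_cos)
    then obtain n where n: "\<i> * u = of_real (real_of_int n * pi) + of_real pi / 2"
      by (auto simp: cos_eq_0)
    then have "Re (\<i> * u) = real_of_int n * pi + pi / 2" "Im (\<i> * u) = 0" by (metis Re_complex_of_real of_real_add of_real_divide of_real_numeral, metis Im_complex_of_real of_real_add of_real_divide of_real_numeral)
    then have *: "Im u = - (real_of_int n * pi + pi / 2)" "Re u = 0" by auto
    have "real_of_int n * pi < 0" using * that pi_gt3 by simp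
    then have "n < 0" by (simp add: mult_less_0_iff)
    have "real_of_int (- 2) * pi < real_of_int n * pi"
      using * that pi_gt3 by simp
    then have "real_of_int (- 2) < real_of_int n" by (rule mult_right_less_imp_less) simp
    then have "- 2 < n" by (simp only: of_int_less_iff)
    then have "n = -1" using \<open>n < 0\<close> by linarith
    then show ?thesis using * by (auto simp: complex_eq_iff)
  qed
  have "?f holomorphic_on {u. -1 < Im u \<and> Im u < 4} - {\<i> * pi / 2}"
    using zero by (auto intro!: holomorphic_intros)
  note R = strip_residue[of "-1" 0 pi 4 "{\<i> * pi / 2}" ?f "1 - \<bar>Re a\<bar>" 1 "4 * exp (\<bar>Im a\<bar> * pi)", OF _ _ _ _ _ this]
  have bd: "norm (?f u) \<le> 4 * exp (\<bar>Im a\<bar> * pi) * exp (- (1 - \<bar>Re a\<bar>) * \<bar>Re u\<bar>)"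
    if u: "0 \<le> Im u" "Im u \<le> pi" "1 \<le> \<bar>Re u\<bar>" for u
  proof -
    have "norm (exp (a * u)) / norm (cosh u) \<le> exp (\<bar>Im a\<bar> * pi) * exp (\<bar>Re a\<bar> * \<bar>Re u\<bar>) / (exp \<bar>Re u\<bar> / 4)"
    proof (intro frac_le exp_over_cosh_bound)
      show "exp \<bar>Re u\<bar> / 4 \<le> norm (cosh u)" using sinh_ge_exp[OF u(3)] norm_cosh_ge[of u] by linarith
    qed (use u in simp_all)
    also have "\<dots> = 4 * exp (\<bar>Im a\<bar> * pi) * exp (- (1 - \<bar>Re a\<bar>) * \<bar>Re u\<bar>)"
      by (simp add: exp_diff left_diff_distrib)
    finally show ?thesis by (simp add: norm_divide)
  qed
  have prem: "-1 < (0::real)" "0 < pi" "pi < 4" "finite {\<i> * complex_of_real pi / 2}" "0 < 1 - \<bar>Re a\<bar>"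
    using a pi_less_4 pi_gt_zero by simp_all
  have "0 < Im (\<i> * complex_of_real pi / 2) \<and> Im (\<i> * complex_of_real pi / 2) < pi" by simp
  then have prem2: "0 < Im p \<and> Im p < pi" if "p \<in> {\<i> * complex_of_real pi / 2}" for p
    using that by (simp only: singleton_iff)
  have R1: "integrable lborel (\<lambda>t. ?f (Complex t 0))"
    by (rule R(1)) (use prem prem2 bd in \<open>simp_all only:\<close>)
  then show "integrable lborel (\<lambda>t::real. exp (a * t) / cosh (of_real t))"
    by (simp add: complex_of_real_def)
  have R3: "(LBINT t. ?f (Complex t 0)) - (LBINT t. ?f (Complex t pi)) = 2 * pi * \<i> * (\<Sum>p\<in>{\<i> * pi / 2}. residue ?f p)"
    by (rule R(3)) (use prem prem2 bd in \<open>simp_all only:\<close>)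
  have ch: "cosh (\<i> * complex_of_real pi / 2) = 0" and sh: "sinh (\<i> * complex_of_real pi / 2) = \<i>"
  proof -
    have "\<i> * (\<i> * complex_of_real pi / 2) = - complex_of_real (pi / 2)" by simp
    then have "cosh (\<i> * complex_of_real pi / 2) = cos (complex_of_real (pi / 2))"
      "sinh (\<i> * complex_of_real pi / 2) = \<i> * sin (complex_of_real (pi / 2))"
      unfolding cosh_conv_cos sinh_conv_sin by (simp_all only: cos_minus sin_minus) auto
    then show "cosh (\<i> * complex_of_real pi / 2) = 0" "sinh (\<i> * complex_of_real pi / 2) = \<i>"
      unfolding cos_of_real sin_of_real by auto
  qed
  have res: "residue ?f (\<i> * pi / 2) = exp (a * (\<i> * pi / 2)) / \<i>"
  proof (rule residue_simple_pole_deriv[where s = UNIV and g' = \<i>])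
    show "(cosh has_field_derivative \<i>) (at (\<i> * complex_of_real pi / 2))"
      by (rule derivative_eq_intros refl)+ (simp add: sh)
  qed (auto intro!: holomorphic_intros simp: ch)
  have shift: "?f (Complex t pi) = - exp (\<i> * pi * a) * ?f (of_real t)" for t
  proof -
    have "Complex t pi = of_real t + \<i> * pi" by (simp add: complex_eq_iff)
    moreover have "cosh (of_real t + \<i> * pi) = - cosh (of_real t)"
      by (simp add: cosh_field_def exp_add exp_diff exp_minus exp_pi_i minus_divide_left[symmetric] algebra_simps)
    ultimately show ?thesis by (simp add: ring_distribs exp_add mult_ac)
  qed
  define I where "I = (LBINT t. ?f (of_real t))"
  have I0: "(LBINT t. ?f (Complex t 0)) = I" by (simp add: I_def complex_of_real_def)
  have I1: "(LBINT t. ?f (Complex t pi)) = - exp (\<i> * pi * a) * I"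
    unfolding shift I_def by (rule integral_mult_right_zero)
  have "I + exp (\<i> * pi * a) * I = 2 * pi * exp (a * (\<i> * pi / 2))"
  proof -
    have s: "sum g {c} = g c" for g :: "complex \<Rightarrow> complex" and c by simp
    have "I - - exp (\<i> * pi * a) * I = 2 * pi * \<i> * (exp (a * (\<i> * pi / 2)) / \<i>)"
      using R3 unfolding I0 I1 s res .
    moreover have "2 * complex_of_real pi * \<i> * (X / \<i>) = 2 * pi * X" for X :: complex by simp
    ultimately show ?thesis by (simp only: mult_minus_left diff_minus_eq_add of_real_mult of_real_numeral)
  qed
  moreover have "cos (pi * a / 2) * (2 * exp (a * (\<i> * pi / 2))) = 1 + exp (\<i> * pi * a)"
  proof -
    define q where "q = exp (\<i> * (pi * a / 2))"
    have q: "exp (a * (\<i> * pi / 2)) = q" "q \<noteq> 0" by (simp_all add: q_def mult_ac)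
    have "\<i> * pi * a = \<i> * (pi * a / 2) + \<i> * (pi * a / 2)" by simp
    then have q2: "exp (\<i> * pi * a) = q * q" unfolding q_def exp_add[symmetric] by (rule arg_cong)
    have "cos (pi * a / 2) = (q + inverse q) / 2" by (simp add: cos_exp_eq q_def exp_minus)
    then show ?thesis unfolding q q2 using q(2) by (simp add: field_simps)
  qed
  ultimately have "I * cos (pi * a / 2) * (2 * exp (a * (\<i> * pi / 2))) = pi * (2 * exp (a * (\<i> * pi / 2)))"
    by (simp add: algebra_simps)
  then show "(LBINT t. exp (a * of_real t) / cosh (of_real t)) * cos (pi * a / 2) = pi"
    unfolding I_def by (subst (asm) mult_right_cancel) auto
qed

lemma isCont_sinh_quotient: "((\<lambda>w::complex. sinh (a * w) / sinh w) \<longlongrightarrow> a) (at 0)"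
proof -
  have 1: "((\<lambda>w. (sinh (a * w) - sinh (a * 0)) / (w - 0)) \<longlongrightarrow> a) (at 0)"
    using DERIV_def[of "\<lambda>w. sinh (a * w)" a 0] unfolding has_field_derivative_iff[symmetric]
    by (auto intro!: derivative_eq_intros)
  have 2: "((\<lambda>w::complex. (sinh w - sinh 0) / (w - 0)) \<longlongrightarrow> 1) (at 0)"
    unfolding has_field_derivative_iff[symmetric] by (auto intro!: derivative_eq_intros)
  have "((\<lambda>w. ((sinh (a * w) - sinh (a * 0)) / (w - 0)) / ((sinh w - sinh 0) / (w - 0))) \<longlongrightarrow> a / 1) (at 0)"
    by (rule tendsto_divide[OF 1 2]) simp
  moreover have "\<forall>\<^sub>F w in at 0. ((sinh (a * w) - sinh (a * 0)) / (w - 0)) / ((sinh w - sinh 0) / (w - 0)) = sinh (a * w) / sinh w"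
    unfolding eventually_at by (rule exI[of _ 1]) (auto simp: field_simps)
  ultimately show ?thesis unfolding div_by_1 by (rule Lim_transform_eventually)
qed

text \<open>The singularity at 0 is removable, so the contour moves up by i pi/2 without crossing a
  pole. There \<open>sinh u\<close> becomes a multiple of \<open>cosh\<close>, and the previous
  integral at \<open>a\<close> and \<open>- a\<close> finishes the computation.\<close>

lemma sinh_over_sinh_integral:
  fixes a :: complex
  assumes a: "\<bar>Re a\<bar> < 1"
  shows "(LBINT t:{0<..}. sinh (a * of_real t) / of_real (sinh t)) * (2 * cos (pi * a / 2)) = pi * sin (pi * a / 2)"
proof -
  define f where "f = (\<lambda>u. if u = 0 then a else sinh (a * u) / sinh u)"
  let ?S = "{u. -1 < Im u \<and> Im u < 3}"
  have S: "open ?S"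
  proof -
    have "?S = {u. Im u > -1} \<inter> {u. Im u < 3}" by auto
    then show "open ?S" by (auto intro!: open_Int open_halfspace_Im_gt open_halfspace_Im_lt)
  qed
  have zero: "u = 0" if "-1 < Im u" "Im u < 3" "sinh u = 0" for u
  proof -
    have "sin (\<i> * u) = 0" using that by (simp add: sinh_conv_sin)
    then obtain n where n: "\<i> * u = of_real (real_of_int n * pi)"
      by (auto simp: sin_eq_0)
    then have "Re (\<i> * u) = real_of_int n * pi" "Im (\<i> * u) = 0" by (metis Re_complex_of_real, metis Im_complex_of_real)
    then have *: "Im u = - (real_of_int n * pi)" "Re u = 0" by auto
    have "real_of_int n * pi < 1 * pi" using *(1) that pi_gt3 unfolding mult_1 by linarith
    then have "real_of_int n < 1" by (rule mult_right_less_imp_less) simp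
    have "(- 1) * pi < real_of_int n * pi" using *(1) that pi_gt3 by linarith
    then have "- 1 < real_of_int n" by (rule mult_right_less_imp_less) simp
    then have "n = 0" using \<open>real_of_int n < 1\<close> by linarith
    then show ?thesis using * by (auto simp: complex_eq_iff)
  qed
  have hol0: "f holomorphic_on ?S - {0}"
  proof -
    have "(\<lambda>u. sinh (a * u) / sinh u) holomorphic_on ?S - {0}"
      using zero by (auto intro!: holomorphic_intros)
    then show ?thesis by (rule holomorphic_transform) (simp add: f_def)
  qed
  have "f holomorphic_on ?S"
  proof (rule no_isolated_singularity[OF _ hol0 S])
    show "continuous_on ?S f"
    proof (rule continuous_at_imp_continuous_on, rule ballI)
      fix x assume x: "x \<in> ?S"
      show "isCont f x"
      proof (cases "x = 0")
        case True
        have "(f \<longlongrightarrow> a) (at 0)"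
          using isCont_sinh_quotient[of a] by (rule Lim_transform_eventually) (auto simp: f_def eventually_at intro!: exI[of _ 1])
        then show ?thesis by (simp add: True isCont_def f_def)
      next
        case False
        have "continuous_on (?S - {0}) f" using hol0 by (rule holomorphic_on_imp_continuous_on)
        then show ?thesis using False x S by (simp add: continuous_on_eq_continuous_at open_delete)
      qed
    qed
  qed simp
  then have hol: "f holomorphic_on ?S - {}" by simp
  note R = strip_residue[of "-1" 0 "pi/2" 3 "{}" f "1 - \<bar>Re a\<bar>" 1 "4 * exp (\<bar>Im a\<bar> * pi)", OF _ _ _ _ _ hol]
  have bd: "norm (f u) \<le> 4 * exp (\<bar>Im a\<bar> * pi) * exp (- (1 - \<bar>Re a\<bar>) * \<bar>Re u\<bar>)"
    if u: "0 \<le> Im u" "Im u \<le> pi / 2" "1 \<le> \<bar>Re u\<bar>" for u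
  proof -
    have 1: "norm (exp (a * u)) \<le> exp (\<bar>Im a\<bar> * pi) * exp (\<bar>Re a\<bar> * \<bar>Re u\<bar>)"
      using u pi_gt_zero by (intro exp_over_cosh_bound) linarith+
    have 2: "norm (exp ((- a) * u)) \<le> exp (\<bar>Im (- a)\<bar> * pi) * exp (\<bar>Re a\<bar> * \<bar>Re u\<bar>)"
      using exp_over_cosh_bound[of u pi "- a" "\<bar>Re a\<bar>"] u pi_gt_zero by simp
    have "norm (sinh (a * u)) \<le> (norm (exp (a * u)) + norm (exp ((- a) * u))) / 2"
      unfolding sinh_field_def norm_divide using norm_triangle_ineq4[of "exp (a * u)" "exp (- (a * u))"]
      by (simp del: norm_exp_eq_Re)
    also have "\<dots> \<le> exp (\<bar>Im a\<bar> * pi) * exp (\<bar>Re a\<bar> * \<bar>Re u\<bar>)" using 1 2 by simp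
    finally have 3: "norm (sinh (a * u)) \<le> exp (\<bar>Im a\<bar> * pi) * exp (\<bar>Re a\<bar> * \<bar>Re u\<bar>)" .
    have "norm (sinh (a * u)) / norm (sinh u) \<le> exp (\<bar>Im a\<bar> * pi) * exp (\<bar>Re a\<bar> * \<bar>Re u\<bar>) / (exp \<bar>Re u\<bar> / 4)"
    proof (intro frac_le 3)
      show "exp \<bar>Re u\<bar> / 4 \<le> norm (sinh u)" using sinh_ge_exp[OF u(3)] norm_sinh_ge[of u] by linarith
    qed simp_all
    also have "\<dots> = 4 * exp (\<bar>Im a\<bar> * pi) * exp (- (1 - \<bar>Re a\<bar>) * \<bar>Re u\<bar>)"
      by (simp add: exp_diff left_diff_distrib)
    finally show ?thesis using u by (auto simp: norm_divide f_def)
  qed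
  have prem: "-1 < (0::real)" "0 < pi / 2" "pi / 2 < 3" "0 < 1 - \<bar>Re a\<bar>"
    using a pi_less_4 by auto
  have R1: "integrable lborel (\<lambda>t. f (Complex t 0))"
    by (rule R(1)) (use prem bd in auto)
  have R3: "(LBINT t. f (Complex t 0)) - (LBINT t. f (Complex t (pi / 2))) = 2 * pi * \<i> * (\<Sum>p\<in>{}. residue f p)"
    by (rule R(3)) (use prem bd in auto)
  then have R4: "(LBINT t. f (Complex t 0)) = (LBINT t. f (Complex t (pi / 2)))" by simp
  have even: "f (Complex (- t) 0) = f (Complex t 0)" for t
  proof -
    have "Complex (- t) 0 = - Complex t 0" by (simp add: complex_eq_iff)
    then show ?thesis by (simp add: f_def)
  qed
  have half: "(LBINT t. f (Complex t 0)) = 2 * (LBINT t:{0<..}. sinh (a * of_real t) / of_real (sinh t))"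
  proof -
    have "(LBINT t. f (Complex t 0)) = 2 * (LBINT t:{0<..}. f (Complex t 0))"
      by (rule integral_even_eq[OF R1 even])
    also have "(LBINT t:{0<..}. f (Complex t 0)) = (LBINT t:{0<..}. sinh (a * of_real t) / of_real (sinh t))"
    proof (rule set_lebesgue_integral_cong)
      have "sinh (complex_of_real t) = of_real (sinh t)" for t
        by (simp add: sinh_field_def exp_of_real[symmetric] del: exp_of_real)
      then show "\<forall>t. t \<in> {0<..} \<longrightarrow> f (Complex t 0) = sinh (a * of_real t) / of_real (sinh t)"
        by (simp add: f_def complex_of_real_def Complex_eq_0)
    qed simp
    finally show ?thesis .
  qed
  let ?e = "\<lambda>a t. exp (a * of_real t) / cosh (complex_of_real t)"
  let ?q = "exp (\<i> * (pi * a / 2))"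
  \<comment> \<open>On the upper line sinh (t + i pi/2) = i cosh t, and the numerator splits into
    two exponentials with opposite phases.\<close>
  have shift: "f (Complex t (pi / 2)) = (?q * ?e a t - inverse ?q * ?e (- a) t) / (2 * \<i>)" for t
  proof -
    have C: "Complex t (pi / 2) = of_real t + \<i> * (pi / 2)" by (simp add: complex_eq_iff)
    have e0: "exp (\<i> * complex_of_real (pi / 2)) = \<i>"
      using exp_Euler[of "complex_of_real (pi / 2)"] cos_of_real[of "pi/2"] sin_of_real[of "pi/2"] by simp
    have e1: "exp (of_real t + \<i> * complex_of_real (pi / 2)) = exp (of_real t) * \<i>" by (simp only: exp_add e0)
    have e2: "exp (- (of_real t + \<i> * complex_of_real (pi / 2))) = - \<i> * exp (- of_real t)"
      unfolding exp_minus e1 by (simp add: field_simps)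
    have s1: "sinh (of_real t + \<i> * (pi / 2)) = \<i> * cosh (of_real t)"
      unfolding sinh_field_def cosh_field_def e1 e2 by (simp add: algebra_simps)
    have s2: "sinh (a * (of_real t + \<i> * (pi / 2))) = (?q * exp (a * t) - inverse ?q * exp (- a * t)) / 2"
      by (simp add: sinh_field_def exp_minus[symmetric] exp_add[symmetric] algebra_simps)
    have "Complex t (pi / 2) \<noteq> 0" by (auto simp: complex_eq_iff)
    then have "f (Complex t (pi / 2)) = sinh (a * Complex t (pi / 2)) / sinh (Complex t (pi / 2))" by (simp add: f_def)
    then show ?thesis unfolding C s1 s2 by (simp add: diff_divide_distrib mult_ac)
  qed
  have Ia: "integrable lborel (\<lambda>t. ?e a t)" "(LBINT t. ?e a t) * cos (pi * a / 2) = pi"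
    using exp_over_cosh_integral[OF a] by auto
  have Ib: "integrable lborel (\<lambda>t. ?e (- a) t)" "(LBINT t. ?e (- a) t) * cos (pi * a / 2) = pi"
    using exp_over_cosh_integral[of "- a"] a by auto
  have "(LBINT t. f (Complex t (pi / 2))) = (?q * (LBINT t. ?e a t) - inverse ?q * (LBINT t. ?e (- a) t)) / (2 * \<i>)"
    unfolding shift by (rule integral_lincomb[OF Ia(1) Ib(1)])
  then have "(LBINT t. f (Complex t (pi / 2))) * cos (pi * a / 2) = (?q * ((LBINT t. ?e a t) * cos (pi * a / 2)) - inverse ?q * ((LBINT t. ?e (- a) t) * cos (pi * a / 2))) / (2 * \<i>)"
    by (simp only:) (simp add: left_diff_distrib mult.assoc)
  also have "\<dots> = pi * ((?q - inverse ?q) / (2 * \<i>))"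
    unfolding Ia(2) Ib(2) by (simp add: algebra_simps)
  also have "(?q - inverse ?q) / (2 * \<i>) = sin (pi * a / 2)"
    by (simp add: sin_exp_eq exp_minus[symmetric])
  finally show ?thesis unfolding R4[symmetric] half by (simp only: mult_ac)
qed

section \<open>An integral representation of the logarithm of the sine\<close>

lemma sinh_complex_of_real: "sinh (complex_of_real y) = of_real (sinh y)"
  and cosh_complex_of_real: "cosh (complex_of_real y) = of_real (cosh y)"
  by (simp_all add: sinh_field_def cosh_field_def exp_of_real[symmetric] del: exp_of_real)

text \<open>Its integral over the half-line represents - ln (2 cos (pi a / 2)).
  \<open>exp_log_sine_integral\<close> proves this in exponentiated form, where no branch of the
  logarithm has to be chosen.\<close>

definition log_sine_kernel :: "complex \<Rightarrow> real \<Rightarrow> complex" where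
  "log_sine_kernel a y = (cosh (a * of_real y) / of_real (sinh y) - 1 / of_real y) / of_real y"

text \<open>This reduces integrability and domination of the kernel to the bounds for the double
  sine kernel with \<alpha> = 1.\<close>

lemma log_sine_kernel_eq:
  assumes "y > 0"
  shows "log_sine_kernel a y = double_sine_kernel 1 (a + 1) y - double_sine_kernel 1 (a - 1) y"
proof -
  define s where "s = complex_of_real (sinh y)"
  have s: "s \<noteq> 0" "sinh (complex_of_real y) = s" using assms
    by (auto simp: s_def sinh_complex_of_real)
  have "sinh ((a + 1) * of_real y) - sinh ((a - 1) * of_real y) = 2 * cosh (a * of_real y) * s"
    by (simp add: ring_distribs left_diff_distrib sinh_add sinh_diff s)
  then have 1: "sinh ((a + 1) * of_real y) = sinh ((a - 1) * of_real y) + 2 * cosh (a * of_real y) * s" by (simp add: algebra_simps)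
  show ?thesis
    unfolding double_sine_kernel_def log_sine_kernel_def 1 of_real_mult mult_1 s_def[symmetric]
    using s(1) assms by (simp add: field_simps)
qed

lemma log_sine_kernel_integrable:
  assumes "\<bar>Re a\<bar> < 1"
  shows "set_integrable lborel {0<..} (log_sine_kernel a)"
proof -
  have "set_integrable lborel {0<..} (\<lambda>y. double_sine_kernel 1 (a + 1) y - double_sine_kernel 1 (a - 1) y)"
    using assms by (intro set_integral_diff double_sine_kernel_integrable) auto
  then show ?thesis
    by (subst set_integrable_cong[OF refl refl log_sine_kernel_eq]) auto
qed

definition log_sine_integral :: "complex \<Rightarrow> complex" where
  "log_sine_integral a = (LBINT y:{0<..}. log_sine_kernel a y)"

text \<open>Differentiating in \<open>a\<close> removes both the factor 1/y and the compensating
  term, which leaves the integrand of \<open>sinh_over_sinh_integral\<close>.\<close>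

lemma log_sine_integral_deriv:
  assumes a: "\<bar>Re a\<bar> < 1"
  shows "(log_sine_integral has_field_derivative (LBINT t:{0<..}. sinh (a * of_real t) / of_real (sinh t))) (at a)"
proof -
  let ?S = "{a. - 1 < Re a \<and> Re a < 1}"
  define m where "m = (\<bar>Re a\<bar> + 1) / 2"
  have m: "\<bar>Re a\<bar> < m" "m < 1" using a by (auto simp: m_def)
  define r where "r = m - \<bar>Re a\<bar>"
  obtain C where C: "C > 0" "\<And>a' y. y > 0 \<Longrightarrow> \<bar>Re a'\<bar> \<le> m + 1 \<Longrightarrow> norm a' \<le> norm a + r + 1 \<Longrightarrow> norm (double_sine_kernel 1 a' y) \<le> C / (1 + y\<^sup>2)"
  proof -
    have p: "(0::real) < 1" "0 \<le> m + 1" "m + 1 < 1 + 1" "0 \<le> norm a + r + 1" using m by (auto simp: r_def)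
    show ?thesis using double_sine_kernel_bound[OF p] that by blast
  qed
  have "((\<lambda>a. \<integral>y. indicator {0<..} y *\<^sub>R log_sine_kernel a y \<partial>lborel) has_field_derivative
     (\<integral>y. deriv (\<lambda>a. indicator {0<..} y *\<^sub>R log_sine_kernel a y) a \<partial>lborel)) (at a)"
  proof (rule has_field_derivative_integral_param[OF open_vertical_strip _ _ _ integrable_inverse_1_plus_square[of "2 * C"], where r = r])
    show "a \<in> ?S" using a by auto
    show "(\<lambda>w. indicat_real {0<..} y *\<^sub>R log_sine_kernel w y) holomorphic_on ?S" for y
      by (cases "y > 0") (auto simp: log_sine_kernel_def indicator_def intro!: holomorphic_intros)
    show "r > 0" using m by (simp add: r_def)
    show "(\<lambda>y. indicat_real {0<..} y *\<^sub>R log_sine_kernel w y) \<in> borel_measurable lborel" for w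
    proof -
      have "(\<lambda>y. indicat_real {0<..} y *\<^sub>R log_sine_kernel w y) \<in> borel_measurable borel"
        unfolding log_sine_kernel_def
        by (rule borel_measurable_continuous_on_indicator) (auto intro!: continuous_intros)
      then show ?thesis by simp
    qed
    fix w y assume w: "w \<in> ?S" "dist a w < r"
    have "\<bar>Re (w - a)\<bar> \<le> norm (w - a)" by (rule abs_Re_le_cmod)
    then have 1: "\<bar>Re w\<bar> \<le> m" using w by (simp add: r_def dist_norm norm_minus_commute)
    have "norm w \<le> norm a + norm (w - a)" by (rule norm_triangle_sub)
    then have 2: "norm w \<le> norm a + r" using w by (simp add: dist_norm norm_minus_commute)
    have 3: "norm (w + 1) \<le> norm a + r + 1" "norm (w - 1) \<le> norm a + r + 1"
      using 2 norm_triangle_ineq[of w 1] norm_triangle_ineq4[of w 1] by auto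
    show "norm (indicat_real {0<..} y *\<^sub>R log_sine_kernel w y) \<le> 2 * C / (1 + y\<^sup>2)"
    proof (cases "y > 0")
      case True
      have "norm (log_sine_kernel w y) \<le> norm (double_sine_kernel 1 (w + 1) y) + norm (double_sine_kernel 1 (w - 1) y)"
        unfolding log_sine_kernel_eq[OF True] by (rule norm_triangle_ineq4)
      also have "\<dots> \<le> C / (1 + y\<^sup>2) + C / (1 + y\<^sup>2)"
        using 1 3 True by (intro add_mono C(2)) auto
      finally show ?thesis using True by (simp add: indicator_def)
    qed (use C(1) in \<open>auto simp: indicator_def\<close>)
  qed
  moreover have "deriv (\<lambda>a. indicator {0<..} y *\<^sub>R log_sine_kernel a y) a = indicator {0<..} y *\<^sub>R (sinh (a * of_real y) / of_real (sinh y))" for y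
  proof (cases "y > 0")
    case True
    have "((\<lambda>a. log_sine_kernel a y) has_field_derivative (sinh (a * of_real y) / of_real (sinh y))) (at a)"
      unfolding log_sine_kernel_def using True by (auto intro!: derivative_eq_intros)
    then show ?thesis using True by (simp add: indicator_def DERIV_imp_deriv)
  qed (auto simp: indicator_def)
  ultimately show ?thesis
    unfolding log_sine_integral_def set_lebesgue_integral_def by simp
qed

text \<open>As cosh (y/2) / sinh y = 1 / (2 sinh (y/2)), the two kernels add up to a rescaled kernel
  at 0, and the integral is invariant under scaling. The relation is the normalisation used in
  \<open>exp_log_sine_integral\<close>.\<close>

lemma log_sine_integral_duplication:
  "log_sine_integral (1 / 2) + log_sine_integral (- 1 / 2) = log_sine_integral 0"
proof -
  have *: "log_sine_kernel (1 / 2) y + log_sine_kernel (- 1 / 2) y = of_real (1 / 2) * log_sine_kernel 0 (1 / 2 * y)" if y: "y > 0" for y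
  proof -
    define s c where "s = complex_of_real (sinh (y / 2))" and "c = complex_of_real (cosh (y / 2))"
    have nz: "s \<noteq> 0" "c \<noteq> 0" using y cosh_real_pos[of "y / 2"] by (auto simp: s_def c_def)
    have 1: "complex_of_real (sinh y) = 2 * s * c"
      using sinh_double[of "y / 2"] by (simp add: s_def c_def)
    have 2: "cosh (1 / 2 * complex_of_real y) = c" "cosh (- 1 / 2 * complex_of_real y) = c"
      using cosh_complex_of_real[of "y / 2"] by (auto simp: c_def)
    show ?thesis unfolding log_sine_kernel_def 1 2 using nz y by (simp add: s_def[symmetric] field_simps)
  qed
  have "log_sine_integral (1 / 2) + log_sine_integral (- 1 / 2) = (LBINT y:{0<..}. log_sine_kernel (1 / 2) y + log_sine_kernel (- 1 / 2) y)"
    unfolding log_sine_integral_def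
    by (rule set_integral_add(2)[symmetric]) (auto intro!: log_sine_kernel_integrable)
  also have "\<dots> = (LBINT y:{0<..}. of_real (1 / 2) * log_sine_kernel 0 (1 / 2 * y))"
    by (rule set_lebesgue_integral_cong) (use * in \<open>auto simp only: greaterThan_iff sets_lborel borel_open open_greaterThan\<close>)
  also have "\<dots> = log_sine_integral 0"
    unfolding log_sine_integral_def by (rule set_integral_Ioi_scale) simp
  finally show ?thesis .
qed

text \<open>The derivative of the product vanishes by \<open>sinh_over_sinh_integral\<close>, so the
  product is a constant \<open>K\<close>. Comparing its values at 1/2, -1/2 and 0 by the duplication
  formula gives K * K = K, and \<open>K\<close> is not 0.\<close>

theorem exp_log_sine_integral:
  fixes a :: complex
  assumes a: "\<bar>Re a\<bar> < 1"
  shows "exp (log_sine_integral a) * (2 * cos (pi * a / 2)) = 1"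
proof -
  let ?S = "{a. - 1 < Re a \<and> Re a < 1}"
  define f where "f = (\<lambda>a::complex. exp (log_sine_integral a) * (2 * cos (pi * a / 2)))"
  have "(f has_field_derivative 0) (at a within ?S)" if "a \<in> ?S" for a
  proof -
    let ?D = "LBINT t:{0<..}. sinh (a * of_real t) / of_real (sinh t)"
    have a: "\<bar>Re a\<bar> < 1" using that by auto
    have "(f has_field_derivative exp (log_sine_integral a) * ?D * (2 * cos (pi * a / 2)) + exp (log_sine_integral a) * (2 * (- sin (pi * a / 2) * (pi / 2)))) (at a)"
      unfolding f_def by (rule derivative_eq_intros log_sine_integral_deriv[OF a] refl | simp)+
    also have "exp (log_sine_integral a) * ?D * (2 * cos (pi * a / 2)) + exp (log_sine_integral a) * (2 * (- sin (pi * a / 2) * (pi / 2))) = 0"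
      using sinh_over_sinh_integral[OF a] by (simp add: algebra_simps)
    finally show ?thesis by (rule has_field_derivative_at_within)
  qed
  from has_field_derivative_zero_constant[OF convex_vertical_strip this]
  obtain K where K: "\<And>a. a \<in> ?S \<Longrightarrow> f a = K" by blast
  have K0: "f 0 = K" "f (1 / 2) = K" "f (- 1 / 2) = K" by (auto intro!: K)
  have nz: "K \<noteq> 0" using K0(1) by (auto simp: f_def)
  have c: "cos (of_real pi * (1 / 2) / 2 :: complex) = of_real (sqrt 2 / 2)" "cos (of_real pi * (- 1 / 2) / 2 :: complex) = of_real (sqrt 2 / 2)"
    using cos_of_real[of "pi / 4", where 'a = complex] by (simp_all add: cos_45)
  have "K * K = f (1 / 2) * f (- 1 / 2)" using K0 by simp
  also have "\<dots> = exp (log_sine_integral (1 / 2) + log_sine_integral (- 1 / 2)) * (of_real (sqrt 2) * of_real (sqrt 2))"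
    unfolding f_def c exp_add by simp
  also have "of_real (sqrt 2) * of_real (sqrt 2) = (2 :: complex)"
    by (simp flip: of_real_mult)
  also have "exp (log_sine_integral (1 / 2) + log_sine_integral (- 1 / 2)) * 2 = K"
    unfolding log_sine_integral_duplication K0(1)[symmetric] by (simp add: f_def)
  finally have "K = 1" using nz by simp
  then have "f a = 1" using K[of a] a by (simp add: abs_less_iff)
  then show ?thesis by (simp add: f_def)
qed

section \<open>The two functional equations\<close>

lemma double_sine_kernel_diff:
  assumes "y > 0" "\<alpha> > 0"
  shows "double_sine_kernel \<alpha> (c + of_real \<alpha>) y - double_sine_kernel \<alpha> (c - of_real \<alpha>) y = log_sine_kernel c y"
    and "double_sine_kernel \<alpha> (c + 1) y - double_sine_kernel \<alpha> (c - 1) y = of_real \<alpha> * log_sine_kernel (c / of_real \<alpha>) (\<alpha> * y)"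
proof -
  define s t where "s = complex_of_real (sinh y)" and "t = complex_of_real (sinh (\<alpha> * y))"
  have s: "s \<noteq> 0" "sinh (complex_of_real y) = s" "t \<noteq> 0" "sinh (complex_of_real \<alpha> * complex_of_real y) = t" using assms
    by (auto simp: s_def t_def sinh_complex_of_real simp flip: of_real_mult)
  have 1: "sinh ((c + of_real \<alpha>) * of_real y) = sinh ((c - of_real \<alpha>) * of_real y) + 2 * cosh (c * of_real y) * t"
    by (simp add: ring_distribs left_diff_distrib sinh_add sinh_diff s)
  show "double_sine_kernel \<alpha> (c + of_real \<alpha>) y - double_sine_kernel \<alpha> (c - of_real \<alpha>) y = log_sine_kernel c y"
    unfolding double_sine_kernel_def log_sine_kernel_def 1 of_real_mult s_def[symmetric] t_def[symmetric]
    using s assms by (simp add: field_simps)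
  have 2: "sinh ((c + 1) * of_real y) = sinh ((c - 1) * of_real y) + 2 * cosh (c * of_real y) * s"
    by (simp add: ring_distribs left_diff_distrib sinh_add sinh_diff s)
  have 3: "c / complex_of_real \<alpha> * (complex_of_real \<alpha> * complex_of_real y) = c * of_real y" using assms by simp
  show "double_sine_kernel \<alpha> (c + 1) y - double_sine_kernel \<alpha> (c - 1) y = of_real \<alpha> * log_sine_kernel (c / of_real \<alpha>) (\<alpha> * y)"
    unfolding double_sine_kernel_def log_sine_kernel_def 2 of_real_mult s_def[symmetric] t_def[symmetric] 3
    using s assms by (simp add: field_simps)
qed

text \<open>The difference of the logarithms at z + \<alpha> and z is
  \<open>log_sine_integral (2 * z - 1)\<close>, and cos (pi (2z - 1) / 2) = sin (pi z). The
  condition on \<open>Re z\<close> puts both points into the strip.\<close>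

theorem S2_strip_shift_alpha:
  fixes z :: complex
  assumes \<alpha>: "\<alpha> > 0" and z: "0 < Re z" "Re z < 1"
  shows "S2_strip \<alpha> z = 2 * sin (pi * z) * S2_strip \<alpha> (z + of_real \<alpha>)"
proof -
  have e: "2 * (z + of_real \<alpha>) - 1 - of_real \<alpha> = 2 * z - 1 + complex_of_real \<alpha>" by simp
  have "log_S2_strip \<alpha> (z + of_real \<alpha>) - log_S2_strip \<alpha> z = (LBINT y:{0<..}. double_sine_kernel \<alpha> (2 * z - 1 + of_real \<alpha>) y - double_sine_kernel \<alpha> (2 * z - 1 - of_real \<alpha>) y)"
    unfolding log_S2_strip_def log_S2_integrand_eq e
    by (rule set_integral_diff(2)[symmetric]; rule double_sine_kernel_integrable) (use \<alpha> z in auto)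
  also have "\<dots> = log_sine_integral (2 * z - 1)"
    unfolding log_sine_integral_def
    by (rule set_lebesgue_integral_cong) (use \<alpha> in \<open>auto simp: double_sine_kernel_diff\<close>)
  finally have "log_S2_strip \<alpha> (z + of_real \<alpha>) = log_S2_strip \<alpha> z + log_sine_integral (2 * z - 1)" by (simp add: algebra_simps)
  then have 1: "S2_strip \<alpha> (z + of_real \<alpha>) = S2_strip \<alpha> z * exp (log_sine_integral (2 * z - 1))"
    by (simp add: S2_strip_def exp_add)
  have "of_real pi * (2 * z - 1) / 2 = of_real pi * z - of_real pi / 2" by (simp add: field_simps)
  then have "cos (of_real pi * (2 * z - 1) / 2) = cos (of_real pi * z - of_real pi / 2)" by (simp only:)
  also have "\<dots> = sin (pi * z)" by (simp add: cos_diff)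
  finally have "cos (of_real pi * (2 * z - 1) / 2) = sin (pi * z)" .
  then have "exp (log_sine_integral (2 * z - 1)) * (2 * sin (pi * z)) = 1"
    using exp_log_sine_integral[of "2 * z - 1"] z by (auto simp: abs_less_iff)
  then show ?thesis unfolding 1 by (simp add: mult_ac)
qed

text \<open>Here the difference of the kernels is a log-sine kernel evaluated at \<alpha> y; scale
  invariance of the integral turns it into \<open>log_sine_integral\<close> at (2z -
  \<alpha>)/\<alpha>.\<close>

theorem S2_strip_shift_1:
  fixes z :: complex
  assumes \<alpha>: "\<alpha> > 0" and z: "0 < Re z" "Re z < \<alpha>"
  shows "S2_strip \<alpha> z = 2 * sin (pi * z / of_real \<alpha>) * S2_strip \<alpha> (z + 1)"
proof -
  let ?c = "2 * z - of_real \<alpha>"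
  have e: "2 * (z + 1) - 1 - of_real \<alpha> = ?c + 1" "2 * z - 1 - of_real \<alpha> = ?c - 1" by simp_all
  have "log_S2_strip \<alpha> (z + 1) - log_S2_strip \<alpha> z = (LBINT y:{0<..}. double_sine_kernel \<alpha> (?c + 1) y - double_sine_kernel \<alpha> (?c - 1) y)"
    unfolding log_S2_strip_def log_S2_integrand_eq e
    by (rule set_integral_diff(2)[symmetric]; rule double_sine_kernel_integrable) (use \<alpha> z in auto)
  also have "\<dots> = (LBINT y:{0<..}. of_real \<alpha> * log_sine_kernel (?c / of_real \<alpha>) (\<alpha> * y))"
    by (rule set_lebesgue_integral_cong) (use \<alpha> in \<open>auto simp: double_sine_kernel_diff\<close>)
  also have "\<dots> = log_sine_integral (?c / of_real \<alpha>)"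
    unfolding log_sine_integral_def by (rule set_integral_Ioi_scale[OF \<alpha>])
  finally have "log_S2_strip \<alpha> (z + 1) = log_S2_strip \<alpha> z + log_sine_integral (?c / of_real \<alpha>)" by (simp add: algebra_simps)
  then have 1: "S2_strip \<alpha> (z + 1) = S2_strip \<alpha> z * exp (log_sine_integral (?c / of_real \<alpha>))"
    by (simp add: S2_strip_def exp_add)
  have "of_real pi * (?c / of_real \<alpha>) / 2 = of_real pi * z / of_real \<alpha> - of_real pi / 2" using \<alpha> by (simp add: field_simps)
  then have "cos (of_real pi * (?c / of_real \<alpha>) / 2) = cos (of_real pi * z / of_real \<alpha> - of_real pi / 2)" by (simp only:)
  also have "\<dots> = sin (pi * z / of_real \<alpha>)" by (simp add: cos_diff)
  finally have "cos (of_real pi * (?c / of_real \<alpha>) / 2) = sin (pi * z / of_real \<alpha>)" .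
  moreover have "\<bar>Re (?c / of_real \<alpha>)\<bar> < 1"
    using z \<alpha> by (simp add: abs_less_iff field_simps)
  ultimately have "exp (log_sine_integral (?c / of_real \<alpha>)) * (2 * sin (pi * z / of_real \<alpha>)) = 1"
    using exp_log_sine_integral[of "?c / of_real \<alpha>"] by auto
  then show ?thesis unfolding 1 by (simp add: mult_ac)
qed

section \<open>Meromorphic continuation\<close>

text \<open>These are the sines collected when \<open>S2_strip_shift_alpha\<close> is applied |n|
  times: going right divides by them, going left multiplies.\<close>

definition shift_factor :: "real \<Rightarrow> int \<Rightarrow> complex \<Rightarrow> complex" where
  "shift_factor \<alpha> n z = (if n \<ge> 0 then \<Prod>k<nat n. inverse (2 * sin (of_real pi * (z - of_real ((real k + 1) * \<alpha>))))
     else \<Prod>k<nat (- n). 2 * sin (of_real pi * (z + of_real (real k * \<alpha>))))"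

definition S2_piece :: "real \<Rightarrow> int \<Rightarrow> complex \<Rightarrow> complex" where
  "S2_piece \<alpha> n z = S2_strip \<alpha> (z - of_int n * of_real \<alpha>) * shift_factor \<alpha> n z"

text \<open>The index puts Re z - n \<alpha> into [1/2, 1/2 + \<alpha>), well inside the strip of
  width 1 + \<alpha> on which \<open>S2_strip\<close> is controlled.\<close>

definition S2_glued :: "real \<Rightarrow> complex \<Rightarrow> complex" where
  "S2_glued \<alpha> z = S2_piece \<alpha> \<lfloor>(Re z - 1 / 2) / \<alpha>\<rfloor> z"

lemma shift_factor_Suc:
  fixes z :: complex
  assumes "sin (of_real pi * (z - (of_int n + 1) * of_real \<alpha>)) \<noteq> 0"
  shows "shift_factor \<alpha> n z = shift_factor \<alpha> (n + 1) z * (2 * sin (of_real pi * (z - (of_int n + 1) * of_real \<alpha>)))"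
proof (cases "n \<ge> 0")
  case True
  then have "nat (n + 1) = Suc (nat n)" by simp
  moreover have "real (nat n) = of_int n" using True by simp
  ultimately show ?thesis using True assms by (simp add: shift_factor_def)
next
  case False
  then have 1: "nat (- n) = Suc (nat (- n - 1))" by simp
  have 2: "z + of_real (real (nat (- n - 1)) * \<alpha>) = z - (of_int n + 1) * of_real \<alpha>"
    using False by (simp add: algebra_simps)
  have "shift_factor \<alpha> n z = (\<Prod>k<nat (- n - 1). 2 * sin (of_real pi * (z + of_real (real k * \<alpha>)))) * (2 * sin (of_real pi * (z - (of_int n + 1) * of_real \<alpha>)))"
    unfolding shift_factor_def 1 prod.lessThan_Suc 2 using False by simp
  also have "(\<Prod>k<nat (- n - 1). 2 * sin (of_real pi * (z + of_real (real k * \<alpha>)))) = shift_factor \<alpha> (n + 1) z"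
  proof (cases "n = -1")
    case False
    have "nat (- (n + 1)) = nat (- n - 1)" by simp
    with False \<open>\<not> n \<ge> 0\<close> show ?thesis by (auto simp: shift_factor_def)
  qed (simp add: shift_factor_def)
  finally show ?thesis .
qed

text \<open>Neighbouring translates overlap in a strip of width 1, which is where the functional
  equation with period \<alpha> holds. The sine there is nonzero because \<open>S2_strip\<close>
  is.\<close>

lemma S2_piece_Suc:
  fixes z :: complex
  assumes \<alpha>: "\<alpha> > 0" and z: "real_of_int (n + 1) * \<alpha> < Re z" "Re z < 1 + \<alpha> + real_of_int n * \<alpha>"
  shows "S2_piece \<alpha> n z = S2_piece \<alpha> (n + 1) z"
proof -
  define w where "w = z - (of_int n + 1) * of_real \<alpha>"
  have w: "0 < Re w" "Re w < 1" using z by (auto simp: w_def algebra_simps)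
  have fe: "S2_strip \<alpha> w = 2 * sin (of_real pi * w) * S2_strip \<alpha> (w + of_real \<alpha>)"
    by (rule S2_strip_shift_alpha[OF \<alpha> w])
  then have nz: "sin (of_real pi * w) \<noteq> 0" by auto
  have e: "z - of_int n * of_real \<alpha> = w + of_real \<alpha>" "z - of_int (n + 1) * of_real \<alpha> = w" by (auto simp: w_def algebra_simps)
  show ?thesis
    unfolding S2_piece_def e fe shift_factor_Suc[of z n \<alpha>, folded w_def, OF nz] by (simp add: mult_ac)
qed

text \<open>A point that lies in two translates lies in all those between them, so the neighbouring
  comparison can be iterated.\<close>

lemma S2_piece_add:
  assumes \<alpha>: "\<alpha> > 0" and z: "real_of_int (n + int k) * \<alpha> < Re z" "Re z < 1 + \<alpha> + real_of_int n * \<alpha>"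
  shows "S2_piece \<alpha> n z = S2_piece \<alpha> (n + int k) z"
  using z(1)
proof (induction k)
  case (Suc k)
  have "real_of_int (n + int k) * \<alpha> < real_of_int (n + int (Suc k)) * \<alpha>"
    using \<alpha> by (intro mult_strict_right_mono) auto
  then have 1: "S2_piece \<alpha> n z = S2_piece \<alpha> (n + int k) z" using Suc by simp
  have "real_of_int n * \<alpha> \<le> real_of_int (n + int k) * \<alpha>" using \<alpha> by (intro mult_right_mono) auto
  then have "S2_piece \<alpha> (n + int k) z = S2_piece \<alpha> (n + int k + 1) z"
    using z(2) Suc.prems by (intro S2_piece_Suc \<alpha>) (auto simp: algebra_simps)
  then show ?case using 1 by (simp add: algebra_simps)
qed simp

lemma S2_glued_eq:
  assumes \<alpha>: "\<alpha> > 0" and z: "real_of_int n * \<alpha> < Re z" "Re z < 1 + \<alpha> + real_of_int n * \<alpha>"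
  shows "S2_glued \<alpha> z = S2_piece \<alpha> n z"
proof -
  define m where "m = \<lfloor>(Re z - 1 / 2) / \<alpha>\<rfloor>"
  have "real_of_int m \<le> (Re z - 1 / 2) / \<alpha>" "(Re z - 1 / 2) / \<alpha> < real_of_int m + 1"
    unfolding m_def by linarith+
  then have m: "real_of_int m * \<alpha> < Re z" "Re z < 1 + \<alpha> + real_of_int m * \<alpha>"
    using \<alpha> by (auto simp: field_simps)
  have "S2_piece \<alpha> m z = S2_piece \<alpha> n z"
  proof (cases "m \<le> n")
    case True
    then show ?thesis using S2_piece_add[OF \<alpha>, of m "nat (n - m)" z] z(1) m(2) by simp
  next
    case False
    then show ?thesis using S2_piece_add[OF \<alpha>, of n "nat (m - n)" z] m(1) z(2) by simp
  qed
  then show ?thesis by (simp add: S2_glued_def m_def)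
qed

lemma S2_strip_shifted_analytic:
  assumes "\<alpha> > 0" "c < Re z" "Re z < 1 + \<alpha> + c"
  shows "(\<lambda>z. S2_strip \<alpha> (z - of_real c)) analytic_on {z}"
proof -
  have "S2_strip \<alpha> \<circ> (\<lambda>z. z - of_real c) holomorphic_on {z. c < Re z \<and> Re z < 1 + \<alpha> + c}"
    by (rule holomorphic_on_compose_gen[OF _ S2_strip_holomorphic[OF assms(1)]])
       (auto intro!: holomorphic_intros)
  then show ?thesis
    unfolding comp_def analytic_at using assms open_vertical_strip by blast
qed

lemma eventually_in_strip:
  assumes "a < Re z" "Re z < b"
  shows "\<forall>\<^sub>F w in nhds z. a < Re w \<and> Re w < b"
  using eventually_nhds_in_open[OF open_vertical_strip[of a b], of z] assms by simp

lemma S2_glued_meromorphic: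
  assumes \<alpha>: "\<alpha> > 0"
  shows "S2_glued \<alpha> meromorphic_on UNIV"
proof -
  have "S2_glued \<alpha> meromorphic_on {z}" for z
  proof -
    define n where "n = \<lfloor>(Re z - 1 / 2) / \<alpha>\<rfloor>"
    have "real_of_int n \<le> (Re z - 1 / 2) / \<alpha>" "(Re z - 1 / 2) / \<alpha> < real_of_int n + 1"
      unfolding n_def by linarith+
    then have n: "real_of_int n * \<alpha> < Re z" "Re z < 1 + \<alpha> + real_of_int n * \<alpha>"
      using \<alpha> by (auto simp: field_simps)
    have "(\<lambda>z. S2_strip \<alpha> (z - of_int n * of_real \<alpha>)) meromorphic_on {z}"
      using S2_strip_shifted_analytic[OF \<alpha> n] by (intro analytic_on_imp_meromorphic_on) simp
    moreover have "shift_factor \<alpha> n meromorphic_on {z}"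
    proof -
      have "(\<lambda>z. \<Prod>k<nat n. inverse (2 * sin (of_real pi * (z - of_real ((real k + 1) * \<alpha>))))) meromorphic_on {z}"
        by (intro meromorphic_intros analytic_on_imp_meromorphic_on analytic_intros)
      moreover have "(\<lambda>z. \<Prod>k<nat (- n). 2 * sin (of_real pi * (z + of_real (real k * \<alpha>)))) meromorphic_on {z}"
        by (intro meromorphic_intros analytic_on_imp_meromorphic_on analytic_intros)
      ultimately show ?thesis unfolding shift_factor_def by (cases "n \<ge> 0") simp_all
    qed
    ultimately have "S2_piece \<alpha> n meromorphic_on {z}"
      unfolding S2_piece_def by (rule meromorphic_on_mult)
    moreover have "\<forall>\<^sub>F w in at z. S2_glued \<alpha> w = S2_piece \<alpha> n w"
      using eventually_in_strip[OF n] unfolding eventually_nhds_conv_at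
      by (auto elim!: eventually_mono intro: S2_glued_eq[OF \<alpha>])
    ultimately show ?thesis by (subst meromorphic_on_cong[of _ _ "S2_piece \<alpha> n"]) auto
  qed
  then show ?thesis unfolding meromorphic_on_def by blast
qed

section \<open>Uniqueness of the continuation and the values of \<open>S2\<close>\<close>

lemma nicely_meromorphic_remove_sings_eq:
  assumes "f nicely_meromorphic_on UNIV"
  shows "remove_sings f z = f z"
proof (cases "is_pole f z \<and> f z = 0")
  case True
  then show ?thesis by simp
next
  case False
  then have "f \<midarrow>z\<rightarrow> f z" using assms by (auto simp: nicely_meromorphic_on_def)
  then show ?thesis by (rule remove_sings_eqI)
qed

text \<open>By the identity theorem the difference with its singularities removed is constant, hence
  0. So \<open>f\<close> and \<open>g\<close> agree near every point, and the convention for values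
  at poles and removable points transfers this to the point itself.\<close>

lemma nicely_meromorphic_unique:
  assumes f: "f nicely_meromorphic_on UNIV" and g: "g nicely_meromorphic_on UNIV"
    and A: "open A" "A \<noteq> {}" "\<And>z. z \<in> A \<Longrightarrow> f z = g z"
  shows "f = g"
proof
  fix z
  let ?h = "\<lambda>z. f z - g z"
  have hm: "?h meromorphic_on UNIV"
    using f g unfolding nicely_meromorphic_on_def by (intro meromorphic_intros) auto
  have "remove_sings ?h constant_on UNIV"
  proof (rule constant_on_extend_nicely_meromorphic_on[OF remove_sings_nicely_meromorphic[OF hm] _ A(1)])
    have "remove_sings ?h z = 0" if "z \<in> A" for z
    proof (rule remove_sings_eqI)
      have "\<forall>\<^sub>F w in at z. ?h w = 0"
        using eventually_at_in_open'[OF A(1) that] by eventually_elim (simp add: A(3))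
      then show "?h \<midarrow>z\<rightarrow> 0" by (rule tendsto_eventually)
    qed
    then show "remove_sings ?h constant_on A" by (auto simp: constant_on_def)
  qed (use A in auto)
  moreover obtain a where a: "a \<in> A" using A(2) by auto
  moreover have "remove_sings ?h a = 0"
  proof (rule remove_sings_eqI)
    have "\<forall>\<^sub>F w in at a. ?h w = 0"
      using eventually_at_in_open'[OF A(1) a] by eventually_elim (simp add: A(3))
    then show "?h \<midarrow>a\<rightarrow> 0" by (rule tendsto_eventually)
  qed
  ultimately have 0: "remove_sings ?h w = 0" for w
    unfolding constant_on_def by (metis UNIV_I)
  have "isolated_singularity_at ?h z" using meromorphic_on_isolated_singularity meromorphic_on_subset[OF hm] by blast
  then have "\<forall>\<^sub>F w in at z. remove_sings ?h w = ?h w" by (rule eventually_remove_sings_eq_at)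
  then have "\<forall>\<^sub>F w in at z. f w = g w" by eventually_elim (simp add: 0)
  then have "remove_sings f z = remove_sings g z" by (rule remove_sings_cong) simp
  then show "f z = g z" by (simp add: nicely_meromorphic_remove_sings_eq f g)
qed

text \<open>This discharges the definite description in \<open>S2\<close>:
  \<open>remove_sings\<close> yields the nicely meromorphic representative of the glued function,
  and an open set of agreement forces uniqueness.\<close>

lemma S2_eq_remove_sings:
  assumes \<alpha>: "\<alpha> > 0"
  shows "S2 \<alpha> = remove_sings (S2_glued \<alpha>)"
proof -
  let ?A = "{z. 0 < Re z \<and> Re z < 1 + \<alpha>}"
  have eq: "remove_sings (S2_glued \<alpha>) z = S2_strip \<alpha> z" if z: "0 < Re z" "Re z < 1 + \<alpha>" for z
  proof -
    have "\<forall>\<^sub>F w in nhds z. S2_glued \<alpha> w = S2_strip \<alpha> w"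
      using eventually_in_strip[OF z]
    proof eventually_elim
      case (elim w)
      then show ?case using S2_glued_eq[OF \<alpha>, of 0 w] by (simp add: S2_piece_def shift_factor_def)
    qed
    then have "remove_sings (S2_glued \<alpha>) z = remove_sings (S2_strip \<alpha>) z"
      by (intro remove_sings_cong) (auto simp: eventually_nhds_conv_at)
    also have "\<dots> = S2_strip \<alpha> z"
      using S2_strip_shifted_analytic[OF \<alpha>, of 0 z] z by (intro remove_sings_at_analytic) simp
    finally show ?thesis .
  qed
  show ?thesis
    unfolding S2_def
  proof (rule the_equality)
    show "remove_sings (S2_glued \<alpha>) nicely_meromorphic_on UNIV \<and>
      (\<forall>z. 0 < Re z \<and> Re z < 1 + \<alpha> \<longrightarrow> remove_sings (S2_glued \<alpha>) z = exp (LBINT y:{0<..}. log_S2_integrand \<alpha> z y))"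
      using eq remove_sings_nicely_meromorphic[OF S2_glued_meromorphic[OF \<alpha>]]
      by (simp add: S2_strip_def log_S2_strip_def)
    fix f
    assume f: "f nicely_meromorphic_on UNIV \<and>
      (\<forall>z. 0 < Re z \<and> Re z < 1 + \<alpha> \<longrightarrow> f z = exp (LBINT y:{0<..}. log_S2_integrand \<alpha> z y))"
    show "f = remove_sings (S2_glued \<alpha>)"
    proof (rule nicely_meromorphic_unique[of _ _ ?A])
      have "complex_of_real (1 / 2) \<in> ?A" using \<alpha> by simp
      then show "?A \<noteq> {}" by blast
      show "f z = remove_sings (S2_glued \<alpha>) z" if "z \<in> ?A" for z
        using f eq that by (simp add: S2_strip_def log_S2_strip_def)
      show "f nicely_meromorphic_on UNIV" using f by (rule conjunct1)
      show "remove_sings (S2_glued \<alpha>) nicely_meromorphic_on UNIV"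
        by (rule remove_sings_nicely_meromorphic[OF S2_glued_meromorphic[OF \<alpha>]])
      show "open ?A" by (rule open_vertical_strip)
    qed
  qed
qed

lemma S2_eq_piece:
  assumes \<alpha>: "\<alpha> > 0" and z: "real_of_int n * \<alpha> < Re z" "Re z < 1 + \<alpha> + real_of_int n * \<alpha>"
    and an: "S2_piece \<alpha> n analytic_on {z}"
  shows "S2 \<alpha> z = S2_piece \<alpha> n z"
proof -
  have "\<forall>\<^sub>F w in nhds z. S2_glued \<alpha> w = S2_piece \<alpha> n w"
    using eventually_in_strip[OF z] by eventually_elim (use S2_glued_eq[OF \<alpha>] in auto)
  then have "remove_sings (S2_glued \<alpha>) z = remove_sings (S2_piece \<alpha> n) z"
    by (intro remove_sings_cong) (auto simp: eventually_nhds_conv_at)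
  also have "\<dots> = S2_piece \<alpha> n z" using an by (rule remove_sings_at_analytic)
  finally show ?thesis by (simp add: S2_eq_remove_sings[OF \<alpha>])
qed

theorem S2_eq_strip:
  assumes \<alpha>: "\<alpha> > 0" and z: "0 < Re z" "Re z < 1 + \<alpha>"
  shows "S2 \<alpha> z = S2_strip \<alpha> z"
proof -
  have e: "S2_piece \<alpha> 0 = S2_strip \<alpha>" by (rule ext) (simp add: S2_piece_def shift_factor_def)
  have "S2_strip \<alpha> analytic_on {z}"
    using S2_strip_shifted_analytic[OF \<alpha>, of 0 z] z by simp
  then show ?thesis using S2_eq_piece[OF \<alpha>, of 0 z] z by (simp add: e)
qed

theorem S2_eq_right:
  fixes z :: complex
  assumes \<alpha>: "\<alpha> > 0" and z: "\<alpha> < Re z" "Re z < 1 + 2 * \<alpha>" and nz: "sin (of_real pi * (z - of_real \<alpha>)) \<noteq> 0"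
  shows "S2 \<alpha> z = S2_strip \<alpha> (z - of_real \<alpha>) / (2 * sin (of_real pi * (z - of_real \<alpha>)))"
proof -
  have e: "S2_piece \<alpha> 1 = (\<lambda>z. S2_strip \<alpha> (z - of_real \<alpha>) / (2 * sin (of_real pi * (z - of_real \<alpha>))))"
    by (rule ext) (simp add: S2_piece_def shift_factor_def inverse_eq_divide)
  have "S2_piece \<alpha> 1 analytic_on {z}"
    unfolding e using nz z by (intro analytic_intros S2_strip_shifted_analytic \<alpha>) auto
  then show ?thesis using S2_eq_piece[OF \<alpha>, of 1 z] z by (simp add: e)
qed

theorem S2_eq_left:
  fixes z :: complex
  assumes \<alpha>: "\<alpha> > 0" and z: "- \<alpha> < Re z" "Re z < 1"
  shows "S2 \<alpha> z = 2 * sin (of_real pi * z) * S2_strip \<alpha> (z + of_real \<alpha>)"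
proof -
  have e: "S2_piece \<alpha> (- 1) = (\<lambda>z. 2 * sin (of_real pi * z) * S2_strip \<alpha> (z - of_real (- \<alpha>)))"
    by (rule ext) (simp add: S2_piece_def shift_factor_def)
  have "S2_piece \<alpha> (- 1) analytic_on {z}"
    unfolding e using z by (intro analytic_intros S2_strip_shifted_analytic \<alpha>) auto
  then show ?thesis using S2_eq_piece[OF \<alpha>, of "-1" z] z by (simp add: e)
qed

section \<open>Growth on vertical lines\<close>

text \<open>Translation by pi/t flips the sign of cos (t y), so twice the integral equals the
  integral of (f y - f (y + pi/t)) cos (t y). This tends to 0 by dominated convergence; a jump of
  \<open>f\<close> at 0 is allowed since a single point is a null set.\<close>

lemma Riemann_Lebesgue_cos:
  fixes f :: "real \<Rightarrow> real"
  assumes m [measurable]: "f \<in> borel_measurable borel"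
    and bd: "\<And>y. \<bar>f y\<bar> \<le> C / (1 + y\<^sup>2)"
    and cont: "\<And>y. y \<noteq> 0 \<Longrightarrow> isCont f y"
  shows "((\<lambda>t. LBINT y. f y * cos (t * y)) \<longlongrightarrow> 0) at_top"
proof -
  have C: "C \<ge> 0" using bd[of 0] by simp
  have int: "integrable lborel (\<lambda>y. f y * cos (t * y))" for t
  proof (rule Bochner_Integration.integrable_bound[OF integrable_inverse_1_plus_square[of C]])
    have "norm (f y * cos (t * y)) \<le> C / (1 + y\<^sup>2)" for y
    proof -
      have "\<bar>f y\<bar> * \<bar>cos (t * y)\<bar> \<le> \<bar>f y\<bar> * 1" by (intro mult_left_mono) auto
      then show ?thesis using bd[of y] by (simp add: abs_mult)
    qed
    then show "AE y in lborel. norm (f y * cos (t * y)) \<le> norm (C / (1 + y\<^sup>2))"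
      by (intro AE_I2) (metis abs_ge_self order_trans real_norm_def)
  qed simp
  have shift: "(LBINT y. f y * cos (t * y)) = - (LBINT y. f (y + pi / t) * cos (t * y))"
    and intshift: "integrable lborel (\<lambda>y. f (y + pi / t) * cos (t * y))" if t: "t > 0" for t
  proof -
    have e: "f (pi / t + 1 * y) * cos (t * (pi / t + 1 * y)) = - (f (y + pi / t) * cos (t * y))" for y
      using t by (simp add: distrib_left add_ac)
    have "(LBINT y. f y * cos (t * y)) = \<bar>1\<bar> *\<^sub>R (LBINT y. f (pi / t + 1 * y) * cos (t * (pi / t + 1 * y)))"
      by (rule lborel_integral_real_affine) simp
    then show "(LBINT y. f y * cos (t * y)) = - (LBINT y. f (y + pi / t) * cos (t * y))"
      unfolding e by simp
    have "integrable lborel (\<lambda>y. f (pi / t + 1 * y) * cos (t * (pi / t + 1 * y)))"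
      by (rule lborel_integrable_real_affine[OF int]) simp
    then show "integrable lborel (\<lambda>y. f (y + pi / t) * cos (t * y))"
      unfolding e by simp
  qed
  have "((\<lambda>t. LBINT y. (f y - f (y + pi / t)) * cos (t * y)) \<longlongrightarrow> (LBINT y::real. 0)) at_top"
  proof (rule integral_dominated_convergence_at_top[where w = "\<lambda>y. (4 * C) / (1 + y\<^sup>2)"])
    show "AE y in lborel. ((\<lambda>t. (f y - f (y + pi / t)) * cos (t * y)) \<longlongrightarrow> 0) at_top"
      using AE_lborel_singleton[of "0::real"]
    proof eventually_elim
      case (elim y)
      have "((\<lambda>t. y + pi / t) \<longlongrightarrow> y) at_top" by real_asymp
      then have "((\<lambda>t. f (y + pi / t)) \<longlongrightarrow> f y) at_top"
        by (rule isCont_tendsto_compose[OF cont[OF elim]])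
      then have "((\<lambda>t. f y - f (y + pi / t)) \<longlongrightarrow> f y - f y) at_top" by (intro tendsto_intros)
      then have 0: "((\<lambda>t. f y - f (y + pi / t)) \<longlongrightarrow> 0) at_top" by simp
      show ?case
      proof (rule Lim_null_comparison[OF always_eventually tendsto_rabs_zero[OF 0]], rule allI)
        fix t
        have "\<bar>f y - f (y + pi / t)\<bar> * \<bar>cos (t * y)\<bar> \<le> \<bar>f y - f (y + pi / t)\<bar> * 1" by (intro mult_left_mono) auto
        then show "norm ((f y - f (y + pi / t)) * cos (t * y)) \<le> \<bar>f y - f (y + pi / t)\<bar>" by (simp add: abs_mult)
      qed
    qed
    show "\<forall>\<^sub>F t in at_top. AE y in lborel. norm ((f y - f (y + pi / t)) * cos (t * y)) \<le> 4 * C / (1 + y\<^sup>2)"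
      \<comment> \<open>From t = pi on the translation pi/t is at most 1, which makes the dominating
        function independent of \<open>t\<close>.\<close>
      using eventually_ge_at_top[of pi]
    proof eventually_elim
      case (elim t)
      show ?case
      proof (rule AE_I2)
        fix y :: real
        define h where "h = pi / t"
        have "t > 0" using elim pi_gt_zero by linarith
        then have h: "0 < h" "h \<le> 1" using elim by (auto simp: h_def)
        have p: "1 + y\<^sup>2 > 0" "1 + (y + h)\<^sup>2 > 0" by (auto simp: add_pos_nonneg)
        have "h\<^sup>2 \<le> 1" using h by (simp add: power_le_one)
        moreover have "0 \<le> (y + 2 * h)\<^sup>2" by simp
        \<comment> \<open>A translation by at most 1 changes 1 + y^2 by a factor of at most 3; the
          shares \<open>C\<close> and \<open>3 * C\<close> give the dominating constant
          \<open>4 * C\<close>.\<close>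
        ultimately have "1 + y\<^sup>2 \<le> 3 * (1 + (y + h)\<^sup>2)"
          by (simp add: power2_eq_square algebra_simps) (sos)
        then have "1 / (1 + (y + h)\<^sup>2) \<le> 3 / (1 + y\<^sup>2)" using p by (simp add: field_simps)
        then have "C / (1 + (y + h)\<^sup>2) \<le> 3 * C / (1 + y\<^sup>2)"
          using mult_left_mono[OF _ C, of "1 / (1 + (y + h)\<^sup>2)" "3 / (1 + y\<^sup>2)"] by (simp add: mult_ac)
        then have "\<bar>f (y + h)\<bar> \<le> 3 * C / (1 + y\<^sup>2)" using bd[of "y + h"] by linarith
        then have "\<bar>f y\<bar> + \<bar>f (y + h)\<bar> \<le> C / (1 + y\<^sup>2) + 3 * C / (1 + y\<^sup>2)" using bd[of y] by linarith
        also have "\<dots> = 4 * C / (1 + y\<^sup>2)" by (simp add: add_divide_distrib[symmetric])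
        finally have 1: "\<bar>f y - f (y + h)\<bar> \<le> 4 * C / (1 + y\<^sup>2)" by linarith
        have "\<bar>f y - f (y + h)\<bar> * \<bar>cos (t * y)\<bar> \<le> \<bar>f y - f (y + h)\<bar> * 1" by (intro mult_left_mono) auto
        then show "norm ((f y - f (y + pi / t)) * cos (t * y)) \<le> 4 * C / (1 + y\<^sup>2)"
          using 1 by (simp add: abs_mult h_def)
      qed
    qed
  qed (auto intro: integrable_inverse_1_plus_square)
  then have "((\<lambda>t. (LBINT y. (f y - f (y + pi / t)) * cos (t * y)) / 2) \<longlongrightarrow> 0 / 2) at_top"
    by (intro tendsto_divide) auto
  moreover have "\<forall>\<^sub>F t in at_top. (LBINT y. (f y - f (y + pi / t)) * cos (t * y)) / 2 = (LBINT y. f y * cos (t * y))"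
    using eventually_gt_at_top[of 0]
  proof eventually_elim
    case (elim t)
    have "(LBINT y. (f y - f (y + pi / t)) * cos (t * y)) = (LBINT y. f y * cos (t * y)) - (LBINT y. f (y + pi / t) * cos (t * y))"
      unfolding left_diff_distrib by (rule Bochner_Integration.integral_diff[OF int intshift[OF elim]])
    then show ?case using shift[OF elim] by simp
  qed
  ultimately show ?thesis by (simp add: tendsto_cong)
qed

text \<open>The part of \<open>Re (log_S2_strip \<alpha> z)\<close> that grows with Im z. It scales
  linearly in |t|, so only its value at 1 has to be found.\<close>

definition cos_integral :: "real \<Rightarrow> real" where
  "cos_integral t = (LBINT y:{0<..}. (1 - cos (2 * t * y)) / y\<^sup>2)"

lemma cos_integrand_integrable: "set_integrable lborel {0<..} (\<lambda>y. (1 - cos (2 * t * y)) / y\<^sup>2)" for t :: real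
  unfolding set_integrable_def
proof (rule Bochner_Integration.integrable_bound[OF integrable_inverse_1_plus_square[of "4 * t\<^sup>2 + 4"]])
  show "(\<lambda>y. indicat_real {0<..} y *\<^sub>R ((1 - cos (2 * t * y)) / y\<^sup>2)) \<in> borel_measurable lborel" by measurable
  show "AE y in lborel. norm (indicat_real {0<..} y *\<^sub>R ((1 - cos (2 * t * y)) / y\<^sup>2)) \<le> norm ((4 * t\<^sup>2 + 4) / (1 + y\<^sup>2))"
  proof (rule AE_I2)
    fix y :: real
    have p: "1 + y\<^sup>2 > 0" by (simp add: add_pos_nonneg)
    have "(1 - cos (2 * t * y)) / y\<^sup>2 \<le> (4 * t\<^sup>2 + 4) / (1 + y\<^sup>2)" if y: "y > 0"
    proof (cases "y \<le> 1")
      case True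
      have "1 - cos (2 * t * y) = 2 * (sin (t * y))\<^sup>2"
        using cos_double_sin[of "t * y"] by (simp add: mult.assoc)
      also have "(sin (t * y))\<^sup>2 \<le> (t * y)\<^sup>2"
        using abs_sin_x_le_abs_x[of "t * y"] by (simp add: abs_le_square_iff)
      finally have "(1 - cos (2 * t * y)) / y\<^sup>2 \<le> 2 * t\<^sup>2" using y by (simp add: field_simps power_mult_distrib)
      also have "\<dots> \<le> (4 * t\<^sup>2 + 4) / (1 + y\<^sup>2)"
      proof -
        have "2 * t\<^sup>2 * (1 + y\<^sup>2) \<le> 2 * t\<^sup>2 * 2" using True y by (intro mult_left_mono) (auto simp: power_le_one)
        then show ?thesis using p by (simp add: pos_le_divide_eq)
      qed
      finally show ?thesis .
    next
      case False
      have y2: "y\<^sup>2 \<ge> 1" using False by simp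
      have "(1 - cos (2 * t * y)) / y\<^sup>2 \<le> 2 / y\<^sup>2" using cos_ge_minus_one[of "2 * t * y"] by (intro divide_right_mono) auto
      also have "\<dots> \<le> 4 / (1 + y\<^sup>2)" using y2 p y by (simp add: field_simps)
      also have "\<dots> \<le> (4 * t\<^sup>2 + 4) / (1 + y\<^sup>2)" using p by (intro divide_right_mono) auto
      finally show ?thesis .
    qed
    then show "norm (indicat_real {0<..} y *\<^sub>R ((1 - cos (2 * t * y)) / y\<^sup>2)) \<le> norm ((4 * t\<^sup>2 + 4) / (1 + y\<^sup>2))"
      using p by (auto simp: indicator_def add_nonneg_nonneg)
  qed
qed

lemma cos_integral_scale: "cos_integral t = \<bar>t\<bar> * cos_integral 1"
proof -
  have pos: "cos_integral t = t * cos_integral 1" if t: "t > 0" for t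
  proof -
    have "cos_integral 1 = \<bar>t\<bar> *\<^sub>R (LBINT y. indicat_real {0<..} (0 + t * y) *\<^sub>R ((1 - cos (2 * 1 * (0 + t * y))) / (0 + t * y)\<^sup>2))"
      unfolding cos_integral_def set_lebesgue_integral_def using t by (subst lborel_integral_real_affine[where c = t and t = 0]) auto
    also have "\<dots> = t * (LBINT y. (1 / t\<^sup>2) * (indicat_real {0<..} y *\<^sub>R ((1 - cos (2 * t * y)) / y\<^sup>2)))"
    proof -
      have "indicat_real {0<..} (0 + t * y) *\<^sub>R ((1 - cos (2 * 1 * (0 + t * y))) / (0 + t * y)\<^sup>2) =
        (1 / t\<^sup>2) * (indicat_real {0<..} y *\<^sub>R ((1 - cos (2 * t * y)) / y\<^sup>2))" for y
        using t by (auto simp: indicator_def zero_less_mult_iff power_mult_distrib mult_ac)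
      then show ?thesis using t by simp
    qed
    also have "\<dots> = cos_integral t / t"
      unfolding cos_integral_def set_lebesgue_integral_def integral_mult_right_zero using t by (simp add: power2_eq_square)
    finally show ?thesis using t by simp
  qed
  have neg: "cos_integral (- t) = cos_integral t" for t
    by (simp add: cos_integral_def)
  have "cos_integral 0 = 0" by (simp add: cos_integral_def set_lebesgue_integral_def)
  then show ?thesis using pos[of t] pos[of "- t"] neg[of t] by (cases t "0::real" rule: linorder_cases) auto
qed

text \<open>The part of \<open>Re (log_S2_strip \<alpha> z)\<close> that stays bounded as Im z
  grows: Im z enters only through the frequency of a cosine, so on a fixed vertical line the
  Riemann-Lebesgue lemma makes it tend to 0.\<close>

definition damped_integral :: "real \<Rightarrow> complex \<Rightarrow> real" where
  "damped_integral \<alpha> z = (LBINT y:{0<..}. Re (double_sine_kernel \<alpha> (of_real (2 * Re z - 1 - \<alpha>)) y) * cos (2 * Im z * y))"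

lemma damped_integrable:
  assumes "\<alpha> > 0" "\<bar>a\<bar> < 1 + \<alpha>"
  shows "set_integrable lborel {0<..} (\<lambda>y. Re (double_sine_kernel \<alpha> (of_real a) y) * cos (s * y))"
proof -
  have i: "set_integrable lborel {0<..} (double_sine_kernel \<alpha> (of_real a))"
    by (rule double_sine_kernel_integrable) (use assms in auto)
  have j: "integrable lborel (\<lambda>y. Re (indicat_real {0<..} y *\<^sub>R double_sine_kernel \<alpha> (of_real a) y))"
    using i unfolding set_integrable_def by (rule integrable_Re)
  show ?thesis
    unfolding set_integrable_def
  proof (rule Bochner_Integration.integrable_bound[OF j])
    have "(\<lambda>y. Re (indicat_real {0<..} y *\<^sub>R double_sine_kernel \<alpha> (of_real a) y) * cos (s * y)) \<in> borel_measurable lborel"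
      using borel_measurable_integrable[OF j] by measurable
    then show "(\<lambda>y. indicat_real {0<..} y *\<^sub>R (Re (double_sine_kernel \<alpha> (of_real a) y) * cos (s * y))) \<in> borel_measurable lborel"
      by (simp add: mult_ac)
    show "AE y in lborel. norm (indicat_real {0<..} y *\<^sub>R (Re (double_sine_kernel \<alpha> (of_real a) y) * cos (s * y))) \<le> norm (Re (indicat_real {0<..} y *\<^sub>R double_sine_kernel \<alpha> (of_real a) y))"
    proof (rule AE_I2)
      fix y
      have "\<bar>Re (double_sine_kernel \<alpha> (of_real a) y)\<bar> * \<bar>cos (s * y)\<bar> \<le> \<bar>Re (double_sine_kernel \<alpha> (of_real a) y)\<bar> * 1"
        by (intro mult_left_mono) auto
      then show "norm (indicat_real {0<..} y *\<^sub>R (Re (double_sine_kernel \<alpha> (of_real a) y) * cos (s * y))) \<le> norm (Re (indicat_real {0<..} y *\<^sub>R double_sine_kernel \<alpha> (of_real a) y))"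
        by (simp add: abs_mult indicator_def)
    qed
  qed
qed

lemma Re_sinh: "Re (sinh w) = sinh (Re w) * cos (Im w)" for w :: complex
  by (simp add: sinh_field_def Re_exp field_simps)

text \<open>Since Re (sinh w) = sinh (Re w) cos (Im w), the cosine multiplies only the first term of
  the kernel. Attaching it to the compensating term as well leaves (1 - cos)/y^2 as the
  remainder.\<close>

lemma Re_log_S2_strip_aux:
  assumes \<alpha>: "\<alpha> > 0" and z: "0 < Re z" "Re z < 1 + \<alpha>"
  shows "Re (log_S2_strip \<alpha> z) = damped_integral \<alpha> z - (2 * Re z - 1 - \<alpha>) / (2 * \<alpha>) * cos_integral 1 * \<bar>Im z\<bar>"
proof -
  define a where "a = 2 * z - 1 - of_real \<alpha>"
  define a0 where "a0 = 2 * Re z - 1 - \<alpha>"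
  have a: "Re a = a0" "Im a = 2 * Im z" by (auto simp: a_def a0_def)
  have a0: "\<bar>a0\<bar> < 1 + \<alpha>" using z by (auto simp: a0_def)
  have e: "Re (double_sine_kernel \<alpha> a y) = Re (double_sine_kernel \<alpha> (of_real a0) y) * cos (2 * Im z * y) - a0 / (2 * \<alpha>) * ((1 - cos (2 * Im z * y)) / y\<^sup>2)"
    if y: "y > 0" for y
  proof -
    have R: "Re (w / of_real r) = Re w / r" for w r by simp
    have A: "Re (double_sine_kernel \<alpha> a y) = (sinh (a0 * y) * cos (2 * Im z * y) / (2 * sinh y * sinh (\<alpha> * y)) - a0 / (2 * \<alpha> * y)) / y"
      unfolding double_sine_kernel_def R by (simp only: minus_complex.simps R Re_sinh) (simp add: a)
    have B: "Re (double_sine_kernel \<alpha> (of_real a0) y) = (sinh (a0 * y) / (2 * sinh y * sinh (\<alpha> * y)) - a0 / (2 * \<alpha> * y)) / y"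
      unfolding double_sine_kernel_def R by (simp only: minus_complex.simps R Re_sinh) simp
    show ?thesis unfolding A B using y \<alpha>
      by (simp add: field_simps power2_eq_square)
  qed
  have "Re (log_S2_strip \<alpha> z) = (LBINT y:{0<..}. Re (double_sine_kernel \<alpha> a y))"
  proof -
    have "set_integrable lborel {0<..} (double_sine_kernel \<alpha> a)"
      by (rule double_sine_kernel_integrable[OF \<alpha>]) (use a a0 in simp)
    then show ?thesis
      unfolding log_S2_strip_def log_S2_integrand_eq a_def[symmetric] set_lebesgue_integral_def set_integrable_def
      by (subst integral_Re[symmetric]) auto
  qed
  also have "\<dots> = (LBINT y:{0<..}. Re (double_sine_kernel \<alpha> (of_real a0) y) * cos (2 * Im z * y) - a0 / (2 * \<alpha>) * ((1 - cos (2 * Im z * y)) / y\<^sup>2))"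
    by (rule set_lebesgue_integral_cong) (use e in auto)
  also have "\<dots> = (LBINT y:{0<..}. Re (double_sine_kernel \<alpha> (of_real a0) y) * cos (2 * Im z * y)) - (LBINT y:{0<..}. a0 / (2 * \<alpha>) * ((1 - cos (2 * Im z * y)) / y\<^sup>2))"
    by (intro set_integral_diff(2) damped_integrable \<alpha> a0 set_integrable_mult_right cos_integrand_integrable)
  also have "(LBINT y:{0<..}. a0 / (2 * \<alpha>) * ((1 - cos (2 * Im z * y)) / y\<^sup>2)) = a0 / (2 * \<alpha>) * cos_integral (Im z)"
    unfolding cos_integral_def by (rule set_integral_mult_right)
  finally show ?thesis
    unfolding damped_integral_def a0_def[symmetric] cos_integral_scale[of "Im z"] by simp
qed

lemma damped_integral_bound:
  assumes \<alpha>: "\<alpha> > 0" and x: "0 < x1" "x2 < 1 + \<alpha>"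
  obtains B where "B > 0" "\<And>z. x1 \<le> Re z \<Longrightarrow> Re z \<le> x2 \<Longrightarrow> \<bar>damped_integral \<alpha> z\<bar> \<le> B"
proof -
  \<comment> \<open>2x - 1 - \<alpha> is extremal at the ends of [x1, x2]; the maximum with 0 makes
    \<open>m\<close> admissible for the kernel bound also when the interval is empty.\<close>
  define m where "m = max 0 (max (1 + \<alpha> - 2 * x1) (2 * x2 - 1 - \<alpha>))"
  have m: "0 \<le> m" "m < 1 + \<alpha>" using x \<alpha> by (auto simp: m_def)
  obtain C where C: "C > 0" "\<And>a y. y > 0 \<Longrightarrow> \<bar>Re a\<bar> \<le> m \<Longrightarrow> norm a \<le> m \<Longrightarrow> norm (double_sine_kernel \<alpha> a y) \<le> C / (1 + y\<^sup>2)"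
    using double_sine_kernel_bound[OF \<alpha> m m(1)] by blast
  define B where "B = (LBINT y. C / (1 + y\<^sup>2)) + 1"
  have B: "B > 0" unfolding B_def using C(1) by (intro add_nonneg_pos integral_nonneg_AE AE_I2) (auto simp: add_nonneg_nonneg)
  show ?thesis
  proof (rule that[OF B])
    fix z assume z: "x1 \<le> Re z" "Re z \<le> x2"
    define a where "a = 2 * Re z - 1 - \<alpha>"
    have a: "\<bar>a\<bar> \<le> m" using z by (auto simp: a_def m_def)
    have "norm (damped_integral \<alpha> z) \<le> (LBINT y. C / (1 + y\<^sup>2))"
      unfolding damped_integral_def a_def[symmetric] set_lebesgue_integral_def
    proof (rule Bochner_Integration.integral_norm_bound_integral)
      show "integrable lborel (\<lambda>y. indicat_real {0<..} y *\<^sub>R (Re (double_sine_kernel \<alpha> (of_real a) y) * cos (2 * Im z * y)))"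
        using damped_integrable[OF \<alpha>, of a "2 * Im z"] a m by (simp add: set_integrable_def)
      fix y :: real
      have "norm (Re (double_sine_kernel \<alpha> (of_real a) y) * cos (2 * Im z * y)) \<le> C / (1 + y\<^sup>2)" if "y > 0"
      proof -
        have "\<bar>Re (double_sine_kernel \<alpha> (of_real a) y)\<bar> * \<bar>cos (2 * Im z * y)\<bar> \<le> \<bar>Re (double_sine_kernel \<alpha> (of_real a) y)\<bar> * 1"
          by (intro mult_left_mono) auto
        also have "\<dots> \<le> norm (double_sine_kernel \<alpha> (of_real a) y)" using abs_Re_le_cmod by simp
        also have "\<dots> \<le> C / (1 + y\<^sup>2)" using a that by (intro C) auto
        finally show ?thesis by (simp add: abs_mult)
      qed
      then show "norm (indicat_real {0<..} y *\<^sub>R (Re (double_sine_kernel \<alpha> (of_real a) y) * cos (2 * Im z * y))) \<le> C / (1 + y\<^sup>2)"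
        using C(1) by (auto simp: indicator_def add_nonneg_nonneg)
    qed (rule integrable_inverse_1_plus_square)
    then show "\<bar>damped_integral \<alpha> z\<bar> \<le> B" by (simp add: B_def)
  qed
qed

text \<open>The constant is read off from the growth of the sine in the functional equation, here for \<open>\<alpha> = 1\<close>.\<close>
lemma cos_integral_1: "cos_integral 1 = pi"
proof -
  obtain B where B: "B > 0" "\<And>z. 1 / 2 \<le> Re z \<Longrightarrow> Re z \<le> 3 / 2 \<Longrightarrow> \<bar>damped_integral 1 z\<bar> \<le> B"
    using damped_integral_bound[of 1 "1 / 2" "3 / 2"] by auto
  have "\<bar>(pi - cos_integral 1) * t\<bar> \<le> 2 * B + ln 2" if t: "t > 0" for t
  proof -
    define z where "z = Complex (1 / 2) t"
    have z: "0 < Re z" "Re z < 1" "Re z < 1 + 1" by (auto simp: z_def)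
    have s: "sin (of_real pi * z) = of_real (cosh (pi * t))"
    proof -
      have "of_real pi * z = \<i> * of_real (pi * t) + of_real pi / 2" by (simp add: z_def complex_eq_iff)
      then have "sin (of_real pi * z) = cos (\<i> * of_real (pi * t))" by (simp only: sin_add sin_of_real cos_of_real sin_cos_eq) (simp add: cos_diff cos_add sin_of_real[symmetric])
      also have "\<dots> = cosh (complex_of_real (pi * t))" by (rule cosh_conv_cos[symmetric])
      finally show ?thesis by (simp only: cosh_complex_of_real)
    qed
    have "S2_strip 1 z = 2 * sin (of_real pi * z) * S2_strip 1 (z + of_real 1)"
      using S2_strip_shift_alpha[of 1 z] z by simp
    then have "exp (Re (log_S2_strip 1 z)) = 2 * cosh (pi * t) * exp (Re (log_S2_strip 1 (z + 1)))"
      unfolding s S2_strip_def by (metis norm_exp_eq_Re norm_mult norm_numeral norm_of_real of_real_1 abs_of_nonneg cosh_real_nonneg)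
    then have "exp (Re (log_S2_strip 1 z) - Re (log_S2_strip 1 (z + 1))) = 2 * cosh (pi * t)"
      by (simp add: exp_diff)
    then have 1: "Re (log_S2_strip 1 z) - Re (log_S2_strip 1 (z + 1)) = ln (2 * cosh (pi * t))"
      by (metis ln_exp)
    have 2: "Re (log_S2_strip 1 z) - Re (log_S2_strip 1 (z + 1)) = damped_integral 1 z - damped_integral 1 (z + 1) + cos_integral 1 * t"
      using Re_log_S2_strip_aux[of 1 z] Re_log_S2_strip_aux[of 1 "z + 1"] t by (simp add: z_def algebra_simps)
    have "exp (pi * t) \<le> 2 * cosh (pi * t)" by (simp add: cosh_field_def)
    then have "ln (exp (pi * t)) \<le> ln (2 * cosh (pi * t))" by (subst ln_le_cancel_iff) (auto simp: cosh_real_pos)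
    then have 3: "pi * t \<le> ln (2 * cosh (pi * t))" by simp
    have "2 * cosh (pi * t) \<le> 2 * exp (pi * t)" using t by (simp add: cosh_field_def)
    then have "ln (2 * cosh (pi * t)) \<le> ln (2 * exp (pi * t))" by (subst ln_le_cancel_iff) (auto simp: cosh_real_pos)
    then have 4: "ln (2 * cosh (pi * t)) \<le> ln 2 + pi * t" by (simp add: ln_mult)
    have "\<bar>damped_integral 1 z\<bar> \<le> B" "\<bar>damped_integral 1 (z + 1)\<bar> \<le> B" by (rule B; simp add: z_def)+
    then show ?thesis using 1 2 3 4 ln_gt_zero[of 2] unfolding left_diff_distrib by linarith
  qed
  note bnd = this
  show ?thesis
  proof (rule ccontr)
    assume "cos_integral 1 \<noteq> pi"
    then have p: "\<bar>pi - cos_integral 1\<bar> > 0" by simp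
    define t where "t = (2 * B + ln 2 + 1) / \<bar>pi - cos_integral 1\<bar>"
    have "2 * B + ln 2 + 1 > 0" using B(1) ln_gt_zero[of 2] by linarith
    then have "t > 0" using p by (simp add: t_def)
    moreover have "\<bar>(pi - cos_integral 1) * t\<bar> = 2 * B + ln 2 + 1"
      using p \<open>2 * B + ln 2 + 1 > 0\<close> by (simp add: abs_mult t_def)
    ultimately show False using bnd[of t] by linarith
  qed
qed

text \<open>An exact formula: the rate pi |Im z| / \<alpha> is multiplied by the signed distance of
  Re z from the centre of the strip, and the other factor is bounded above and away from 0 on closed
  substrips.\<close>

theorem norm_S2_strip:
  assumes "\<alpha> > 0" "0 < Re z" "Re z < 1 + \<alpha>"
  shows "norm (S2_strip \<alpha> z) = exp (damped_integral \<alpha> z) * exp (- (pi * \<bar>Im z\<bar> / \<alpha>) * (Re z - (1 + \<alpha>) / 2))"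
  unfolding S2_strip_def norm_exp_eq_Re Re_log_S2_strip_aux[OF assms] cos_integral_1 exp_add[symmetric]
  using assms by (simp add: field_simps)

theorem S2_strip_bounds:
  assumes \<alpha>: "\<alpha> > 0" and x: "0 < x1" "x2 < 1 + \<alpha>"
  obtains B where "B > 0"
    "\<And>z. x1 \<le> Re z \<Longrightarrow> Re z \<le> x2 \<Longrightarrow> norm (S2_strip \<alpha> z) \<le> B * exp (- (pi * \<bar>Im z\<bar> / \<alpha>) * (Re z - (1 + \<alpha>) / 2))"
    "\<And>z. x1 \<le> Re z \<Longrightarrow> Re z \<le> x2 \<Longrightarrow> inverse (norm (S2_strip \<alpha> z)) \<le> B * exp ((pi * \<bar>Im z\<bar> / \<alpha>) * (Re z - (1 + \<alpha>) / 2))"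
proof -
  obtain B where B: "B > 0" "\<And>z. x1 \<le> Re z \<Longrightarrow> Re z \<le> x2 \<Longrightarrow> \<bar>damped_integral \<alpha> z\<bar> \<le> B"
    using damped_integral_bound[OF \<alpha> x] by blast
  show ?thesis
  proof (rule that[of "exp B"])
    fix z assume z: "x1 \<le> Re z" "Re z \<le> x2"
    have z': "0 < Re z" "Re z < 1 + \<alpha>" using z x by auto
    have "damped_integral \<alpha> z \<le> B" "- damped_integral \<alpha> z \<le> B" using B(2)[OF z] by linarith+
    then have e: "exp (damped_integral \<alpha> z) \<le> exp B" "exp (- damped_integral \<alpha> z) \<le> exp B" by auto
    show "norm (S2_strip \<alpha> z) \<le> exp B * exp (- (pi * \<bar>Im z\<bar> / \<alpha>) * (Re z - (1 + \<alpha>) / 2))"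
      unfolding norm_S2_strip[OF \<alpha> z'] using e(1) by (rule mult_right_mono) simp
    have "inverse (norm (S2_strip \<alpha> z)) = exp (- damped_integral \<alpha> z) * exp ((pi * \<bar>Im z\<bar> / \<alpha>) * (Re z - (1 + \<alpha>) / 2))"
      unfolding norm_S2_strip[OF \<alpha> z'] by (simp add: exp_minus mult_ac)
    also have "\<dots> \<le> exp B * exp ((pi * \<bar>Im z\<bar> / \<alpha>) * (Re z - (1 + \<alpha>) / 2))"
      using e(2) by (rule mult_right_mono) simp
    finally show "inverse (norm (S2_strip \<alpha> z)) \<le> exp B * exp ((pi * \<bar>Im z\<bar> / \<alpha>) * (Re z - (1 + \<alpha>) / 2))" .
  qed simp
qed

text \<open>On a fixed vertical line the damped integral is a cosine transform of an integrable
  function, so its exponential tends to 1.\<close>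

theorem norm_S2_strip_asymptotic:
  assumes \<alpha>: "\<alpha> > 0" and x: "0 < x" "x < 1 + \<alpha>"
  shows "((\<lambda>t. norm (S2_strip \<alpha> (Complex x t)) * exp ((pi * t / \<alpha>) * (x - (1 + \<alpha>) / 2))) \<longlongrightarrow> 1) at_top"
proof -
  define a where "a = 2 * x - 1 - \<alpha>"
  have a: "\<bar>a\<bar> < 1 + \<alpha>" using x by (auto simp: a_def)
  let ?f = "\<lambda>y. indicat_real {0<..} y *\<^sub>R Re (double_sine_kernel \<alpha> (of_real a) y)"
  obtain C where C: "C > 0" "\<And>a' y. y > 0 \<Longrightarrow> \<bar>Re a'\<bar> \<le> \<bar>a\<bar> \<Longrightarrow> norm a' \<le> \<bar>a\<bar> \<Longrightarrow> norm (double_sine_kernel \<alpha> a' y) \<le> C / (1 + y\<^sup>2)"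
    using double_sine_kernel_bound[OF \<alpha> abs_ge_zero a abs_ge_zero[of a]] by blast
  have lim: "((\<lambda>t. LBINT y. ?f y * cos (t * y)) \<longlongrightarrow> 0) at_top"
  proof (rule Riemann_Lebesgue_cos)
    have "(\<lambda>y. Re (indicat_real {0<..} y *\<^sub>R double_sine_kernel \<alpha> (of_real a) y)) \<in> borel_measurable borel"
      using double_sine_kernel_measurable[OF \<alpha>, of "of_real a"] by measurable
    then show "?f \<in> borel_measurable borel" by simp
    show "\<bar>?f y\<bar> \<le> C / (1 + y\<^sup>2)" for y
    proof (cases "y > 0")
      case True
      have "\<bar>Re (double_sine_kernel \<alpha> (of_real a) y)\<bar> \<le> norm (double_sine_kernel \<alpha> (of_real a) y)" by (rule abs_Re_le_cmod)
      also have "\<dots> \<le> C / (1 + y\<^sup>2)" by (rule C(2)[OF True]) auto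
      finally show ?thesis using True by simp
    qed (use C(1) in \<open>auto simp: add_nonneg_nonneg\<close>)
    fix y :: real assume "y \<noteq> 0"
    then consider "y > 0" | "y < 0" by linarith
    then show "isCont ?f y"
    proof cases
      case 1
      have c: "continuous_on {0<..} (\<lambda>y. Re (double_sine_kernel \<alpha> (of_real a) y))"
        unfolding double_sine_kernel_def using \<alpha> by (auto intro!: continuous_intros)
      then have "continuous_on {0<..} ?f" by (subst continuous_on_cong[OF refl, where g = "\<lambda>y. Re (double_sine_kernel \<alpha> (of_real a) y)"]) auto
      then show ?thesis using 1 by (simp add: continuous_on_eq_continuous_at)
    next
      case 2
      have "continuous_on {..<0} (\<lambda>y::real. 0::real)" by (rule continuous_on_const)
      then have "continuous_on {..<0} ?f" by (subst continuous_on_cong[OF refl, where g = "\<lambda>y. 0"]) auto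
      then show ?thesis using 2 by (simp add: continuous_on_eq_continuous_at)
    qed
  qed
  have "filterlim (\<lambda>t::real. 2 * t) at_top at_top" by real_asymp
  from filterlim_compose[OF lim this]
  have "((\<lambda>t. exp (LBINT y. ?f y * cos (2 * t * y))) \<longlongrightarrow> exp 0) at_top" by (rule tendsto_exp)
  moreover have "\<forall>\<^sub>F t in at_top. exp (LBINT y. ?f y * cos (2 * t * y)) = norm (S2_strip \<alpha> (Complex x t)) * exp ((pi * t / \<alpha>) * (x - (1 + \<alpha>) / 2))"
    using eventually_gt_at_top[of 0]
  proof eventually_elim
    case (elim t)
    have "(LBINT y. ?f y * cos (2 * t * y)) = damped_integral \<alpha> (Complex x t)"
      by (simp add: damped_integral_def a_def set_lebesgue_integral_def mult_ac)
    moreover have "norm (S2_strip \<alpha> (Complex x t)) = exp (damped_integral \<alpha> (Complex x t)) * exp (- ((pi * t / \<alpha>) * (x - (1 + \<alpha>) / 2)))"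
      using norm_S2_strip[of \<alpha> "Complex x t"] \<alpha> x elim by simp
    ultimately show ?case by (simp add: exp_minus)
  qed
  ultimately show ?thesis by (simp add: tendsto_cong)
qed

section \<open>Real values and special values\<close>

lemma S2_strip_of_real: "S2_strip \<alpha> (of_real x) = of_real (exp (Re (log_S2_strip \<alpha> (of_real x))))"
proof -
  have "cnj (log_S2_strip \<alpha> (of_real x)) = log_S2_strip \<alpha> (of_real x)"
    using log_S2_strip_cnj[of \<alpha> "of_real x"] by simp
  then have "log_S2_strip \<alpha> (of_real x) = of_real (Re (log_S2_strip \<alpha> (of_real x)))"
    by (simp add: complex_eq_iff)
  then show ?thesis unfolding S2_strip_def by (metis exp_of_real)
qed

lemma S2_strip_mult_cnj: "S2_strip \<alpha> z * S2_strip \<alpha> (cnj z) = of_real ((norm (S2_strip \<alpha> z))\<^sup>2)"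
  by (simp only: S2_strip_cnj complex_norm_square)

text \<open>Equating the two functional equations at small x > 0 and dividing by x gives S2 1 =
  \<alpha> S2 \<alpha> in the limit. Reflection gives S2 1 * S2 \<alpha> = 1, and positivity on the
  real axis selects the square root.\<close>

lemma S2_strip_at_1:
  assumes \<alpha>: "\<alpha> > 0"
  shows "S2_strip \<alpha> 1 = of_real (sqrt \<alpha>)" and "S2_strip \<alpha> (of_real \<alpha>) = of_real (1 / sqrt \<alpha>)"
proof -
  have cont: "isCont (S2_strip \<alpha>) w" if "0 < Re w" "Re w < 1 + \<alpha>" for w
  proof -
    have "continuous_on {z. 0 < Re z \<and> Re z < 1 + \<alpha>} (S2_strip \<alpha>)"
      by (rule holomorphic_on_imp_continuous_on[OF S2_strip_holomorphic[OF \<alpha>]])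
    then show ?thesis using that open_vertical_strip by (auto simp: continuous_on_eq_continuous_at)
  qed
  have l1: "((\<lambda>x. of_real (sin (pi * x) / x) * S2_strip \<alpha> (of_real x + of_real \<alpha>)) \<longlongrightarrow> of_real pi * S2_strip \<alpha> (of_real \<alpha>)) (at_right 0)"
  proof (intro tendsto_mult tendsto_of_real)
    show "((\<lambda>x::real. sin (pi * x) / x) \<longlongrightarrow> pi) (at_right 0)" by real_asymp
    have "((\<lambda>x::real. complex_of_real x + of_real \<alpha>) \<longlongrightarrow> of_real 0 + of_real \<alpha>) (at_right 0)"
      by (intro tendsto_intros)
    then show "((\<lambda>x::real. S2_strip \<alpha> (of_real x + of_real \<alpha>)) \<longlongrightarrow> S2_strip \<alpha> (of_real \<alpha>)) (at_right 0)"
      using \<alpha> by (intro isCont_tendsto_compose[OF cont]) auto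
  qed
  have l2: "((\<lambda>x. of_real (sin (pi * x / \<alpha>) / x) * S2_strip \<alpha> (of_real x + 1)) \<longlongrightarrow> of_real (pi / \<alpha>) * S2_strip \<alpha> 1) (at_right 0)"
  proof (intro tendsto_mult tendsto_of_real)
    have "((\<lambda>x::real. sin (c * x) / x) \<longlongrightarrow> c) (at_right 0)" for c by real_asymp
    from this[of "pi / \<alpha>"] show "((\<lambda>x::real. sin (pi * x / \<alpha>) / x) \<longlongrightarrow> pi / \<alpha>) (at_right 0)" by simp
    have "((\<lambda>x::real. complex_of_real x + 1) \<longlongrightarrow> of_real 0 + 1) (at_right 0)"
      by (intro tendsto_intros)
    then show "((\<lambda>x::real. S2_strip \<alpha> (of_real x + 1)) \<longlongrightarrow> S2_strip \<alpha> 1) (at_right 0)"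
      using \<alpha> by (intro isCont_tendsto_compose[OF cont]) auto
  qed
  have ev: "\<forall>\<^sub>F x in at_right (0::real). x \<in> {0<..<min 1 \<alpha>}"
    using \<alpha> by (intro eventually_at_right_real) auto
  have "\<forall>\<^sub>F x in at_right 0. of_real (sin (pi * x) / x) * S2_strip \<alpha> (of_real x + of_real \<alpha>) = of_real (sin (pi * x / \<alpha>) / x) * S2_strip \<alpha> (of_real x + 1)"
    using ev
  proof eventually_elim
    case (elim x)
    then have x: "0 < x" "x < 1" "x < \<alpha>" by auto
    have "sin (of_real pi * complex_of_real x) = of_real (sin (pi * x))" "sin (of_real pi * complex_of_real x / of_real \<alpha>) = of_real (sin (pi * x / \<alpha>))"
      by (simp_all flip: sin_of_real)
    then have "2 * of_real (sin (pi * x)) * S2_strip \<alpha> (of_real x + of_real \<alpha>) = 2 * of_real (sin (pi * x / \<alpha>)) * S2_strip \<alpha> (of_real x + 1)"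
      using S2_strip_shift_alpha[OF \<alpha>, of "of_real x"] S2_strip_shift_1[OF \<alpha>, of "of_real x"] x by simp
    then show ?case using x by (simp add: field_simps)
  qed
  from tendsto_cong[OF this] l1 have "((\<lambda>x. of_real (sin (pi * x / \<alpha>) / x) * S2_strip \<alpha> (of_real x + 1)) \<longlongrightarrow> of_real pi * S2_strip \<alpha> (of_real \<alpha>)) (at_right 0)"
    by simp
  from tendsto_unique[OF _ this l2] have 1: "of_real pi * S2_strip \<alpha> (of_real \<alpha>) = of_real (pi / \<alpha>) * S2_strip \<alpha> 1" by simp
  obtain r where r: "S2_strip \<alpha> 1 = of_real r" "r > 0"
    using S2_strip_of_real[of \<alpha> 1] by (metis exp_gt_zero of_real_1)
  have 2: "S2_strip \<alpha> 1 = of_real \<alpha> * S2_strip \<alpha> (of_real \<alpha>)" using 1 \<alpha> by (simp add: field_simps)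
  have 3: "S2_strip \<alpha> 1 * S2_strip \<alpha> (of_real \<alpha>) = 1" using S2_strip_reflection[of \<alpha> 1] by simp
  have "of_real (r * r) = S2_strip \<alpha> 1 * (of_real \<alpha> * S2_strip \<alpha> (of_real \<alpha>))" using 2 r by simp
  also have "\<dots> = of_real \<alpha>" using 3 by (simp add: mult_ac)
  finally have "r * r = \<alpha>" by (simp only: of_real_eq_iff)
  then have "r = sqrt \<alpha>" using r by (metis abs_of_pos real_sqrt_abs2)
  then show s1: "S2_strip \<alpha> 1 = of_real (sqrt \<alpha>)" using r by simp
  then show "S2_strip \<alpha> (of_real \<alpha>) = of_real (1 / sqrt \<alpha>)" using 3 \<alpha> by (simp add: field_simps)
qed

section \<open>The Laplace transform in logarithmic coordinates\<close>

text \<open>Both cases of admissibility are condensed into inequalities symmetric under exchanging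
  \<rho> and 1 - \<rho>, so that the locale can be interpreted for \<open>F\<close> and for its
  conjugate.\<close>

locale stable_params =
  fixes \<alpha> \<rho> :: real
  assumes alpha: "0 < \<alpha>" "\<alpha> < 2" and rho: "0 < \<rho>" "\<rho> < 1" and ar: "\<alpha> * \<rho> < 1" "\<alpha> * (1 - \<rho>) < 1"
begin

definition b :: real where "b = \<alpha> * (1 - \<rho>) / 2"
definition \<theta> :: real where "\<theta> = pi * \<rho>"
text \<open>The constant in front of (i). It reappears as the limit of \<open>h\<close> at minus
  infinity and thereby as the strength of the pole at 1 in \<open>M_near_1\<close>.\<close>

definition C0 :: complex where "C0 = of_real (sqrt \<alpha> / 2) * S2_strip \<alpha> (of_real (\<alpha> * \<rho>))"

lemma b: "0 < b" "2 * b < 1" "2 * b < \<alpha>" "\<alpha> - 2 * b = \<alpha> * \<rho>" "\<alpha> - 2 * b < 1"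
  using alpha rho ar by (auto simp: b_def field_simps)

lemma theta: "0 < \<theta>" "\<theta> < pi" "pi * b / \<alpha> = (pi - \<theta>) / 2" "sin \<theta> > 0"
proof -
  show t: "0 < \<theta>" "\<theta> < pi" using rho by (auto simp: \<theta>_def)
  then show "sin \<theta> > 0" by (rule sin_gt_zero)
  show "pi * b / \<alpha> = (pi - \<theta>) / 2" using alpha by (simp add: b_def \<theta>_def field_simps)
qed

definition hnum :: "complex \<Rightarrow> complex" where
  "hnum u = C0 * exp (- of_real (b + 1 / 2) * u) *
     (S2_strip \<alpha> (of_real (\<alpha> / 2 + b) + \<i> * of_real (\<alpha> / (2 * pi)) * u) * S2_strip \<alpha> (of_real (\<alpha> / 2 + b) - \<i> * of_real (\<alpha> / (2 * pi)) * u))"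

text \<open>On the real line \<open>h u\<close> is the right-hand side of (i) at \<open>z = exp u\<close>, see \<open>h_ln\<close>; both functional
  equations have been used to exhibit the poles.\<close>
definition h :: "complex \<Rightarrow> complex" where
  "h u = hnum u / (2 * (cosh u - of_real (cos \<theta>)))"

text \<open>A margin beyond |Im u| = pi. It keeps the real parts of the arguments of
  \<open>S2_strip\<close> in \<open>hnum\<close> between b/2 and \<alpha> + 3b/2, and the next zeros
  of cosh u - cos \<theta>, at \<plusminus> i (2 pi - \<theta>), outside.\<close>

definition \<epsilon> :: real where "\<epsilon> = pi * b / \<alpha>"

lemma eps: "\<epsilon> > 0" "\<alpha> / (2 * pi) * (pi + \<epsilon>) = \<alpha> / 2 + b / 2" "\<epsilon> < pi - \<theta>"
proof -
  show "\<epsilon> > 0" using b alpha by (simp add: \<epsilon>_def)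
  show "\<alpha> / (2 * pi) * (pi + \<epsilon>) = \<alpha> / 2 + b / 2" using alpha by (simp add: \<epsilon>_def field_simps)
  show "\<epsilon> < pi - \<theta>" unfolding \<epsilon>_def theta(3) using theta(2) by simp
qed

lemma hnum_holomorphic: "hnum holomorphic_on {u. - (pi + \<epsilon>) < Im u \<and> Im u < pi + \<epsilon>}"
proof -
  let ?S = "{u. - (pi + \<epsilon>) < Im u \<and> Im u < pi + \<epsilon>}"
  have bnd: "\<bar>\<alpha> / (2 * pi) * Im u\<bar> < \<alpha> / 2 + b / 2" if "u \<in> ?S" for u
  proof -
    have "\<alpha> / (2 * pi) * \<bar>Im u\<bar> < \<alpha> / (2 * pi) * (pi + \<epsilon>)"
      using that alpha by (intro mult_strict_left_mono) auto
    then show ?thesis using alpha unfolding eps(2) by (simp add: abs_mult)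
  qed
  have 1: "S2_strip \<alpha> \<circ> (\<lambda>u. of_real (\<alpha> / 2 + b) + \<i> * of_real (\<alpha> / (2 * pi)) * u) holomorphic_on ?S"
  proof (rule holomorphic_on_compose_gen[OF _ S2_strip_holomorphic[OF alpha(1)]])
    show "(\<lambda>u. of_real (\<alpha> / 2 + b) + \<i> * of_real (\<alpha> / (2 * pi)) * u) ` ?S \<subseteq> {z. 0 < Re z \<and> Re z < 1 + \<alpha>}"
    proof (rule image_subsetI)
      fix u assume "u \<in> ?S"
      have R: "Re (of_real (\<alpha> / 2 + b) + \<i> * of_real (\<alpha> / (2 * pi)) * u) = \<alpha> / 2 + b - \<alpha> / (2 * pi) * Im u" by simp
      show "of_real (\<alpha> / 2 + b) + \<i> * of_real (\<alpha> / (2 * pi)) * u \<in> {z. 0 < Re z \<and> Re z < 1 + \<alpha>}"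
        using bnd[OF \<open>u \<in> ?S\<close>] b unfolding mem_Collect_eq R by linarith
    qed
  qed (intro holomorphic_intros)
  have 2: "S2_strip \<alpha> \<circ> (\<lambda>u. of_real (\<alpha> / 2 + b) - \<i> * of_real (\<alpha> / (2 * pi)) * u) holomorphic_on ?S"
  proof (rule holomorphic_on_compose_gen[OF _ S2_strip_holomorphic[OF alpha(1)]])
    show "(\<lambda>u. of_real (\<alpha> / 2 + b) - \<i> * of_real (\<alpha> / (2 * pi)) * u) ` ?S \<subseteq> {z. 0 < Re z \<and> Re z < 1 + \<alpha>}"
    proof (rule image_subsetI)
      fix u assume "u \<in> ?S"
      have R: "Re (of_real (\<alpha> / 2 + b) - \<i> * of_real (\<alpha> / (2 * pi)) * u) = \<alpha> / 2 + b + \<alpha> / (2 * pi) * Im u" by simp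
      show "of_real (\<alpha> / 2 + b) - \<i> * of_real (\<alpha> / (2 * pi)) * u \<in> {z. 0 < Re z \<and> Re z < 1 + \<alpha>}"
        using bnd[OF \<open>u \<in> ?S\<close>] b unfolding mem_Collect_eq R by linarith
    qed
  qed (intro holomorphic_intros)
  have 3: "(\<lambda>u. C0 * exp (- of_real (b + 1 / 2) * u)) holomorphic_on ?S" by (intro holomorphic_intros)
  show ?thesis unfolding hnum_def using holomorphic_on_mult[OF 3 holomorphic_on_mult[OF 1 2]] by (simp add: comp_def)
qed

lemma cosh_eq_cos_theta:
  assumes u: "cosh u = of_real (cos \<theta>)" "- (pi + \<epsilon>) < Im u" "Im u < pi + \<epsilon>"
  shows "u = \<i> * of_real \<theta> \<or> u = - (\<i> * of_real \<theta>)"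
proof -
  have "cos (\<i> * u) = cos (of_real \<theta>)" using u(1) by (simp add: cosh_conv_cos cos_of_real)
  then obtain n where n: "n \<in> \<int>" "\<i> * u = of_real \<theta> + of_real (2 * n * pi) \<or> \<i> * u = - of_real \<theta> + of_real (2 * n * pi)"
    using complex_cos_eq[of "\<i> * u" "of_real \<theta>"] by auto
  then obtain k where k: "n = of_int k" by (auto elim: Ints_cases)
  define m where "m = real_of_int k"
  have w: "\<i> * u = of_real (\<theta> + 2 * m * pi) \<or> \<i> * u = of_real (- \<theta> + 2 * m * pi)"
    using n(2) k by (simp add: m_def)
  then have re: "Re u = 0" by (metis Im_complex_of_real Im_i_times)
  have im: "- Im u = \<theta> + 2 * m * pi \<or> - Im u = - \<theta> + 2 * m * pi"
    using w by (metis Re_complex_of_real Re_i_times)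
  have bnd: "\<bar>Im u\<bar> < 2 * pi - \<theta>" using u(2,3) eps(3) by linarith
  have "k = 0"
  proof (rule ccontr)
    assume "k \<noteq> 0"
    then consider "1 \<le> m" | "m \<le> -1" unfolding m_def by linarith
    then show False
    proof cases
      case 1
      then have "1 * pi \<le> m * pi" by (intro mult_right_mono) auto
      then show False using im bnd theta(1) by linarith
    next
      case 2
      then have "m * pi \<le> (-1) * pi" by (intro mult_right_mono) auto
      then show False using im bnd theta(1) by linarith
    qed
  qed
  then have "m = 0" by (simp add: m_def)
  then have "\<i> * u = of_real \<theta> \<or> \<i> * u = - of_real \<theta>" using w by simp
  then have "- \<i> * (\<i> * u) = - \<i> * of_real \<theta> \<or> - \<i> * (\<i> * u) = - \<i> * - of_real \<theta>" by metis
  then show ?thesis by (auto simp: mult.assoc[symmetric])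
qed

text \<open>The real parts of the two arguments add up to \<alpha> + 2b whatever Im u is, so the
  dependence of the two growth rates on Im u cancels.\<close>

lemma S2_strip_pair_bound:
  obtains B where "B > 0" "\<And>u. \<bar>Im u\<bar> \<le> pi \<Longrightarrow>
     norm (S2_strip \<alpha> (of_real (\<alpha> / 2 + b) + \<i> * of_real (\<alpha> / (2 * pi)) * u) * S2_strip \<alpha> (of_real (\<alpha> / 2 + b) - \<i> * of_real (\<alpha> / (2 * pi)) * u))
       \<le> B * exp ((1 / 2 - b) * \<bar>Re u\<bar>)"
proof -
  obtain B where B: "B > 0" "\<And>z. b \<le> Re z \<Longrightarrow> Re z \<le> \<alpha> + b \<Longrightarrow> norm (S2_strip \<alpha> z) \<le> B * exp (- (pi * \<bar>Im z\<bar> / \<alpha>) * (Re z - (1 + \<alpha>) / 2))"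
  proof -
    have pb: "0 < b" "\<alpha> + b < 1 + \<alpha>" using b by auto
    show ?thesis by (rule S2_strip_bounds[OF alpha(1) pb]) (rule that)
  qed
  show ?thesis
  proof (rule that[of "B * B"])
    fix u :: complex assume u: "\<bar>Im u\<bar> \<le> pi"
    define v where "v = \<alpha> / (2 * pi) * Im u"
    have "\<bar>v\<bar> \<le> \<alpha> / (2 * pi) * pi"
      unfolding v_def abs_mult using u alpha by (intro mult_mono) auto
    then have v: "\<bar>v\<bar> \<le> \<alpha> / 2" by simp
    let ?p = "of_real (\<alpha> / 2 + b) + \<i> * of_real (\<alpha> / (2 * pi)) * u" and ?q = "of_real (\<alpha> / 2 + b) - \<i> * of_real (\<alpha> / (2 * pi)) * u"
    have p: "Re ?p = \<alpha> / 2 + b - v" "Im ?p = \<alpha> / (2 * pi) * Re u" and q: "Re ?q = \<alpha> / 2 + b + v" "Im ?q = - (\<alpha> / (2 * pi) * Re u)"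
      by (simp_all add: v_def)
    have im: "pi * \<bar>Im ?p\<bar> / \<alpha> = \<bar>Re u\<bar> / 2" "pi * \<bar>Im ?q\<bar> / \<alpha> = \<bar>Re u\<bar> / 2"
      unfolding p q using alpha by (simp_all add: abs_mult)
    have "norm (S2_strip \<alpha> ?p) \<le> B * exp (- (\<bar>Re u\<bar> / 2) * (\<alpha> / 2 + b - v - (1 + \<alpha>) / 2))"
      using B(2)[of ?p, unfolded im, unfolded p] v by linarith
    moreover have "norm (S2_strip \<alpha> ?q) \<le> B * exp (- (\<bar>Re u\<bar> / 2) * (\<alpha> / 2 + b + v - (1 + \<alpha>) / 2))"
      using B(2)[of ?q, unfolded im, unfolded q] v by linarith
    ultimately have "norm (S2_strip \<alpha> ?p * S2_strip \<alpha> ?q) \<le> (B * exp (- (\<bar>Re u\<bar> / 2) * (\<alpha> / 2 + b - v - (1 + \<alpha>) / 2))) * (B * exp (- (\<bar>Re u\<bar> / 2) * (\<alpha> / 2 + b + v - (1 + \<alpha>) / 2)))"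
      unfolding norm_mult using B(1) by (intro mult_mono) auto
    also have "\<dots> = B * B * exp ((1 / 2 - b) * \<bar>Re u\<bar>)"
    proof -
      have E: "- (\<bar>Re u\<bar> / 2) * (\<alpha> / 2 + b - v - (1 + \<alpha>) / 2) + - (\<bar>Re u\<bar> / 2) * (\<alpha> / 2 + b + v - (1 + \<alpha>) / 2) = (1 / 2 - b) * \<bar>Re u\<bar>"
        by (simp add: field_simps)
      have "x * exp p * (x * exp q) = x * x * exp r" if "p + q = r" for x p q r :: real
        unfolding that[symmetric] exp_add by (simp only: mult_ac)
      from this[OF E] show ?thesis .
    qed
    finally show "norm (S2_strip \<alpha> ?p * S2_strip \<alpha> ?q) \<le> B * B * exp ((1 / 2 - b) * \<bar>Re u\<bar>)" .
  qed (use B in simp)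
qed

text \<open>The right side is constant for Re u \<le> 0 and exp (- (2b + 1) Re u) for Re u \<ge> 0;
  in terms of z = exp u this is decay like z^(-1-2b). From |Re u| = 3 on, \<open>cosh u\<close>
  dominates \<open>cos \<theta>\<close>.\<close>

lemma h_bound:
  obtains K where "K > 0" "\<And>u. \<bar>Im u\<bar> \<le> pi \<Longrightarrow> 3 \<le> \<bar>Re u\<bar> \<Longrightarrow> norm (h u) \<le> K * exp (- (b + 1 / 2) * (Re u + \<bar>Re u\<bar>))"
proof -
  obtain B where B: "B > 0" "\<And>u. \<bar>Im u\<bar> \<le> pi \<Longrightarrow>
     norm (S2_strip \<alpha> (of_real (\<alpha> / 2 + b) + \<i> * of_real (\<alpha> / (2 * pi)) * u) * S2_strip \<alpha> (of_real (\<alpha> / 2 + b) - \<i> * of_real (\<alpha> / (2 * pi)) * u))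
       \<le> B * exp ((1 / 2 - b) * \<bar>Re u\<bar>)"
    by (rule S2_strip_pair_bound) (rule that)
  show ?thesis
  proof (rule that[of "4 * (norm C0 + 1) * B"])
    fix u :: complex assume u: "\<bar>Im u\<bar> \<le> pi" "3 \<le> \<bar>Re u\<bar>"
    let ?P = "S2_strip \<alpha> (of_real (\<alpha> / 2 + b) + \<i> * of_real (\<alpha> / (2 * pi)) * u) * S2_strip \<alpha> (of_real (\<alpha> / 2 + b) - \<i> * of_real (\<alpha> / (2 * pi)) * u)"
    \<comment> \<open>This makes exp |Re u| / 4 - 1 at least exp |Re u| / 8, a lower bound for the
      denominator.\<close>
    have e8: "8 \<le> exp \<bar>Re u\<bar>"
    proof -
      have "2 \<le> exp (1::real)" using exp_ge_add_one_self[of 1] by simp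
      then have "2 ^ 3 \<le> exp (1::real) ^ 3" by (intro power_mono) auto
      also have "\<dots> = exp (3::real)" by (simp flip: exp_of_nat_mult)
      also have "\<dots> \<le> exp \<bar>Re u\<bar>" using u by simp
      finally show ?thesis by simp
    qed
    have "exp \<bar>Re u\<bar> / 8 \<le> exp \<bar>Re u\<bar> / 4 - 1" using e8 by simp
    also have "\<dots> \<le> norm (cosh u) - norm (complex_of_real (cos \<theta>))"
      unfolding norm_of_real using sinh_ge_exp[of "\<bar>Re u\<bar>"] norm_cosh_ge[of u] u abs_cos_le_one[of \<theta>] by linarith
    also have "\<dots> \<le> norm (cosh u - of_real (cos \<theta>))" by (rule norm_triangle_ineq2)
    finally have den: "exp \<bar>Re u\<bar> / 8 \<le> norm (cosh u - of_real (cos \<theta>))" .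
    have n: "norm (hnum u) \<le> norm C0 * exp (- (b + 1 / 2) * Re u) * (B * exp ((1 / 2 - b) * \<bar>Re u\<bar>))"
    proof -
      have "norm (hnum u) = norm C0 * exp (- (b + 1 / 2) * Re u) * norm ?P"
        unfolding hnum_def norm_mult[of "C0 * _"] norm_mult[of C0] by (simp add: norm_mult)
      also have "\<dots> \<le> norm C0 * exp (- (b + 1 / 2) * Re u) * (B * exp ((1 / 2 - b) * \<bar>Re u\<bar>))"
        by (intro mult_left_mono B(2) u(1)) auto
      finally show ?thesis .
    qed
    have "norm (h u) = norm (hnum u) / (2 * norm (cosh u - of_real (cos \<theta>)))"
      unfolding h_def norm_divide norm_mult by simp
    also have "\<dots> \<le> (norm C0 * exp (- (b + 1 / 2) * Re u) * (B * exp ((1 / 2 - b) * \<bar>Re u\<bar>))) / (2 * (exp \<bar>Re u\<bar> / 8))"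
      using n den B(1) by (intro frac_le mult_left_mono) auto
    also have "\<dots> = (4 * norm C0 * B) * exp (- (b + 1 / 2) * Re u + (1 / 2 - b) * \<bar>Re u\<bar> - \<bar>Re u\<bar>)"
      unfolding exp_add exp_diff by (simp add: mult_ac)
    also have "- (b + 1 / 2) * Re u + (1 / 2 - b) * \<bar>Re u\<bar> - \<bar>Re u\<bar> = - (b + 1 / 2) * (Re u + \<bar>Re u\<bar>)"
      by (simp add: algebra_simps)
    also have "(4 * norm C0 * B) * exp (- (b + 1 / 2) * (Re u + \<bar>Re u\<bar>)) \<le> 4 * (norm C0 + 1) * B * exp (- (b + 1 / 2) * (Re u + \<bar>Re u\<bar>))"
      using B(1) by (intro mult_right_mono mult_left_mono) auto
    finally show "norm (h u) \<le> 4 * (norm C0 + 1) * B * exp (- (b + 1 / 2) * (Re u + \<bar>Re u\<bar>))" .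
  qed (use B in \<open>auto intro!: mult_pos_pos add_nonneg_pos\<close>)
qed

text \<open>Raising both arguments by 1 produces 4 cos (\<beta> + it/2) cos (\<beta> - it/2) = 2
  (cosh t - cos \<theta>), because 2 \<beta> = pi - \<theta>; this cancels the denominator of
  \<open>h\<close>.\<close>

lemma h_of_real:
  "h (of_real t) = C0 * of_real (exp (- (b + 1 / 2) * t) * (norm (S2_strip \<alpha> (Complex (1 + \<alpha> / 2 + b) (\<alpha> * t / (2 * pi)))))\<^sup>2)"
proof -
  define p where "p = Complex (\<alpha> / 2 + b) (\<alpha> * t / (2 * pi))"
  define \<beta> where "\<beta> = complex_of_real (pi * b / \<alpha>)"
  have p1: "of_real (\<alpha> / 2 + b) + \<i> * of_real (\<alpha> / (2 * pi)) * of_real t = p"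
    "of_real (\<alpha> / 2 + b) - \<i> * of_real (\<alpha> / (2 * pi)) * of_real t = cnj p"
    by (simp_all add: p_def complex_eq_iff)
  have p': "0 < Re p" "Re p < \<alpha>" "0 < Re (cnj p)" "Re (cnj p) < \<alpha>" using b alpha by (auto simp: p_def)
  have a1: "of_real pi * p / of_real \<alpha> = \<beta> + \<i> * of_real t / 2 + of_real pi / 2"
    using alpha by (simp add: p_def \<beta>_def complex_eq_iff field_simps)
  have a2: "of_real pi * cnj p / of_real \<alpha> = \<beta> - \<i> * of_real t / 2 + of_real pi / 2"
    using alpha by (simp add: p_def \<beta>_def complex_eq_iff field_simps)
  have c1: "sin (of_real pi * p / of_real \<alpha>) = cos (\<beta> + \<i> * of_real t / 2)" "sin (of_real pi * cnj p / of_real \<alpha>) = cos (\<beta> - \<i> * of_real t / 2)"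
    unfolding a1 a2 by (simp_all add: sin_add)
  have "cos (\<beta> + \<i> * of_real t / 2) * cos (\<beta> - \<i> * of_real t / 2) = (cos (\<i> * of_real t) + cos (2 * \<beta>)) / 2"
    unfolding cos_times_cos by (simp add: algebra_simps)
  also have "cos (2 * \<beta>) = - of_real (cos \<theta>)"
  proof -
    have "2 * (pi * b / \<alpha>) = pi - \<theta>" unfolding theta(3) by simp
    moreover have "2 * \<beta> = of_real (2 * (pi * b / \<alpha>))" by (simp add: \<beta>_def)
    ultimately have "2 * \<beta> = of_real (pi - \<theta>)" by (simp only:)
    then show ?thesis by (simp only: cos_of_real) (simp add: cos_diff)
  qed
  also have "cos (\<i> * of_real t) = cosh (complex_of_real t)" by (simp add: cosh_conv_cos)
  finally have q: "cos (\<beta> + \<i> * of_real t / 2) * cos (\<beta> - \<i> * of_real t / 2) = (cosh (complex_of_real t) + - of_real (cos \<theta>)) / 2" .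
  have cc: "4 * (cos (\<beta> + \<i> * of_real t / 2) * cos (\<beta> - \<i> * of_real t / 2)) = 2 * (cosh (complex_of_real t) - of_real (cos \<theta>))" unfolding q by simp
  have nz: "2 * (cosh (complex_of_real t) - of_real (cos \<theta>)) \<noteq> 0"
  proof -
    have "cos \<theta> < 1" using theta cos_monotone_0_pi[of 0 \<theta>] by simp
    then have "cosh t - cos \<theta> > 0" using cosh_real_ge_1[of t] by linarith
    then show ?thesis by (simp add: cosh_complex_of_real flip: of_real_diff)
  qed
  have "S2_strip \<alpha> p * S2_strip \<alpha> (cnj p) = (4 * (cos (\<beta> + \<i> * of_real t / 2) * cos (\<beta> - \<i> * of_real t / 2))) * (S2_strip \<alpha> (p + 1) * S2_strip \<alpha> (cnj (p + 1)))"
    using S2_strip_shift_1[OF alpha(1) p'(1,2)] S2_strip_shift_1[OF alpha(1) p'(3,4)] unfolding c1 by (simp add: mult_ac)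
  also have "p + 1 = Complex (1 + \<alpha> / 2 + b) (\<alpha> * t / (2 * pi))" by (simp add: p_def complex_eq_iff)
  finally have pp: "S2_strip \<alpha> p * S2_strip \<alpha> (cnj p) = 2 * (cosh (complex_of_real t) - of_real (cos \<theta>)) * of_real ((norm (S2_strip \<alpha> (Complex (1 + \<alpha> / 2 + b) (\<alpha> * t / (2 * pi)))))\<^sup>2)"
    unfolding cc S2_strip_mult_cnj .
  have ee: "exp (- complex_of_real (b + 1 / 2) * of_real t) = of_real (exp (- (b + 1 / 2) * t))"
    by (simp flip: exp_of_real)
  have "h (of_real t) = C0 * of_real (exp (- (b + 1 / 2) * t)) * (S2_strip \<alpha> p * S2_strip \<alpha> (cnj p)) / (2 * (cosh (complex_of_real t) - of_real (cos \<theta>)))"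
    unfolding h_def hnum_def p1 ee ..
  also have "\<dots> = C0 * of_real (exp (- (b + 1 / 2) * t)) * of_real ((norm (S2_strip \<alpha> (Complex (1 + \<alpha> / 2 + b) (\<alpha> * t / (2 * pi)))))\<^sup>2)"
    unfolding pp using nz by (simp add: field_simps)
  finally show ?thesis by simp
qed

end

section \<open>The jump of \<open>h\<close> across the cut and its poles\<close>

lemma exp_sin_combination:
  fixes B Y :: complex
  shows "exp (- \<i> * B) * sin (B + \<i> * Y) + exp (\<i> * B) * sin (B - \<i> * Y) = exp Y * sin (2 * B)"
proof -
  define q r where "q = exp (\<i> * B)" and "r = exp Y"
  have nz: "q \<noteq> 0" "r \<noteq> 0" by (auto simp: q_def r_def)
  have ii: "\<i> * (\<i> * Y) = - Y" by simp
  have i: "\<i> * (B + \<i> * Y) = \<i> * B - Y" "\<i> * (B - \<i> * Y) = \<i> * B + Y" "\<i> * (2 * B) = \<i> * B + \<i> * B"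
    by (simp_all only: distrib_left right_diff_distrib ii mult_2) simp_all
  have 1: "sin (B + \<i> * Y) = (q / r - r / q) / (2 * \<i>)"
    unfolding sin_exp_eq i minus_diff_eq by (simp only: exp_diff q_def r_def)
  have 2: "sin (B - \<i> * Y) = (q * r - inverse (q * r)) / (2 * \<i>)"
    unfolding sin_exp_eq i by (simp only: exp_minus exp_add q_def r_def)
  have 3: "sin (2 * B) = (q * q - inverse (q * q)) / (2 * \<i>)"
    unfolding sin_exp_eq i by (simp only: exp_minus exp_add q_def)
  have 4: "exp (- \<i> * B) = inverse q" by (simp add: q_def exp_minus)
  show ?thesis unfolding 1 2 3 4 q_def[symmetric] r_def[symmetric]
    using nz by (simp add: field_simps)
qed

lemma cosh_plus_i_pi: "cosh (u + \<i> * of_real pi) = - cosh u" "cosh (u - \<i> * of_real pi) = - cosh u" for u :: complex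
proof -
  have e: "exp (\<i> * of_real pi) = - 1" by simp
  have "exp (u + \<i> * of_real pi) = - exp u" "exp (- (u + \<i> * of_real pi)) = - exp (- u)"
    "exp (u - \<i> * of_real pi) = - exp u" "exp (- (u - \<i> * of_real pi)) = - exp (- u)"
    by (simp_all add: exp_add exp_diff exp_minus inverse_eq_divide)
  then show "cosh (u + \<i> * of_real pi) = - cosh u" "cosh (u - \<i> * of_real pi) = - cosh u"
    by (simp_all only: cosh_field_def) (simp_all add: field_simps)
qed

context stable_params
begin

text \<open>The density whose Laplace transform is \<open>G\<close>; in the variable w = exp u it
  lives on the cut along the negative axis.\<close>

definition g :: "real \<Rightarrow> real" where
  "g s = s powr (\<alpha> * \<rho> / 2 - 1 / 2) * (cmod (S2 \<alpha> (Complex (1 + \<alpha> + \<alpha> * (1 - \<rho>) / 2) (\<alpha> * ln s / (2 * pi)))))\<^sup>2"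

lemma g_nonneg: "g s \<ge> 0"
  by (simp add: g_def)

lemma sin_pi_nonzero:
  assumes "0 < Re p" "Re p < 1"
  shows "sin (of_real pi * p) \<noteq> 0"
  using S2_strip_shift_alpha[OF alpha(1) assms] by auto

lemma cosh_cos_pos: "cosh t + cos \<theta> > 0"
proof -
  have "cos \<theta> > -1" using theta cos_monotone_0_pi[of \<theta> pi] by simp
  then show ?thesis using cosh_real_ge_1[of t] by linarith
qed

text \<open>The point lies to the right of the strip and is first brought back by period \<alpha>.
  Going through \<open>p\<close> by both functional equations then replaces p + 1 by p + \<alpha>;
  the sines of pi p cancel up to sign, and 4 |sin (pi p / \<alpha>)|^2 = 2 (cosh t + cos \<theta>)
  remains.\<close>

lemma norm_S2_G:
  "(cmod (S2 \<alpha> (Complex (1 + \<alpha> + b) (\<alpha> * t / (2 * pi)))))\<^sup>2 = (cmod (S2_strip \<alpha> (Complex (\<alpha> + b) (\<alpha> * t / (2 * pi)))))\<^sup>2 / (2 * (cosh t + cos \<theta>))"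
proof -
  define p where "p = Complex b (\<alpha> * t / (2 * pi))"
  have p: "0 < Re p" "Re p < 1" "Re p < \<alpha>" using b by (auto simp: p_def)
  have nz: "sin (of_real pi * p) \<noteq> 0" by (rule sin_pi_nonzero[OF p(1,2)])
  have s1: "sin (of_real pi * (p + 1)) = - sin (of_real pi * p)"
    by (simp add: distrib_left sin_add)
  have e1: "S2_strip \<alpha> p = 2 * sin (of_real pi * p) * S2_strip \<alpha> (p + of_real \<alpha>)"
    by (rule S2_strip_shift_alpha[OF alpha(1) p(1,2)])
  have e2: "S2_strip \<alpha> p = 2 * sin (of_real pi * p / of_real \<alpha>) * S2_strip \<alpha> (p + 1)"
    by (rule S2_strip_shift_1[OF alpha(1) p(1,3)])
  have nz2: "sin (of_real pi * p / of_real \<alpha>) \<noteq> 0" using e2 by auto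
  have e: "p + 1 + of_real \<alpha> - of_real \<alpha> = p + 1" by simp
  have "S2 \<alpha> (p + 1 + of_real \<alpha>) = S2_strip \<alpha> (p + 1) / (2 * sin (of_real pi * (p + 1)))"
    using S2_eq_right[OF alpha(1), of "p + 1 + of_real \<alpha>", unfolded e] p nz s1 by simp
  also have "S2_strip \<alpha> (p + 1) = sin (of_real pi * p) * S2_strip \<alpha> (p + of_real \<alpha>) / sin (of_real pi * p / of_real \<alpha>)"
    using e1 e2 nz2 by (simp add: field_simps)
  finally have "S2 \<alpha> (p + 1 + of_real \<alpha>) = - (S2_strip \<alpha> (p + of_real \<alpha>) / (2 * sin (of_real pi * p / of_real \<alpha>)))"
    unfolding s1 using nz by simp
  then have "(cmod (S2 \<alpha> (p + 1 + of_real \<alpha>)))\<^sup>2 = (cmod (S2_strip \<alpha> (p + of_real \<alpha>)))\<^sup>2 / (4 * (cmod (sin (of_real pi * p / of_real \<alpha>)))\<^sup>2)"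
    by (simp add: norm_divide norm_mult power_divide power_mult_distrib)
  also have "4 * (cmod (sin (of_real pi * p / of_real \<alpha>)))\<^sup>2 = 2 * (cosh t + cos \<theta>)"
  proof -
    have "2 * Re (of_real pi * p / of_real \<alpha>) = 2 * (pi * b / \<alpha>)" by (simp add: p_def)
    also have "\<dots> = pi - \<theta>" unfolding theta(3) by simp
    finally have re: "2 * Re (of_real pi * p / of_real \<alpha>) = pi - \<theta>" .
    have im: "2 * Im (of_real pi * p / of_real \<alpha>) = t" using alpha by (simp add: p_def)
    show ?thesis
      unfolding norm_sin_squared re im by (simp add: cos_diff cosh_field_def exp_minus)
  qed
  also have "p + of_real \<alpha> = Complex (\<alpha> + b) (\<alpha> * t / (2 * pi))" by (simp add: p_def complex_eq_iff)
  also have "p + 1 + of_real \<alpha> = Complex (1 + \<alpha> + b) (\<alpha> * t / (2 * pi))" by (simp add: p_def complex_eq_iff)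
  finally show ?thesis .
qed

lemma g_exp: "g (exp t) = exp ((\<alpha> * \<rho> / 2 - 1 / 2) * t) * (cmod (S2_strip \<alpha> (Complex (\<alpha> + b) (\<alpha> * t / (2 * pi)))))\<^sup>2 / (2 * (cosh t + cos \<theta>))"
  using norm_S2_G[of t] by (simp add: g_def powr_def b_def mult_ac)

text \<open>On each edge one argument has real part \<open>b\<close> and the other \<alpha> + b.
  Shifting the former by \<alpha> gives the same squared modulus \<open>A\<close> on both edges, and
  \<open>exp_sin_combination\<close> merges the remaining phases and sines into one real
  exponential.\<close>

lemma h_jump: "h (Complex t pi) - h (Complex t (- pi)) = 2 * \<i> * C0 * of_real (sin (2 * pi * b)) * of_real (g (exp t))"
proof -
  define \<tau> where "\<tau> = \<alpha> * t / (2 * pi)"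
  define p where "p = Complex b \<tau>"
  define A where "A = complex_of_real ((cmod (S2_strip \<alpha> (Complex (\<alpha> + b) \<tau>)))\<^sup>2)"
  define X where "X = exp (complex_of_real (- (b + 1 / 2) * t))"
  define D where "D = complex_of_real (cosh t + cos \<theta>)"
  have D: "D \<noteq> 0" using cosh_cos_pos[of t] by (simp add: D_def del: of_real_add)
  have p: "0 < Re p" "Re p < 1" "0 < Re (cnj p)" "Re (cnj p) < 1" using b by (auto simp: p_def)
  have pa: "Complex (\<alpha> + b) \<tau> = p + of_real \<alpha>" by (simp add: p_def complex_eq_iff)
  have A: "S2_strip \<alpha> (p + of_real \<alpha>) * S2_strip \<alpha> (cnj p + of_real \<alpha>) = A"
    using S2_strip_mult_cnj[of \<alpha> "p + of_real \<alpha>"] by (simp add: A_def pa)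
  have c1: "Complex t pi = of_real t + \<i> * of_real pi" and c2: "Complex t (- pi) = of_real t - \<i> * of_real pi"
    by (simp_all add: complex_eq_iff)
  have u1: "of_real (\<alpha> / 2 + b) + \<i> * of_real (\<alpha> / (2 * pi)) * Complex t pi = p"
    "of_real (\<alpha> / 2 + b) - \<i> * of_real (\<alpha> / (2 * pi)) * Complex t pi = cnj p + of_real \<alpha>"
    "of_real (\<alpha> / 2 + b) + \<i> * of_real (\<alpha> / (2 * pi)) * Complex t (- pi) = p + of_real \<alpha>"
    "of_real (\<alpha> / 2 + b) - \<i> * of_real (\<alpha> / (2 * pi)) * Complex t (- pi) = cnj p"
    by (simp_all add: p_def \<tau>_def complex_eq_iff)
  have ihalf': "exp (\<i> * of_real (pi / 2)) = \<i>"
    using exp_Euler[of "complex_of_real (pi / 2)"] cos_of_real[of "pi / 2"] sin_of_real[of "pi / 2"] by simp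
  have "exp (- \<i> * of_real (pi / 2)) = - \<i>"
    by (simp only: mult_minus_left exp_minus ihalf') simp
  note ihalf = this ihalf'
  have x1: "exp (- of_real (b + 1 / 2) * Complex t pi) = X * exp (- \<i> * of_real (pi * b)) * (- \<i>)"
  proof -
    have "- of_real (b + 1 / 2) * Complex t pi = of_real (- (b + 1 / 2) * t) + - \<i> * of_real (pi * b) + - \<i> * of_real (pi / 2)"
      by (simp add: complex_eq_iff field_simps)
    then show ?thesis by (simp only: exp_add X_def ihalf)
  qed
  have x2: "exp (- of_real (b + 1 / 2) * Complex t (- pi)) = X * exp (\<i> * of_real (pi * b)) * \<i>"
  proof -
    have "- of_real (b + 1 / 2) * Complex t (- pi) = of_real (- (b + 1 / 2) * t) + \<i> * of_real (pi * b) + \<i> * of_real (pi / 2)"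
      by (simp add: complex_eq_iff field_simps)
    then show ?thesis by (simp only: exp_add X_def ihalf)
  qed
  have d: "cosh (Complex t pi) - of_real (cos \<theta>) = - D" "cosh (Complex t (- pi)) - of_real (cos \<theta>) = - D"
    unfolding c1 c2 cosh_plus_i_pi by (simp_all add: D_def cosh_complex_of_real)
  have e1: "S2_strip \<alpha> p = 2 * sin (of_real pi * p) * S2_strip \<alpha> (p + of_real \<alpha>)"
    by (rule S2_strip_shift_alpha[OF alpha(1) p(1,2)])
  have e2: "S2_strip \<alpha> (cnj p) = 2 * sin (of_real pi * cnj p) * S2_strip \<alpha> (cnj p + of_real \<alpha>)"
    by (rule S2_strip_shift_alpha[OF alpha(1) p(3,4)])
  have h1: "h (Complex t pi) = C0 * (X * exp (- \<i> * of_real (pi * b)) * (- \<i>)) * (2 * sin (of_real pi * p) * A) / (2 * - D)"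
    unfolding h_def hnum_def u1 x1 d e1 A[symmetric] by (simp add: mult_ac)
  have h2: "h (Complex t (- pi)) = C0 * (X * exp (\<i> * of_real (pi * b)) * \<i>) * (2 * sin (of_real pi * cnj p) * A) / (2 * - D)"
    unfolding h_def hnum_def u1 x2 d e2 A[symmetric] by (simp add: mult_ac)
  have "h (Complex t pi) - h (Complex t (- pi)) = \<i> * C0 * X * A / D * (exp (- \<i> * of_real (pi * b)) * sin (of_real pi * p) + exp (\<i> * of_real (pi * b)) * sin (of_real pi * cnj p))"
    unfolding h1 h2 using D by (simp add: field_simps)
  also have "of_real pi * p = of_real (pi * b) + \<i> * of_real (\<alpha> * t / 2)" by (simp add: p_def \<tau>_def complex_eq_iff)
  also have "of_real pi * cnj p = of_real (pi * b) - \<i> * of_real (\<alpha> * t / 2)" by (simp add: p_def \<tau>_def complex_eq_iff)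
  also note exp_sin_combination
  also have "sin (2 * complex_of_real (pi * b)) = of_real (sin (2 * pi * b))"
    by (simp flip: sin_of_real add: mult.assoc)
  also have "\<i> * C0 * X * A / D * (exp (of_real (\<alpha> * t / 2)) * of_real (sin (2 * pi * b))) = 2 * \<i> * C0 * of_real (sin (2 * pi * b)) * (X * exp (of_real (\<alpha> * t / 2)) * A / (2 * D))"
    by simp
  also have "X * exp (of_real (\<alpha> * t / 2)) * A / (2 * D) = of_real (g (exp t))"
  proof -
    have "- (b + 1 / 2) * t + \<alpha> * t / 2 = (\<alpha> * \<rho> / 2 - 1 / 2) * t" by (simp add: b_def field_simps)
    then have "X * exp (of_real (\<alpha> * t / 2)) = of_real (exp ((\<alpha> * \<rho> / 2 - 1 / 2) * t))"
      unfolding X_def exp_add[symmetric] of_real_add[symmetric] by (simp only: exp_of_real)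
    then show ?thesis unfolding g_exp by (simp add: A_def D_def \<tau>_def)
  qed
  finally show ?thesis .
qed

lemma C0_nonzero: "C0 \<noteq> 0"
  using alpha by (simp add: C0_def)

text \<open>This identifies the coefficient of \<open>G\<close> in \<open>F\<close> with minus the
  jump constant 2 i C0 sin (2 pi b) divided by the 2 pi i of Cauchy's formula.\<close>

lemma C0_S2: "of_real (sqrt \<alpha> / (4 * pi)) * S2 \<alpha> (of_real (- \<alpha> * (1 - \<rho>))) = - (C0 * of_real (sin (2 * pi * b)) / of_real pi)"
proof -
  have "S2 \<alpha> (of_real (- \<alpha> * (1 - \<rho>))) = 2 * sin (of_real pi * of_real (- \<alpha> * (1 - \<rho>))) * S2_strip \<alpha> (of_real (- \<alpha> * (1 - \<rho>)) + of_real \<alpha>)"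
    using b alpha rho by (intro S2_eq_left) (auto simp: b_def)
  also have "of_real (- \<alpha> * (1 - \<rho>)) + of_real \<alpha> = complex_of_real (\<alpha> * \<rho>)"
    by (simp flip: of_real_add add: algebra_simps)
  also have "sin (of_real pi * of_real (- \<alpha> * (1 - \<rho>))) = - complex_of_real (sin (2 * pi * b))"
  proof -
    have "pi * (- \<alpha> * (1 - \<rho>)) = - (2 * pi * b)" by (simp add: b_def)
    then have "of_real pi * of_real (- \<alpha> * (1 - \<rho>)) = complex_of_real (- (2 * pi * b))"
      by (simp only: of_real_mult[symmetric])
    then show ?thesis by (simp only: sin_of_real sin_minus of_real_minus)
  qed
  finally show ?thesis using alpha by (simp add: C0_def field_simps)
qed

lemma sin_2pib: "sin (2 * pi * b) > 0"
  using b by (intro sin_gt_zero) auto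

lemma S2_strip_2b: "S2_strip \<alpha> (of_real (2 * b)) * S2_strip \<alpha> (of_real (\<alpha> * \<rho>)) = of_real (2 * sin \<theta>)"
proof -
  have "S2_strip \<alpha> (of_real (2 * b)) = 2 * sin (of_real pi * of_real (2 * b) / of_real \<alpha>) * S2_strip \<alpha> (of_real (2 * b) + 1)"
    using b by (intro S2_strip_shift_1 alpha) auto
  moreover have "sin (of_real pi * of_real (2 * b) / of_real \<alpha>) = complex_of_real (sin \<theta>)"
  proof -
    have "pi * (2 * b) / \<alpha> = 2 * (pi * b / \<alpha>)" by simp
    also have "\<dots> = pi - \<theta>" unfolding theta(3) by simp
    finally have "of_real pi * of_real (2 * b) / of_real \<alpha> = complex_of_real (pi - \<theta>)"
      by (simp flip: of_real_mult of_real_divide)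
    then show ?thesis by (simp only: sin_of_real) simp
  qed
  moreover have "S2_strip \<alpha> (of_real (2 * b) + 1) * S2_strip \<alpha> (of_real (\<alpha> * \<rho>)) = 1"
    using S2_strip_reflection[of \<alpha> "of_real (2 * b) + 1"] b(4) by (simp flip: of_real_diff of_real_mult)
  ultimately show ?thesis by (simp add: mult.assoc)
qed

text \<open>At \<plusminus> i \<theta> the two arguments of \<open>S2_strip\<close> become 2b and
  \<alpha>, where \<open>S2_strip_2b\<close> and \<open>S2_strip_at_1\<close> evaluate the product
  explicitly. The factor sin \<theta> will cancel against the derivative of \<open>cosh\<close> in
  the residue.\<close>

lemma hnum_at_poles:
  "hnum (\<i> * of_real \<theta>) = of_real (sin \<theta>) * exp (- \<i> * of_real ((b + 1 / 2) * \<theta>))"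
  "hnum (- (\<i> * of_real \<theta>)) = of_real (sin \<theta>) * exp (\<i> * of_real ((b + 1 / 2) * \<theta>))"
proof -
  have v: "\<alpha> / (2 * pi) * \<theta> = \<alpha> * \<rho> / 2" by (simp add: \<theta>_def)
  have b2: "\<alpha> / 2 + b - \<alpha> * \<rho> / 2 = 2 * b" "\<alpha> / 2 + b + \<alpha> * \<rho> / 2 = \<alpha>" by (simp_all add: b_def field_simps)
  have i: "\<i> * of_real (\<alpha> / (2 * pi)) * (\<i> * of_real \<theta>) = - complex_of_real (\<alpha> * \<rho> / 2)"
    using v by (simp add: complex_eq_iff)
  have "C0 * (S2_strip \<alpha> (of_real (2 * b)) * S2_strip \<alpha> (of_real \<alpha>)) = of_real (sqrt \<alpha> / 2 * (1 / sqrt \<alpha>)) * (S2_strip \<alpha> (of_real (2 * b)) * S2_strip \<alpha> (of_real (\<alpha> * \<rho>)))"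
    unfolding C0_def S2_strip_at_1(2)[OF alpha(1)] of_real_mult by (simp add: mult_ac)
  also have "\<dots> = of_real (sin \<theta>)"
    unfolding S2_strip_2b of_real_mult[symmetric] using alpha by simp
  finally have c: "C0 * (S2_strip \<alpha> (of_real (2 * b)) * S2_strip \<alpha> (of_real \<alpha>)) = of_real (sin \<theta>)" .
  have 1: "of_real (\<alpha> / 2 + b) + \<i> * of_real (\<alpha> / (2 * pi)) * (\<i> * of_real \<theta>) = complex_of_real (2 * b)"
    "of_real (\<alpha> / 2 + b) - \<i> * of_real (\<alpha> / (2 * pi)) * (\<i> * of_real \<theta>) = complex_of_real \<alpha>"
    unfolding i using b2 by (simp_all only: diff_minus_eq_add add_uminus_conv_diff flip: of_real_add of_real_diff)
  have 2: "of_real (\<alpha> / 2 + b) + \<i> * of_real (\<alpha> / (2 * pi)) * - (\<i> * of_real \<theta>) = complex_of_real \<alpha>"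
    "of_real (\<alpha> / 2 + b) - \<i> * of_real (\<alpha> / (2 * pi)) * - (\<i> * of_real \<theta>) = complex_of_real (2 * b)"
    using 1 by simp_all
  have x: "- of_real (b + 1 / 2) * (\<i> * of_real \<theta>) = - \<i> * of_real ((b + 1 / 2) * \<theta>)"
    "- of_real (b + 1 / 2) * - (\<i> * of_real \<theta>) = \<i> * of_real ((b + 1 / 2) * \<theta>)"
    by (simp_all add: algebra_simps)
  show "hnum (\<i> * of_real \<theta>) = of_real (sin \<theta>) * exp (- \<i> * of_real ((b + 1 / 2) * \<theta>))"
    unfolding hnum_def 1 x c[symmetric] by (simp only: mult_ac)
  show "hnum (- (\<i> * of_real \<theta>)) = of_real (sin \<theta>) * exp (\<i> * of_real ((b + 1 / 2) * \<theta>))"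
    unfolding hnum_def 2 x c[symmetric] by (simp only: mult_ac)
qed

end

section \<open>Cauchy's formula on the slit plane\<close>

lemma exp_eq_of_real_imp:
  assumes "exp u = complex_of_real z" "z > 0" "\<bar>Im u\<bar> < 2 * pi"
  shows "u = of_real (ln z)"
proof -
  have "exp u = exp (complex_of_real (ln z))" using assms by (simp add: exp_of_real)
  then obtain n :: int where n: "u = of_real (ln z) + (of_int (2 * n) * of_real pi) * \<i>"
    by (auto simp: exp_eq)
  then have im: "Im u = 2 * of_int n * pi" by simp
  have "n = 0"
  proof (rule ccontr)
    assume "n \<noteq> 0"
    then have "1 \<le> \<bar>real_of_int n\<bar>" by linarith
    then have "2 * pi * 1 \<le> 2 * pi * \<bar>real_of_int n\<bar>" by (intro mult_left_mono) auto
    also have "\<dots> = \<bar>Im u\<bar>" by (simp add: im abs_mult)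
    finally show False using assms(3) by simp
  qed
  then show ?thesis using n by simp
qed

lemma exp_Complex_pi: "exp (Complex t pi) = - of_real (exp t)" "exp (Complex t (- pi)) = - of_real (exp t)"
proof -
  have "Complex t pi = of_real t + \<i> * of_real pi" "Complex t (- pi) = of_real t - \<i> * of_real pi"
    by (simp_all add: complex_eq_iff)
  then show "exp (Complex t pi) = - of_real (exp t)" "exp (Complex t (- pi)) = - of_real (exp t)"
    by (simp_all only: exp_add exp_diff) (simp_all add: exp_of_real)
qed

lemma open_horizontal_strip: "open {u. a < Im u \<and> Im u < b}" and convex_horizontal_strip: "convex {u. a < Im u \<and> Im u < b}"
proof -
  have "{z. a < Im z \<and> Im z < b} = {z. Im z > a} \<inter> {z. Im z < b}" by auto
  then show "open {z. a < Im z \<and> Im z < b}" "convex {z. a < Im z \<and> Im z < b}"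
    by (auto intro!: open_Int convex_Int open_halfspace_Im_gt open_halfspace_Im_lt
        convex_halfspace_Im_gt convex_halfspace_Im_lt)
qed

context stable_params
begin

text \<open>The phase of the sine in \<open>F\<close>: the factor exp u contributes \<theta> at the
  pole i \<theta>, and \<open>hnum\<close> takes away (b + 1/2) \<theta>.\<close>

definition \<phi> :: real where "\<phi> = \<theta> * (1 / 2 - b)"

lemma h_of_real_nonzero: "h (of_real t) \<noteq> 0"
  unfolding h_of_real using C0_nonzero by simp

text \<open>The slit plane becomes the strip |Im u| < pi under w = exp u. The residue at ln z is the
  value sought, those at \<plusminus> i \<theta> give the simple fractions, and the two edges are
  the two sides of the cut.\<close>

lemma stieltjes_representation:
  assumes z: "z > 0"
  shows "integrable lborel (\<lambda>t. g (exp t) * (exp t / (exp t + z)))"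
    and "h (of_real (ln z)) = (exp (\<i> * \<phi>) / (z - exp (\<i> * \<theta>)) - exp (- \<i> * \<phi>) / (z - exp (- \<i> * \<theta>))) / (2 * \<i>)
       - C0 * of_real (sin (2 * pi * b)) / of_real pi * of_real (LBINT t. g (exp t) * (exp t / (exp t + z)))"
proof -
  let ?S = "{u. - (pi + \<epsilon>) < Im u \<and> Im u < pi + \<epsilon>}"
  \<comment> \<open>The pullback of h (ln w) / (w - z) dw under w = exp u.\<close>
  let ?f = "\<lambda>u. h u * exp u / (exp u - of_real z)"
  let ?P = "{of_real (ln z), \<i> * of_real \<theta>, - (\<i> * of_real \<theta>)} :: complex set"
  have eps_pi: "\<epsilon> < pi" using eps(3) theta(1) by linarith
  have expz: "u = of_real (ln z)" if "u \<in> ?S" "exp u = of_real z" for u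
    using that eps_pi z by (intro exp_eq_of_real_imp) auto
  have coshz: "u = \<i> * of_real \<theta> \<or> u = - (\<i> * of_real \<theta>)" if "u \<in> ?S" "cosh u = of_real (cos \<theta>)" for u
    using cosh_eq_cos_theta that by auto
  have holh: "h holomorphic_on A" if "A \<subseteq> ?S" "\<i> * of_real \<theta> \<notin> A" "- (\<i> * of_real \<theta>) \<notin> A" for A
    unfolding h_def
  proof (intro holomorphic_on_divide holomorphic_intros)
    show "hnum holomorphic_on A" by (rule holomorphic_on_subset[OF hnum_holomorphic that(1)])
    fix u assume u: "u \<in> A"
    then have "cosh u \<noteq> of_real (cos \<theta>)" using coshz[of u] that by auto
    then show "2 * (cosh u - of_real (cos \<theta>)) \<noteq> 0" by simp
  qed
  have hol: "?f holomorphic_on ?S - ?P"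
  proof (intro holomorphic_on_divide holomorphic_on_mult holomorphic_intros)
    show "h holomorphic_on ?S - ?P" by (rule holh) auto
    show "exp u - of_real z \<noteq> 0" if "u \<in> ?S - ?P" for u using that expz[of u] by auto
  qed
  obtain K where K: "K > 0" "\<And>u. \<bar>Im u\<bar> \<le> pi \<Longrightarrow> 3 \<le> \<bar>Re u\<bar> \<Longrightarrow> norm (h u) \<le> K * exp (- (b + 1 / 2) * (Re u + \<bar>Re u\<bar>))"
    by (rule h_bound) (rule that)
  \<comment> \<open>Beyond \<open>X\<close> the numbers exp (Re u) and \<open>z\<close> differ by a
    factor of at least exp 3 > 2, so |exp u - z| is at least half of the larger one.\<close>
  define X where "X = 3 + \<bar>ln z\<bar>"
  have two: "2 \<le> exp (3::real)" using exp_ge_add_one_self[of 3] by simp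
  have bd: "norm (?f u) \<le> 2 * K * (1 + 1 / z) * exp (- 1 * \<bar>Re u\<bar>)"
    if u: "- pi \<le> Im u" "Im u \<le> pi" "X \<le> \<bar>Re u\<bar>" for u
  proof -
    have u3: "3 \<le> \<bar>Re u\<bar>" "\<bar>Im u\<bar> \<le> pi" using u by (auto simp: X_def)
    note Ku = K(2)[OF u3(2,1)]
    have Kz: "2 * K \<le> 2 * K * (1 + 1 / z)" "2 * K / z \<le> 2 * K * (1 + 1 / z)"
      using K(1) z by (auto simp: field_simps)
    consider "Re u \<ge> 0" | "Re u < 0" by linarith
    then show ?thesis
    proof cases
      case 1
      then have r: "Re u = \<bar>Re u\<bar>" by simp
      have "ln z + 3 \<le> Re u" using u(3) 1 by (simp add: X_def)
      then have "exp (ln z + 3) \<le> exp (Re u)" by (simp only: exp_le_cancel_iff)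
      then have "z * exp 3 \<le> exp (Re u)" using z by (simp add: exp_add)
      moreover have "z * 2 \<le> z * exp 3" using two z by (intro mult_left_mono) auto
      ultimately have "exp (Re u) / 2 \<le> exp (Re u) - z" by linarith
      also have "\<dots> \<le> norm (exp u - of_real z)"
        using norm_triangle_ineq2[of "exp u" "of_real z"] z by simp
      finally have d: "exp (Re u) / 2 \<le> norm (exp u - of_real z)" .
      have hu: "norm (h u) \<le> K * exp (- \<bar>Re u\<bar>)"
      proof -
        have "- (b + 1 / 2) * (Re u + \<bar>Re u\<bar>) \<le> - \<bar>Re u\<bar>"
          using 1 b by (simp add: algebra_simps)
        then have "K * exp (- (b + 1 / 2) * (Re u + \<bar>Re u\<bar>)) \<le> K * exp (- \<bar>Re u\<bar>)"
          using K(1) by (intro mult_left_mono) auto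
        then show ?thesis using Ku by linarith
      qed
      have "norm (?f u) = norm (h u) * exp (Re u) / norm (exp u - of_real z)" by (simp add: norm_divide norm_mult)
      also have "\<dots> \<le> (K * exp (- \<bar>Re u\<bar>)) * exp (Re u) / (exp (Re u) / 2)"
        using hu d K(1) by (intro frac_le mult_right_mono) auto
      also have "\<dots> = 2 * K * exp (- 1 * \<bar>Re u\<bar>)" by simp
      also have "\<dots> \<le> 2 * K * (1 + 1 / z) * exp (- 1 * \<bar>Re u\<bar>)" by (rule mult_right_mono[OF Kz(1)]) simp
      finally show ?thesis .
    next
      case 2
      have "Re u \<le> ln z - 3" using u(3) 2 by (simp add: X_def)
      then have "exp (Re u) \<le> exp (ln z - 3)" by (simp only: exp_le_cancel_iff)
      then have "exp (Re u) \<le> z / exp 3" using z by (simp add: exp_diff)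
      moreover have "z / exp 3 \<le> z / 2" using two z by (intro divide_left_mono) auto
      ultimately have "z / 2 \<le> z - exp (Re u)" by linarith
      also have "\<dots> \<le> norm (exp u - of_real z)"
        using norm_triangle_ineq2[of "of_real z" "exp u"] z by (simp add: norm_minus_commute)
      finally have d: "z / 2 \<le> norm (exp u - of_real z)" .
      have hu: "norm (h u) \<le> K" using Ku 2 by simp
      have "norm (?f u) = norm (h u) * exp (Re u) / norm (exp u - of_real z)" by (simp add: norm_divide norm_mult)
      also have "\<dots> \<le> K * exp (Re u) / (z / 2)"
        using hu d K(1) z by (intro frac_le mult_right_mono) auto
      also have "\<dots> = 2 * K / z * exp (- 1 * \<bar>Re u\<bar>)" using 2 by simp
      also have "\<dots> \<le> 2 * K * (1 + 1 / z) * exp (- 1 * \<bar>Re u\<bar>)" by (rule mult_right_mono[OF Kz(2)]) simp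
      finally show ?thesis .
    qed
  qed
  have prem: "- (pi + \<epsilon>) < - pi" "- pi < pi" "pi < pi + \<epsilon>" "finite ?P"
    "\<And>p. p \<in> ?P \<Longrightarrow> - pi < Im p \<and> Im p < pi" "(0::real) < 1"
    using eps theta by auto
  note SR = strip_residue[of "- (pi + \<epsilon>)" "- pi" pi "pi + \<epsilon>" ?P ?f 1 X "2 * K * (1 + 1 / z)", OF prem(1-5) hol prem(6) bd]
  define r where "r = (\<lambda>t. complex_of_real (exp t / (exp t + z)))"
  have fpi: "?f (Complex t pi) = h (Complex t pi) * r t" "?f (Complex t (- pi)) = h (Complex t (- pi)) * r t" for t
  proof -
    have "- x / (- x - y) = x / (x + y)" for x y :: complex
      by (metis add_uminus_conv_diff minus_add_distrib minus_divide_divide)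
    then have "- complex_of_real (exp t) / (- of_real (exp t) - of_real z) = r t"
      unfolding r_def by (simp only: of_real_divide of_real_add)
    then show "?f (Complex t pi) = h (Complex t pi) * r t" "?f (Complex t (- pi)) = h (Complex t (- pi)) * r t"
      unfolding exp_Complex_pi times_divide_eq_right[symmetric] by simp_all
  qed
  define c where "c = 2 * \<i> * C0 * of_real (sin (2 * pi * b))"
  \<comment> \<open>Because the jump constant is nonzero, integrability of the two edges passes to
    the density.\<close>
  have c: "c \<noteq> 0" using C0_nonzero sin_2pib by (simp add: c_def)
  have diff: "?f (Complex t pi) - ?f (Complex t (- pi)) = c * of_real (g (exp t) * (exp t / (exp t + z)))" for t
    unfolding fpi left_diff_distrib[symmetric] h_jump c_def r_def by simp
  have "integrable lborel (\<lambda>t. ?f (Complex t pi) - ?f (Complex t (- pi)))"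
    by (intro Bochner_Integration.integrable_diff SR(1) SR(2))
  then have "integrable lborel (\<lambda>t. c * of_real (g (exp t) * (exp t / (exp t + z))))" unfolding diff .
  then have "integrable lborel (\<lambda>t. inverse c * (c * of_real (g (exp t) * (exp t / (exp t + z)))))"
    by (rule integrable_mult_right)
  moreover have "inverse c * (c * x) = x" for x using c by (simp add: mult.assoc[symmetric])
  ultimately have "integrable lborel (\<lambda>t. complex_of_real (g (exp t) * (exp t / (exp t + z))))" by (simp only:)
  then show int: "integrable lborel (\<lambda>t. g (exp t) * (exp t / (exp t + z)))"
    by (simp only: complex_of_real_integrable_eq)
  have I: "(LBINT t. ?f (Complex t pi)) - (LBINT t. ?f (Complex t (- pi))) = c * of_real (LBINT t. g (exp t) * (exp t / (exp t + z)))"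
  proof -
    have "(LBINT t. ?f (Complex t pi)) - (LBINT t. ?f (Complex t (- pi))) = (LBINT t. ?f (Complex t pi) - ?f (Complex t (- pi)))"
      by (rule Bochner_Integration.integral_diff[symmetric, OF SR(2) SR(1)])
    also have "\<dots> = c * of_real (LBINT t. g (exp t) * (exp t / (exp t + z)))"
      unfolding diff integral_mult_right_zero integral_complex_of_real ..
    finally show ?thesis .
  qed
  \<comment> \<open>The residue formula for a simple pole assumes a nonzero numerator, whence the
    appeal to \<open>h_of_real_nonzero\<close>.\<close>
  have r0: "residue ?f (of_real (ln z)) = h (of_real (ln z))"
  proof -
    have "residue (\<lambda>w. (h w * exp w) / (exp w - of_real z)) (of_real (ln z)) = (h (of_real (ln z)) * exp (of_real (ln z))) / of_real z"
    proof (rule residue_simple_pole_deriv[where s = "{u. - \<theta> < Im u \<and> Im u < \<theta>}"])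
      show "(\<lambda>w. h w * exp w) holomorphic_on {u. - \<theta> < Im u \<and> Im u < \<theta>}"
        using theta eps by (intro holomorphic_intros holh) auto
      show "((\<lambda>w. exp w - complex_of_real z) has_field_derivative complex_of_real z) (at (of_real (ln z)))"
        using z by (auto intro!: derivative_eq_intros simp: exp_of_real)
    qed (use theta z h_of_real_nonzero[of "ln z"] in \<open>auto intro!: holomorphic_intros open_horizontal_strip convex_connected convex_horizontal_strip simp: exp_of_real\<close>)
    then show ?thesis using z by (simp add: exp_of_real)
  qed
  \<comment> \<open>At \<plusminus> i \<theta> the roles change: cosh w - cos \<theta> is now the
    vanishing denominator, and exp w - z joins the numerator, which is holomorphic off the real
    axis.\<close>
  have swap: "?f = (\<lambda>w. (hnum w * exp w / (exp w - of_real z)) / (2 * (cosh w - of_real (cos \<theta>))))"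
    by (rule ext) (simp add: h_def)
  have sh: "sinh (\<i> * of_real \<theta>) = \<i> * of_real (sin \<theta>)" "sinh (- (\<i> * of_real \<theta>)) = - \<i> * of_real (sin \<theta>)"
    and ch: "cosh (\<i> * of_real \<theta>) = of_real (cos \<theta>)" "cosh (- (\<i> * of_real \<theta>)) = of_real (cos \<theta>)"
  proof -
    have "\<i> * (\<i> * complex_of_real \<theta>) = - of_real \<theta>" by simp
    then have "sinh (\<i> * of_real \<theta>) = - \<i> * sin (- complex_of_real \<theta>)" "cosh (\<i> * of_real \<theta>) = cos (- complex_of_real \<theta>)"
      by (simp_all only: sinh_conv_sin cosh_conv_cos)
    then show a: "sinh (\<i> * of_real \<theta>) = \<i> * of_real (sin \<theta>)" "cosh (\<i> * of_real \<theta>) = of_real (cos \<theta>)"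
      by (simp_all add: sin_of_real cos_of_real)
    then show "sinh (- (\<i> * of_real \<theta>)) = - \<i> * of_real (sin \<theta>)" "cosh (- (\<i> * of_real \<theta>)) = of_real (cos \<theta>)"
      by (simp_all add: a)
  qed
  have r1: "residue ?f (\<i> * of_real \<theta>) = hnum (\<i> * of_real \<theta>) * exp (\<i> * of_real \<theta>) / (exp (\<i> * of_real \<theta>) - of_real z) / (2 * (\<i> * of_real (sin \<theta>)))"
    unfolding swap
  proof (rule residue_simple_pole_deriv[where s = "{u. 0 < Im u \<and> Im u < pi + \<epsilon>}"])
    show "(\<lambda>w. hnum w * exp w / (exp w - of_real z)) holomorphic_on {u. 0 < Im u \<and> Im u < pi + \<epsilon>}"
    proof (intro holomorphic_intros)
      show "hnum holomorphic_on {u. 0 < Im u \<and> Im u < pi + \<epsilon>}"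
        by (rule holomorphic_on_subset[OF hnum_holomorphic]) auto
      show "exp u - of_real z \<noteq> 0" if "u \<in> {u. 0 < Im u \<and> Im u < pi + \<epsilon>}" for u
        using that expz[of u] by auto
    qed
    show "((\<lambda>w. 2 * (cosh w - of_real (cos \<theta>))) has_field_derivative 2 * (\<i> * of_real (sin \<theta>))) (at (\<i> * of_real \<theta>))"
      by (auto intro!: derivative_eq_intros simp: sh)
    have "exp (\<i> * of_real \<theta>) \<noteq> of_real z" using expz[of "\<i> * of_real \<theta>"] theta eps by (auto simp: complex_eq_iff)
    then show "hnum (\<i> * of_real \<theta>) * exp (\<i> * of_real \<theta>) / (exp (\<i> * of_real \<theta>) - of_real z) \<noteq> 0"
      using theta unfolding hnum_at_poles by simp
  qed (use theta eps in \<open>auto intro!: holomorphic_intros open_horizontal_strip convex_connected convex_horizontal_strip simp: ch\<close>)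
  have r2: "residue ?f (- (\<i> * of_real \<theta>)) = hnum (- (\<i> * of_real \<theta>)) * exp (- (\<i> * of_real \<theta>)) / (exp (- (\<i> * of_real \<theta>)) - of_real z) / (2 * (- \<i> * of_real (sin \<theta>)))"
    unfolding swap
  proof (rule residue_simple_pole_deriv[where s = "{u. - (pi + \<epsilon>) < Im u \<and> Im u < 0}"])
    show "(\<lambda>w. hnum w * exp w / (exp w - of_real z)) holomorphic_on {u. - (pi + \<epsilon>) < Im u \<and> Im u < 0}"
    proof (intro holomorphic_intros)
      show "hnum holomorphic_on {u. - (pi + \<epsilon>) < Im u \<and> Im u < 0}"
        by (rule holomorphic_on_subset[OF hnum_holomorphic]) auto
      show "exp u - of_real z \<noteq> 0" if "u \<in> {u. - (pi + \<epsilon>) < Im u \<and> Im u < 0}" for u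
        using that expz[of u] by auto
    qed
    show "((\<lambda>w. 2 * (cosh w - of_real (cos \<theta>))) has_field_derivative 2 * (- \<i> * of_real (sin \<theta>))) (at (- (\<i> * of_real \<theta>)))"
      by (rule derivative_eq_intros refl)+ (simp add: sh(2)[unfolded mult_minus_left] sh)
    have "exp (- (\<i> * of_real \<theta>)) \<noteq> of_real z" using expz[of "- (\<i> * of_real \<theta>)"] theta eps by (auto simp: complex_eq_iff)
    then show "hnum (- (\<i> * of_real \<theta>)) * exp (- (\<i> * of_real \<theta>)) / (exp (- (\<i> * of_real \<theta>)) - of_real z) \<noteq> 0"
      using theta unfolding hnum_at_poles by simp
  qed (use theta eps ch(2) in \<open>auto intro!: holomorphic_intros open_horizontal_strip convex_connected convex_horizontal_strip simp: ch\<close>)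
  have e1: "exp (- \<i> * of_real ((b + 1 / 2) * \<theta>)) * exp (\<i> * of_real \<theta>) = exp (\<i> * \<phi>)"
    and e2: "exp (\<i> * of_real ((b + 1 / 2) * \<theta>)) * exp (- (\<i> * of_real \<theta>)) = exp (- \<i> * \<phi>)"
    unfolding exp_add[symmetric] \<phi>_def by (rule arg_cong[where f = exp], simp add: complex_eq_iff algebra_simps)+
  have s: "of_real (sin \<theta>) \<noteq> (0::complex)" using theta by simp
  have q: "x * e / d / (2 * (i * x)) = e / d / (2 * i)" if "x \<noteq> 0" "i \<noteq> 0" for x e d i :: complex
    using that by (cases "d = 0") (simp_all add: field_simps)
  have r1': "residue ?f (\<i> * of_real \<theta>) = exp (\<i> * \<phi>) / (exp (\<i> * \<theta>) - of_real z) / (2 * \<i>)"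
  proof -
    have "residue ?f (\<i> * of_real \<theta>) = of_real (sin \<theta>) * (exp (- \<i> * of_real ((b + 1 / 2) * \<theta>)) * exp (\<i> * of_real \<theta>)) / (exp (\<i> * of_real \<theta>) - of_real z) / (2 * (\<i> * of_real (sin \<theta>)))"
      unfolding r1 hnum_at_poles by (simp only: mult.assoc)
    also have "\<dots> = exp (\<i> * \<phi>) / (exp (\<i> * \<theta>) - of_real z) / (2 * \<i>)"
      unfolding e1 by (rule q[OF s]) simp
    finally show ?thesis .
  qed
  have r2': "residue ?f (- (\<i> * of_real \<theta>)) = - (exp (- \<i> * \<phi>) / (exp (- \<i> * \<theta>) - of_real z) / (2 * \<i>))"
  proof -
    have "residue ?f (- (\<i> * of_real \<theta>)) = of_real (sin \<theta>) * (exp (\<i> * of_real ((b + 1 / 2) * \<theta>)) * exp (- (\<i> * of_real \<theta>))) / (exp (- (\<i> * of_real \<theta>)) - of_real z) / (2 * (- \<i> * of_real (sin \<theta>)))"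
      unfolding r2 hnum_at_poles by (simp only: mult.assoc)
    also have "\<dots> = - (exp (- \<i> * \<phi>) / (exp (- \<i> * \<theta>) - of_real z) / (2 * \<i>))"
    proof -
      have "- \<i> \<noteq> (0::complex)" by simp
      from q[OF s this] show ?thesis unfolding e2 by (simp only: mult_minus_right mult_minus_left minus_divide_right[symmetric])
    qed
    finally show ?thesis .
  qed
  have dist: "of_real (ln z) \<noteq> \<i> * of_real \<theta>" "of_real (ln z) \<noteq> - (\<i> * of_real \<theta>)" "\<i> * of_real \<theta> \<noteq> - (\<i> * of_real \<theta>)"
    using theta by (auto simp: complex_eq_iff)
  have sumP: "(\<Sum>p\<in>?P. residue ?f p) = residue ?f (of_real (ln z)) + (residue ?f (\<i> * of_real \<theta>) + residue ?f (- (\<i> * of_real \<theta>)))"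
    using dist by (subst sum.insert, simp, simp, subst sum.insert) auto
  have "- (c * of_real (LBINT t. g (exp t) * (exp t / (exp t + z)))) = (LBINT t. ?f (Complex t (- pi))) - (LBINT t. ?f (Complex t pi))"
    unfolding I[symmetric] by simp
  also have "\<dots> = 2 * pi * \<i> * (\<Sum>p\<in>?P. residue ?f p)" by (rule SR(3))
  finally have fin: "- (c * of_real (LBINT t. g (exp t) * (exp t / (exp t + z)))) = 2 * pi * \<i> * (h (of_real (ln z)) + (exp (\<i> * \<phi>) / (exp (\<i> * \<theta>) - of_real z) / (2 * \<i>) + - (exp (- \<i> * \<phi>) / (exp (- \<i> * \<theta>) - of_real z) / (2 * \<i>))))"
    unfolding sumP r0 r1' r2' .
  have neg: "a / (x - y) = - (a / (y - x))" for a x y :: complex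
    by (metis minus_diff_eq minus_divide_right)
  define J where "J = complex_of_real (LBINT t. g (exp t) * (exp t / (exp t + z)))"
  define A B where "A = exp (\<i> * \<phi>) / (of_real z - exp (\<i> * \<theta>))" and "B = exp (- \<i> * \<phi>) / (of_real z - exp (- \<i> * \<theta>))"
  have "- (c * J) = 2 * pi * \<i> * (h (of_real (ln z)) - (A - B) / (2 * \<i>))"
  proof -
    have nA: "exp (\<i> * \<phi>) / (exp (\<i> * \<theta>) - of_real z) = - A" unfolding A_def by (rule neg)
    have nB: "exp (- \<i> * \<phi>) / (exp (- \<i> * \<theta>) - of_real z) = - B" unfolding B_def by (rule neg)
    have e: "x + (- A / y + - (- B / y)) = x - (A - B) / y" for x y by (simp add: diff_divide_distrib)
    show ?thesis using fin unfolding J_def[symmetric] nA nB e .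
  qed
  then have "h (of_real (ln z)) = (A - B) / (2 * \<i>) - C0 * of_real (sin (2 * pi * b)) / of_real pi * J"
  proof -
    assume *: "- (c * J) = 2 * pi * \<i> * (h (of_real (ln z)) - (A - B) / (2 * \<i>))"
    define k where "k = C0 * of_real (sin (2 * pi * b))"
    define y where "y = h (of_real (ln z)) - (A - B) / (2 * \<i>)"
    have ck: "c = 2 * \<i> * k" by (simp add: c_def k_def)
    have "2 * \<i> * (of_real pi * y + k * J) = 2 * pi * \<i> * y - - (c * J)"
      unfolding ck by (simp add: algebra_simps)
    also have "\<dots> = 0" unfolding *[folded y_def] by simp
    finally have "of_real pi * y + k * J = 0" by simp
    then have "of_real pi * y = - (k * J)" by (rule eq_neg_iff_add_eq_0[THEN iffD2])
    then have "y = - (k * J) / of_real pi" by (subst nonzero_eq_divide_eq) (simp_all add: mult.commute)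
    then show ?thesis unfolding y_def k_def by (simp add: algebra_simps)
  qed
  then show "h (of_real (ln z)) = (exp (\<i> * \<phi>) / (z - exp (\<i> * \<theta>)) - exp (- \<i> * \<phi>) / (z - exp (- \<i> * \<theta>))) / (2 * \<i>)
       - C0 * of_real (sin (2 * pi * b)) / of_real pi * of_real (LBINT t. g (exp t) * (exp t / (exp t + z)))"
    unfolding A_def B_def J_def .
qed

end

section \<open>Laplace transforms of \<open>G\<close> and \<open>F\<close>\<close>

lemma exp_substitution_real:
  fixes f :: "real \<Rightarrow> real"
  assumes m: "set_borel_measurable borel {0<..} f"
  shows "set_integrable lborel {0<..} f \<longleftrightarrow> integrable lborel (\<lambda>t. exp t * f (exp t))" (is ?A)
    and "(LBINT x:{0<..}. f x) = (LBINT t. exp t * f (exp t))" (is ?B)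
proof -
  have m': "set_borel_measurable borel {0<..} (\<lambda>x. complex_of_real (f x))"
  proof -
    have "(\<lambda>x. complex_of_real (indicator {0<..} x *\<^sub>R f x)) \<in> borel_measurable borel"
      using m unfolding set_borel_measurable_def by measurable
    then show ?thesis unfolding set_borel_measurable_def by (simp add: scaleR_conv_of_real)
  qed
  have e: "(\<lambda>t. exp t *\<^sub>R complex_of_real (f (exp t))) = (\<lambda>t. complex_of_real (exp t * f (exp t)))"
    by (simp add: scaleR_conv_of_real)
  have e': "(\<lambda>x. indicator {0<..} x *\<^sub>R complex_of_real (f x)) = (\<lambda>x. complex_of_real (indicator {0<..} x *\<^sub>R f x))"
    by (simp add: scaleR_conv_of_real)
  show ?A
    using exp_substitution(1)[OF m'] unfolding set_integrable_def e e' complex_of_real_integrable_eq .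
  show ?B
    using exp_substitution(2)[OF m'] unfolding set_lebesgue_integral_def e e' integral_complex_of_real of_real_eq_iff .
qed

lemma exp_half_line_integral:
  fixes c :: complex
  assumes c: "Re c > 0"
  shows "set_integrable lborel {0<..} (\<lambda>x. exp (- c * of_real x))"
    and "(LBINT x:{0<..}. exp (- c * of_real x)) = 1 / c"
proof -
  show int: "set_integrable lborel {0<..} (\<lambda>x. exp (- c * of_real x))"
    unfolding set_integrable_def
  proof (rule Bochner_Integration.integrable_bound[OF integrable_exp_neg_abs[OF c]])
    show "AE x in lborel. norm (indicat_real {0<..} x *\<^sub>R exp (- c * of_real x)) \<le> norm (exp (- Re c * \<bar>x\<bar>))"
      by (rule AE_I2) (auto simp: indicator_def)
  qed simp
  have "set_integrable lborel (einterval 0 \<infinity>) (\<lambda>x. exp (- c * of_real x))"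
  proof -
    have "einterval 0 \<infinity> = {0::real<..}" by (auto simp: einterval_iff zero_ereal_def)
    then show ?thesis using int by simp
  qed
  moreover have "((\<lambda>x. - exp (- c * complex_of_real x) / c) has_vector_derivative exp (- c * of_real x)) (at x)" for x :: real
  proof -
    have "((\<lambda>w. - exp (- c * w) / c) has_field_derivative exp (- c * of_real x)) (at (of_real x))"
      using c by (auto intro!: derivative_eq_intros simp: field_simps)
    from has_vector_derivative_real_field[OF this] show ?thesis .
  qed
  moreover have "(((\<lambda>x. - exp (- c * complex_of_real x) / c) \<circ> real_of_ereal) \<longlongrightarrow> - 1 / c) (at_right 0)"
  proof -
    have "((\<lambda>x::real. - exp (- c * complex_of_real x) / c) \<longlongrightarrow> - exp (- c * of_real 0) / c) (at_right 0)"
      by (intro tendsto_intros) (use c in auto)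
    then show ?thesis unfolding zero_ereal_def ereal_tendsto_simps by simp
  qed
  moreover have "(((\<lambda>x. - exp (- c * complex_of_real x) / c) \<circ> real_of_ereal) \<longlongrightarrow> 0) (at_left \<infinity>)"
  proof -
    have "((\<lambda>x. exp (- Re c * x) / norm c) \<longlongrightarrow> 0 / norm c) at_top"
    proof (intro tendsto_divide tendsto_const)
      show "((\<lambda>x. exp (- Re c * x)) \<longlongrightarrow> 0) at_top" using c by real_asymp
    qed (use c in auto)
    then have "((\<lambda>x. - exp (- c * complex_of_real x) / c) \<longlongrightarrow> 0) at_top"
      by (intro tendsto_norm_zero_cancel[of "\<lambda>x. - exp (- c * complex_of_real x) / c"]) (simp add: norm_divide)
    then show ?thesis by (simp add: ereal_tendsto_simps)
  qed
  ultimately have "(LBINT x=0..\<infinity>. exp (- c * of_real x)) = 0 - (- 1 / c)"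
    by (intro interval_integral_FTC_integrable[where F = "\<lambda>x. - exp (- c * complex_of_real x) / c"]) (auto intro!: continuous_intros)
  moreover have "(LBINT x=0..\<infinity>. exp (- c * of_real x)) = (LBINT x:{0<..}. exp (- c * of_real x))"
    by (simp add: interval_lebesgue_integral_0_infty)
  ultimately show "(LBINT x:{0<..}. exp (- c * of_real x)) = 1 / c" by simp
qed

context stable_params
begin

lemma S2_strip_line_continuous:
  assumes "0 < c" "c < 1 + \<alpha>"
  shows "continuous_on UNIV (\<lambda>t. S2_strip \<alpha> (Complex c (k * t / l)))"
proof (rule continuous_on_compose2[OF holomorphic_on_imp_continuous_on[OF S2_strip_holomorphic[OF alpha(1)]]])
  show "continuous_on UNIV (\<lambda>t. Complex c (k * t / l))"
    unfolding Complex_eq divide_inverse by (intro continuous_intros)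
qed (use assms in auto)

lemma g_exp_continuous: "continuous_on UNIV (\<lambda>t. g (exp t))"
proof -
  have "2 * cosh t + 2 * cos \<theta> \<noteq> 0" for t using cosh_cos_pos[of t] by linarith
  then show ?thesis
    unfolding g_exp using b
    by (intro continuous_intros S2_strip_line_continuous) auto
qed

lemma g_exp_measurable [measurable]: "(\<lambda>t. g (exp t)) \<in> borel_measurable borel"
  by (rule borel_measurable_continuous_onI[OF g_exp_continuous])

lemma g_continuous: "continuous_on {0<..} g"
proof -
  have "continuous_on {0<..} (\<lambda>s. g (exp (ln s)))"
    by (rule continuous_on_compose2[OF g_exp_continuous]) (auto intro!: continuous_intros)
  then show ?thesis by (rule continuous_on_eq) simp
qed

lemma g_exp_bound:
  obtains K where "K > 0" "\<And>t. g (exp t) \<le> K * exp ((\<alpha> * \<rho> / 2 - 1 / 2) * t - (\<alpha> / 2 + b + 1 / 2) * \<bar>t\<bar>)"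
proof -
  have pb: "0 < \<alpha> + b" "\<alpha> + b < 1 + \<alpha>" using b alpha by auto
  obtain B where B: "B > 0"
    "\<And>z. \<alpha> + b \<le> Re z \<Longrightarrow> Re z \<le> \<alpha> + b \<Longrightarrow> norm (S2_strip \<alpha> z) \<le> B * exp (- (pi * \<bar>Im z\<bar> / \<alpha>) * (Re z - (1 + \<alpha>) / 2))"
    by (rule S2_strip_bounds[OF alpha(1) pb]) (rule that)
  \<comment> \<open>The minimum gives m * cosh t \<le> cosh t + cos \<theta> for either sign of cos
    \<theta>.\<close>
  define m where "m = min 1 (1 + cos \<theta>)"
  have m: "m > 0" using cosh_cos_pos[of 0] by (simp add: m_def)
  show ?thesis
  proof (rule that[of "B\<^sup>2 / m"])
    show "B\<^sup>2 / m > 0" using B m by simp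
    fix t
    have "norm (S2_strip \<alpha> (Complex (\<alpha> + b) (\<alpha> * t / (2 * pi)))) \<le> B * exp (- (\<bar>t\<bar> / 2) * (\<alpha> + b - (1 + \<alpha>) / 2))"
    proof -
      have e: "pi * \<bar>\<alpha> * t / (2 * pi)\<bar> / \<alpha> = \<bar>t\<bar> / 2" using alpha by (simp add: abs_mult)
      show ?thesis using B(2)[of "Complex (\<alpha> + b) (\<alpha> * t / (2 * pi))", unfolded complex.sel e] by simp
    qed
    then have "(norm (S2_strip \<alpha> (Complex (\<alpha> + b) (\<alpha> * t / (2 * pi)))))\<^sup>2 \<le> (B * exp (- (\<bar>t\<bar> / 2) * (\<alpha> + b - (1 + \<alpha>) / 2)))\<^sup>2"
      by (intro power_mono) auto
    also have "\<dots> = B\<^sup>2 * exp (- (\<alpha> / 2 + b - 1 / 2) * \<bar>t\<bar>)"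
      unfolding power_mult_distrib exp_double[symmetric] by (simp add: field_simps)
    finally have n: "(norm (S2_strip \<alpha> (Complex (\<alpha> + b) (\<alpha> * t / (2 * pi)))))\<^sup>2 \<le> B\<^sup>2 * exp (- (\<alpha> / 2 + b - 1 / 2) * \<bar>t\<bar>)" .
    have d: "m * exp \<bar>t\<bar> \<le> 2 * (cosh t + cos \<theta>)"
    proof -
      have c: "exp \<bar>t\<bar> \<le> 2 * cosh t" by (auto simp: cosh_field_def abs_if)
      have "m * cosh t \<le> cosh t + cos \<theta>"
      proof (cases "cos \<theta> \<le> 0")
        case True
        have "cos \<theta> * cosh t \<le> cos \<theta> * 1" using True cosh_real_ge_1[of t] by (intro mult_left_mono_neg) auto
        moreover have "m * cosh t \<le> (1 + cos \<theta>) * cosh t" by (intro mult_right_mono) (auto simp: m_def)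
        ultimately show ?thesis unfolding distrib_right by simp
      next
        case False
        have "m * cosh t \<le> 1 * cosh t" by (intro mult_right_mono) (auto simp: m_def)
        then show ?thesis using False by linarith
      qed
      then have mc: "2 * (m * cosh t) \<le> 2 * (cosh t + cos \<theta>)" by (intro mult_left_mono) auto
      have "m * exp \<bar>t\<bar> \<le> m * (2 * cosh t)" using c m by (intro mult_left_mono) auto
      also have "\<dots> = 2 * (m * cosh t)" by simp
      finally show ?thesis using mc by linarith
    qed
    have "g (exp t) \<le> exp ((\<alpha> * \<rho> / 2 - 1 / 2) * t) * (B\<^sup>2 * exp (- (\<alpha> / 2 + b - 1 / 2) * \<bar>t\<bar>)) / (m * exp \<bar>t\<bar>)"
      unfolding g_exp using n d m by (intro frac_le mult_left_mono) auto
    also have "\<dots> = B\<^sup>2 / m * exp ((\<alpha> * \<rho> / 2 - 1 / 2) * t + - (\<alpha> / 2 + b - 1 / 2) * \<bar>t\<bar> - \<bar>t\<bar>)"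
      unfolding exp_add exp_diff by (simp add: mult_ac)
    also have "(\<alpha> * \<rho> / 2 - 1 / 2) * t + - (\<alpha> / 2 + b - 1 / 2) * \<bar>t\<bar> - \<bar>t\<bar> = (\<alpha> * \<rho> / 2 - 1 / 2) * t - (\<alpha> / 2 + b + 1 / 2) * \<bar>t\<bar>"
      by (simp add: algebra_simps)
    finally show "g (exp t) \<le> B\<^sup>2 / m * exp ((\<alpha> * \<rho> / 2 - 1 / 2) * t - (\<alpha> / 2 + b + 1 / 2) * \<bar>t\<bar>)" .
  qed
qed

text \<open>The integrand decays like exp (- (2b - k) t) to the right and at least like exp ((1 + k)
  t) to the left. The case k = 0 makes \<open>G\<close> finite at 0; positive k measure the
  regularity of \<open>G\<close> there.\<close>

lemma g_moment_integrable:
  assumes k: "- 1 < k" "k < 2 * b"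
  shows "integrable lborel (\<lambda>t. g (exp t) * exp t * exp (k * t))"
proof -
  obtain K where K: "K > 0" "\<And>t. g (exp t) \<le> K * exp ((\<alpha> * \<rho> / 2 - 1 / 2) * t - (\<alpha> / 2 + b + 1 / 2) * \<bar>t\<bar>)"
    by (rule g_exp_bound) (rule that)
  define \<delta> where "\<delta> = min (2 * b - k) (1 + k)"
  have \<delta>: "\<delta> > 0" using k by (simp add: \<delta>_def)
  show ?thesis
  proof (rule Bochner_Integration.integrable_bound[OF integrable_mult_right[OF integrable_exp_neg_abs[OF \<delta>], of K]])
    show "AE t in lborel. norm (g (exp t) * exp t * exp (k * t)) \<le> norm (K * exp (- \<delta> * \<bar>t\<bar>))"
    proof (rule AE_I2)
      fix t :: real
      have ar2: "\<alpha> * \<rho> = \<alpha> - 2 * b" using b(4) by simp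
      have le: "(\<alpha> * \<rho> / 2 - 1 / 2) * t - (\<alpha> / 2 + b + 1 / 2) * \<bar>t\<bar> + t + k * t \<le> - \<delta> * \<bar>t\<bar>"
      proof (cases "t \<ge> 0")
        case True
        have "(\<alpha> * \<rho> / 2 - 1 / 2) * t - (\<alpha> / 2 + b + 1 / 2) * \<bar>t\<bar> + t + k * t = - (2 * b - k) * t"
          unfolding ar2 using True by (simp add: field_simps)
        also have "\<dots> \<le> - \<delta> * t" using True by (intro mult_right_mono) (auto simp: \<delta>_def)
        finally show ?thesis using True by simp
      next
        case False
        have "(\<alpha> * \<rho> / 2 - 1 / 2) * t - (\<alpha> / 2 + b + 1 / 2) * \<bar>t\<bar> + t + k * t = (\<alpha> + 1 + k) * t"
          unfolding ar2 using False by (simp add: field_simps)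
        also have "\<dots> \<le> \<delta> * t" using False alpha by (intro mult_right_mono_neg) (auto simp: \<delta>_def)
        finally show ?thesis using False by simp
      qed
      have "g (exp t) * exp t * exp (k * t) \<le> K * exp ((\<alpha> * \<rho> / 2 - 1 / 2) * t - (\<alpha> / 2 + b + 1 / 2) * \<bar>t\<bar>) * exp t * exp (k * t)"
        by (intro mult_right_mono K(2)) auto
      also have "\<dots> = K * exp ((\<alpha> * \<rho> / 2 - 1 / 2) * t - (\<alpha> / 2 + b + 1 / 2) * \<bar>t\<bar> + t + k * t)"
        by (simp add: exp_add)
      also have "\<dots> \<le> K * exp (- \<delta> * \<bar>t\<bar>)" using K(1) le by (intro mult_left_mono) auto
      finally show "norm (g (exp t) * exp t * exp (k * t)) \<le> norm (K * exp (- \<delta> * \<bar>t\<bar>))"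
        using K(1) by (simp add: g_nonneg abs_mult)
    qed
  qed measurable
qed

lemma g_weight_integrable: "integrable lborel (\<lambda>t. g (exp t) * exp t)"
  using g_moment_integrable[of 0] b by simp

lemma G_eq: "G \<alpha> \<rho> x = (LBINT t. exp (- exp t * x) * (g (exp t) * exp t))"
proof -
  have "G \<alpha> \<rho> x = (LBINT s:{0<..}. exp (- s * x) * g s)"
    unfolding G_def g_def mult.assoc ..
  also have "\<dots> = (LBINT t. exp t * (exp (- exp t * x) * g (exp t)))"
  proof (rule exp_substitution_real(2))
    show "set_borel_measurable borel {0<..} (\<lambda>s. exp (- s * x) * g s)"
      unfolding set_borel_measurable_def
      by (rule borel_measurable_continuous_on_indicator) (auto intro!: continuous_intros g_continuous)
  qed
  finally show ?thesis by (simp add: mult_ac)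
qed

lemma G_integrand_integrable:
  assumes "x \<ge> 0"
  shows "integrable lborel (\<lambda>t. exp (- exp t * x) * (g (exp t) * exp t))"
proof (rule Bochner_Integration.integrable_bound[OF g_weight_integrable])
  show "AE t in lborel. norm (exp (- exp t * x) * (g (exp t) * exp t)) \<le> norm (g (exp t) * exp t)"
    using assms by (intro AE_I2) (auto simp: abs_mult g_nonneg intro!: mult_left_le_one_le)
qed measurable

lemma G_bounds:
  assumes "x \<ge> 0"
  shows "0 \<le> G \<alpha> \<rho> x" "G \<alpha> \<rho> x \<le> G \<alpha> \<rho> 0"
proof -
  show "0 \<le> G \<alpha> \<rho> x" unfolding G_eq by (intro integral_nonneg_AE AE_I2) (auto simp: g_nonneg)
  show "G \<alpha> \<rho> x \<le> G \<alpha> \<rho> 0"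
    unfolding G_eq
  proof (rule integral_mono[OF G_integrand_integrable[OF assms] G_integrand_integrable])
    fix t
    show "exp (- exp t * x) * (g (exp t) * exp t) \<le> exp (- exp t * 0) * (g (exp t) * exp t)"
      using assms by (intro mult_right_mono) (auto simp: g_nonneg)
  qed simp
qed

lemma G_measurable: "(\<lambda>x. indicator {0<..} x * G \<alpha> \<rho> x) \<in> borel_measurable borel"
proof -
  have "(\<lambda>x. LBINT t. exp (- exp t * x) * (g (exp t) * exp t)) \<in> borel_measurable lborel"
    by (rule lborel.borel_measurable_lebesgue_integral) measurable
  then show ?thesis unfolding G_eq by measurable
qed

text \<open>By Fubini, integrating exp (- (s + z) x) over x > 0 yields the Stieltjes kernel 1 / (s +
  z); positivity of the density supplies absolute convergence.\<close>

lemma G_Laplace: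
  assumes z: "z > 0"
  shows "set_integrable lborel {0<..} (\<lambda>x. exp (- z * x) * G \<alpha> \<rho> x)"
    and "(LBINT x:{0<..}. exp (- z * x) * G \<alpha> \<rho> x) = (LBINT t. g (exp t) * (exp t / (exp t + z)))"
proof -
  let ?e = "\<lambda>x. indicat_real {0<..} x * exp (- z * x)"
  let ?f = "\<lambda>x t. ?e x * (exp (- exp t * x) * (g (exp t) * exp t))"
  have int_e: "integrable lborel (\<lambda>x. ?e x * C)" for C
  proof (rule Bochner_Integration.integrable_bound[OF integrable_mult_left[OF integrable_exp_neg_abs[OF z], of C]])
    show "AE x in lborel. norm (?e x * C) \<le> norm (exp (- z * \<bar>x\<bar>) * C)"
      by (rule AE_I2) (auto simp: indicator_def abs_mult)
  qed measurable
  have intx: "(\<integral>t. ?f x t \<partial>lborel) = ?e x * G \<alpha> \<rho> x" for x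
    unfolding G_eq by (rule integral_mult_right_zero)
  have intG: "integrable lborel (\<lambda>x. ?e x * G \<alpha> \<rho> x)"
  proof (rule Bochner_Integration.integrable_bound[OF int_e[of "G \<alpha> \<rho> 0"]])
    have "(\<lambda>x. exp (- z * x) * (indicator {0<..} x * G \<alpha> \<rho> x)) \<in> borel_measurable borel"
      using G_measurable by measurable
    then show "(\<lambda>x. ?e x * G \<alpha> \<rho> x) \<in> borel_measurable lborel" by (simp add: mult_ac)
    show "AE x in lborel. norm (?e x * G \<alpha> \<rho> x) \<le> norm (?e x * G \<alpha> \<rho> 0)"
    proof (rule AE_I2)
      fix x :: real
      show "norm (?e x * G \<alpha> \<rho> x) \<le> norm (?e x * G \<alpha> \<rho> 0)"
        using G_bounds[of x] by (cases "x > 0") (auto simp: abs_mult)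
    qed
  qed
  then show "set_integrable lborel {0<..} (\<lambda>x. exp (- z * x) * G \<alpha> \<rho> x)"
    by (simp add: set_integrable_def mult.assoc)
  have prod: "integrable (lborel \<Otimes>\<^sub>M lborel) (\<lambda>(x, t). ?f x t)"
  proof (rule lborel_pair.Fubini_integrable)
    show "(\<lambda>(x, t). ?f x t) \<in> borel_measurable (lborel \<Otimes>\<^sub>M lborel)" by measurable
    have "(\<integral>t. norm (?f x t) \<partial>lborel) = ?e x * G \<alpha> \<rho> x" for x
      unfolding intx[symmetric] by (rule Bochner_Integration.integral_cong) (auto simp: abs_mult g_nonneg)
    then show "integrable lborel (\<lambda>x. \<integral>t. norm (case (x, t) of (x, t) \<Rightarrow> ?f x t) \<partial>lborel)" using intG by simp
    show "AE x in lborel. integrable lborel (\<lambda>t. case (x, t) of (x, t) \<Rightarrow> ?f x t)"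
    proof (rule AE_I2)
      fix x :: real
      show "integrable lborel (\<lambda>t. case (x, t) of (x, t) \<Rightarrow> ?f x t)"
        using integrable_mult_right[OF G_integrand_integrable[of x], of "?e x"] by (cases "x > 0") auto
    qed
  qed
  have "(LBINT x:{0<..}. exp (- z * x) * G \<alpha> \<rho> x) = (LBINT x. \<integral>t. ?f x t \<partial>lborel)"
    unfolding intx set_lebesgue_integral_def by (simp add: mult.assoc)
  also have "\<dots> = (LBINT t. LBINT x. ?f x t)"
    by (rule lborel_pair.Fubini_integral[OF prod, symmetric])
  also have "\<dots> = (LBINT t. g (exp t) * (exp t / (exp t + z)))"
  proof (rule Bochner_Integration.integral_cong[OF refl])
    fix t :: real
    have p: "exp t + z > 0" using z by (simp add: add_pos_pos)
    have "(LBINT x. ?f x t) = (LBINT x. (indicat_real {0<..} x *\<^sub>R exp (- (exp t + z) * x)) * (g (exp t) * exp t))"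
      by (rule Bochner_Integration.integral_cong[OF refl]) (simp add: algebra_simps exp_add[symmetric])
    also have "\<dots> = (LBINT x:{0<..}. exp (- (exp t + z) * x)) * (g (exp t) * exp t)"
      unfolding set_lebesgue_integral_def by (rule integral_mult_left_zero)
    also have "(LBINT x:{0<..}. exp (- (exp t + z) * x)) = 1 / (exp t + z)"
    proof -
      have "complex_of_real (LBINT x:{0<..}. exp (- (exp t + z) * x)) = (LBINT x:{0<..}. exp (- of_real (exp t + z) * complex_of_real x))"
        unfolding set_integral_complex_of_real[symmetric] by (simp add: exp_of_real[symmetric])
      also have "\<dots> = complex_of_real (1 / (exp t + z))"
        using exp_half_line_integral(2)[of "of_real (exp t + z)"] p by simp
      finally show ?thesis by (simp only: of_real_eq_iff)
    qed
    finally show "(LBINT x. ?f x t) = g (exp t) * (exp t / (exp t + z))" by simp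
  qed
  finally show "(LBINT x:{0<..}. exp (- z * x) * G \<alpha> \<rho> x) = (LBINT t. g (exp t) * (exp t / (exp t + z)))" .
qed


definition k0 :: complex where "k0 = C0 * of_real (sin (2 * pi * b)) / of_real pi"

lemma F_eq: "F \<alpha> \<rho> x = of_real (exp (x * cos \<theta>) * sin (x * sin \<theta> + \<phi>)) - k0 * of_real (G \<alpha> \<rho> x)"
proof -
  have "pi * \<rho> * (1 - \<alpha> * (1 - \<rho>)) / 2 = \<phi>" by (simp add: \<phi>_def \<theta>_def b_def field_simps)
  then show ?thesis unfolding F_def C0_S2 \<theta>_def[symmetric] k0_def by simp
qed

lemma exp_sin_eq:
  "complex_of_real (exp (x * cos \<theta>) * sin (x * sin \<theta> + \<phi>)) =
     (exp (\<i> * \<phi>) * exp (x * exp (\<i> * \<theta>)) - exp (- \<i> * \<phi>) * exp (x * exp (- \<i> * \<theta>))) / (2 * \<i>)"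
proof -
  have e1: "exp (\<i> * \<theta>) = of_real (cos \<theta>) + \<i> * of_real (sin \<theta>)" "exp (- \<i> * \<theta>) = of_real (cos \<theta>) - \<i> * of_real (sin \<theta>)"
    using exp_Euler[of "of_real \<theta>"] exp_Euler[of "- of_real \<theta>"] by (simp_all add: cos_of_real sin_of_real)
  have 1: "exp (\<i> * \<phi>) * exp (x * exp (\<i> * \<theta>)) = of_real (exp (x * cos \<theta>)) * exp (\<i> * of_real (x * sin \<theta> + \<phi>))"
    unfolding e1 exp_of_real[symmetric] exp_add[symmetric] by (rule arg_cong[where f = exp]) (simp add: algebra_simps)
  have 2: "exp (- \<i> * \<phi>) * exp (x * exp (- \<i> * \<theta>)) = of_real (exp (x * cos \<theta>)) * exp (- (\<i> * of_real (x * sin \<theta> + \<phi>)))"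
    unfolding e1 exp_of_real[symmetric] exp_add[symmetric] by (rule arg_cong[where f = exp]) (simp add: algebra_simps)
  show ?thesis unfolding 1 2 of_real_mult sin_of_real[symmetric] sin_exp_eq
    by (simp add: algebra_simps diff_divide_distrib)
qed

text \<open>By Euler's formula the oscillating term is a combination of exponentials with rates exp
  (\<plusminus> i \<theta>), each transforming into a simple fraction. Their common real part cos
  \<theta> explains the lower bound on \<open>z\<close>.\<close>

lemma exp_sin_Laplace:
  assumes z: "z > cos \<theta>"
  shows "set_integrable lborel {0<..} (\<lambda>x. of_real (exp (- z * x)) * complex_of_real (exp (x * cos \<theta>) * sin (x * sin \<theta> + \<phi>)))"
    and "(LBINT x:{0<..}. of_real (exp (- z * x)) * complex_of_real (exp (x * cos \<theta>) * sin (x * sin \<theta> + \<phi>))) =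
      (exp (\<i> * \<phi>) / (z - exp (\<i> * \<theta>)) - exp (- \<i> * \<phi>) / (z - exp (- \<i> * \<theta>))) / (2 * \<i>)"
proof -
  let ?c = "of_real z - exp (\<i> * \<theta>)" and ?d = "of_real z - exp (- \<i> * \<theta>)"
  have c: "Re ?c > 0" "Re ?d > 0" using z by (simp_all add: Re_exp)
  have e: "of_real (exp (- z * x)) * complex_of_real (exp (x * cos \<theta>) * sin (x * sin \<theta> + \<phi>)) =
    (exp (\<i> * \<phi>) * exp (- ?c * of_real x) - exp (- \<i> * \<phi>) * exp (- ?d * of_real x)) / (2 * \<i>)" for x
  proof -
    have "exp (- ?c * of_real x) = of_real (exp (- z * x)) * exp (x * exp (\<i> * \<theta>))"
      "exp (- ?d * of_real x) = of_real (exp (- z * x)) * exp (x * exp (- \<i> * \<theta>))"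
      unfolding exp_of_real[symmetric] exp_add[symmetric] by (rule arg_cong[where f = exp], simp add: algebra_simps)+
    then show ?thesis unfolding exp_sin_eq by (simp add: algebra_simps)
  qed
  note I = exp_half_line_integral[OF c(1)] exp_half_line_integral[OF c(2)]
  show "set_integrable lborel {0<..} (\<lambda>x. of_real (exp (- z * x)) * complex_of_real (exp (x * cos \<theta>) * sin (x * sin \<theta> + \<phi>)))"
    unfolding e by (intro set_integrable_divide set_integral_diff(1) set_integrable_mult_right I(1,3))
  have "(LBINT x:{0<..}. of_real (exp (- z * x)) * complex_of_real (exp (x * cos \<theta>) * sin (x * sin \<theta> + \<phi>))) =
    (LBINT x. (exp (\<i> * \<phi>) * (indicat_real {0<..} x *\<^sub>R exp (- ?c * of_real x)) - exp (- \<i> * \<phi>) * (indicat_real {0<..} x *\<^sub>R exp (- ?d * of_real x))) / (2 * \<i>))"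
    unfolding e set_lebesgue_integral_def
    by (rule Bochner_Integration.integral_cong) (auto simp: indicator_def)
  also have "\<dots> = (exp (\<i> * \<phi>) * (1 / ?c) - exp (- \<i> * \<phi>) * (1 / ?d)) / (2 * \<i>)"
    unfolding I(2,4)[symmetric] set_lebesgue_integral_def
    by (rule integral_lincomb) (use I(1,3) in \<open>simp_all add: set_integrable_def\<close>)
  finally show "(LBINT x:{0<..}. of_real (exp (- z * x)) * complex_of_real (exp (x * cos \<theta>) * sin (x * sin \<theta> + \<phi>))) =
      (exp (\<i> * \<phi>) / (z - exp (\<i> * \<theta>)) - exp (- \<i> * \<phi>) / (z - exp (- \<i> * \<theta>))) / (2 * \<i>)"
    by simp
qed

lemma F_Laplace:
  assumes z: "z > max 0 (cos \<theta>)"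
  shows "set_integrable lborel {0<..} (\<lambda>x. of_real (exp (- z * x)) * F \<alpha> \<rho> x)"
    and "(LBINT x:{0<..}. of_real (exp (- z * x)) * F \<alpha> \<rho> x) = h (of_real (ln z))"
proof -
  let ?s = "\<lambda>x. of_real (exp (- z * x)) * complex_of_real (exp (x * cos \<theta>) * sin (x * sin \<theta> + \<phi>))"
  have z': "z > 0" "z > cos \<theta>" using z by auto
  have e: "of_real (exp (- z * x)) * F \<alpha> \<rho> x = ?s x - k0 * complex_of_real (exp (- z * x) * G \<alpha> \<rho> x)" for x
    unfolding F_eq by (simp add: algebra_simps)
  have G1: "set_integrable lborel {0<..} (\<lambda>x. complex_of_real (exp (- z * x) * G \<alpha> \<rho> x))"
    using G_Laplace(1)[OF z'(1)] unfolding set_integrable_def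
    by (simp add: scaleR_conv_of_real complex_of_real_integrable_eq flip: of_real_mult)
  show "set_integrable lborel {0<..} (\<lambda>x. of_real (exp (- z * x)) * F \<alpha> \<rho> x)"
    unfolding e by (intro set_integral_diff(1) set_integrable_mult_right exp_sin_Laplace(1) z' G1)
  have "(LBINT x:{0<..}. of_real (exp (- z * x)) * F \<alpha> \<rho> x) = (LBINT x:{0<..}. ?s x) - (LBINT x:{0<..}. k0 * complex_of_real (exp (- z * x) * G \<alpha> \<rho> x))"
    unfolding e by (intro set_integral_diff(2) set_integrable_mult_right exp_sin_Laplace(1) z' G1)
  also have "(LBINT x:{0<..}. k0 * complex_of_real (exp (- z * x) * G \<alpha> \<rho> x)) = k0 * of_real (LBINT x:{0<..}. exp (- z * x) * G \<alpha> \<rho> x)"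
    unfolding set_integral_mult_right set_integral_complex_of_real ..
  finally show "(LBINT x:{0<..}. of_real (exp (- z * x)) * F \<alpha> \<rho> x) = h (of_real (ln z))"
    unfolding exp_sin_Laplace(2)[OF z'(2)] G_Laplace(2)[OF z'(1)] stieltjes_representation(2)[OF z'(1)] k0_def .
qed

lemma h_ln:
  assumes z: "z > 0"
  shows "h (of_real (ln z)) = of_real (sqrt \<alpha> / 2) * S2 \<alpha> (of_real (\<alpha> * \<rho>)) *
     of_real (z powr (- \<alpha> * (1 - \<rho>) / 2 - 1 / 2) * (cmod (S2 \<alpha> (Complex (1 + \<alpha> / 2 + \<alpha> * (1 - \<rho>) / 2) (\<alpha> * ln z / (2 * pi)))))\<^sup>2)"
proof -
  have 1: "S2 \<alpha> (of_real (\<alpha> * \<rho>)) = S2_strip \<alpha> (of_real (\<alpha> * \<rho>))"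
    using alpha rho ar by (intro S2_eq_strip) (auto simp: mult_pos_pos)
  have 2: "S2 \<alpha> (Complex (1 + \<alpha> / 2 + b) (\<alpha> * ln z / (2 * pi))) = S2_strip \<alpha> (Complex (1 + \<alpha> / 2 + b) (\<alpha> * ln z / (2 * pi)))"
    using alpha b by (intro S2_eq_strip) auto
  have 3: "exp (- (b + 1 / 2) * ln z) = z powr (- \<alpha> * (1 - \<rho>) / 2 - 1 / 2)"
  proof -
    have "- (b + 1 / 2) * ln z = (- \<alpha> * (1 - \<rho>) / 2 - 1 / 2) * ln z" by (simp add: b_def)
    then show ?thesis using z by (simp add: powr_def)
  qed
  show ?thesis unfolding h_of_real 1 C0_def 3 b_def[symmetric] 2 ..
qed

text \<open>Multiply the Stieltjes representation by z = exp n and let n grow. The left side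
  vanishes like exp (- 2 b n), and the right side tends to sin \<phi> - k0 * G 0, which is the value
  of \<open>F\<close> at 0.\<close>

lemma F_at_0: "of_real (sin \<phi>) = k0 * of_real (G \<alpha> \<rho> 0)"
proof -
  define A where "A = exp (\<i> * \<phi>)"
  define a where "a = exp (\<i> * \<theta>)"
  define A' where "A' = exp (- \<i> * \<phi>)"
  define a' where "a' = exp (- \<i> * \<theta>)"
  have h: "h (of_real (ln (exp (real n)))) * of_real (exp (real n)) = (A * (exp (real n) / (exp (real n) - a)) - A' * (exp (real n) / (exp (real n) - a'))) / (2 * \<i>)
    - k0 * of_real (LBINT t. g (exp t) * exp t * (exp (real n) / (exp t + exp (real n))))" for n
  proof -
    have "(LBINT t. g (exp t) * exp t * (exp (real n) / (exp t + exp (real n)))) = (LBINT t. exp (real n) * (g (exp t) * (exp t / (exp t + exp (real n)))))"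
      by (rule Bochner_Integration.integral_cong) auto
    also have "\<dots> = exp (real n) * (LBINT t. g (exp t) * (exp t / (exp t + exp (real n))))"
      by (rule integral_mult_right_zero)
    finally have I: "(LBINT t. g (exp t) * exp t * (exp (real n) / (exp t + exp (real n)))) = exp (real n) * (LBINT t. g (exp t) * (exp t / (exp t + exp (real n))))" .
    have e: "((x / p - y / q) / c - k * J) * w = (x * (w / p) - y * (w / q)) / c - k * (w * J)" for x y p q c k J w :: complex
      by (simp add: algebra_simps diff_divide_distrib)
    show ?thesis
      unfolding I stieltjes_representation(2)[OF exp_gt_zero] k0_def[symmetric] A_def[symmetric] A'_def[symmetric] a_def[symmetric] a'_def[symmetric] e of_real_mult ..
  qed
  have l1: "(\<lambda>n. complex_of_real (exp (real n)) / (of_real (exp (real n)) - c)) \<longlonglongrightarrow> 1" for c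
  proof -
    have 0: "(\<lambda>n. exp (- real n)) \<longlonglongrightarrow> 0" by real_asymp
    have "(\<lambda>n. 1 / (1 - c * complex_of_real (exp (- real n)))) \<longlonglongrightarrow> 1 / (1 - c * of_real 0)"
      by (intro tendsto_intros 0) simp
    moreover have "1 / (1 - c * complex_of_real (exp (- real n))) = complex_of_real (exp (real n)) / (of_real (exp (real n)) - c)" for n
    proof -
      define E where "E = complex_of_real (exp (real n))"
      have E: "E \<noteq> 0" "complex_of_real (exp (- real n)) = inverse E" by (simp_all add: E_def exp_minus)
      have "1 - c * inverse E = (E - c) / E" using E(1) by (simp add: field_simps)
      then show ?thesis unfolding E(2) E_def[symmetric] by simp
    qed
    ultimately show ?thesis by simp
  qed
  have l2: "(\<lambda>n. LBINT t. g (exp t) * exp t * (exp (real n) / (exp t + exp (real n)))) \<longlonglongrightarrow> (LBINT t. g (exp t) * exp t)"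
  proof (rule integral_dominated_convergence[where w = "\<lambda>t. g (exp t) * exp t"])
    show "AE t in lborel. (\<lambda>n. g (exp t) * exp t * (exp (real n) / (exp t + exp (real n)))) \<longlonglongrightarrow> g (exp t) * exp t"
    proof (rule AE_I2)
      fix t :: real
      have "(\<lambda>n. exp (real n) / (exp t + exp (real n))) \<longlonglongrightarrow> 1" by real_asymp
      from tendsto_mult[OF tendsto_const this, of "g (exp t) * exp t"]
      show "(\<lambda>n. g (exp t) * exp t * (exp (real n) / (exp t + exp (real n)))) \<longlonglongrightarrow> g (exp t) * exp t" by simp
    qed
    show "AE t in lborel. norm (g (exp t) * exp t * (exp (real n) / (exp t + exp (real n)))) \<le> g (exp t) * exp t" for n
    proof (rule AE_I2)
      fix t :: real
      have "exp (real n) / (exp t + exp (real n)) \<le> 1" by (simp add: add_pos_pos)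
      then have "g (exp t) * exp t * (exp (real n) / (exp t + exp (real n))) \<le> g (exp t) * exp t * 1"
        by (intro mult_left_mono) (auto simp: g_nonneg)
      moreover have "0 \<le> g (exp t) * exp t * (exp (real n) / (exp t + exp (real n)))"
        by (intro mult_nonneg_nonneg divide_nonneg_nonneg add_nonneg_nonneg g_nonneg) auto
      ultimately show "norm (g (exp t) * exp t * (exp (real n) / (exp t + exp (real n)))) \<le> g (exp t) * exp t" by simp
    qed
  qed (use g_weight_integrable in auto)
  have G0: "(LBINT t. g (exp t) * exp t) = G \<alpha> \<rho> 0" by (simp add: G_eq)
  have "(\<lambda>n. (A * (exp (real n) / (exp (real n) - a)) - A' * (exp (real n) / (exp (real n) - a'))) / (2 * \<i>)
    - k0 * of_real (LBINT t. g (exp t) * exp t * (exp (real n) / (exp t + exp (real n))))) \<longlonglongrightarrow> (A * 1 - A' * 1) / (2 * \<i>) - k0 * of_real (LBINT t. g (exp t) * exp t)"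
    by (intro tendsto_intros l1 l2) auto
  then have lim: "(\<lambda>n. h (of_real (ln (exp (real n)))) * of_real (exp (real n))) \<longlonglongrightarrow> (A - A') / (2 * \<i>) - k0 * of_real (G \<alpha> \<rho> 0)"
    unfolding h G0 by simp
  obtain K where K: "K > 0" "\<And>u. \<bar>Im u\<bar> \<le> pi \<Longrightarrow> 3 \<le> \<bar>Re u\<bar> \<Longrightarrow> norm (h u) \<le> K * exp (- (b + 1 / 2) * (Re u + \<bar>Re u\<bar>))"
    by (rule h_bound) (rule that)
  have "(\<lambda>n. h (of_real (ln (exp (real n)))) * of_real (exp (real n))) \<longlonglongrightarrow> 0"
  proof (rule Lim_null_comparison)
    show "\<forall>\<^sub>F n in sequentially. norm (h (of_real (ln (exp (real n)))) * of_real (exp (real n))) \<le> K * exp (- (2 * b) * real n)"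
      using eventually_ge_at_top[of 3]
    proof eventually_elim
      case (elim n)
      have "norm (h (of_real (real n))) \<le> K * exp (- (b + 1 / 2) * (real n + real n))"
        using K(2)[of "of_real (real n)"] elim by simp
      then have "norm (h (of_real (real n))) * exp (real n) \<le> K * exp (- (b + 1 / 2) * (real n + real n)) * exp (real n)"
        by (intro mult_right_mono) auto
      also have "\<dots> = K * exp (- (b + 1 / 2) * (real n + real n) + real n)" by (simp only: exp_add mult.assoc)
      also have "- (b + 1 / 2) * (real n + real n) + real n = - (2 * b) * real n" by (simp add: algebra_simps)
      finally show ?case by (simp add: norm_mult)
    qed
    have "((\<lambda>n. exp (- (2 * b) * real n)) \<longlongrightarrow> 0) sequentially" using b by real_asymp
    from tendsto_mult[OF tendsto_const this, of K] show "(\<lambda>n. K * exp (- (2 * b) * real n)) \<longlonglongrightarrow> 0" by simp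
  qed
  from LIMSEQ_unique[OF lim this] have "(A - A') / (2 * \<i>) = k0 * of_real (G \<alpha> \<rho> 0)" by simp
  moreover have "(A - A') / (2 * \<i>) = of_real (sin \<phi>)"
    unfolding A_def A'_def sin_of_real[symmetric] sin_exp_eq by simp
  ultimately show ?thesis by simp
qed

end

section \<open>Mellin transform\<close>

text \<open>Euler's integral after the substitution t = x exp u.\<close>

lemma Gamma_integral_exp:
  fixes w :: complex
  assumes w: "Re w > 0" and x: "x > 0"
  shows "integrable lborel (\<lambda>u. exp (w * of_real u) * of_real (exp (- exp u * x)))"
    and "(LBINT u. exp (w * of_real u) * of_real (exp (- exp u * x))) = Gamma w * of_real x powr (- w)"
proof -
  let ?f = "\<lambda>t. complex_of_real t powr (w - 1) / of_real (exp t)"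
  let ?g = "\<lambda>u. exp (w * of_real u) * complex_of_real (exp (- exp u))"
  have "continuous_on {0<..} ?f" by (auto intro!: continuous_intros)
  then have m: "set_borel_measurable borel {0<..} ?f"
    unfolding set_borel_measurable_def by (intro borel_measurable_continuous_on_indicator) auto
  have a: "set_integrable lborel {0<..} ?f"
    using absolutely_integrable_Gamma_integral'[OF w] m unfolding set_integrable_def set_borel_measurable_def
    by (simp add: integrable_completion)
  have v: "(LBINT t:{0<..}. ?f t) = Gamma w"
    using set_borel_integral_eq_integral(2)[OF a] integral_unique[OF Gamma_integral_complex'[OF w]] by simp
  have e: "exp u *\<^sub>R ?f (exp u) = ?g u" for u
  proof -
    have "complex_of_real (exp u) powr (w - 1) = exp ((w - 1) * of_real u)"
      by (simp add: powr_def Ln_of_real)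
    then show ?thesis
      by (simp add: scaleR_conv_of_real exp_minus exp_of_real[symmetric] left_diff_distrib exp_diff field_simps del: exp_of_real)
  qed
  have i1: "integrable lborel ?g" and v1: "(LBINT u. ?g u) = Gamma w"
    using exp_substitution[OF m] a v unfolding e by auto
  \<comment> \<open>The factor \<open>x\<close> turns into a translation by ln x in the logarithmic
    variable.\<close>
  have s: "?g (ln x + 1 * u) = exp (w * of_real (ln x)) * (exp (w * of_real u) * of_real (exp (- exp u * x)))" for u
    using x by (simp add: exp_add distrib_left mult_ac)
  have "integrable lborel (\<lambda>u. ?g (ln x + 1 * u))"
    by (rule lborel_integrable_real_affine[OF i1]) simp
  then have "integrable lborel (\<lambda>u. exp (- (w * of_real (ln x))) * (exp (w * of_real (ln x)) * (exp (w * of_real u) * of_real (exp (- exp u * x)))))"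
    unfolding s by (rule integrable_mult_right)
  then show "integrable lborel (\<lambda>u. exp (w * of_real u) * of_real (exp (- exp u * x)))"
    by (simp only: mult.assoc[symmetric] exp_add[symmetric] left_minus) simp
  have "Gamma w = \<bar>1\<bar> *\<^sub>R (LBINT u. ?g (ln x + 1 * u))"
    unfolding v1[symmetric] by (rule lborel_integral_real_affine) simp
  also have "\<dots> = exp (w * of_real (ln x)) * (LBINT u. exp (w * of_real u) * of_real (exp (- exp u * x)))"
    unfolding s by simp
  finally have "Gamma w = exp (w * of_real (ln x)) * (LBINT u. exp (w * of_real u) * of_real (exp (- exp u * x)))" .
  moreover have "complex_of_real x powr (- w) = exp (- (w * of_real (ln x)))"
    using x by (simp add: powr_def Ln_of_real)
  ultimately show "(LBINT u. exp (w * of_real u) * of_real (exp (- exp u * x))) = Gamma w * of_real x powr (- w)"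
    by (simp add: exp_minus)
qed

lemma abs_sin_diff_le: "\<bar>sin a - sin b\<bar> \<le> \<bar>a - b\<bar>" for a b :: real
proof -
  have "\<bar>sin a - sin b\<bar> = 2 * \<bar>sin ((a - b) / 2)\<bar> * \<bar>cos ((a + b) / 2)\<bar>"
    unfolding sin_diff_sin by (simp add: abs_mult)
  also have "\<dots> \<le> 2 * \<bar>(a - b) / 2\<bar> * 1"
    by (intro mult_mono abs_sin_x_le_abs_x) auto
  finally show ?thesis by simp
qed

text \<open>The left side is below both 1 and y, and \<open>y powr k\<close> lies above the smaller
  of these for 0 < k \<le> 1.\<close>

lemma one_minus_exp_le_powr:
  fixes y k :: real
  assumes "y > 0" "0 < k" "k \<le> 1"
  shows "1 - exp (- y) \<le> y powr k"
proof (cases "y \<le> 1")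
  case True
  have "1 - exp (- y) \<le> y" using exp_ge_add_one_self[of "- y"] by simp
  also have "y = y powr 1" using assms by simp
  also have "\<dots> \<le> y powr k" using True assms by (intro powr_mono') auto
  finally show ?thesis .
next
  case False
  have "1 - exp (- y) \<le> 1" by simp
  also have "\<dots> \<le> y powr k" using False assms by (intro ge_one_powr_ge_zero) auto
  finally show ?thesis .
qed

context stable_params
begin

text \<open>The pointwise bound 1 - exp (- s x) \<le> (s x)^k is integrated against the density,
  whose moment of order k is finite for k < 2b.\<close>

lemma G_Hoelder:
  assumes k: "0 < k" "k < 2 * b" and x: "x > 0"
  shows "\<bar>G \<alpha> \<rho> 0 - G \<alpha> \<rho> x\<bar> \<le> x powr k * (LBINT t. g (exp t) * exp t * exp (k * t))"
proof -
  have i0: "integrable lborel (\<lambda>t. exp (- exp t * 0) * (g (exp t) * exp t))" by (rule G_integrand_integrable) simp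
  have ix: "integrable lborel (\<lambda>t. exp (- exp t * x) * (g (exp t) * exp t))" by (rule G_integrand_integrable) (use x in simp)
  have "G \<alpha> \<rho> 0 - G \<alpha> \<rho> x = (LBINT t. exp (- exp t * 0) * (g (exp t) * exp t) - exp (- exp t * x) * (g (exp t) * exp t))"
    unfolding G_eq by (rule Bochner_Integration.integral_diff[OF i0 ix, symmetric])
  also have "\<dots> \<le> (LBINT t. x powr k * (g (exp t) * exp t * exp (k * t)))"
  proof (rule integral_mono[OF Bochner_Integration.integrable_diff[OF i0 ix]])
    show "integrable lborel (\<lambda>t. x powr k * (g (exp t) * exp t * exp (k * t)))"
      using k b by (intro integrable_mult_right g_moment_integrable) auto
    fix t
    have "1 - exp (- (exp t * x)) \<le> (exp t * x) powr k"
      using x k b by (intro one_minus_exp_le_powr) auto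
    also have "\<dots> = exp (k * t) * x powr k" using x by (simp add: powr_def ln_mult distrib_left exp_add)
    finally have "(1 - exp (- (exp t * x))) * (g (exp t) * exp t) \<le> (exp (k * t) * x powr k) * (g (exp t) * exp t)"
      by (rule mult_right_mono) (simp add: g_nonneg)
    then show "exp (- exp t * 0) * (g (exp t) * exp t) - exp (- exp t * x) * (g (exp t) * exp t) \<le> x powr k * (g (exp t) * exp t * exp (k * t))"
      by (simp add: algebra_simps)
  qed
  also have "\<dots> = x powr k * (LBINT t. g (exp t) * exp t * exp (k * t))" by (rule integral_mult_right_zero)
  finally show ?thesis using G_bounds(2)[of x] x by simp
qed

text \<open>For x \<le> 1 the value \<open>F x\<close> is the difference from
  \<open>F 0 = 0\<close>, hence of order x^k; for x \<ge> 1 the function is bounded since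
  \<open>cos \<theta> \<le> 0\<close>. The factor exp (k * min t 0) records both cases at x = exp
  t.\<close>

lemma F_bound:
  assumes k: "0 < k" "k < 2 * b" and c: "cos \<theta> \<le> 0"
  obtains D where "D > 0" "\<And>t. norm (F \<alpha> \<rho> (exp t)) \<le> D * exp (k * min t 0)"
proof -
  define J where "J = (LBINT t. g (exp t) * exp t * exp (k * t))"
  define D where "D = 3 + norm k0 * (\<bar>J\<bar> + G \<alpha> \<rho> 0)"
  have G0: "G \<alpha> \<rho> 0 \<ge> 0" using G_bounds(1)[of 0] by simp
  have D: "D > 0" unfolding D_def using G0 by (intro add_pos_nonneg mult_nonneg_nonneg) auto
  have c1: "\<bar>cos \<theta>\<bar> \<le> 1" "\<bar>sin \<theta>\<bar> \<le> 1" by auto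
  have "norm (F \<alpha> \<rho> (exp t)) \<le> D * exp (k * min t 0)" for t
  proof (cases "t \<ge> 0")
    case True
    define x where "x = exp t"
    have x: "x > 0" by (simp add: x_def)
    have xc: "exp (x * cos \<theta>) \<le> 1" using c x by (simp add: mult_nonneg_nonpos)
    have "norm (F \<alpha> \<rho> x) \<le> norm (complex_of_real (exp (x * cos \<theta>) * sin (x * sin \<theta> + \<phi>))) + norm (k0 * of_real (G \<alpha> \<rho> x))"
      unfolding F_eq by (rule norm_triangle_ineq4)
    also have "norm (complex_of_real (exp (x * cos \<theta>) * sin (x * sin \<theta> + \<phi>))) \<le> 1 * 1"
      unfolding norm_of_real abs_mult using xc by (intro mult_mono) auto
    also have "norm (k0 * of_real (G \<alpha> \<rho> x)) \<le> norm k0 * G \<alpha> \<rho> 0"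
      unfolding norm_mult norm_of_real using G_bounds[of x] x by (intro mult_left_mono) auto
    also have "1 * 1 + norm k0 * G \<alpha> \<rho> 0 \<le> D" by (simp add: D_def distrib_left)
    finally show ?thesis using True by (simp add: x_def)
  next
    case False
    define x where "x = exp t"
    have x: "x > 0" "x \<le> 1" using False by (auto simp: x_def)
    have xk: "x powr k = exp (k * min t 0)" using False by (simp add: x_def powr_def)
    have xle: "x \<le> x powr k"
      using x k b powr_mono'[of k 1 x] by simp
    have d: "F \<alpha> \<rho> x = of_real (exp (x * cos \<theta>) * sin (x * sin \<theta> + \<phi>) - sin \<phi>) + k0 * of_real (G \<alpha> \<rho> 0 - G \<alpha> \<rho> x)"
      unfolding F_eq using F_at_0 by (simp add: algebra_simps)
    have "\<bar>exp (x * cos \<theta>) * sin (x * sin \<theta> + \<phi>) - sin \<phi>\<bar> \<le> 2 * x"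
    proof -
      have "exp (x * cos \<theta>) * sin (x * sin \<theta> + \<phi>) - sin \<phi> = (exp (x * cos \<theta>) - 1) * sin (x * sin \<theta> + \<phi>) + (sin (x * sin \<theta> + \<phi>) - sin \<phi>)"
        by (simp add: algebra_simps)
      then have "\<bar>exp (x * cos \<theta>) * sin (x * sin \<theta> + \<phi>) - sin \<phi>\<bar> \<le> \<bar>exp (x * cos \<theta>) - 1\<bar> * \<bar>sin (x * sin \<theta> + \<phi>)\<bar> + \<bar>sin (x * sin \<theta> + \<phi>) - sin \<phi>\<bar>"
        by (metis abs_mult abs_triangle_ineq)
      also have "\<bar>exp (x * cos \<theta>) - 1\<bar> * \<bar>sin (x * sin \<theta> + \<phi>)\<bar> \<le> x * 1"
      proof (intro mult_mono)
        have "exp (x * cos \<theta>) \<le> 1" using c x by (simp add: mult_nonneg_nonpos)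
        moreover have "x * cos \<theta> \<ge> x * (- 1)" using c1 x by (intro mult_left_mono) auto
        ultimately show "\<bar>exp (x * cos \<theta>) - 1\<bar> \<le> x"
          using exp_ge_add_one_self[of "x * cos \<theta>"] by linarith
      qed (use x in auto)
      also have "\<bar>sin (x * sin \<theta> + \<phi>) - sin \<phi>\<bar> \<le> x * 1"
      proof -
        have "\<bar>sin (x * sin \<theta> + \<phi>) - sin \<phi>\<bar> \<le> \<bar>x * sin \<theta>\<bar>"
          using abs_sin_diff_le[of "x * sin \<theta> + \<phi>" \<phi>] by simp
        also have "\<dots> \<le> x * 1" unfolding abs_mult using x c1 by (intro mult_mono) auto
        finally show ?thesis .
      qed
      finally show ?thesis by simp
    qed
    then have s: "norm (complex_of_real (exp (x * cos \<theta>) * sin (x * sin \<theta> + \<phi>) - sin \<phi>)) \<le> 2 * x powr k"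
      unfolding norm_of_real using xle by linarith
    have "norm (k0 * of_real (G \<alpha> \<rho> 0 - G \<alpha> \<rho> x)) \<le> norm k0 * (x powr k * \<bar>J\<bar>)"
      unfolding norm_mult norm_of_real
    proof (rule mult_left_mono)
      have "x powr k * J \<le> x powr k * \<bar>J\<bar>" by (intro mult_left_mono) auto
      then show "\<bar>G \<alpha> \<rho> 0 - G \<alpha> \<rho> x\<bar> \<le> x powr k * \<bar>J\<bar>"
        using G_Hoelder[OF k x(1)] unfolding J_def[symmetric] by linarith
    qed simp
    then have "norm (F \<alpha> \<rho> x) \<le> 2 * x powr k + norm k0 * (x powr k * \<bar>J\<bar>)"
      unfolding d using s norm_triangle_mono by blast
    also have "\<dots> = (2 + norm k0 * \<bar>J\<bar>) * x powr k" by (simp add: algebra_simps)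
    also have "\<dots> \<le> D * x powr k" using G0 by (intro mult_right_mono) (auto simp: D_def distrib_left intro!: add_nonneg_nonneg)
    finally show ?thesis unfolding xk by (simp add: x_def)
  qed
  then show ?thesis using that D by blast
qed

lemma F_measurable: "(\<lambda>x. indicator {0<..} x *\<^sub>R F \<alpha> \<rho> x) \<in> borel_measurable borel"
proof -
  have "(\<lambda>x. indicator {0<..} x *\<^sub>R complex_of_real (exp (x * cos \<theta>) * sin (x * sin \<theta> + \<phi>)) - k0 * complex_of_real (indicator {0<..} x * G \<alpha> \<rho> x)) \<in> borel_measurable borel"
    using G_measurable by measurable
  moreover have "(\<lambda>x. indicator {0<..} x *\<^sub>R complex_of_real (exp (x * cos \<theta>) * sin (x * sin \<theta> + \<phi>)) - k0 * complex_of_real (indicator {0<..} x * G \<alpha> \<rho> x)) = (\<lambda>x. indicator {0<..} x *\<^sub>R F \<alpha> \<rho> x)"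
    by (rule ext) (simp add: F_eq scaleR_conv_of_real algebra_simps)
  ultimately show ?thesis by simp
qed

lemma powr_indicator_measurable: "(\<lambda>x. indicator {0<..} x *\<^sub>R (complex_of_real x powr w)) \<in> borel_measurable borel"
  by (rule borel_measurable_continuous_on_indicator) (auto intro!: continuous_intros)

lemma F_Mellin_integrable:
  assumes z: "- (2 * b) < Re z" "Re z < 0" and c: "cos \<theta> \<le> 0"
  shows "set_integrable lborel {0<..} (\<lambda>x. of_real x powr (z - 1) * F \<alpha> \<rho> x)"
proof -
  \<comment> \<open>The midpoint between - Re z and 2b, so that k < 2b and k + Re z > 0 hold
    together.\<close>
  define k where "k = (2 * b - Re z) / 2"
  have k: "0 < k" "k < 2 * b" "k + Re z > 0" using z b(1) unfolding k_def by (simp_all add: field_simps)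
  obtain D where D: "D > 0" "\<And>t. norm (F \<alpha> \<rho> (exp t)) \<le> D * exp (k * min t 0)"
    by (rule F_bound[OF k(1,2) c]) (rule that)
  define \<delta> where "\<delta> = min (k + Re z) (- Re z)"
  have \<delta>: "\<delta> > 0" using k z by (simp add: \<delta>_def)
  have m: "(\<lambda>x. indicator {0<..} x *\<^sub>R (of_real x powr (z - 1) * F \<alpha> \<rho> x)) \<in> borel_measurable borel"
  proof -
    have "(\<lambda>x. (indicator {0<..} x *\<^sub>R (complex_of_real x powr (z - 1))) * (indicator {0<..} x *\<^sub>R F \<alpha> \<rho> x)) \<in> borel_measurable borel"
      using powr_indicator_measurable F_measurable by (rule borel_measurable_times)
    moreover have "(\<lambda>x. (indicator {0<..} x *\<^sub>R (complex_of_real x powr (z - 1))) * (indicator {0<..} x *\<^sub>R F \<alpha> \<rho> x)) = (\<lambda>x. indicator {0<..} x *\<^sub>R (of_real x powr (z - 1) * F \<alpha> \<rho> x))"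
      by (rule ext) (simp add: indicator_def)
    ultimately show ?thesis by simp
  qed
  then have m': "set_borel_measurable borel {0<..} (\<lambda>x. of_real x powr (z - 1) * F \<alpha> \<rho> x)"
    by (simp add: set_borel_measurable_def)
  have "integrable lborel (\<lambda>t. exp t *\<^sub>R (of_real (exp t) powr (z - 1) * F \<alpha> \<rho> (exp t)))"
  proof (rule Bochner_Integration.integrable_bound[OF integrable_mult_right[OF integrable_exp_neg_abs[OF \<delta>], of D]])
    have e: "(exp :: real \<Rightarrow> real) \<in> borel \<rightarrow>\<^sub>M borel"
      by (intro borel_measurable_continuous_onI continuous_on_exp continuous_on_id)
    have "(\<lambda>t. exp t *\<^sub>R ((\<lambda>x. indicator {0<..} x *\<^sub>R (of_real x powr (z - 1) * F \<alpha> \<rho> x)) (exp t))) \<in> borel_measurable borel"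
      by (intro borel_measurable_scaleR e measurable_compose[OF e m])
    then show "(\<lambda>t. exp t *\<^sub>R (of_real (exp t) powr (z - 1) * F \<alpha> \<rho> (exp t))) \<in> borel_measurable lborel" by simp
    show "AE t in lborel. norm (exp t *\<^sub>R (of_real (exp t) powr (z - 1) * F \<alpha> \<rho> (exp t))) \<le> norm (D * exp (- \<delta> * \<bar>t\<bar>))"
    proof (rule AE_I2)
      fix t :: real
      have "norm (exp t *\<^sub>R (complex_of_real (exp t) powr (z - 1) * F \<alpha> \<rho> (exp t))) = exp t * (exp t powr (Re z - 1) * norm (F \<alpha> \<rho> (exp t)))"
        by (simp add: norm_mult norm_powr_real_powr)
      also have "\<dots> = exp (Re z * t) * norm (F \<alpha> \<rho> (exp t))"
        by (simp add: powr_def left_diff_distrib exp_diff)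
      also have "\<dots> \<le> exp (Re z * t) * (D * exp (k * min t 0))"
        by (intro mult_left_mono D(2)) auto
      also have "\<dots> = D * exp (Re z * t + k * min t 0)" by (simp add: exp_add)
      also have "\<dots> \<le> D * exp (- \<delta> * \<bar>t\<bar>)"
      proof -
        have "Re z * t + k * min t 0 \<le> - \<delta> * \<bar>t\<bar>"
        proof (cases "t \<ge> 0")
          case True
          have "Re z * t \<le> - \<delta> * t" using True by (intro mult_right_mono) (auto simp: \<delta>_def)
          then show ?thesis using True by simp
        next
          case False
          have "(k + Re z) * t \<le> \<delta> * t" using False by (intro mult_right_mono_neg) (auto simp: \<delta>_def)
          then show ?thesis using False by (simp add: algebra_simps)
        qed
        then show ?thesis using D(1) by simp
      qed
      finally show "norm (exp t *\<^sub>R (of_real (exp t) powr (z - 1) * F \<alpha> \<rho> (exp t))) \<le> norm (D * exp (- \<delta> * \<bar>t\<bar>))"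
        using D(1) by simp
    qed
  qed
  then show ?thesis using exp_substitution(1)[OF m'] by simp
qed

text \<open>The Mellin transform of the Laplace transform, with w = exp u. It converges for -2b < Re
  z < 1, beyond the strip of (ii); the extra room lets it be shifted by 1 and examined at its
  pole.\<close>

definition M :: "complex \<Rightarrow> complex" where
  "M z = (LBINT u. exp ((1 - z) * of_real u) * h (of_real u))"

text \<open>Fubini: integrating exp ((1 - z) u - x exp u) over \<open>u\<close> gives Gamma (1 - z)
  x^(z-1), while integrating \<open>F\<close> against exp (- x exp u) gives \<open>h u\<close>. For
  \<open>cos \<theta> \<le> 0\<close> the latter is available at every real
  \<open>u\<close>.\<close>

lemma F_Mellin_eq_M:
  assumes z: "- (2 * b) < Re z" "Re z < 0" and c: "cos \<theta> \<le> 0"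
  shows "Gamma (1 - z) * (LBINT x:{0<..}. of_real x powr (z - 1) * F \<alpha> \<rho> x) = M z"
proof -
  let ?k = "\<lambda>x u. exp ((1 - z) * of_real u) * complex_of_real (exp (- exp u * x))"
  let ?f = "\<lambda>x u. (indicat_real {0<..} x *\<^sub>R F \<alpha> \<rho> x) * ?k x u"
  have w: "Re (1 - z) > 0" "Re (of_real (1 - Re z)) > 0" using z by auto
  have nk: "norm (?k x u) = Re (exp (of_real (1 - Re z) * of_real u) * complex_of_real (exp (- exp u * x)))" for x u
  proof -
    have "exp (of_real (1 - Re z) * of_real u) * complex_of_real (exp (- exp u * x)) = of_real (exp ((1 - Re z) * u) * exp (- exp u * x))"
      by (simp only: of_real_mult[symmetric] exp_of_real)
    then show ?thesis by (simp add: norm_mult)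
  qed
  have ink: "(LBINT u. norm (?k x u)) = Re (Gamma (of_real (1 - Re z))) * x powr (Re z - 1)" if x: "x > 0" for x
  proof -
    have "(LBINT u. norm (?k x u)) = Re (LBINT u. exp (of_real (1 - Re z) * of_real u) * complex_of_real (exp (- exp u * x)))"
      unfolding nk by (rule integral_Re) (rule Gamma_integral_exp(1)[OF w(2) x])
    also have "\<dots> = Re (Gamma (of_real (1 - Re z)) * of_real x powr (- of_real (1 - Re z)))"
      by (subst Gamma_integral_exp(2)[OF w(2) x]) simp
    also have "complex_of_real x powr (- of_real (1 - Re z)) = of_real (x powr (Re z - 1))"
      using x by (simp add: powr_of_real[symmetric])
    finally show ?thesis by simp
  qed
  have "integrable lborel (\<lambda>x. norm (indicat_real {0<..} x *\<^sub>R (of_real x powr (z - 1) * F \<alpha> \<rho> x)))"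
    using F_Mellin_integrable[OF z c] unfolding set_integrable_def by (rule integrable_norm)
  then have "integrable lborel (\<lambda>x. Re (Gamma (of_real (1 - Re z))) * norm (indicat_real {0<..} x *\<^sub>R (complex_of_real x powr (z - 1) * F \<alpha> \<rho> x)))"
    by (rule integrable_mult_right)
  moreover have "Re (Gamma (of_real (1 - Re z))) * norm (indicat_real {0<..} x *\<^sub>R (complex_of_real x powr (z - 1) * F \<alpha> \<rho> x)) = (LBINT u. norm (?f x u))" for x
  proof (cases "x > 0")
    case True
    have A: "(LBINT u. norm (?f x u)) = norm (F \<alpha> \<rho> x) * (LBINT u. norm (?k x u))"
      unfolding norm_mult[of "indicat_real {0<..} x *\<^sub>R F \<alpha> \<rho> x"] using True by simp
    show ?thesis unfolding A ink[OF True] using True by (simp add: norm_mult norm_powr_real_powr)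
  qed simp
  ultimately have i1: "integrable lborel (\<lambda>x. LBINT u. norm (?f x u))" by (simp only:)
  have prod: "integrable (lborel \<Otimes>\<^sub>M lborel) (\<lambda>(x, u). ?f x u)"
  proof (rule lborel_pair.Fubini_integrable)
    show "(\<lambda>(x, u). ?f x u) \<in> borel_measurable (lborel \<Otimes>\<^sub>M lborel)" using F_measurable by measurable
    show "integrable lborel (\<lambda>x. \<integral>u. norm (case (x, u) of (x, u) \<Rightarrow> ?f x u) \<partial>lborel)" using i1 by simp
    show "AE x in lborel. integrable lborel (\<lambda>u. case (x, u) of (x, u) \<Rightarrow> ?f x u)"
    proof (rule AE_I2)
      fix x :: real
      show "integrable lborel (\<lambda>u. case (x, u) of (x, u) \<Rightarrow> ?f x u)"
      proof (cases "x > 0")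
        case True
        show ?thesis unfolding prod.case by (rule integrable_mult_right[OF Gamma_integral_exp(1)[OF w(1) True]])
      qed simp
    qed
  qed
  have "Gamma (1 - z) * (LBINT x:{0<..}. of_real x powr (z - 1) * F \<alpha> \<rho> x) = (LBINT x. Gamma (1 - z) * (indicat_real {0<..} x *\<^sub>R (of_real x powr (z - 1) * F \<alpha> \<rho> x)))"
    unfolding set_lebesgue_integral_def by (rule integral_mult_right_zero[symmetric])
  also have "\<dots> = (LBINT x. LBINT u. ?f x u)"
  proof (rule Bochner_Integration.integral_cong[OF refl])
    fix x :: real
    show "Gamma (1 - z) * (indicat_real {0<..} x *\<^sub>R (of_real x powr (z - 1) * F \<alpha> \<rho> x)) = (LBINT u. ?f x u)"
    proof (cases "x > 0")
      case True
      have A: "(LBINT u. ?f x u) = F \<alpha> \<rho> x * (LBINT u. ?k x u)"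
        using True by simp
      show ?thesis unfolding A Gamma_integral_exp(2)[OF w(1) True] using True by simp
    qed simp
  qed
  also have "\<dots> = (LBINT u. LBINT x. ?f x u)"
    by (rule lborel_pair.Fubini_integral[OF prod, symmetric])
  also have "\<dots> = M z"
    unfolding M_def
  proof (rule Bochner_Integration.integral_cong[OF refl])
    fix u :: real
    have "max 0 (cos \<theta>) < exp u" using c by simp
    have "(LBINT x. ?f x u) = (LBINT x. exp ((1 - z) * of_real u) * (indicat_real {0<..} x *\<^sub>R (of_real (exp (- exp u * x)) * F \<alpha> \<rho> x)))"
      by (rule Bochner_Integration.integral_cong) (auto simp: indicator_def)
    also have "\<dots> = exp ((1 - z) * of_real u) * (LBINT x:{0<..}. of_real (exp (- exp u * x)) * F \<alpha> \<rho> x)"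
      unfolding set_lebesgue_integral_def by (rule integral_mult_right_zero)
    also have "(LBINT x:{0<..}. of_real (exp (- exp u * x)) * F \<alpha> \<rho> x) = h (of_real u)"
      using F_Laplace(2)[OF \<open>max 0 (cos \<theta>) < exp u\<close>] by simp
    finally show "(LBINT x. ?f x u) = exp ((1 - z) * of_real u) * h (of_real u)" .
  qed
  finally show ?thesis .
qed

end

text \<open>Integrating against the difference of two cotangents, which decays like
  \<open>exp (- 2 * pi * \<bar>Im z\<bar>)\<close>, any slower exponential growth of \<open>R\<close> can be allowed.\<close>
lemma periodic_strip_constant_nonzero:
  fixes R :: "complex \<Rightarrow> complex"
  assumes x: "a < x0" "x0 + 1 < b"
    and hol: "R holomorphic_on {z. a < Re z \<and> Re z < b}"
    and per: "\<And>z. Re z = x0 \<Longrightarrow> R (z + 1) = R z"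
    and c: "c < 2 * pi"
    and bd: "\<And>z. x0 \<le> Re z \<Longrightarrow> Re z \<le> x0 + 1 \<Longrightarrow> norm (R z) \<le> C * exp (c * \<bar>Im z\<bar>)"
    and z0: "x0 < Re z0" "Re z0 < x0 + 1" and z1: "x0 < Re z1" "Re z1 < x0 + 1"
    and nz01: "R z0 \<noteq> 0" "R z1 \<noteq> 0"
  shows "R z0 = R z1"
proof (cases "z0 = z1")
  case False
  define s where "s = (\<lambda>p z. sin (of_real pi * (z - p)) :: complex)"
  \<comment> \<open>Setting u = i z turns vertical lines into the horizontal ones of
    \<open>strip_residue\<close>. The quotient of sines is cot (pi (z - z0)) - cot (pi (z - z1)),
    with opposite residues at z0 and z1.\<close>
  define f where "f = (\<lambda>u. R (- \<i> * u) * sin (of_real pi * (z0 - z1)) / (s z0 (- \<i> * u) * s z1 (- \<i> * u)))"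
  \<comment> \<open>In this strip all real parts are within distance 1 of Re z0 and Re z1, so the
    two sines have no zeros besides z0 and z1.\<close>
  define a' b' where "a' = max a (max (Re z0) (Re z1) - 1)" and "b' = min b (min (Re z0) (Re z1) + 1)"
  have ab: "a' < x0" "x0 < x0 + 1" "x0 + 1 < b'" using x z0 z1 by (auto simp: a'_def b'_def)
  let ?S = "{u. a' < Im u \<and> Im u < b'}"
  let ?P = "{\<i> * z0, \<i> * z1}"
  have sz: "z = p" if s0: "s p z = 0" and lt1: "\<bar>Re z - Re p\<bar> < 1" for p z
  proof -
    obtain n where n: "of_real pi * (z - p) = of_real (real_of_int n * pi)"
      using s0 unfolding s_def sin_eq_0 by blast
    then have "of_real pi * (z - p) = of_real pi * of_int n" by (simp add: mult.commute)
    then have zn: "z - p = of_int n" by simp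
    then have "Re z - Re p = of_int n" by (metis Re_complex_of_real minus_complex.simps(1) of_real_of_int_eq)
    then have "\<bar>real_of_int n\<bar> < 1" using lt1 by simp
    then have "n = 0" by linarith
    then show ?thesis using zn by simp
  qed
  have inS: "a < Re (- \<i> * u)" "Re (- \<i> * u) < b" "\<bar>Re (- \<i> * u) - Re z0\<bar> < 1" "\<bar>Re (- \<i> * u) - Re z1\<bar> < 1"
    if "u \<in> ?S" for u
    using that by (auto simp: a'_def b'_def abs_less_iff)
  have Rc: "(\<lambda>u. R (- \<i> * u)) holomorphic_on ?S"
  proof -
    have "R \<circ> (\<lambda>u. - \<i> * u) holomorphic_on ?S"
    proof (rule holomorphic_on_compose_gen[OF _ hol])
      show "(\<lambda>u. - \<i> * u) ` ?S \<subseteq> {z. a < Re z \<and> Re z < b}" using inS by blast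
    qed (intro holomorphic_intros)
    then show ?thesis by (simp add: comp_def)
  qed
  have sne: "s z0 (- \<i> * u) \<noteq> 0 \<or> u = \<i> * z0" "s z1 (- \<i> * u) \<noteq> 0 \<or> u = \<i> * z1" if "u \<in> ?S" for u
  proof -
    have i: "u = \<i> * p" if "- \<i> * u = p" for p using that by auto
    show "s z0 (- \<i> * u) \<noteq> 0 \<or> u = \<i> * z0" using sz[of z0 "- \<i> * u"] inS(3)[OF that] i by blast
    show "s z1 (- \<i> * u) \<noteq> 0 \<or> u = \<i> * z1" using sz[of z1 "- \<i> * u"] inS(4)[OF that] i by blast
  qed
  have hols: "(\<lambda>u. s p (- \<i> * u)) holomorphic_on A" for p A
    unfolding s_def by (intro holomorphic_intros)
  have holf: "f holomorphic_on ?S - ?P"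
    unfolding f_def
  proof (intro holomorphic_on_divide holomorphic_on_mult hols holomorphic_on_const)
    show "(\<lambda>u. R (- \<i> * u)) holomorphic_on ?S - ?P" by (rule holomorphic_on_subset[OF Rc]) auto
    show "s z0 (- \<i> * u) * s z1 (- \<i> * u) \<noteq> 0" if "u \<in> ?S - ?P" for u using sne[of u] that by auto
  qed
  define Y where "Y = 1 + \<bar>Im z0\<bar> + \<bar>Im z1\<bar>"
  have slow: "exp (pi * \<bar>Im z\<bar>) * exp (- pi * Y) / 4 \<le> norm (s p z)" if "p = z0 \<or> p = z1" "\<bar>Im z\<bar> \<ge> Y" for p z
  proof -
    have d: "\<bar>Im z\<bar> - Y + 1 \<le> \<bar>Im (z - p)\<bar>" using that by (auto simp: Y_def)
    have "s p z = - \<i> * sinh (\<i> * (of_real pi * (z - p)))" unfolding s_def sinh_conv_sin by simp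
    then have ns: "norm (s p z) = norm (sinh (\<i> * (of_real pi * (z - p))))" by (simp add: norm_mult)
    have sg: "sinh \<bar>Re (\<i> * (of_real pi * (z - p)))\<bar> \<le> norm (sinh (\<i> * (of_real pi * (z - p))))" by (rule norm_sinh_ge)
    have re: "\<bar>Re (\<i> * (of_real pi * (z - p)))\<bar> = pi * \<bar>Im (z - p)\<bar>" by (simp add: abs_mult abs_minus_commute)
    have "sinh (pi * \<bar>Im (z - p)\<bar>) \<le> norm (s p z)" using sg unfolding re ns .
    moreover have "exp (pi * \<bar>Im (z - p)\<bar>) / 4 \<le> sinh (pi * \<bar>Im (z - p)\<bar>)"
    proof (rule sinh_ge_exp)
      have "1 * 1 \<le> pi * \<bar>Im (z - p)\<bar>" using d that(2) pi_ge_two by (intro mult_mono) linarith+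
      then show "1 \<le> pi * \<bar>Im (z - p)\<bar>" by simp
    qed
    moreover have "exp (pi * \<bar>Im z\<bar>) * exp (- pi * Y) \<le> exp (pi * \<bar>Im (z - p)\<bar>)"
    proof -
      have "pi * (\<bar>Im z\<bar> - Y) \<le> pi * \<bar>Im (z - p)\<bar>" using d by (intro mult_left_mono) auto
      then show ?thesis by (simp add: exp_add[symmetric] right_diff_distrib)
    qed
    ultimately show ?thesis by linarith
  qed
  define K where "K = \<bar>C\<bar> * norm (sin (of_real pi * (z0 - z1))) * (16 * exp (2 * pi * Y))"
  have bdf: "norm (f u) \<le> K * exp (- (2 * pi - c) * \<bar>Re u\<bar>)"
    if u: "x0 \<le> Im u" "Im u \<le> x0 + 1" "Y \<le> \<bar>Re u\<bar>" for u
  proof -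
    define z where "z = - \<i> * u"
    have z: "Re z = Im u" "\<bar>Im z\<bar> = \<bar>Re u\<bar>" by (simp_all add: z_def)
    define e where "e = exp (pi * \<bar>Im z\<bar>) * exp (- pi * Y) / 4"
    have e: "e > 0" by (simp add: e_def)
    have "norm (R z) \<le> C * exp (c * \<bar>Im z\<bar>)" using u z by (intro bd) auto
    also have "\<dots> \<le> \<bar>C\<bar> * exp (c * \<bar>Im z\<bar>)" by (intro mult_right_mono) auto
    finally have Rz: "norm (R z) \<le> \<bar>C\<bar> * exp (c * \<bar>Im z\<bar>)" .
    have "norm (f u) = norm (R z) * norm (sin (of_real pi * (z0 - z1))) / (norm (s z0 z) * norm (s z1 z))"
      unfolding f_def z_def[symmetric] by (simp add: norm_mult norm_divide)
    also have "\<dots> \<le> (\<bar>C\<bar> * exp (c * \<bar>Im z\<bar>)) * norm (sin (of_real pi * (z0 - z1))) / (e * e)"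
      using Rz slow[of z0 z] slow[of z1 z] u z e unfolding e_def[symmetric]
      by (intro frac_le mult_right_mono mult_mono mult_pos_pos mult_nonneg_nonneg) auto
    also have "\<dots> = \<bar>C\<bar> * norm (sin (of_real pi * (z0 - z1))) * (exp (c * \<bar>Im z\<bar>) / (e * e))" by simp
    also have "exp (c * \<bar>Im z\<bar>) / (e * e) = 16 * exp (c * \<bar>Im z\<bar> - (pi * \<bar>Im z\<bar> + - pi * Y + (pi * \<bar>Im z\<bar> + - pi * Y)))"
      unfolding e_def exp_diff exp_add by simp
    also have "c * \<bar>Im z\<bar> - (pi * \<bar>Im z\<bar> + - pi * Y + (pi * \<bar>Im z\<bar> + - pi * Y)) = 2 * pi * Y + - (2 * pi - c) * \<bar>Im z\<bar>"
      by (simp add: algebra_simps)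
    finally show ?thesis unfolding exp_add z(2) K_def by (simp only: mult.assoc)
  qed
  have prem: "finite ?P" "\<And>p. p \<in> ?P \<Longrightarrow> x0 < Im p \<and> Im p < x0 + 1" "0 < 2 * pi - c"
    using z0 z1 c by auto
  have SR: "(LBINT t. f (Complex t x0)) - (LBINT t. f (Complex t (x0 + 1))) = 2 * pi * \<i> * (\<Sum>p\<in>?P. residue f p)"
    by (rule strip_residue(3)[OF ab prem(1,2) holf prem(3) bdf])
  \<comment> \<open>Both sines change sign under the period, so their product does not. The two
    edges therefore carry the same integral and the residues add up to 0.\<close>
  have "f (Complex t (x0 + 1)) = f (Complex t x0)" for t
  proof -
    have 1: "- \<i> * Complex t (x0 + 1) = - \<i> * Complex t x0 + 1" by (simp add: complex_eq_iff)
    have 2: "s p (z + 1) = - s p z" for p z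
    proof -
      have "of_real pi * (z + 1 - p) = of_real pi * (z - p) + of_real pi" by (simp add: algebra_simps)
      then show ?thesis unfolding s_def by (simp add: sin_add)
    qed
    have 3: "R (- \<i> * Complex t x0 + 1) = R (- \<i> * Complex t x0)" by (rule per) simp
    show ?thesis unfolding f_def 1 2 3 by simp
  qed
  then have "2 * pi * \<i> * (\<Sum>p\<in>?P. residue f p) = 0" using SR by simp
  then have sum0: "residue f (\<i> * z0) + residue f (\<i> * z1) = 0" using False by simp
  have sp: "sin (of_real pi * (z0 - z1)) \<noteq> 0"
    using sz[of z1 z0] False z0 z1 by (auto simp: s_def abs_less_iff)
  have sm: "s z0 z1 = - sin (of_real pi * (z0 - z1))" "s z1 z0 = sin (of_real pi * (z0 - z1))"
    unfolding s_def sin_minus[symmetric] by (simp_all add: algebra_simps)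
  have ii: "- \<i> * (\<i> * p) = p" for p by simp
  have ds: "((\<lambda>u. s p (- \<i> * u)) has_field_derivative - \<i> * of_real pi) (at (\<i> * p))" for p
    unfolding s_def by (auto intro!: derivative_eq_intros)
  have res: "residue f (\<i> * p) = R p * sin (of_real pi * (z0 - z1)) / s q p / (- \<i> * of_real pi)"
    if pq: "p = z0 \<and> q = z1 \<or> p = z1 \<and> q = z0" and nz: "R p \<noteq> 0" for p q
  proof -
    have fe: "f = (\<lambda>u. (R (- \<i> * u) * sin (of_real pi * (z0 - z1)) / s q (- \<i> * u)) / s p (- \<i> * u))"
      using pq by (auto simp: f_def fun_eq_iff mult_ac)
    have qp: "s q p \<noteq> 0" using pq sm sp by auto
    have pS: "\<i> * p \<in> ?S" using pq ab z0 z1 by (auto simp: a'_def b'_def)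
    obtain r where r: "r > 0" "ball (\<i> * p) r \<subseteq> ?S - {\<i> * q}"
    proof -
      have "open (?S - {\<i> * q})" by (intro open_delete open_horizontal_strip)
      moreover have "\<i> * p \<in> ?S - {\<i> * q}" using pS pq False by auto
      ultimately show ?thesis using that open_contains_ball by blast
    qed
    have "residue (\<lambda>u. (R (- \<i> * u) * sin (of_real pi * (z0 - z1)) / s q (- \<i> * u)) / s p (- \<i> * u)) (\<i> * p) =
       (R (- \<i> * (\<i> * p)) * sin (of_real pi * (z0 - z1)) / s q (- \<i> * (\<i> * p))) / (- \<i> * of_real pi)"
    proof (rule residue_simple_pole_deriv[where s = "ball (\<i> * p) r"])
      show "(\<lambda>u. R (- \<i> * u) * sin (of_real pi * (z0 - z1)) / s q (- \<i> * u)) holomorphic_on ball (\<i> * p) r"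
      proof (intro holomorphic_on_divide holomorphic_on_mult hols holomorphic_on_const)
        show "(\<lambda>u. R (- \<i> * u)) holomorphic_on ball (\<i> * p) r" by (rule holomorphic_on_subset[OF Rc]) (use r in auto)
        show "s q (- \<i> * u) \<noteq> 0" if "u \<in> ball (\<i> * p) r" for u
          using sne[of u] r(2) that pq by auto
      qed
      show "R (- \<i> * (\<i> * p)) * sin (of_real pi * (z0 - z1)) / s q (- \<i> * (\<i> * p)) \<noteq> 0"
        unfolding ii using nz qp sp by simp
      show "s p (- \<i> * (\<i> * p)) = 0" unfolding ii by (simp add: s_def)
    qed (use r ds hols in auto)
    then show ?thesis unfolding fe[symmetric] ii .
  qed
  have "R z0 * sin (of_real pi * (z0 - z1)) / s z1 z0 / (- \<i> * of_real pi) + R z1 * sin (of_real pi * (z0 - z1)) / s z0 z1 / (- \<i> * of_real pi) = 0"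
    using sum0 res[of z0 z1] res[of z1 z0] nz01 by simp
  then have "(R z0 - R z1) / (- \<i> * of_real pi) = 0"
    unfolding sm using sp by (simp add: diff_divide_distrib)
  then show ?thesis by simp
qed simp

text \<open>Adding a constant preserves the assumptions, and a suitable constant makes both values
  nonzero, as the residue formula demands. The growth exponent \<open>c \<ge> 0\<close> lets the
  constant be absorbed into the bound.\<close>

lemma periodic_strip_constant:
  fixes R :: "complex \<Rightarrow> complex"
  assumes x: "a < x0" "x0 + 1 < b"
    and hol: "R holomorphic_on {z. a < Re z \<and> Re z < b}"
    and per: "\<And>z. Re z = x0 \<Longrightarrow> R (z + 1) = R z"
    and c: "0 \<le> c" "c < 2 * pi"
    and bd: "\<And>z. x0 \<le> Re z \<Longrightarrow> Re z \<le> x0 + 1 \<Longrightarrow> norm (R z) \<le> C * exp (c * \<bar>Im z\<bar>)"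
    and z0: "x0 < Re z0" "Re z0 < x0 + 1" and z1: "x0 < Re z1" "Re z1 < x0 + 1"
  shows "R z0 = R z1"
proof -
  have "infinite (UNIV :: complex set)" by (rule infinite_UNIV_char_0)
  then obtain k where k: "k \<notin> {- R z0, - R z1}"
    by (metis ex_new_if_finite finite.emptyI finite.insertI)
  have "R z0 + k = R z1 + k"
  proof (rule periodic_strip_constant_nonzero[OF x, of "\<lambda>z. R z + k" c "C + norm k"])
    show "(\<lambda>z. R z + k) holomorphic_on {z. a < Re z \<and> Re z < b}" by (intro holomorphic_intros hol)
    show "norm (R z + k) \<le> (C + norm k) * exp (c * \<bar>Im z\<bar>)" if "x0 \<le> Re z" "Re z \<le> x0 + 1" for z
    proof -
      have "1 \<le> exp (c * \<bar>Im z\<bar>)" using c by simp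
      then have "norm k * 1 \<le> norm k * exp (c * \<bar>Im z\<bar>)" by (intro mult_left_mono) auto
      then show ?thesis using bd[OF that] norm_triangle_ineq[of "R z" k] unfolding distrib_right by linarith
    qed
    show "R z0 + k \<noteq> 0" "R z1 + k \<noteq> 0" using k by (auto simp: add_eq_0_iff)
  qed (use per c z0 z1 in auto)
  then show ?thesis by simp
qed

context stable_params
begin

section \<open>Difference equation\<close>

text \<open>On the real line \<open>h_of_real\<close> has no denominator left, so the estimate of
  \<open>h_bound\<close> extends to all real \<open>u\<close>.\<close>

lemma h_real_bound:
  obtains K where "K > 0" "\<And>u. norm (h (of_real u)) \<le> K * exp (- (b + 1 / 2) * (u + \<bar>u\<bar>))"
proof -
  have pb: "0 < 1 + \<alpha> / 2 + b" "1 + \<alpha> / 2 + b < 1 + \<alpha>" using b alpha by auto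
  obtain B where B: "B > 0"
    "\<And>z. 1 + \<alpha> / 2 + b \<le> Re z \<Longrightarrow> Re z \<le> 1 + \<alpha> / 2 + b \<Longrightarrow> norm (S2_strip \<alpha> z) \<le> B * exp (- (pi * \<bar>Im z\<bar> / \<alpha>) * (Re z - (1 + \<alpha>) / 2))"
    by (rule S2_strip_bounds[OF alpha(1) pb]) (rule that)
  show ?thesis
  proof (rule that[of "norm C0 * B\<^sup>2"])
    fix u :: real
    let ?E = "norm (S2_strip \<alpha> (Complex (1 + \<alpha> / 2 + b) (\<alpha> * u / (2 * pi))))"
    have e: "pi * \<bar>\<alpha> * u / (2 * pi)\<bar> / \<alpha> = \<bar>u\<bar> / 2" using alpha by (simp add: abs_mult)
    have "?E \<le> B * exp (- (\<bar>u\<bar> / 2) * (1 + \<alpha> / 2 + b - (1 + \<alpha>) / 2))"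
      using B(2)[of "Complex (1 + \<alpha> / 2 + b) (\<alpha> * u / (2 * pi))", unfolded complex.sel e] by simp
    then have "?E\<^sup>2 \<le> (B * exp (- (\<bar>u\<bar> / 2) * (1 + \<alpha> / 2 + b - (1 + \<alpha>) / 2)))\<^sup>2"
      by (intro power_mono) auto
    also have "\<dots> = B\<^sup>2 * exp (- (b + 1 / 2) * \<bar>u\<bar>)"
      unfolding power_mult_distrib exp_double[symmetric] by (simp add: field_simps)
    finally have E: "?E\<^sup>2 \<le> B\<^sup>2 * exp (- (b + 1 / 2) * \<bar>u\<bar>)" .
    have "norm (h (of_real u)) = norm C0 * (exp (- (b + 1 / 2) * u) * ?E\<^sup>2)"
      unfolding h_of_real norm_mult norm_of_real by simp
    also have "\<dots> \<le> norm C0 * (exp (- (b + 1 / 2) * u) * (B\<^sup>2 * exp (- (b + 1 / 2) * \<bar>u\<bar>)))"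
      by (intro mult_left_mono E) auto
    also have "\<dots> = norm C0 * B\<^sup>2 * exp (- (b + 1 / 2) * (u + \<bar>u\<bar>))"
      unfolding distrib_left exp_add by (simp only: mult_ac)
    finally show "norm (h (of_real u)) \<le> norm C0 * B\<^sup>2 * exp (- (b + 1 / 2) * (u + \<bar>u\<bar>))" .
  qed (use B C0_nonzero in simp)
qed

lemma h_real_continuous: "continuous_on UNIV (\<lambda>u. h (of_real u))"
  unfolding h_of_real using b alpha
  by (intro continuous_intros S2_strip_line_continuous) auto

lemma h_moment_integrable:
  assumes x: "- (2 * b) < x" "x < 1"
  shows "integrable lborel (\<lambda>u. exp ((1 - x) * u) * norm (h (of_real u)))"
proof -
  obtain K where K: "K > 0" "\<And>u. norm (h (of_real u)) \<le> K * exp (- (b + 1 / 2) * (u + \<bar>u\<bar>))"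
    by (rule h_real_bound) (rule that)
  define \<delta> where "\<delta> = min (x + 2 * b) (1 - x)"
  have \<delta>: "\<delta> > 0" using x by (simp add: \<delta>_def)
  have "integrable lborel (\<lambda>u. complex_of_real (exp ((1 - x) * u)) * h (of_real u))"
  proof (rule integrable_continuous_exp_decay[OF _ \<delta>, where X = 0 and C = K])
    show "continuous_on UNIV (\<lambda>u. complex_of_real (exp ((1 - x) * u)) * h (of_real u))"
      by (intro continuous_intros h_real_continuous)
    fix u :: real
    have "norm (complex_of_real (exp ((1 - x) * u)) * h (of_real u)) = exp ((1 - x) * u) * norm (h (of_real u))"
      by (simp add: norm_mult)
    also have "\<dots> \<le> exp ((1 - x) * u) * (K * exp (- (b + 1 / 2) * (u + \<bar>u\<bar>)))"
      by (intro mult_left_mono K(2)) auto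
    also have "\<dots> = K * exp ((1 - x) * u + - (b + 1 / 2) * (u + \<bar>u\<bar>))" unfolding exp_add by simp
    also have "\<dots> \<le> K * exp (- \<delta> * \<bar>u\<bar>)"
    proof -
      have "(1 - x) * u + - (b + 1 / 2) * (u + \<bar>u\<bar>) \<le> - \<delta> * \<bar>u\<bar>"
      proof (cases "u \<ge> 0")
        case True
        have "(1 - x) * u + - (b + 1 / 2) * (u + \<bar>u\<bar>) = - (x + 2 * b) * u" using True by (simp add: algebra_simps)
        also have "\<dots> \<le> - \<delta> * u" using True by (intro mult_right_mono) (auto simp: \<delta>_def)
        finally show ?thesis using True by simp
      next
        case False
        have "(1 - x) * u \<le> \<delta> * u" using False by (intro mult_right_mono_neg) (auto simp: \<delta>_def)
        then show ?thesis using False by simp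
      qed
      then show ?thesis using K(1) by simp
    qed
    finally show "norm (complex_of_real (exp ((1 - x) * u)) * h (of_real u)) \<le> K * exp (- \<delta> * \<bar>u\<bar>)" .
  qed
  from integrable_norm[OF this] show ?thesis by (simp add: norm_mult)
qed

lemma M_integrand_norm: "norm (exp ((1 - z) * of_real u) * h (of_real u)) = exp ((1 - Re z) * u) * norm (h (of_real u))"
  by (simp add: norm_mult)

lemma M_integrand_measurable: "(\<lambda>u. exp ((1 - z) * of_real u) * h (of_real u)) \<in> borel_measurable borel"
  by (intro borel_measurable_continuous_onI continuous_intros h_real_continuous)

lemma M_integrand_integrable:
  assumes z: "- (2 * b) < Re z" "Re z < 1"
  shows "integrable lborel (\<lambda>u. exp ((1 - z) * of_real u) * h (of_real u))"
proof (rule Bochner_Integration.integrable_bound[OF h_moment_integrable[OF z]])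
  show "(\<lambda>u. exp ((1 - z) * of_real u) * h (of_real u)) \<in> borel_measurable lborel"
    using M_integrand_measurable by simp
qed (intro AE_I2, simp only: M_integrand_norm, simp)

text \<open>For fixed \<open>u\<close> the exponential is monotone in x, so its values at the two
  ends dominate a whole vertical strip. The sum of both covers either sign of
  \<open>u\<close>.\<close>

lemma exp_convex_bound:
  fixes n u :: real
  assumes "x1 \<le> x" "x \<le> x2" and n: "n \<ge> 0"
  shows "exp ((1 - x) * u) * n \<le> exp ((1 - x1) * u) * n + exp ((1 - x2) * u) * n"
proof -
  have "exp ((1 - x) * u) \<le> exp ((1 - x1) * u) + exp ((1 - x2) * u)"
  proof (cases "u \<ge> 0")
    case True
    then have "exp ((1 - x) * u) \<le> exp ((1 - x1) * u)" using assms by (simp add: mult_right_mono)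
    then show ?thesis by (simp add: add_increasing2)
  next
    case False
    then have "exp ((1 - x) * u) \<le> exp ((1 - x2) * u)" using assms by (simp add: mult_right_mono_neg)
    then show ?thesis by (simp add: add_increasing)
  qed
  then show ?thesis unfolding distrib_right[symmetric] using n by (rule mult_right_mono)
qed

lemma M_holomorphic: "M holomorphic_on {z. - (2 * b) < Re z \<and> Re z < 1}"
proof (rule holomorphic_onI)
  let ?S = "{z. - (2 * b) < Re z \<and> Re z < 1}"
  fix z assume z: "z \<in> ?S"
  define r where "r = min (Re z + 2 * b) (1 - Re z) / 2"
  have r: "r > 0" "- (2 * b) < Re z - r" "Re z - r < 1" "- (2 * b) < Re z + r" "Re z + r < 1"
    using z by (auto simp: r_def min_def field_simps)
  have "((\<lambda>w. \<integral>u. exp ((1 - w) * of_real u) * h (of_real u) \<partial>lborel) has_field_derivative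
    (\<integral>u. deriv (\<lambda>w. exp ((1 - w) * of_real u) * h (of_real u)) z \<partial>lborel)) (at z)"
  proof (rule has_field_derivative_integral_param[OF open_vertical_strip z _ _
      Bochner_Integration.integrable_add[OF h_moment_integrable[OF r(2,3)] h_moment_integrable[OF r(4,5)]] r(1)])
    show "(\<lambda>u. exp ((1 - w) * of_real u) * h (of_real u)) \<in> borel_measurable lborel" for w
      using M_integrand_measurable by simp
    show "(\<lambda>w. exp ((1 - w) * of_real u) * h (of_real u)) holomorphic_on ?S" for u
      by (intro holomorphic_intros)
    fix w u assume w: "dist z w < r"
    have "\<bar>Re (w - z)\<bar> \<le> norm (w - z)" by (rule abs_Re_le_cmod)
    then have "Re z - r \<le> Re w" "Re w \<le> Re z + r" using w by (auto simp: dist_norm norm_minus_commute)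
    then show "norm (exp ((1 - w) * of_real u) * h (of_real u)) \<le> exp ((1 - (Re z - r)) * u) * norm (h (of_real u)) + exp ((1 - (Re z + r)) * u) * norm (h (of_real u))"
      unfolding M_integrand_norm by (rule exp_convex_bound[OF _ _ norm_ge_zero])
  qed
  then have "(M has_field_derivative (\<integral>u. deriv (\<lambda>w. exp ((1 - w) * of_real u) * h (of_real u)) z \<partial>lborel)) (at z)"
    unfolding M_def[abs_def] .
  then have "M field_differentiable at z" unfolding field_differentiable_def by (rule exI)
  then show "M field_differentiable at z within ?S" by (rule field_differentiable_at_within)
qed

lemma M_bounded:
  assumes x: "- (2 * b) < x1" "x1 < 1" "- (2 * b) < x2" "x2 < 1"
  obtains C where "C > 0" "\<And>z. x1 \<le> Re z \<Longrightarrow> Re z \<le> x2 \<Longrightarrow> norm (M z) \<le> C"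
proof -
  let ?g = "\<lambda>u. exp ((1 - x1) * u) * norm (h (of_real u)) + exp ((1 - x2) * u) * norm (h (of_real u))"
  have ig: "integrable lborel ?g"
    by (rule Bochner_Integration.integrable_add[OF h_moment_integrable[OF x(1,2)] h_moment_integrable[OF x(3,4)]])
  have g0: "(LBINT u. ?g u) \<ge> 0" by (intro integral_nonneg_AE AE_I2) simp
  show ?thesis
  proof (rule that[of "(LBINT u. ?g u) + 1"])
    fix z assume z: "x1 \<le> Re z" "Re z \<le> x2"
    have "norm (M z) \<le> (LBINT u. ?g u)"
      unfolding M_def
    proof (rule Bochner_Integration.integral_norm_bound_integral[OF _ ig])
      show "integrable lborel (\<lambda>u. exp ((1 - z) * of_real u) * h (of_real u))"
        by (rule M_integrand_integrable) (use x z in auto)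
      show "norm (exp ((1 - z) * of_real u) * h (of_real u)) \<le> ?g u" for u
        unfolding M_integrand_norm by (rule exp_convex_bound[OF z norm_ge_zero])
    qed
    then show "norm (M z) \<le> (LBINT u. ?g u) + 1" by simp
  qed (use g0 in linarith)
qed

text \<open>On the lines \<open>Im w = 0\<close> and \<open>Im w = 1\<close> this is a cosine times the squared modulus in \<open>h_of_real\<close>,
  so both boundary integrals of the shifted contour are combinations of \<open>M z\<close> and \<open>M (z + 1)\<close>.\<close>
definition q :: "complex \<Rightarrow> complex" where
  "q w = S2_strip \<alpha> (of_real (1 + \<alpha> / 2 + b) + \<i> * w) / (2 * S2_strip \<alpha> (of_real (1 + \<alpha> / 2 - b) + \<i> * w))"

text \<open>On the lower edge, reflection and a shift by 1 turn the denominator into a cosine and a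
  factor at \<open>cnj P\<close>. On the upper edge both arguments drop by 1: the numerator is
  raised again by the functional equation, and the denominator becomes the reflection of
  \<open>cnj P\<close>.\<close>

lemma q_edges:
  fixes t :: real
  defines "p \<equiv> complex_of_real ((norm (S2_strip \<alpha> (Complex (1 + \<alpha> / 2 + b) (\<alpha> * t / (2 * pi)))))\<^sup>2)"
    and "\<beta> \<equiv> complex_of_real (pi * b / \<alpha>)"
  shows "q (of_real (\<alpha> * t / (2 * pi))) = p * cos (- \<beta> + \<i> * of_real t / 2)"
    and "q (of_real (\<alpha> * t / (2 * pi)) + \<i>) = p * cos (\<beta> + \<i> * of_real t / 2)"
proof -
  define \<tau> where "\<tau> = \<alpha> * t / (2 * pi)"
  define P where "P = Complex (1 + \<alpha> / 2 + b) \<tau>"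
  have p: "p = S2_strip \<alpha> P * S2_strip \<alpha> (cnj P)" unfolding S2_strip_mult_cnj p_def P_def \<tau>_def ..
  have inv: "1 / (2 * S2_strip \<alpha> (v + 1)) = sin (of_real pi * v / of_real \<alpha>) * S2_strip \<alpha> (cnj P)"
    if "v = Complex (\<alpha> / 2 - b) \<tau>" for v
  proof -
    have "S2_strip \<alpha> v = 2 * sin (of_real pi * v / of_real \<alpha>) * S2_strip \<alpha> (v + 1)"
      by (rule S2_strip_shift_1[OF alpha(1)]) (use that b alpha in auto)
    moreover have "S2_strip \<alpha> v * S2_strip \<alpha> (cnj P) = 1"
    proof -
      have "1 + of_real \<alpha> - v = cnj P" using that by (simp add: P_def complex_eq_iff)
      then show ?thesis using S2_strip_reflection[of \<alpha> v] by simp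
    qed
    ultimately show ?thesis by (simp add: field_simps)
  qed
  show "q (of_real (\<alpha> * t / (2 * pi))) = p * cos (- \<beta> + \<i> * of_real t / 2)"
  proof -
    define v where "v = Complex (\<alpha> / 2 - b) \<tau>"
    have a: "of_real (1 + \<alpha> / 2 + b) + \<i> * of_real (\<alpha> * t / (2 * pi)) = P" "of_real (1 + \<alpha> / 2 - b) + \<i> * of_real (\<alpha> * t / (2 * pi)) = v + 1"
      by (simp_all add: P_def v_def \<tau>_def complex_eq_iff)
    have "of_real pi * v / of_real \<alpha> = of_real pi / 2 - (\<beta> - \<i> * of_real t / 2)"
      using alpha by (simp add: v_def \<tau>_def \<beta>_def complex_eq_iff field_simps)
    then have s: "sin (of_real pi * v / of_real \<alpha>) = cos (\<beta> - \<i> * of_real t / 2)" by (simp add: sin_diff)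
    have "- \<beta> + \<i> * of_real t / 2 = - (\<beta> - \<i> * of_real t / 2)" by simp
    then have c: "cos (- \<beta> + \<i> * of_real t / 2) = cos (\<beta> - \<i> * of_real t / 2)" by (simp only: cos_minus)
    have "q (of_real (\<alpha> * t / (2 * pi))) = S2_strip \<alpha> P * (1 / (2 * S2_strip \<alpha> (v + 1)))"
      unfolding q_def a by simp
    then show ?thesis unfolding inv[OF v_def] s c p by simp
  qed
  show "q (of_real (\<alpha> * t / (2 * pi)) + \<i>) = p * cos (\<beta> + \<i> * of_real t / 2)"
  proof -
    define v where "v = Complex (\<alpha> / 2 + b) \<tau>"
    have a: "of_real (1 + \<alpha> / 2 + b) + \<i> * (of_real (\<alpha> * t / (2 * pi)) + \<i>) = v" "of_real (1 + \<alpha> / 2 - b) + \<i> * (of_real (\<alpha> * t / (2 * pi)) + \<i>) = 1 + of_real \<alpha> - cnj P" "P = v + 1"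
      by (simp_all add: P_def v_def \<tau>_def complex_eq_iff)
    have "of_real pi * v / of_real \<alpha> = of_real pi / 2 + (\<beta> + \<i> * of_real t / 2)"
      using alpha by (simp add: v_def \<tau>_def \<beta>_def complex_eq_iff field_simps)
    then have s: "sin (of_real pi * v / of_real \<alpha>) = cos (\<beta> + \<i> * of_real t / 2)" by (simp add: sin_add)
    have e1: "S2_strip \<alpha> v = 2 * cos (\<beta> + \<i> * of_real t / 2) * S2_strip \<alpha> P"
      unfolding a(3) s[symmetric] by (rule S2_strip_shift_1[OF alpha(1)]) (use b alpha in \<open>auto simp: v_def\<close>)
    have "S2_strip \<alpha> (cnj P) * S2_strip \<alpha> (1 + of_real \<alpha> - cnj P) = 1" by (rule S2_strip_reflection)
    then have e2: "S2_strip \<alpha> (cnj P) = 1 / S2_strip \<alpha> (1 + of_real \<alpha> - cnj P)" by (simp add: field_simps)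
    show ?thesis unfolding q_def a(1,2) e1 p e2 by simp
  qed
qed

lemma q_holomorphic: "q holomorphic_on {w. - ((\<alpha> / 2 - b) / 2) < Im w \<and> Im w < 1 + (\<alpha> / 2 - b) / 2}"
proof -
  let ?S = "{w. - ((\<alpha> / 2 - b) / 2) < Im w \<and> Im w < 1 + (\<alpha> / 2 - b) / 2}"
  have "S2_strip \<alpha> \<circ> (\<lambda>w. of_real (1 + \<alpha> / 2 + b) + \<i> * w) holomorphic_on ?S"
    by (rule holomorphic_on_compose_gen[OF _ S2_strip_holomorphic[OF alpha(1)]])
       (use b in \<open>auto intro!: holomorphic_intros simp: field_simps\<close>)
  moreover have "S2_strip \<alpha> \<circ> (\<lambda>w. of_real (1 + \<alpha> / 2 - b) + \<i> * w) holomorphic_on ?S"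
    by (rule holomorphic_on_compose_gen[OF _ S2_strip_holomorphic[OF alpha(1)]])
       (use b in \<open>auto intro!: holomorphic_intros simp: field_simps\<close>)
  ultimately show ?thesis
    unfolding q_def comp_def by (intro holomorphic_intros) auto
qed

text \<open>The two arguments differ by 2b only, so in the quotient of the growth rates Im w cancels
  and the rate 2b is left.\<close>

lemma q_bound:
  obtains B where "B > 0" "\<And>w. 0 \<le> Im w \<Longrightarrow> Im w \<le> 1 \<Longrightarrow> norm (q w) \<le> B * exp (- (pi * \<bar>Re w\<bar> / \<alpha>) * (2 * b))"
proof -
  have pb: "0 < \<alpha> / 2 - b" "1 + \<alpha> / 2 + b < 1 + \<alpha>" using b by auto
  obtain B where B: "B > 0"
    "\<And>z. \<alpha> / 2 - b \<le> Re z \<Longrightarrow> Re z \<le> 1 + \<alpha> / 2 + b \<Longrightarrow> norm (S2_strip \<alpha> z) \<le> B * exp (- (pi * \<bar>Im z\<bar> / \<alpha>) * (Re z - (1 + \<alpha>) / 2))"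
    "\<And>z. \<alpha> / 2 - b \<le> Re z \<Longrightarrow> Re z \<le> 1 + \<alpha> / 2 + b \<Longrightarrow> inverse (norm (S2_strip \<alpha> z)) \<le> B * exp ((pi * \<bar>Im z\<bar> / \<alpha>) * (Re z - (1 + \<alpha>) / 2))"
    by (rule S2_strip_bounds[OF alpha(1) pb]) (rule that)
  show ?thesis
  proof (rule that[of "B * B"])
    fix w assume w: "0 \<le> Im w" "Im w \<le> 1"
    let ?x = "of_real (1 + \<alpha> / 2 + b) + \<i> * w" and ?y = "of_real (1 + \<alpha> / 2 - b) + \<i> * w"
    have x: "Re ?x = 1 + \<alpha> / 2 + b - Im w" "Im ?x = Re w" and y: "Re ?y = 1 + \<alpha> / 2 - b - Im w" "Im ?y = Re w" by simp_all
    have 1: "norm (S2_strip \<alpha> ?x) \<le> B * exp (- (pi * \<bar>Re w\<bar> / \<alpha>) * (1 + \<alpha> / 2 + b - Im w - (1 + \<alpha>) / 2))"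
      using B(2)[of ?x, unfolded x] w b(1) by simp
    have 2: "inverse (norm (S2_strip \<alpha> ?y)) \<le> B * exp ((pi * \<bar>Re w\<bar> / \<alpha>) * (1 + \<alpha> / 2 - b - Im w - (1 + \<alpha>) / 2))"
      using B(3)[of ?y, unfolded y] w b(1) by simp
    have "norm (q w) = norm (S2_strip \<alpha> ?x) * inverse (norm (S2_strip \<alpha> ?y)) / 2"
    proof -
      have "norm (x / (2 * y)) = norm x * inverse (norm y) / 2" for x y :: complex
        by (simp add: norm_divide norm_mult inverse_eq_divide)
      then show ?thesis unfolding q_def .
    qed
    also have "\<dots> \<le> norm (S2_strip \<alpha> ?x) * inverse (norm (S2_strip \<alpha> ?y))" by simp
    also have "\<dots> \<le> (B * exp (- (pi * \<bar>Re w\<bar> / \<alpha>) * (1 + \<alpha> / 2 + b - Im w - (1 + \<alpha>) / 2))) * (B * exp ((pi * \<bar>Re w\<bar> / \<alpha>) * (1 + \<alpha> / 2 - b - Im w - (1 + \<alpha>) / 2)))"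
      by (rule mult_mono[OF 1 2]) (intro mult_nonneg_nonneg exp_ge_zero less_imp_le[OF B(1)] inverse_nonnegative_iff_nonnegative[THEN iffD2] norm_ge_zero)+
    also have "\<dots> = B * B * exp (- (pi * \<bar>Re w\<bar> / \<alpha>) * (2 * b))"
    proof -
      have "(B * exp (- k * x)) * (B * exp (k * y)) = B * B * exp (- k * (2 * b))" if "x - y = 2 * b" for k x y :: real
      proof -
        have "- k * (2 * b) = - k * x + k * y" unfolding that[symmetric] by (simp add: algebra_simps)
        then show ?thesis by (simp only: exp_add mult_ac)
      qed
      note * = this
      show ?thesis by (rule *) simp
    qed
    finally show "norm (q w) \<le> B * B * exp (- (pi * \<bar>Re w\<bar> / \<alpha>) * (2 * b))" .
  qed (use B in simp)
qed

text \<open>On each edge the cosine splits the integrand into a part with exp (t/2), belonging to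
  \<open>M z\<close>, and a part with exp (- t/2), belonging to \<open>M (z + 1)\<close>. No pole
  lies between the edges, so the two combinations are equal.\<close>

lemma M_shift:
  assumes z: "- (2 * b) < Re z" "Re z < 0"
  shows "M (z + 1) * sin (of_real pi * z / of_real \<alpha>) = - (M z * sin (of_real pi * (z + of_real (2 * b)) / of_real \<alpha>))"
proof -
  \<comment> \<open>Moving \<open>u\<close> up by L i moves the argument of \<open>q\<close> by
    exactly i, from its lower edge to its upper one.\<close>
  define L where "L = 2 * pi / \<alpha>"
  have L: "L > 0" "\<alpha> / (2 * pi) * L = 1" using alpha by (simp_all add: L_def)
  define \<eta> where "\<eta> = (\<alpha> / 2 - b) / 2"
  have \<eta>: "\<eta> > 0" using b by (simp add: \<eta>_def)
  define f where "f = (\<lambda>u. exp (- (of_real b + z) * u) * q (of_real (\<alpha> / (2 * pi)) * u))"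
  have im: "Im (of_real (\<alpha> / (2 * pi)) * u) = Im u / L" "Re (of_real (\<alpha> / (2 * pi)) * u) = Re u / L" for u
    using alpha by (simp_all add: L_def)
  let ?S = "{u. - (L * \<eta>) < Im u \<and> Im u < L + L * \<eta>}"
  have hol: "f holomorphic_on ?S - {}"
  proof -
    have "q \<circ> (\<lambda>u. of_real (\<alpha> / (2 * pi)) * u) holomorphic_on ?S"
    proof (rule holomorphic_on_compose_gen[OF _ q_holomorphic[folded \<eta>_def]])
      show "(\<lambda>u. of_real (\<alpha> / (2 * pi)) * u) ` ?S \<subseteq> {w. - \<eta> < Im w \<and> Im w < 1 + \<eta>}"
      proof (rule image_subsetI)
        fix u assume "u \<in> ?S"
        then have "- (L * \<eta>) < Im u" "Im u < L + L * \<eta>" by auto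
        then have "- \<eta> < Im u / L" "Im u / L < 1 + \<eta>" using L(1) by (simp_all add: field_simps)
        then show "of_real (\<alpha> / (2 * pi)) * u \<in> {w. - \<eta> < Im w \<and> Im w < 1 + \<eta>}" unfolding mem_Collect_eq im by simp
      qed
    qed (intro holomorphic_intros)
    then show ?thesis unfolding f_def comp_def by (auto intro!: holomorphic_intros)
  qed
  obtain B where B: "B > 0" "\<And>w. 0 \<le> Im w \<Longrightarrow> Im w \<le> 1 \<Longrightarrow> norm (q w) \<le> B * exp (- (pi * \<bar>Re w\<bar> / \<alpha>) * (2 * b))"
    by (rule q_bound) (rule that)
  \<comment> \<open>\<open>q\<close> decays at rate \<open>b\<close> and the exponential grows at
    most at rate |b + Re z|; the difference is positive precisely for -2b < Re z < 0.\<close>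
  define \<delta> where "\<delta> = b - \<bar>b + Re z\<bar>"
  have \<delta>: "\<delta> > 0" using z by (auto simp: \<delta>_def)
  have bd: "norm (f u) \<le> exp (\<bar>Im z\<bar> * L) * B * exp (- \<delta> * \<bar>Re u\<bar>)" if u: "0 \<le> Im u" "Im u \<le> L" "0 \<le> \<bar>Re u\<bar>" for u
  proof -
    have "norm (q (of_real (\<alpha> / (2 * pi)) * u)) \<le> B * exp (- (pi * \<bar>Re u / L\<bar> / \<alpha>) * (2 * b))"
    proof -
      have "0 \<le> Im u / L" "Im u / L \<le> 1" using u L(1) by simp_all
      from B(2)[of "of_real (\<alpha> / (2 * pi)) * u", unfolded im, OF this] show ?thesis .
    qed
    also have "pi * \<bar>Re u / L\<bar> / \<alpha> = \<bar>Re u\<bar> / 2" using alpha by (simp add: L_def abs_mult abs_divide)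
    finally have 1: "norm (q (of_real (\<alpha> / (2 * pi)) * u)) \<le> B * exp (- b * \<bar>Re u\<bar>)" by (simp add: mult_ac)
    have "Re (- (of_real b + z) * u) = - ((b + Re z) * Re u) + Im z * Im u" by (simp add: algebra_simps)
    also have "\<dots> \<le> \<bar>b + Re z\<bar> * \<bar>Re u\<bar> + \<bar>Im z\<bar> * L"
    proof (rule add_mono)
      show "- ((b + Re z) * Re u) \<le> \<bar>b + Re z\<bar> * \<bar>Re u\<bar>" by (metis abs_ge_minus_self abs_mult)
      have "Im z * Im u \<le> \<bar>Im z\<bar> * \<bar>Im u\<bar>" by (metis abs_ge_self abs_mult)
      also have "\<dots> \<le> \<bar>Im z\<bar> * L" using u by (intro mult_left_mono) auto
      finally show "Im z * Im u \<le> \<bar>Im z\<bar> * L" .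
    qed
    finally have 2: "norm (exp (- (of_real b + z) * u)) \<le> exp (\<bar>b + Re z\<bar> * \<bar>Re u\<bar> + \<bar>Im z\<bar> * L)" by simp
    have "norm (f u) \<le> exp (\<bar>b + Re z\<bar> * \<bar>Re u\<bar> + \<bar>Im z\<bar> * L) * (B * exp (- b * \<bar>Re u\<bar>))"
      unfolding f_def norm_mult using 1 2 by (intro mult_mono) auto
    also have "\<dots> = exp (\<bar>Im z\<bar> * L) * B * exp (\<bar>b + Re z\<bar> * \<bar>Re u\<bar> + - b * \<bar>Re u\<bar>)"
      unfolding exp_add by (simp only: mult_ac)
    also have "\<bar>b + Re z\<bar> * \<bar>Re u\<bar> + - b * \<bar>Re u\<bar> = - \<delta> * \<bar>Re u\<bar>" by (simp add: \<delta>_def algebra_simps)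
    finally show ?thesis .
  qed
  have ab: "- (L * \<eta>) < 0" "0 < L" "L < L + L * \<eta>" using L \<eta> by auto
  have "(LBINT t. f (Complex t 0)) - (LBINT t. f (Complex t L)) = 2 * pi * \<i> * (\<Sum>p\<in>{}. residue f p)"
    by (rule strip_residue(3)[OF ab finite.emptyI _ hol \<delta> bd]) auto
  then have eq: "(LBINT t. f (Complex t 0)) = (LBINT t. f (Complex t L))" by simp
  define \<beta> where "\<beta> = complex_of_real (pi * b / \<alpha>)"
  define y where "y = of_real pi * z / of_real \<alpha>"
  define a where "a = (\<lambda>t. exp ((1 - z) * of_real t) * h (of_real t))"
  define a1 where "a1 = (\<lambda>t. exp ((1 - (z + 1)) * of_real t) * h (of_real t))"
  have ia: "integrable lborel a" "integrable lborel a1"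
    unfolding a_def a1_def by (rule M_integrand_integrable; use z b(1) in simp)+
  define p where "p = (\<lambda>t. complex_of_real ((norm (S2_strip \<alpha> (Complex (1 + \<alpha> / 2 + b) (\<alpha> * t / (2 * pi)))))\<^sup>2))"
  have p_eq: "complex_of_real ((norm (S2_strip \<alpha> (Complex (1 + \<alpha> / 2 + b) (\<alpha> * t / (2 * pi)))))\<^sup>2) = p t" for t
    by (simp add: p_def)
  have hp: "h (of_real t) = C0 * (exp (- of_real (b + 1 / 2) * of_real t) * p t)" for t
    unfolding h_of_real p_def by (simp flip: exp_of_real)
  have ii: "\<i> * (\<i> * w / 2) = - (w / 2)" for w :: complex by simp
  have cosexp: "cos w = (exp (\<i> * w) + exp (- (\<i> * w))) / 2" for w :: complex by (rule cos_exp_eq)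
  have base: "exp (- (of_real b + z) * of_real t) * (p t * exp (of_real t / 2)) = a t / C0"
    "exp (- (of_real b + z) * of_real t) * (p t * exp (- (of_real t / 2))) = a1 t / C0" for t
  proof -
    have "exp (- (of_real b + z) * of_real t) * exp (of_real t / 2) = exp ((1 - z) * of_real t) * exp (- of_real (b + 1 / 2) * of_real t)"
      "exp (- (of_real b + z) * of_real t) * exp (- (of_real t / 2)) = exp ((1 - (z + 1)) * of_real t) * exp (- of_real (b + 1 / 2) * of_real t)"
      unfolding exp_add[symmetric] by (rule arg_cong[where f = exp], simp add: algebra_simps)+
    then show "exp (- (of_real b + z) * of_real t) * (p t * exp (of_real t / 2)) = a t / C0"
      "exp (- (of_real b + z) * of_real t) * (p t * exp (- (of_real t / 2))) = a1 t / C0"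
      unfolding a_def a1_def hp using C0_nonzero by (simp_all add: mult_ac)
  qed
  have f0: "f (Complex t 0) = (exp (- \<i> * \<beta>) * a1 t - (- exp (\<i> * \<beta>)) * a t) / (2 * C0)" for t
  proof -
    have w: "of_real (\<alpha> / (2 * pi)) * Complex t 0 = complex_of_real (\<alpha> * t / (2 * pi))" "Complex t 0 = of_real t"
      by (simp_all add: complex_eq_iff)
    have i: "\<i> * (- \<beta> + \<i> * of_real t / 2) = - \<i> * \<beta> + - (of_real t / 2)" "- (- \<i> * \<beta> + - (of_real t / 2)) = \<i> * \<beta> + complex_of_real t / 2"
      using ii[of "of_real t"] by (simp_all add: distrib_left right_diff_distrib)
    have "f (Complex t 0) = exp (- (of_real b + z) * of_real t) * (p t * ((exp (- \<i> * \<beta>) * exp (- (of_real t / 2)) + exp (\<i> * \<beta>) * exp (of_real t / 2)) / 2))"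
      unfolding f_def w(1) q_edges(1) unfolding w(2) p_eq \<beta>_def[symmetric] cosexp i exp_add ..
    also have "\<dots> = (exp (- \<i> * \<beta>) * (exp (- (of_real b + z) * of_real t) * (p t * exp (- (of_real t / 2)))) + exp (\<i> * \<beta>) * (exp (- (of_real b + z) * of_real t) * (p t * exp (of_real t / 2)))) / 2"
      by (simp add: algebra_simps)
    finally show ?thesis unfolding base by (simp add: add_divide_distrib mult_ac)
  qed
  \<comment> \<open>The factor that exp (- (b + z) u) acquires when \<open>u\<close> is moved up by
    L i.\<close>
  define \<omega> where "\<omega> = exp (- (\<i> * (2 * \<beta> + 2 * y)))"
  have fL: "f (Complex t L) = (\<omega> * exp (\<i> * \<beta>) * a1 t - (- (\<omega> * exp (- \<i> * \<beta>))) * a t) / (2 * C0)" for t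
  proof -
    have w: "of_real (\<alpha> / (2 * pi)) * Complex t L = complex_of_real (\<alpha> * t / (2 * pi)) + \<i>"
      using L alpha(1) by (simp add: complex_eq_iff)
    have i: "\<i> * (\<beta> + \<i> * of_real t / 2) = \<i> * \<beta> + - (of_real t / 2)" "- (\<i> * \<beta> + - (of_real t / 2)) = - \<i> * \<beta> + complex_of_real t / 2"
      using ii[of "of_real t"] by (simp_all add: distrib_left right_diff_distrib)
    have e: "exp (- (of_real b + z) * Complex t L) = \<omega> * exp (- (of_real b + z) * of_real t)"
    proof -
      have "Complex t L = of_real t + \<i> * of_real L" by (simp add: complex_eq_iff)
      moreover have "- (of_real b + z) * (\<i> * of_real L) = - (\<i> * (2 * \<beta> + 2 * y))"
        using alpha by (simp add: L_def \<beta>_def y_def field_simps)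
      ultimately show ?thesis unfolding \<omega>_def exp_add[symmetric] by (simp only: distrib_left add.commute)
    qed
    have "f (Complex t L) = \<omega> * exp (- (of_real b + z) * of_real t) * (p t * ((exp (\<i> * \<beta>) * exp (- (of_real t / 2)) + exp (- \<i> * \<beta>) * exp (of_real t / 2)) / 2))"
      unfolding f_def w q_edges(2) e unfolding p_eq \<beta>_def[symmetric] cosexp i exp_add ..
    also have "\<dots> = (\<omega> * exp (\<i> * \<beta>) * (exp (- (of_real b + z) * of_real t) * (p t * exp (- (of_real t / 2)))) + \<omega> * exp (- \<i> * \<beta>) * (exp (- (of_real b + z) * of_real t) * (p t * exp (of_real t / 2)))) / 2"
      by (simp add: algebra_simps)
    finally show ?thesis unfolding base by (simp add: add_divide_distrib mult_ac)
  qed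
  have Ma: "(LBINT t. a t) = M z" "(LBINT t. a1 t) = M (z + 1)" by (simp_all add: M_def a_def a1_def)
  have "(exp (- \<i> * \<beta>) * M (z + 1) - (- exp (\<i> * \<beta>)) * M z) / (2 * C0) = (\<omega> * exp (\<i> * \<beta>) * M (z + 1) - (- (\<omega> * exp (- \<i> * \<beta>))) * M z) / (2 * C0)"
    using eq unfolding f0 fL integral_lincomb[OF ia(2,1)] Ma .
  then have main: "exp (- \<i> * \<beta>) * M (z + 1) + exp (\<i> * \<beta>) * M z = \<omega> * exp (\<i> * \<beta>) * M (z + 1) + \<omega> * exp (- \<i> * \<beta>) * M z"
    using C0_nonzero by simp
  \<comment> \<open>After multiplication by \<open>Q * Y\<close> the relation pairs each monomial
    with its inverse, which displays the two sines.\<close>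
  define Q Y where "Q = exp (\<i> * \<beta>)" and "Y = exp (\<i> * y)"
  have nz: "Q \<noteq> 0" "Y \<noteq> 0" by (simp_all add: Q_def Y_def)
  have Qi: "exp (- \<i> * \<beta>) = inverse Q" by (simp add: Q_def exp_minus)
  have om: "\<omega> = inverse (Q * Q * (Y * Y))"
  proof -
    have "\<i> * (2 * \<beta> + 2 * y) = \<i> * \<beta> + \<i> * \<beta> + (\<i> * y + \<i> * y)" by (simp add: algebra_simps)
    then show ?thesis unfolding \<omega>_def exp_minus by (simp only: exp_add Q_def Y_def)
  qed
  have "M (z + 1) * (Y - inverse Y) = - (M z * (Q * Q * Y - inverse (Q * Q * Y)))"
  proof -
    have "inverse Q * M (z + 1) + Q * M z = inverse (Q * Q * (Y * Y)) * Q * M (z + 1) + inverse (Q * Q * (Y * Y)) * inverse Q * M z"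
      using main unfolding Qi om Q_def[symmetric] .
    then have "(Q * Y) * (inverse Q * M (z + 1) + Q * M z) = (Q * Y) * (inverse (Q * Q * (Y * Y)) * Q * M (z + 1) + inverse (Q * Q * (Y * Y)) * inverse Q * M z)"
      by (rule arg_cong)
    moreover have "(Q * Y) * (inverse Q * M (z + 1) + Q * M z) = Y * M (z + 1) + Q * Q * Y * M z"
      using nz by (simp add: field_simps)
    moreover have "(Q * Y) * (inverse (Q * Q * (Y * Y)) * Q * M (z + 1) + inverse (Q * Q * (Y * Y)) * inverse Q * M z) = inverse Y * M (z + 1) + inverse (Q * Q * Y) * M z"
      using nz by (simp add: field_simps)
    ultimately have "Y * M (z + 1) + Q * Q * Y * M z = inverse Y * M (z + 1) + inverse (Q * Q * Y) * M z" by (simp only:)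
    then show ?thesis by (simp add: algebra_simps)
  qed
  moreover have "sin y = (Y - inverse Y) / (2 * \<i>)" by (simp add: sin_exp_eq Y_def exp_minus)
  moreover have "sin (2 * \<beta> + y) = (Q * Q * Y - inverse (Q * Q * Y)) / (2 * \<i>)"
  proof -
    have "\<i> * (2 * \<beta> + y) = \<i> * \<beta> + \<i> * \<beta> + \<i> * y" by (simp add: algebra_simps)
    then have "exp (\<i> * (2 * \<beta> + y)) = Q * Q * Y" by (simp only: exp_add Q_def Y_def)
    then show ?thesis by (simp add: sin_exp_eq exp_minus)
  qed
  ultimately have "M (z + 1) * sin y = - (M z * sin (2 * \<beta> + y))"
    by (simp only: times_divide_eq_right minus_divide_left)
  moreover have "of_real pi * (z + of_real (2 * b)) / of_real \<alpha> = 2 * \<beta> + y"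
    using alpha by (simp add: y_def \<beta>_def field_simps)
  ultimately show ?thesis unfolding y_def by simp
qed


text \<open>The right side of (ii) times Gamma (1 - z): the reflection formula for Gamma produces pi
  / sin (pi z), and the functional equation with period \<alpha> absorbs that sine. In this form
  there are neither zeros nor poles for -2b < Re z < 1.\<close>

definition T :: "complex \<Rightarrow> complex" where
  "T z = of_real pi * S2_strip \<alpha> (z + of_real \<alpha>) / S2_strip \<alpha> (z + of_real (2 * b))"

lemma T_nonzero: "T z \<noteq> 0"
  by (simp add: T_def)

text \<open>Numerator and denominator each obey the functional equation with period 1; the minus
  sign comes from sin (x + pi) = - sin x.\<close>

lemma T_shift:
  assumes z: "- (2 * b) < Re z" "Re z < 0"
  shows "T (z + 1) * sin (of_real pi * z / of_real \<alpha>) = - (T z * sin (of_real pi * (z + of_real (2 * b)) / of_real \<alpha>))"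
proof -
  have 1: "S2_strip \<alpha> (z + of_real \<alpha>) = 2 * sin (of_real pi * (z + of_real \<alpha>) / of_real \<alpha>) * S2_strip \<alpha> (z + of_real \<alpha> + 1)"
    by (rule S2_strip_shift_1[OF alpha(1)]) (use z b(3) in auto)
  have 2: "S2_strip \<alpha> (z + of_real (2 * b)) = 2 * sin (of_real pi * (z + of_real (2 * b)) / of_real \<alpha>) * S2_strip \<alpha> (z + of_real (2 * b) + 1)"
    by (rule S2_strip_shift_1[OF alpha(1)]) (use z b(3) in auto)
  have "of_real pi * (z + of_real \<alpha>) / of_real \<alpha> = of_real pi * z / of_real \<alpha> + of_real pi"
    using alpha by (simp add: field_simps)
  then have s: "sin (of_real pi * (z + of_real \<alpha>) / of_real \<alpha>) = - sin (of_real pi * z / of_real \<alpha>)"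
    by (simp only: sin_add) simp
  define x y where "x = sin (of_real pi * z / of_real \<alpha>)" and "y = sin (of_real pi * (z + of_real (2 * b)) / of_real \<alpha>)"
  have y0: "y \<noteq> 0" using 2 unfolding y_def by auto
  have "T z * y = of_real pi * (2 * - x * S2_strip \<alpha> (z + of_real \<alpha> + 1)) / (2 * y * S2_strip \<alpha> (z + of_real (2 * b) + 1)) * y"
    unfolding T_def by (subst 1, subst 2) (simp only: s x_def y_def)
  also have "\<dots> = - (T (z + 1) * x)"
    unfolding T_def using y0 by (simp add: field_simps)
  finally show ?thesis unfolding x_def y_def by simp
qed

section \<open>Uniqueness of the solution of the difference equation\<close>

definition R :: "complex \<Rightarrow> complex" where "R z = M z / T z"

lemma R_holomorphic: "R holomorphic_on {z. - (2 * b) < Re z \<and> Re z < 1}"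
proof -
  let ?S = "{z. - (2 * b) < Re z \<and> Re z < 1}"
  have "S2_strip \<alpha> \<circ> (\<lambda>z. z + of_real \<alpha>) holomorphic_on ?S" "S2_strip \<alpha> \<circ> (\<lambda>z. z + of_real (2 * b)) holomorphic_on ?S"
    by (rule holomorphic_on_compose_gen[OF _ S2_strip_holomorphic[OF alpha(1)]],
        use b in \<open>auto intro!: holomorphic_intros\<close>)+
  then have "T holomorphic_on ?S"
    unfolding T_def comp_def by (intro holomorphic_intros) auto
  then show ?thesis unfolding R_def using M_holomorphic T_nonzero by (intro holomorphic_intros) auto
qed

lemma sin_nonzero_left:
  assumes z: "- \<alpha> < Re z" "Re z < 0"
  shows "sin (of_real pi * z / of_real \<alpha>) \<noteq> 0"
proof
  assume "sin (of_real pi * z / of_real \<alpha>) = 0"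
  then obtain n :: int where "of_real pi * z / of_real \<alpha> = of_real (real_of_int n * pi)" unfolding sin_eq_0 by blast
  then have "z = of_real (real_of_int n * \<alpha>)" using alpha by (simp add: field_simps)
  then have re: "Re z = real_of_int n * \<alpha>" by simp
  then have "real_of_int n * \<alpha> < 0 * \<alpha>" "(-1) * \<alpha> < real_of_int n * \<alpha>" using z by simp_all
  then have "real_of_int n < 0" "-1 < real_of_int n" using alpha(1) by (metis mult_less_cancel_right_pos)+
  then have "n < 0" "-1 < n" by linarith+
  then show False by linarith
qed

lemma R_periodic:
  assumes z: "- (2 * b) < Re z" "Re z < 0"
  shows "R (z + 1) = R z"
proof -
  define x y where "x = sin (of_real pi * z / of_real \<alpha>)" and "y = sin (of_real pi * (z + of_real (2 * b)) / of_real \<alpha>)"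
  have x0: "x \<noteq> 0" unfolding x_def by (rule sin_nonzero_left) (use z b(3) in auto)
  have m: "M (z + 1) = - (M z * y) / x" using M_shift[OF z] x0 unfolding x_def[symmetric] y_def[symmetric] by (simp add: field_simps)
  have t: "T (z + 1) = - (T z * y) / x" using T_shift[OF z] x0 unfolding x_def[symmetric] y_def[symmetric] by (simp add: field_simps)
  have y0: "y \<noteq> 0" using t T_nonzero[of "z + 1"] by auto
  show ?thesis unfolding R_def m t using x0 y0 T_nonzero[of z] by (simp add: field_simps)
qed

text \<open>\<open>M\<close> is bounded, and the arguments in \<open>T\<close> differ by \<alpha> -
  2b = \<alpha> \<rho>. Multiplied by the rate pi |Im z| / \<alpha> this is the exponent in the
  statement.\<close>

lemma R_bound:
  assumes x: "- (2 * b) < x1" "x1 < 1" "- (2 * b) < x2" "x2 < 1"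
  obtains C where "\<And>z. x1 \<le> Re z \<Longrightarrow> Re z \<le> x2 \<Longrightarrow> norm (R z) \<le> C * exp (pi * \<rho> * \<bar>Im z\<bar>)"
proof -
  obtain C where C: "C > 0" "\<And>z. x1 \<le> Re z \<Longrightarrow> Re z \<le> x2 \<Longrightarrow> norm (M z) \<le> C"
    by (rule M_bounded[OF x]) (rule that)
  have p1: "0 < x1 + 2 * b" "x2 + 2 * b < 1 + \<alpha>" using x b by auto
  have p2: "0 < x1 + \<alpha>" "x2 + \<alpha> < 1 + \<alpha>" using x b by auto
  obtain B where B: "B > 0"
    "\<And>z. x1 + 2 * b \<le> Re z \<Longrightarrow> Re z \<le> x2 + 2 * b \<Longrightarrow> norm (S2_strip \<alpha> z) \<le> B * exp (- (pi * \<bar>Im z\<bar> / \<alpha>) * (Re z - (1 + \<alpha>) / 2))"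
    by (rule S2_strip_bounds[OF alpha(1) p1]) (rule that)
  obtain B' where B': "B' > 0"
    "\<And>z. x1 + \<alpha> \<le> Re z \<Longrightarrow> Re z \<le> x2 + \<alpha> \<Longrightarrow> inverse (norm (S2_strip \<alpha> z)) \<le> B' * exp ((pi * \<bar>Im z\<bar> / \<alpha>) * (Re z - (1 + \<alpha>) / 2))"
    by (rule S2_strip_bounds[OF alpha(1) p2]) (rule that)
  show ?thesis
  proof (rule that[of "C * (B * B' / pi)"])
    fix z assume z: "x1 \<le> Re z" "Re z \<le> x2"
    define k where "k = pi * \<bar>Im z\<bar> / \<alpha>"
    have 1: "norm (S2_strip \<alpha> (z + of_real (2 * b))) \<le> B * exp (- k * (Re z + 2 * b - (1 + \<alpha>) / 2))"
      using B(2)[of "z + of_real (2 * b)"] z by (simp add: k_def)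
    have 2: "inverse (norm (S2_strip \<alpha> (z + of_real \<alpha>))) \<le> B' * exp (k * (Re z + \<alpha> - (1 + \<alpha>) / 2))"
      using B'(2)[of "z + of_real \<alpha>"] z by (simp add: k_def)
    have kr: "- k * (Re z + 2 * b - (1 + \<alpha>) / 2) + k * (Re z + \<alpha> - (1 + \<alpha>) / 2) = pi * \<rho> * \<bar>Im z\<bar>"
    proof -
      have "- k * (Re z + 2 * b - (1 + \<alpha>) / 2) + k * (Re z + \<alpha> - (1 + \<alpha>) / 2) = k * (\<alpha> - 2 * b)" by (simp add: field_simps)
      also have "\<dots> = pi * \<rho> * \<bar>Im z\<bar>" unfolding b(4) k_def using alpha by simp
      finally show ?thesis .
    qed
    have "norm (S2_strip \<alpha> (z + of_real (2 * b))) * inverse (norm (S2_strip \<alpha> (z + of_real \<alpha>))) \<le> (B * exp (- k * (Re z + 2 * b - (1 + \<alpha>) / 2))) * (B' * exp (k * (Re z + \<alpha> - (1 + \<alpha>) / 2)))"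
      by (rule mult_mono[OF 1 2]) (intro mult_nonneg_nonneg exp_ge_zero less_imp_le[OF B(1)] inverse_nonnegative_iff_nonnegative[THEN iffD2] norm_ge_zero)+
    also have "\<dots> = B * B' * exp (- k * (Re z + 2 * b - (1 + \<alpha>) / 2) + k * (Re z + \<alpha> - (1 + \<alpha>) / 2))"
      unfolding exp_add by simp
    finally have e: "norm (S2_strip \<alpha> (z + of_real (2 * b))) * inverse (norm (S2_strip \<alpha> (z + of_real \<alpha>))) \<le> B * B' * exp (pi * \<rho> * \<bar>Im z\<bar>)" unfolding kr .
    have "norm (R z) = norm (M z) * ((norm (S2_strip \<alpha> (z + of_real (2 * b))) * inverse (norm (S2_strip \<alpha> (z + of_real \<alpha>)))) / pi)"
      unfolding R_def T_def by (simp add: norm_divide norm_mult inverse_eq_divide)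
    also have "\<dots> \<le> C * ((B * B' * exp (pi * \<rho> * \<bar>Im z\<bar>)) / pi)"
      by (rule mult_mono[OF C(2)[OF z] divide_right_mono[OF e]]) (use C(1) in auto)
    finally show "norm (R z) \<le> C * (B * B' / pi) * exp (pi * \<rho> * \<bar>Im z\<bar>)" by simp
  qed
qed

lemma R_local_constant:
  assumes x: "- (2 * b) < x0" "x0 < 0" and z: "x0 < Re z" "Re z < x0 + 1" and w: "x0 < Re w" "Re w < x0 + 1"
  shows "R z = R w"
proof -
  have x': "x0 < 1" "- (2 * b) < x0 + 1" "x0 + 1 < 1" using x by auto
  obtain C where C: "\<And>z. x0 \<le> Re z \<Longrightarrow> Re z \<le> x0 + 1 \<Longrightarrow> norm (R z) \<le> C * exp (pi * \<rho> * \<bar>Im z\<bar>)"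
    by (rule R_bound[OF x(1) x']) (rule that)
  show ?thesis
  proof (rule periodic_strip_constant[OF x(1) x'(3) R_holomorphic _ _ _ C z w])
    show "R (z + 1) = R z" if "Re z = x0" for z using R_periodic[of z] that x by simp
    show "0 \<le> pi * \<rho>" using rho by simp
    have "pi * \<rho> < pi * 1" using rho by (intro mult_strict_left_mono) auto
    then show "pi * \<rho> < 2 * pi" using pi_gt_zero by linarith
  qed
qed

text \<open>Any strip of width 1 starting in (-2b, 0) contains the point 0, so two such strips, one
  around \<open>z\<close> and one around \<open>w\<close>, are linked through
  \<open>R 0\<close>.\<close>

lemma R_constant:
  assumes z: "- (2 * b) < Re z" "Re z < 0" and w: "0 < Re w" "Re w < 1"
  shows "R z = R w"
proof -
  define x0 where "x0 = (Re z - 2 * b) / 2"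
  have "R z = R 0"
    by (rule R_local_constant[of x0]) (use z b in \<open>auto simp: x0_def field_simps\<close>)
  also have "R 0 = R w"
  proof -
    obtain y where y: "- (2 * b) < y" "Re w - 1 < y" "y < 0" "y < Re w"
      using w b dense[of "max (- (2 * b)) (Re w - 1)" 0] by fastforce
    then show ?thesis using w by (intro R_local_constant[of y]) auto
  qed
  finally show ?thesis .
qed

section \<open>Behaviour at the pole z = 1\<close>

lemma h_tendsto_C0: "((\<lambda>s. h (of_real (- s))) \<longlongrightarrow> C0) at_top"
proof -
  have x: "0 < 1 + \<alpha> / 2 + b" "1 + \<alpha> / 2 + b < 1 + \<alpha>" using b alpha by auto
  have "filterlim (\<lambda>s. \<alpha> / (2 * pi) * s) at_top at_top"
    by (rule filterlim_tendsto_pos_mult_at_top[OF tendsto_const _ filterlim_ident]) (use alpha in simp)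
  from tendsto_power[OF filterlim_compose[OF norm_S2_strip_asymptotic[OF alpha(1) x] this], of 2]
  have "((\<lambda>s. (norm (S2_strip \<alpha> (Complex (1 + \<alpha> / 2 + b) (\<alpha> / (2 * pi) * s))) * exp ((pi * (\<alpha> / (2 * pi) * s) / \<alpha>) * (1 + \<alpha> / 2 + b - (1 + \<alpha>) / 2)))\<^sup>2) \<longlongrightarrow> 1) at_top"
    by simp
  from tendsto_mult[OF tendsto_const[of C0] tendsto_of_real[OF this]]
  have "((\<lambda>s. C0 * of_real ((norm (S2_strip \<alpha> (Complex (1 + \<alpha> / 2 + b) (\<alpha> / (2 * pi) * s))) * exp ((pi * (\<alpha> / (2 * pi) * s) / \<alpha>) * (1 + \<alpha> / 2 + b - (1 + \<alpha>) / 2)))\<^sup>2)) \<longlongrightarrow> C0) at_top"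
    by simp
  moreover have "C0 * of_real ((norm (S2_strip \<alpha> (Complex (1 + \<alpha> / 2 + b) (\<alpha> / (2 * pi) * s))) * exp ((pi * (\<alpha> / (2 * pi) * s) / \<alpha>) * (1 + \<alpha> / 2 + b - (1 + \<alpha>) / 2)))\<^sup>2) = h (of_real (- s))" for s
  proof -
    have "Complex (1 + \<alpha> / 2 + b) (\<alpha> * (- s) / (2 * pi)) = cnj (Complex (1 + \<alpha> / 2 + b) (\<alpha> / (2 * pi) * s))" by (simp add: complex_eq_iff)
    then have n: "norm (S2_strip \<alpha> (Complex (1 + \<alpha> / 2 + b) (\<alpha> * (- s) / (2 * pi)))) = norm (S2_strip \<alpha> (Complex (1 + \<alpha> / 2 + b) (\<alpha> / (2 * pi) * s)))"
      by (simp only: S2_strip_cnj complex_mod_cnj)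
    have "2 * ((pi * (\<alpha> / (2 * pi) * s) / \<alpha>) * (1 + \<alpha> / 2 + b - (1 + \<alpha>) / 2)) = - (b + 1 / 2) * (- s)" using alpha by (simp add: field_simps)
    then have e: "(exp ((pi * (\<alpha> / (2 * pi) * s) / \<alpha>) * (1 + \<alpha> / 2 + b - (1 + \<alpha>) / 2)))\<^sup>2 = exp (- (b + 1 / 2) * (- s))"
      unfolding exp_double[symmetric] by (simp only:)
    show ?thesis unfolding h_of_real n power_mult_distrib e by (simp only: mult_ac)
  qed
  ultimately show ?thesis by (simp only:)
qed

text \<open>With u = L v the quotient becomes the integral of exp v * h (L v). As L grows,
  \<open>h (L v)\<close> tends to \<open>C0\<close> for v < 0 and to 0 for v > 0, so the limit is
  \<open>C0\<close> times the integral of exp over the negative half-line.\<close>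

lemma M_near_1: "((\<lambda>L. M (of_real (1 - 1 / L)) / of_real L) \<longlongrightarrow> C0) at_top"
proof -
  obtain K where K: "K > 0" "\<And>u. norm (h (of_real u)) \<le> K * exp (- (b + 1 / 2) * (u + \<bar>u\<bar>))"
    by (rule h_real_bound) (rule that)
  define l :: "real \<Rightarrow> complex" where "l = (\<lambda>v. indicat_real {..<0} v *\<^sub>R (of_real (exp v) * C0))"
  have cv: "M (of_real (1 - 1 / L)) / of_real L = (LBINT v. of_real (exp v) * h (of_real (L * v)))" if L: "L > 0" for L
  proof -
    have "M (of_real (1 - 1 / L)) = \<bar>L\<bar> *\<^sub>R (LBINT v. exp ((1 - of_real (1 - 1 / L)) * of_real (0 + L * v)) * h (of_real (0 + L * v)))"
      unfolding M_def by (rule lborel_integral_real_affine) (use L in simp)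
    moreover have "exp ((1 - of_real (1 - 1 / L)) * of_real (0 + L * v)) = complex_of_real (exp v)" for v
    proof -
      have "(1 - of_real (1 - 1 / L)) * of_real (0 + L * v) = complex_of_real v"
        using L by simp
      then show ?thesis by (simp only: exp_of_real)
    qed
    ultimately show ?thesis using L by (simp add: scaleR_conv_of_real)
  qed
  \<comment> \<open>The rates on the two sides: to the left exp v alone decays, at rate 1; to the
    right L \<ge> 1 leaves at least the rate 2b.\<close>
  define d where "d = min 1 (2 * b)"
  have d: "d > 0" using b by (simp add: d_def)
  have "((\<lambda>L. LBINT v. of_real (exp v) * h (of_real (L * v))) \<longlongrightarrow> (LBINT v. l v)) at_top"
  proof (rule integral_dominated_convergence_at_top[where w = "\<lambda>v. K * exp (- d * \<bar>v\<bar>)"])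
    show "integrable lborel (\<lambda>v. K * exp (- d * \<bar>v\<bar>))" by (intro integrable_mult_right integrable_exp_neg_abs d)
    show "l \<in> borel_measurable lborel" unfolding l_def by measurable
    show "(\<lambda>v. complex_of_real (exp v) * h (of_real (L * v))) \<in> borel_measurable lborel" for L
    proof -
      have "continuous_on UNIV (\<lambda>v. h (of_real (L * v)))"
        by (rule continuous_on_compose2[OF h_real_continuous]) (auto intro!: continuous_intros)
      then have "(\<lambda>v. complex_of_real (exp v) * h (of_real (L * v))) \<in> borel_measurable borel"
        by (intro borel_measurable_continuous_onI continuous_intros)
      then show ?thesis by simp
    qed
    show "\<forall>\<^sub>F L in at_top. AE v in lborel. norm (complex_of_real (exp v) * h (of_real (L * v))) \<le> K * exp (- d * \<bar>v\<bar>)"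
      using eventually_ge_at_top[of 1]
    proof eventually_elim
      case (elim L)
      show ?case
      proof (rule AE_I2)
        fix v :: real
        have "norm (complex_of_real (exp v) * h (of_real (L * v))) \<le> exp v * (K * exp (- (b + 1 / 2) * (L * v + \<bar>L * v\<bar>)))"
          unfolding norm_mult using K(2)[of "L * v"] by simp
        also have "\<dots> = K * exp (v + - (b + 1 / 2) * (L * v + \<bar>L * v\<bar>))" unfolding exp_add by simp
        also have "\<dots> \<le> K * exp (- d * \<bar>v\<bar>)"
        proof -
          have "v + - (b + 1 / 2) * (L * v + \<bar>L * v\<bar>) \<le> - d * \<bar>v\<bar>"
          proof (cases "v \<ge> 0")
            case True
            have "\<bar>L * v\<bar> = L * v" using True elim by simp
            then have "v + - (b + 1 / 2) * (L * v + \<bar>L * v\<bar>) = v - (2 * b + 1) * (L * v)" by (simp add: algebra_simps)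
            moreover have "(2 * b + 1) * (1 * v) \<le> (2 * b + 1) * (L * v)" using b True elim by (intro mult_left_mono mult_right_mono) auto
            moreover have "d * v \<le> 2 * b * v" using True by (intro mult_right_mono) (auto simp: d_def)
            ultimately have "v + - (b + 1 / 2) * (L * v + \<bar>L * v\<bar>) \<le> - (d * v)" by (simp add: algebra_simps)
            then show ?thesis using True by simp
          next
            case False
            have "\<bar>L * v\<bar> = - (L * v)" using False elim by (simp add: abs_if mult_less_0_iff)
            then have "v + - (b + 1 / 2) * (L * v + \<bar>L * v\<bar>) = 1 * v" by simp
            also have "\<dots> \<le> d * v" using False by (intro mult_right_mono_neg) (auto simp: d_def)
            finally show ?thesis using False by simp
          qed
          then show ?thesis using K(1) by simp
        qed
        finally show "norm (complex_of_real (exp v) * h (of_real (L * v))) \<le> K * exp (- d * \<bar>v\<bar>)" .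
      qed
    qed
    show "AE v in lborel. ((\<lambda>L. of_real (exp v) * h (of_real (L * v))) \<longlongrightarrow> l v) at_top"
      using AE_lborel_singleton[of "0::real"]
    proof eventually_elim
      case (elim v)
      then consider "v > 0" | "v < 0" by linarith
      then show ?case
      proof cases
        case 1
        have "((\<lambda>L. h (of_real (L * v))) \<longlongrightarrow> 0) at_top"
        proof (rule Lim_null_comparison)
          show "\<forall>\<^sub>F L in at_top. norm (h (of_real (L * v))) \<le> K * exp (- ((2 * b + 1) * v) * L)"
            using eventually_ge_at_top[of 0]
          proof eventually_elim
            case (elim L)
            have "- (b + 1 / 2) * (L * v + \<bar>L * v\<bar>) = - ((2 * b + 1) * v) * L" using elim 1 by (simp add: algebra_simps)
            then show ?case using K(2)[of "L * v"] by simp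
          qed
          have "(2 * b + 1) * v > 0" using b 1 by simp
          then have "((\<lambda>L. exp (- a * L)) \<longlongrightarrow> 0) at_top" if "a = (2 * b + 1) * v" for a
            unfolding that[symmetric] by real_asymp
          then have "((\<lambda>L. exp (- ((2 * b + 1) * v) * L)) \<longlongrightarrow> 0) at_top" by simp
          from tendsto_mult[OF tendsto_const this, of K] show "((\<lambda>L. K * exp (- ((2 * b + 1) * v) * L)) \<longlongrightarrow> 0) at_top" by simp
        qed
        from tendsto_mult[OF tendsto_const this, of "of_real (exp v)"] show ?thesis using 1 by (simp add: l_def)
      next
        case 2
        have "filterlim (\<lambda>L. (- v) * L) at_top at_top"
          by (rule filterlim_tendsto_pos_mult_at_top[OF tendsto_const _ filterlim_ident]) (use 2 in simp)
        from filterlim_compose[OF h_tendsto_C0 this] have "((\<lambda>L. h (of_real (L * v))) \<longlongrightarrow> C0) at_top" by (simp add: mult.commute)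
        from tendsto_mult[OF tendsto_const this, of "of_real (exp v)"] show ?thesis using 2 by (simp add: l_def)
      qed
    qed
  qed
  moreover have "(LBINT v. l v) = C0"
  proof -
    have "(LBINT v. l v) = \<bar>-1\<bar> *\<^sub>R (LBINT v. l (0 + (-1) * v))" by (rule lborel_integral_real_affine) simp
    also have "\<dots> = (LBINT v. (indicat_real {0<..} v *\<^sub>R exp (- 1 * complex_of_real v)) * C0)"
      by (simp add: l_def indicator_def exp_of_real[symmetric] cong: if_cong)
    also have "\<dots> = (LBINT v:{0<..}. exp (- 1 * complex_of_real v)) * C0"
      unfolding set_lebesgue_integral_def by (rule integral_mult_left_zero)
    finally show ?thesis using exp_half_line_integral(2)[of 1] by simp
  qed
  ultimately have "((\<lambda>L. LBINT v. of_real (exp v) * h (of_real (L * v))) \<longlongrightarrow> C0) at_top" by simp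
  moreover have "\<forall>\<^sub>F L in at_top. (LBINT v. of_real (exp v) * h (of_real (L * v))) = M (of_real (1 - 1 / L)) / of_real L"
    using eventually_gt_at_top[of 0] by eventually_elim (simp only: cv)
  ultimately show ?thesis by (rule Lim_transform_eventually)
qed

text \<open>The functional equation with period \<alpha> replaces the singular factor at z +
  \<alpha> by the regular one at \<open>z\<close> divided by 2 sin (pi z), and L sin (pi / L) tends
  to pi. The value at 1 and the reflection of 1 + 2b assemble to \<open>C0\<close>.\<close>

lemma T_near_1: "((\<lambda>L. T (of_real (1 - 1 / L)) / of_real L) \<longlongrightarrow> C0) at_top"
proof -
  have cont: "((\<lambda>L. S2_strip \<alpha> (of_real (1 - 1 / L) + of_real c)) \<longlongrightarrow> S2_strip \<alpha> (1 + of_real c)) at_top"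
    if c: "0 \<le> c" "c < \<alpha>" for c
  proof -
    have "continuous_on {z. 0 < Re z \<and> Re z < 1 + \<alpha>} (S2_strip \<alpha>)"
      by (rule holomorphic_on_imp_continuous_on[OF S2_strip_holomorphic[OF alpha(1)]])
    then have i: "isCont (S2_strip \<alpha>) (1 + of_real c)"
      using open_vertical_strip c by (simp add: continuous_on_eq_continuous_at)
    have "((\<lambda>L. 1 - 1 / L) \<longlongrightarrow> (1::real)) at_top" by real_asymp
    from tendsto_add[OF tendsto_of_real[OF this] tendsto_const[of "complex_of_real c"]]
    have "((\<lambda>L. complex_of_real (1 - 1 / L) + of_real c) \<longlongrightarrow> 1 + of_real c) at_top" by simp
    then show ?thesis by (rule isCont_tendsto_compose[OF i])
  qed
  have "((\<lambda>L. pi / (2 * L * sin (pi * (1 / L)))) \<longlongrightarrow> 1 / 2) at_top" by real_asymp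
  from tendsto_of_real[OF this, where 'a = complex]
  have l1: "((\<lambda>L. complex_of_real (pi / (2 * L * sin (pi * (1 / L))))) \<longlongrightarrow> 1 / 2) at_top" by simp
  have l2: "((\<lambda>L. S2_strip \<alpha> (of_real (1 - 1 / L))) \<longlongrightarrow> of_real (sqrt \<alpha>)) at_top"
    using cont[of 0] S2_strip_at_1(1)[OF alpha(1)] alpha by simp
  have l3: "((\<lambda>L. S2_strip \<alpha> (of_real (1 - 1 / L) + of_real (2 * b))) \<longlongrightarrow> S2_strip \<alpha> (1 + of_real (2 * b))) at_top"
    by (rule cont) (use b in auto)
  have "((\<lambda>L. complex_of_real (pi / (2 * L * sin (pi * (1 / L)))) * S2_strip \<alpha> (of_real (1 - 1 / L)) / S2_strip \<alpha> (of_real (1 - 1 / L) + of_real (2 * b))) \<longlongrightarrow> 1 / 2 * of_real (sqrt \<alpha>) / S2_strip \<alpha> (1 + of_real (2 * b))) at_top"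
    by (intro tendsto_intros l1 l2 l3) simp
  moreover have "1 / 2 * of_real (sqrt \<alpha>) / S2_strip \<alpha> (1 + of_real (2 * b)) = C0"
  proof -
    have "1 + of_real \<alpha> - (1 + of_real (2 * b)) = complex_of_real (\<alpha> * \<rho>)" using b(4) by (simp flip: of_real_diff of_real_mult)
    then have "S2_strip \<alpha> (1 + of_real (2 * b)) * S2_strip \<alpha> (of_real (\<alpha> * \<rho>)) = 1"
      using S2_strip_reflection[of \<alpha> "1 + of_real (2 * b)"] by simp
    then show ?thesis unfolding C0_def by (simp add: field_simps)
  qed
  ultimately have lim: "((\<lambda>L. complex_of_real (pi / (2 * L * sin (pi * (1 / L)))) * S2_strip \<alpha> (of_real (1 - 1 / L)) / S2_strip \<alpha> (of_real (1 - 1 / L) + of_real (2 * b))) \<longlongrightarrow> C0) at_top" by simp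
  have "\<forall>\<^sub>F L in at_top. complex_of_real (pi / (2 * L * sin (pi * (1 / L)))) * S2_strip \<alpha> (of_real (1 - 1 / L)) / S2_strip \<alpha> (of_real (1 - 1 / L) + of_real (2 * b)) = T (of_real (1 - 1 / L)) / of_real L"
    using eventually_gt_at_top[of 1]
  proof eventually_elim
    case (elim L)
    define x where "x = 1 - 1 / L"
    have x: "0 < x" "x < 1" using elim by (auto simp: x_def field_simps)
    have s: "sin (of_real pi * complex_of_real x) = of_real (sin (pi * (1 / L)))"
    proof -
      have "pi * x = pi - pi * (1 / L)" by (simp add: x_def algebra_simps)
      then have "sin (pi * x) = sin (pi * (1 / L))" by (simp add: sin_diff)
      then show ?thesis by (simp only: sin_of_real of_real_mult[symmetric])
    qed
    have e: "S2_strip \<alpha> (of_real x) = 2 * of_real (sin (pi * (1 / L))) * S2_strip \<alpha> (of_real x + of_real \<alpha>)"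
      using S2_strip_shift_alpha[OF alpha(1), of "of_real x"] x unfolding s by simp
    then have "sin (pi * (1 / L)) \<noteq> 0" by auto
    then show ?case unfolding x_def[symmetric] e T_def using elim by (simp add: field_simps)
  qed
  then show ?thesis by (rule Lim_transform_eventually[OF lim])
qed

lemma M_eq_T:
  assumes z: "- (2 * b) < Re z" "Re z < 0"
  shows "M z = T z"
proof -
  have "((\<lambda>L. (M (of_real (1 - 1 / L)) / of_real L) / (T (of_real (1 - 1 / L)) / of_real L)) \<longlongrightarrow> C0 / C0) at_top"
    by (rule tendsto_divide[OF M_near_1 T_near_1 C0_nonzero])
  moreover have "\<forall>\<^sub>F L in at_top. (M (of_real (1 - 1 / L)) / of_real L) / (T (of_real (1 - 1 / L)) / of_real L) = R z"
    using eventually_gt_at_top[of 1]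
  proof eventually_elim
    case (elim L)
    have "R z = R (of_real (1 - 1 / L))"
      by (rule R_constant[OF z]) (use elim in \<open>auto simp: field_simps\<close>)
    then show ?case using elim by (simp add: R_def)
  qed
  ultimately have "((\<lambda>L::real. R z) \<longlongrightarrow> C0 / C0) at_top" by (rule Lim_transform_eventually)
  then have "R z = 1" using C0_nonzero by (simp add: tendsto_const_iff)
  then show ?thesis using T_nonzero[of z] by (simp add: R_def)
qed

lemma F_Mellin:
  assumes z: "- (2 * b) < Re z" "Re z < 0" and c: "cos \<theta> \<le> 0"
  shows "(LBINT x:{0<..}. of_real x powr (z - 1) * F \<alpha> \<rho> x) = Gamma z * S2 \<alpha> z / (2 * S2 \<alpha> (of_real (2 * b) + z))"
proof -
  let ?I = "LBINT x:{0<..}. of_real x powr (z - 1) * F \<alpha> \<rho> x"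
  have 1: "S2 \<alpha> z = 2 * sin (of_real pi * z) * S2_strip \<alpha> (z + of_real \<alpha>)"
    using z b by (intro S2_eq_left alpha) auto
  have 2: "S2 \<alpha> (of_real (2 * b) + z) = S2_strip \<alpha> (z + of_real (2 * b))"
    unfolding add.commute[of _ z] using z b by (intro S2_eq_strip alpha) auto
  \<comment> \<open>Since 2b < 1, the strip lies between the integers -1 and 0; this keeps
    \<open>Gamma z\<close> off its poles and sin (pi z) off its zeros.\<close>
  have zint: "z \<notin> \<int>"
  proof
    assume "z \<in> \<int>"
    then obtain n where "z = of_int n" by (auto elim: Ints_cases)
    then have "-1 < real_of_int n" "real_of_int n < 0" using z b by auto
    then have "-1 < n" "n < 0" by linarith+
    then show False by linarith
  qed
  then have s0: "sin (of_real pi * z) \<noteq> 0"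
  proof -
    have "sin (of_real pi * z) = - sin (of_real pi * (- z))" by simp
    moreover have "sin (of_real pi * (- z)) \<noteq> 0" by (rule sin_pi_nonzero) (use z b in auto)
    ultimately show ?thesis by simp
  qed
  have refl: "Gamma z * Gamma (1 - z) = of_real pi / sin (of_real pi * z)" by (rule Gamma_reflection_complex)
  have G0: "Gamma z \<noteq> 0" using zint by (auto simp: Gamma_eq_zero_iff nonpos_Ints_def)
  have "Gamma z * (Gamma (1 - z) * ?I) = Gamma z * T z"
    unfolding F_Mellin_eq_M[OF z c] M_eq_T[OF z] ..
  then have "of_real pi * ?I = Gamma z * T z * sin (of_real pi * z)"
    unfolding mult.assoc[symmetric] refl using s0 by (simp add: field_simps)
  also have "\<dots> = of_real pi * (Gamma z * S2 \<alpha> z / (2 * S2 \<alpha> (of_real (2 * b) + z)))"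
    unfolding 1 2 T_def by simp
  finally show ?thesis unfolding mult_cancel_left by simp
qed

end

section \<open>From admissible parameters to the theorem\<close>

lemma admissible_imp_stable_params:
  assumes "admissible \<alpha> \<rho>"
  shows "stable_params \<alpha> \<rho>" "stable_params \<alpha> (1 - \<rho>)"
proof -
  have *: "0 < \<alpha> \<and> \<alpha> < 2 \<and> 0 < \<rho> \<and> \<rho> < 1 \<and> \<alpha> * \<rho> < 1 \<and> \<alpha> * (1 - \<rho>) < 1"
    using assms unfolding admissible_def
  proof (elim disjE)
    assume a: "0 < \<alpha> \<and> \<alpha> \<le> 1 \<and> 0 < \<rho> \<and> \<rho> < 1"
    have "\<alpha> * \<rho> \<le> 1 * \<rho>" "\<alpha> * (1 - \<rho>) \<le> 1 * (1 - \<rho>)" by (rule mult_right_mono; use a in linarith)+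
    moreover have "1 * \<rho> < 1" "1 * (1 - \<rho>) < 1" using a by simp_all
    ultimately have "\<alpha> * \<rho> < 1" "\<alpha> * (1 - \<rho>) < 1" by (blast intro: le_less_trans)+
    moreover have "\<alpha> < 2" using a by linarith
    ultimately show ?thesis using a by blast
  next
    assume a: "1 < \<alpha> \<and> \<alpha> \<le> 2 \<and> 1 - 1 / \<alpha> < \<rho> \<and> \<rho> < 1 / \<alpha>"
    then have pos: "0 < \<alpha>" by simp
    have "1 / \<alpha> < 1" using a by simp
    then have "0 < \<rho>" "\<rho> < 1" "1 < 2 * (1 / \<alpha>)" using a by linarith+
    moreover from this have "\<alpha> < 2" using pos by (simp add: field_simps)
    moreover have "\<alpha> * \<rho> < 1" using a pos by (simp add: field_simps)
    moreover have "1 - \<rho> < 1 / \<alpha>" using a by linarith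
    then have "\<alpha> * (1 - \<rho>) < 1" using pos by (simp add: field_simps)
    ultimately show ?thesis using pos by blast
  qed
  then show "stable_params \<alpha> \<rho>" "stable_params \<alpha> (1 - \<rho>)" by (unfold_locales; simp)+
qed

theorem theorem3:
  fixes \<alpha> \<rho> :: real
  assumes "admissible \<alpha> \<rho>"
  shows "(\<forall>z::real. z > max 0 (cos (pi * \<rho>)) \<longrightarrow>
           set_integrable lborel {0<..} (\<lambda>x. of_real (exp (- z * x)) * F \<alpha> \<rho> x) \<and>
           (LBINT x:{0<..}. of_real (exp (- z * x)) * F \<alpha> \<rho> x) =
             of_real (sqrt \<alpha> / 2) * S2 \<alpha> (of_real (\<alpha> * \<rho>)) *
             of_real (z powr (- \<alpha> * (1 - \<rho>) / 2 - 1 / 2) *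
               (cmod (S2 \<alpha> (Complex (1 + \<alpha> / 2 + \<alpha> * (1 - \<rho>) / 2) (\<alpha> * ln z / (2 * pi)))))\<^sup>2)) \<and>
         (\<forall>z::real. z > max 0 (cos (pi * (1 - \<rho>))) \<longrightarrow>
           set_integrable lborel {0<..} (\<lambda>x. of_real (exp (- z * x)) * F \<alpha> (1 - \<rho>) x) \<and>
           (LBINT x:{0<..}. of_real (exp (- z * x)) * F \<alpha> (1 - \<rho>) x) =
             of_real (sqrt \<alpha> / 2) * S2 \<alpha> (of_real (\<alpha> * (1 - \<rho>))) *
             of_real (z powr (- \<alpha> * \<rho> / 2 - 1 / 2) *
               (cmod (S2 \<alpha> (Complex (1 + \<alpha> / 2 + \<alpha> * \<rho> / 2) (\<alpha> * ln z / (2 * pi)))))\<^sup>2)) \<and>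
         (\<rho> \<ge> 1 / 2 \<longrightarrow>
           (\<forall>z::complex. - \<alpha> * (1 - \<rho>) < Re z \<and> Re z < 0 \<longrightarrow>
             set_integrable lborel {0<..} (\<lambda>x. of_real x powr (z - 1) * F \<alpha> \<rho> x) \<and>
             (LBINT x:{0<..}. of_real x powr (z - 1) * F \<alpha> \<rho> x) =
               Gamma z * S2 \<alpha> z / (2 * S2 \<alpha> (of_real (\<alpha> * (1 - \<rho>)) + z))))"
proof -
  interpret A: stable_params \<alpha> \<rho> by (rule admissible_imp_stable_params(1)[OF assms])
  interpret B: stable_params \<alpha> "1 - \<rho>" by (rule admissible_imp_stable_params(2)[OF assms])
  \<comment> \<open>A general parameter \<open>r\<close> lets one argument serve \<open>F\<close>
    and its conjugate.\<close>
  have i: "set_integrable lborel {0<..} (\<lambda>x. of_real (exp (- z * x)) * F \<alpha> r x) \<and>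
           (LBINT x:{0<..}. of_real (exp (- z * x)) * F \<alpha> r x) =
             of_real (sqrt \<alpha> / 2) * S2 \<alpha> (of_real (\<alpha> * r)) *
             of_real (z powr (- \<alpha> * (1 - r) / 2 - 1 / 2) *
               (cmod (S2 \<alpha> (Complex (1 + \<alpha> / 2 + \<alpha> * (1 - r) / 2) (\<alpha> * ln z / (2 * pi)))))\<^sup>2)"
    if "stable_params \<alpha> r" "z > max 0 (cos (pi * r))" for z r
  proof -
    interpret C: stable_params \<alpha> r by (rule that(1))
    have z: "z > 0" "z > max 0 (cos C.\<theta>)" using that(2) by (auto simp: C.\<theta>_def)
    show ?thesis using C.F_Laplace[OF z(2)] unfolding C.h_ln[OF z(1)] by blast
  qed
  have ii: "set_integrable lborel {0<..} (\<lambda>x. of_real x powr (z - 1) * F \<alpha> \<rho> x) \<and>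
             (LBINT x:{0<..}. of_real x powr (z - 1) * F \<alpha> \<rho> x) =
               Gamma z * S2 \<alpha> z / (2 * S2 \<alpha> (of_real (\<alpha> * (1 - \<rho>)) + z))"
    if "\<rho> \<ge> 1 / 2" and z: "- \<alpha> * (1 - \<rho>) < Re z" "Re z < 0" for z
  proof -
    have c: "cos A.\<theta> \<le> 0"
    proof -
      have "pi * (1 / 2) \<le> pi * \<rho>" using that(1) by (intro mult_left_mono) auto
      then have "cos A.\<theta> \<le> cos (pi / 2)"
        using A.theta(2) unfolding A.\<theta>_def by (intro cos_monotone_0_pi_le) auto
      then show ?thesis by simp
    qed
    have b2: "2 * A.b = \<alpha> * (1 - \<rho>)" by (simp add: A.b_def)
    have z': "- (2 * A.b) < Re z" using z b2 by simp
    show ?thesis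
      using A.F_Mellin_integrable[OF z' z(2) c] A.F_Mellin[OF z' z(2) c] unfolding b2 by blast
  qed
  have e: "1 - (1 - \<rho>) = \<rho>" by simp
  show ?thesis
    using i[OF A.stable_params_axioms] i[OF B.stable_params_axioms, unfolded e] ii by blast
qed

end
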